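(* Let $\eta$ be a Poisson process on a measurable space $(\mathbb{X},\mathcal{X})$ with $\sigma$-finite intensity measure $\lambda$. Let $F$ be a square-integrable Poisson functional of $\eta$ with $DF\in L^2(\mathbb{P}\otimes\lambda)$, $\mathbb{E}[F]=0$ and $\mathbb{E}[F^2]=1$, and let $Z\sim\mathcal{N}(0,1)$. Define $\gamma_1,\gamma_2,\gamma_3\ge 0$ by $$\gamma_1^2=4\int\mathbb{E}\big[(D_{z_1}F)^2(D_{z_2}F)^2\big]^{1/2}\,\mathbb{E}\big[(D^2_{z_1,z_3}F)^2(D^2_{z_2,z_3}F)^2\big]^{1/2}\,\lambda^3(d(z_1,z_2,z_3)),$$ $$\gamma_2^2=\int\mathbb{E}\big[(D^2_{z_1,z_3}F)^2(D^2_{z_2,z_3}F)^2\big]\,\lambda^3(d(z_1,z_2,z_3)),$$ $$\gamma_3=\int\mathbb{E}\big[|D_zF|^3\big]^{1/3}\,\mathbb{E}\big[\min\big(\sqrt8\,|D_zF|^{3/2},|D_zF|^3\big)\big]^{2/3}\,\lambda(dz).$$ Then $$d_W(F,Z)\le\gamma_1+\gamma_2+\gamma_3 .$$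
   Context: $\mathbf{N}$ denotes the space of integer-valued $\sigma$-finite measures on $\mathbb{X}$, with the $\sigma$-algebra generated by the evaluations $\mu\mapsto\mu(A)$, $A\in\mathcal{X}$; $\eta$ is viewed as a random element of $\mathbf{N}$. A real random variable $F$ is a Poisson functional if $F=\phi(\eta)$ a.s. for some measurable $\phi:\mathbf{N}\to\mathbb{R}$. Its Malliavin derivative (difference operator) in direction $z\in\mathbb{X}$ is $D_zF=\phi(\eta+\delta_z)-\phi(\eta)$, and the second-order derivative is $D^2_{z_1,z_2}F=D_{z_1}(D_{z_2}F)=\phi(\eta+\delta_{z_1}+\delta_{z_2})-\phi(\eta+\delta_{z_1})-\phi(\eta+\delta_{z_2})+\phi(\eta)$, where $\delta_z$ is the Dirac measure at $z$. $DF\in L^2(\mathbb{P}\otimes\lambda)$ means that $(\omega,z)\mapsto D_zF(\omega)$ is square integrable with respect to $\mathbb{P}\otimes\lambda$. Notation: $\mathbb{E}[Y]^{r}=(\mathbb{E}[Y])^{r}$, and $\lambda^3$ is the threefold product measure. The Wasserstein distance is $d_W(F,G)=\sup_h|\mathbb{E}[h(F)]-\mathbb{E}[h(G)]|$, the supremum being over all functions $h:\mathbb{R}\to\mathbb{R}$ that are Lipschitz with constant at most $1$. *)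

theory Defs
  imports "HOL-Probability.Probability"
begin

text \<open>
  Throughout, a measure \<open>L\<close> supplies both the intensity and the measurable space it lives on.
  As usual for point processes, ``integer-valued'' allows the value \<open>\<infinity>\<close>.
\<close>

definition point_measures :: "'a measure \<Rightarrow> 'a measure set" where
  "point_measures L = {\<mu>. sets \<mu> = sets L \<and> sigma_finite_measure \<mu> \<and>
     (\<forall>A\<in>sets L. emeasure \<mu> A = \<infinity> \<or> (\<exists>n::nat. emeasure \<mu> A = of_nat n))}"

definition point_algebra :: "'a measure \<Rightarrow> 'a measure measure" where
  "point_algebra L =
     (SUP A\<in>sets L. vimage_algebra (point_measures L) (\<lambda>\<mu>. emeasure \<mu> A) borel)"

text \<open>The Poisson probabilities are written out since \<^const>\<open>poisson_pmf\<close> is only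
  specified for positive rates, whereas \<open>measure L A = 0\<close> is possible.\<close>

definition poisson_process :: "'w measure \<Rightarrow> 'a measure \<Rightarrow> ('w \<Rightarrow> 'a measure) \<Rightarrow> bool" where
  "poisson_process M L \<eta> \<longleftrightarrow>
     \<eta> \<in> measurable M (point_algebra L) \<and>
     (\<forall>A\<in>sets L. emeasure L A < \<infinity> \<longrightarrow>
        (\<forall>k::nat. measure M {\<omega>\<in>space M. emeasure (\<eta> \<omega>) A = of_nat k} =
           measure L A ^ k / fact k * exp (- measure L A))) \<and>
     (\<forall>A\<in>sets L. emeasure L A = \<infinity> \<longrightarrow> (AE \<omega> in M. emeasure (\<eta> \<omega>) A = \<infinity>)) \<and>
     (\<forall>(n::nat) A. A ` {..<n} \<subseteq> sets L \<longrightarrow> disjoint_family_on A {..<n} \<longrightarrow>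
        prob_space.indep_vars M (\<lambda>_. borel) (\<lambda>i \<omega>. emeasure (\<eta> \<omega>) (A i)) {..<n})"

definition add_dirac :: "'a measure \<Rightarrow> 'a \<Rightarrow> 'a measure" where
  "add_dirac \<mu> z =
     measure_of (space \<mu>) (sets \<mu>) (\<lambda>A. emeasure \<mu> A + emeasure (return \<mu> z) A)"

definition poisson_functional ::
  "'w measure \<Rightarrow> 'a measure \<Rightarrow> ('w \<Rightarrow> 'a measure) \<Rightarrow> ('w \<Rightarrow> real) \<Rightarrow> ('a measure \<Rightarrow> real) \<Rightarrow> bool"
where
  "poisson_functional M L \<eta> F \<phi> \<longleftrightarrow>
     F \<in> borel_measurable M \<and> \<phi> \<in> borel_measurable (point_algebra L) \<and>
     (AE \<omega> in M. F \<omega> = \<phi> (\<eta> \<omega>))"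

definition diff_op :: "'a \<Rightarrow> ('a measure \<Rightarrow> real) \<Rightarrow> 'a measure \<Rightarrow> real" where
  "diff_op z \<phi> \<mu> = \<phi> (add_dirac \<mu> z) - \<phi> \<mu>"

definition diff_op2 :: "'a \<Rightarrow> 'a \<Rightarrow> ('a measure \<Rightarrow> real) \<Rightarrow> 'a measure \<Rightarrow> real" where
  "diff_op2 z\<^sub>1 z\<^sub>2 \<phi> = diff_op z\<^sub>1 (diff_op z\<^sub>2 \<phi>)"

definition square_integrable :: "'b measure \<Rightarrow> ('b \<Rightarrow> real) \<Rightarrow> bool" where
  "square_integrable N f \<longleftrightarrow> f \<in> borel_measurable N \<and> integrable N (\<lambda>x. (f x)\<^sup>2)"

text \<open>Used for exponents \<open>r > 0\<close> only, where \<open>\<infinity>\<^sup>r = \<infinity>\<close> and \<open>0\<^sup>r = 0\<close>.\<close>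

definition ennreal_powr :: "ennreal \<Rightarrow> real \<Rightarrow> ennreal" where
  "ennreal_powr x r = (if x = \<infinity> then \<infinity> else ennreal (enn2real x powr r))"

text \<open>For integrable \<open>F\<close> and \<open>G\<close>, every \<open>h(F)\<close> and \<open>h(G)\<close> below is integrable.\<close>

definition wasserstein_dist ::
  "'w measure \<Rightarrow> ('w \<Rightarrow> real) \<Rightarrow> 'v measure \<Rightarrow> ('v \<Rightarrow> real) \<Rightarrow> ennreal" where
  "wasserstein_dist M F M' G =
     (SUP h\<in>{h :: real \<Rightarrow> real. 1-lipschitz_on UNIV h}.
        ennreal \<bar>(\<integral>\<omega>. h (F \<omega>) \<partial>M) - (\<integral>\<omega>. h (G \<omega>) \<partial>M')\<bar>)"

lemma space_point_algebra: "space (point_algebra L) = point_measures L"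
  by (auto simp add: point_algebra_def space_Sup_eq_UN)

lemma sets_add_dirac [simp]: "sets (add_dirac \<mu> z) = sets \<mu>"
  by (simp add: add_dirac_def)

lemma emeasure_add_dirac:
  assumes "A \<in> sets \<mu>"
  shows "emeasure (add_dirac \<mu> z) A = emeasure \<mu> A + indicator A z"
proof -
  have "emeasure (add_dirac \<mu> z) A = emeasure \<mu> A + emeasure (return \<mu> z) A"
    unfolding add_dirac_def
  proof (rule emeasure_measure_of_sigma)
    show "countably_additive (sets \<mu>) (\<lambda>A. emeasure \<mu> A + emeasure (return \<mu> z) A)"
      by (auto simp: countably_additive_def suminf_add[symmetric] suminf_emeasure
               simp del: emeasure_return)
  qed (use assms in \<open>auto simp: positive_def sets.sigma_algebra_axioms\<close>)
  then show ?thesis using assms by simp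
qed

lemma add_dirac_in_point_measures:
  assumes \<mu>: "\<mu> \<in> point_measures L"
  shows "add_dirac \<mu> z \<in> point_measures L"
proof -
  have sets: "sets \<mu> = sets L" and sf: "sigma_finite_measure \<mu>"
    and int: "\<And>A. A \<in> sets L \<Longrightarrow> emeasure \<mu> A = \<infinity> \<or> (\<exists>n::nat. emeasure \<mu> A = of_nat n)"
    using \<mu> by (auto simp: point_measures_def)
  obtain C where C: "countable C" "C \<subseteq> sets \<mu>" "\<Union>C = space \<mu>" "\<forall>a\<in>C. emeasure \<mu> a \<noteq> \<infinity>"
    using sigma_finite_measure.sigma_finite_countable[OF sf] by blast
  have "sigma_finite_measure (add_dirac \<mu> z)"
  proof
    have "\<forall>a\<in>C. emeasure (add_dirac \<mu> z) a \<noteq> \<infinity>"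
      using C by (auto simp: emeasure_add_dirac subset_iff indicator_def)
    then show "\<exists>B. countable B \<and> B \<subseteq> sets (add_dirac \<mu> z) \<and> \<Union>B = space (add_dirac \<mu> z) \<and>
        (\<forall>a\<in>B. emeasure (add_dirac \<mu> z) a \<noteq> \<infinity>)"
      using C sets_eq_imp_space_eq[OF sets_add_dirac[of \<mu> z]] by (intro exI[of _ C]) simp
  qed
  moreover have "emeasure (add_dirac \<mu> z) A = \<infinity> \<or> (\<exists>n::nat. emeasure (add_dirac \<mu> z) A = of_nat n)"
    if A: "A \<in> sets L" for A
  proof (cases "emeasure \<mu> A = \<infinity>")
    case False
    then obtain n :: nat where "emeasure \<mu> A = of_nat n" using int[OF A] by blast
    then have "emeasure (add_dirac \<mu> z) A = of_nat (n + (if z \<in> A then 1 else 0))"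
      using A sets by (simp add: emeasure_add_dirac)
    then show ?thesis by blast
  qed (use A sets in \<open>simp add: emeasure_add_dirac\<close>)
  ultimately show ?thesis using sets by (simp add: point_measures_def)
qed

lemma diff_op2_expand:
  "diff_op2 z\<^sub>1 z\<^sub>2 \<phi> \<mu> =
     \<phi> (add_dirac (add_dirac \<mu> z\<^sub>1) z\<^sub>2) - \<phi> (add_dirac \<mu> z\<^sub>1) - \<phi> (add_dirac \<mu> z\<^sub>2) + \<phi> \<mu>"
  by (simp add: diff_op2_def diff_op_def)

end

theory Submission
  imports Defs
begin

text \<open>
  Let \<open>h\<close> be 1-Lipschitz and let \<open>f\<close> solve Stein's equation \<open>f' w - w * f w = h w - E h(Z)\<close>.
  Then \<open>E h(F) - E h(Z) = E f'(F) - E f(F) F\<close>, where \<open>\<bar>f'\<bar> \<le> 1\<close> and \<open>f'\<close> is 2-Lipschitz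
  (\<open>stein_equation_solution\<close>). The theorem therefore rests on a formula for \<open>E f(F) F\<close> in terms of
  difference operators.

  Fix a set \<open>B\<close> of finite intensity. A Poisson process arises from a configuration without points in
  \<open>B\<close> by adding a Poisson number of independent points of \<open>B\<close>, say at uniform times in \<open>[0, 1]\<close>.
  Let two copies of the process share the points outside \<open>B\<close> and those added before time \<open>s\<close>, and let
  the points added later be independent. The copies coincide for \<open>s = 1\<close>, and for \<open>s = 0\<close> they only share
  the outside of \<open>B\<close>. Differentiating in \<open>s\<close> shows (\<open>coup_covariance\<close>, \<open>coupling_covariance\<close>) that
  \<open>E f(F) F\<close> is the mean of \<open>f(F)\<close> at the first times \<open>F\<close> at the second copy for \<open>s = 0\<close>, plus the integral
  over \<open>s\<close> and over \<open>y \<in> B\<close> of the mean of \<open>D\<^sub>y f(F)\<close> at the first times \<open>D\<^sub>y F\<close> at the second copy.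

  Now replace \<open>D\<^sub>y f(F)\<close> by \<open>f'(F) D\<^sub>y F\<close>. The Taylor remainder is at most the minimum of \<open>2 \<bar>D\<^sub>y F\<bar>\<close> and
  \<open>(D\<^sub>y F)\<^sup>2\<close>, and Hoelder's inequality with exponents 3/2 and 3 bounds its contribution by \<open>\<gamma>\<^sub>3\<close>
  (\<open>coupling_min_square_le\<close>). What is left is the mean of \<open>f'(F) \<Psi>\<close>, where \<open>\<Psi>\<close> is the integral over \<open>B\<close>
  of the product of \<open>D\<^sub>y F\<close> at the two copies. Taking \<open>f\<close> to be the identity, the same formula expresses
  \<open>E F\<^sup>2 = 1\<close> by the mean of \<open>\<Psi>\<close>. Hence, up to the terms for \<open>s = 0\<close>, \<open>E f(F) F - E f'(F)\<close> is an average
  of covariances of \<open>f'(F)\<close> and \<open>\<Psi>\<close>; since \<open>\<bar>f'\<bar> \<le> 1\<close>, each is at most the standard deviation of \<open>\<Psi>\<close>.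
  A Poincare inequality for the coupled pair (\<open>poincare_coupling\<close>) reduces this standard deviation to
  increments of \<open>\<Psi>\<close>. The product rule splits these into three terms, and Minkowski's and the
  Cauchy-Schwarz inequality bound them by \<open>\<gamma>\<^sub>1 + \<gamma>\<^sub>2\<close> (\<open>gradient_product_variance\<close>).

  Finally \<open>B\<close> increases to the whole space. The terms for \<open>s = 0\<close> vanish in the limit because conditional
  means given the process outside \<open>B\<close> converge to unconditional ones (\<open>vanishing_square_integrable\<close>). The
  Poisson property enters only through the Mecke equation (\<open>mecke_of_poisson_process\<close>).
\<close>

section \<open>Stein's equation for Lipschitz test functions\<close>

definition std_normal_cdf :: "real \<Rightarrow> real" where
  "std_normal_cdf w = (\<integral>x. indicator {..w} x * std_normal_density x \<partial>lborel)"

lemma has_real_derivative_integral_atMost: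
  fixes g :: "real \<Rightarrow> real"
  assumes g: "integrable lborel g" and cont: "continuous_on UNIV g"
  shows "((\<lambda>w. \<integral>x. indicator {..w} x * g x \<partial>lborel) has_real_derivative g w) (at w)"
proof -
  let ?G = "\<lambda>w. \<integral>x. indicator {..w} x * g x \<partial>lborel"
  have int: "integrable lborel (\<lambda>x. indicator A x * g x)" if "A \<in> sets borel" for A
    using integrable_mult_indicator[of A lborel g] g that by simp
  have split: "?G y = ?G (w - 1) + integral {w - 1..y} g" if "w - 1 \<le> y" for y
  proof -
    have si: "set_integrable lborel {w - 1..y} g"
      unfolding set_integrable_def using int[of "{w - 1..y}"] by simp
    have "integral {w - 1..y} g = (\<integral>x. indicator {w - 1..y} x * g x \<partial>lborel)"
      using set_borel_integral_eq_integral(2)[OF si] by (simp add: set_lebesgue_integral_def)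
    moreover have "?G y = (\<integral>x. indicator {..w - 1} x * g x + indicator {w - 1..y} x * g x \<partial>lborel)"
    proof (rule integral_cong_AE)
      show "AE x in lborel. indicator {..y} x * g x = indicator {..w - 1} x * g x + indicator {w - 1..y} x * g x"
        using AE_lborel_singleton[of "w - 1"] by eventually_elim (use that in \<open>auto simp: indicator_def\<close>)
    qed (use g in measurable)
    ultimately show ?thesis using int by simp
  qed
  have "((\<lambda>y. integral {w - 1..y} g) has_real_derivative g w) (at w within {w - 1..w + 1})"
    by (rule integral_has_real_derivative) (auto intro: continuous_on_subset[OF cont])
  then have "((\<lambda>y. ?G (w - 1) + integral {w - 1..y} g) has_real_derivative g w) (at w within {w - 1..w + 1})"
    by (auto intro!: derivative_eq_intros)
  then have "(?G has_real_derivative g w) (at w within {w - 1..w + 1})"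
    by (rule has_field_derivative_transform_within[where d = 1]) (auto intro: split[symmetric])
  then show ?thesis by (simp add: at_within_Icc_at)
qed

lemma std_normal_density_derivative:
  "(std_normal_density has_real_derivative - w * std_normal_density w) (at w)"
  unfolding std_normal_density_def
  by (auto intro!: derivative_eq_intros simp: field_simps)

lemma std_normal_density_le_half: "std_normal_density w \<le> 1 / 2"
proof -
  have "2 \<le> sqrt (2 * pi)" using pi_ge_two by (intro real_le_rsqrt) simp
  then have "1 / sqrt (2 * pi) \<le> 1 / 2" by (simp add: field_simps)
  moreover have "exp (- w\<^sup>2 / 2) \<le> 1" by simp
  ultimately have "1 / sqrt (2 * pi) * exp (- w\<^sup>2 / 2) \<le> 1 / 2 * 1"
    by (intro mult_mono) auto
  then show ?thesis by (simp add: std_normal_density_def)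
qed

lemma std_normal_density_mult_tendsto_0: "((\<lambda>w. w * std_normal_density w) \<longlongrightarrow> 0) at_top"
proof -
  have "filterlim (\<lambda>w::real. w\<^sup>2 / 2) at_top at_top"
    using filterlim_tendsto_pos_mult_at_top[of "\<lambda>_::real. 1 / 2 :: real" "1 / 2" at_top "\<lambda>w. w\<^sup>2"]
      filterlim_pow_at_top[of 2 "\<lambda>w::real. w" at_top] filterlim_ident[of "at_top :: real filter"] by simp
  from filterlim_compose[OF tendsto_power_div_exp_0[of 1] this]
  have "((\<lambda>w::real. w\<^sup>2 / 2 / exp (w\<^sup>2 / 2)) \<longlongrightarrow> 0) at_top" by simp
  from tendsto_mult_left_zero[OF this, of 2]
  have lim: "((\<lambda>w::real. w\<^sup>2 * exp (- w\<^sup>2 / 2)) \<longlongrightarrow> 0) at_top"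
    by (simp add: exp_minus field_simps)
  show ?thesis
  proof (rule tendsto_sandwich[OF _ _ tendsto_const lim])
    show "\<forall>\<^sub>F w in at_top. 0 \<le> w * std_normal_density w"
      using eventually_ge_at_top[of 0] by eventually_elim (simp add: normal_density_nonneg)
    show "\<forall>\<^sub>F w in at_top. w * std_normal_density w \<le> w\<^sup>2 * exp (- w\<^sup>2 / 2)"
      using eventually_ge_at_top[of 1]
    proof eventually_elim
      case (elim w)
      have "1 \<le> sqrt (2 * pi)" using pi_ge_two by simp
      then have "std_normal_density w \<le> exp (- w\<^sup>2 / 2)"
        by (simp add: std_normal_density_def divide_le_eq mult_le_cancel_left1)
      moreover have "w \<le> w\<^sup>2" using elim by (simp add: power2_eq_square)
      ultimately show ?case using elim by (intro mult_mono) (auto simp: normal_density_nonneg)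
    qed
  qed
qed

lemma std_normal_density_tendsto_0: "(std_normal_density \<longlongrightarrow> 0) at_top"
proof (rule tendsto_sandwich[OF _ _ tendsto_const std_normal_density_mult_tendsto_0])
  show "\<forall>\<^sub>F w in at_top. 0 \<le> std_normal_density w" by (simp add: normal_density_nonneg)
  show "\<forall>\<^sub>F w in at_top. std_normal_density w \<le> w * std_normal_density w"
    using eventually_ge_at_top[of 1]
    by eventually_elim (metis mult_1 mult_right_mono normal_density_nonneg)
qed

lemma integrable_std_normal_density_ident: "integrable lborel (\<lambda>x. std_normal_density x * x)"
  using integrable_std_normal_moment[of 1] by simp

lemma integrable_std_normal_restrict:
  assumes "integrable lborel (\<lambda>x. g x * std_normal_density x)" "A \<in> sets borel"
  shows "integrable lborel (\<lambda>x. indicator A x * (g x * std_normal_density x))"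
  using integrable_mult_indicator[of A lborel "\<lambda>x. g x * std_normal_density x"] assms by simp

lemma std_normal_cdf_derivative:
  "(std_normal_cdf has_real_derivative std_normal_density w) (at w)"
  unfolding std_normal_cdf_def[abs_def]
  by (rule has_real_derivative_integral_atMost[OF integrable_normal_density])
     (auto simp: std_normal_density_def intro!: continuous_intros)

lemma std_normal_cdf_tendsto_1: "(std_normal_cdf \<longlongrightarrow> 1) at_top"
  using tendsto_integral_at_top[of lborel std_normal_density]
  by (simp add: std_normal_cdf_def[abs_def])

lemma std_normal_cdf_minus: "std_normal_cdf (- w) = 1 - std_normal_cdf w"
proof -
  have "std_normal_cdf (- w) = (\<integral>x. indicator {..- w} (- x) * std_normal_density (- x) \<partial>lborel)"
    unfolding std_normal_cdf_def by (subst lborel_integral_real_affine[where c="-1" and t=0]) auto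
  also have "... = (\<integral>x. std_normal_density x - indicator {..w} x * std_normal_density x \<partial>lborel)"
  proof (rule integral_cong_AE)
    show "AE x in lborel. indicator {..- w} (- x) * std_normal_density (- x) =
        std_normal_density x - indicator {..w} x * std_normal_density x"
      using AE_lborel_singleton[of w]
      by eventually_elim (auto simp: indicator_def std_normal_density_def)
  qed measurable
  also have "... = 1 - std_normal_cdf w"
    unfolding std_normal_cdf_def
    using integrable_mult_indicator[of "{..w}" lborel std_normal_density] by simp
  finally show ?thesis .
qed

lemma std_normal_partial_first_moment:
  "(\<integral>x. indicator {..w} x * (x * std_normal_density x) \<partial>lborel) = - std_normal_density w"
proof -
  let ?G = "\<lambda>w. \<integral>x. indicator {..w} x * (x * std_normal_density x) \<partial>lborel"
  have int: "integrable lborel (\<lambda>x. x * std_normal_density x)"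
    using integrable_std_normal_density_ident by (simp add: mult.commute)
  have "((\<lambda>w. ?G w + std_normal_density w) has_real_derivative 0) (at v)" for v
  proof -
    have "(?G has_real_derivative v * std_normal_density v) (at v)"
      by (rule has_real_derivative_integral_atMost[OF int])
         (auto simp: std_normal_density_def intro!: continuous_intros)
    from DERIV_add[OF this std_normal_density_derivative[of v]] show ?thesis by simp
  qed
  then have const: "?G v + std_normal_density v = ?G w + std_normal_density w" for v
    by (rule DERIV_isconst_all[rule_format]) 
  have "(?G \<longlongrightarrow> (\<integral>x. x * std_normal_density x \<partial>lborel)) at_top"
    using tendsto_integral_at_top[OF _ int] by simp
  moreover have "(\<integral>x. x * std_normal_density x \<partial>lborel) = 0"
    using integral_std_normal_moment_odd[of 0] by (simp add: mult.commute)
  ultimately have "((\<lambda>v. ?G v + std_normal_density v) \<longlongrightarrow> 0 + 0) at_top"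
    using std_normal_density_tendsto_0 by (intro tendsto_add) auto
  moreover have "(\<lambda>v. ?G v + std_normal_density v) = (\<lambda>v. ?G w + std_normal_density w)"
    using const by (rule ext)
  ultimately have "((\<lambda>v::real. ?G w + std_normal_density w) \<longlongrightarrow> 0) at_top"
    by (simp only: add_0)
  then have "?G w + std_normal_density w = 0"
    by (simp add: tendsto_const_iff)
  then show ?thesis by simp
qed

text \<open>
  For a standard normal \<open>X\<close> the left-hand sides are the means of \<open>(w - X)\<^sup>+\<close> and \<open>(X - w)\<^sup>+\<close>. They dominate
  the mean increments of a 1-Lipschitz function to the left and to the right of \<open>w\<close>.
\<close>

lemma
  shows std_normal_lower_excess: "(\<integral>x. indicator {..w} x * ((w - x) * std_normal_density x) \<partial>lborel) =
          std_normal_density w + w * std_normal_cdf w"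
    and std_normal_upper_excess: "(\<integral>x. indicator {w<..} x * ((x - w) * std_normal_density x) \<partial>lborel) =
          std_normal_density w - w * (1 - std_normal_cdf w)"
proof -
  have int: "integrable lborel (\<lambda>x. x * std_normal_density x)"
    using integrable_std_normal_density_ident by (simp add: mult.commute)
  have int1: "integrable lborel (\<lambda>x. indicator {..w} x * (x * std_normal_density x))"
    using integrable_mult_indicator[OF _ int, of "{..w}"] by simp
  have int2: "integrable lborel (\<lambda>x. indicator {..w} x * std_normal_density x)"
    using integrable_mult_indicator[of "{..w}" lborel std_normal_density] by simp
  have "(\<integral>x. indicator {..w} x * ((w - x) * std_normal_density x) \<partial>lborel) =
     (\<integral>x. w * (indicator {..w} x * std_normal_density x) - indicator {..w} x * (x * std_normal_density x) \<partial>lborel)"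
    by (intro Bochner_Integration.integral_cong) (auto simp: algebra_simps)
  also have "... = w * std_normal_cdf w + std_normal_density w"
    using int1 int2 by (simp add: std_normal_partial_first_moment std_normal_cdf_def)
  finally show lo: "(\<integral>x. indicator {..w} x * ((w - x) * std_normal_density x) \<partial>lborel) =
          std_normal_density w + w * std_normal_cdf w" by simp
  have int3: "integrable lborel (\<lambda>x. indicator {..w} x * ((w - x) * std_normal_density x))"
  proof -
    have "integrable lborel (\<lambda>x. w * (indicator {..w} x * std_normal_density x) - indicator {..w} x * (x * std_normal_density x))"
      using int1 int2 by auto
    then show ?thesis by (simp add: algebra_simps)
  qed
  have "(\<integral>x. indicator {w<..} x * ((x - w) * std_normal_density x) \<partial>lborel) =
     (\<integral>x. x * std_normal_density x - w * std_normal_density x + indicator {..w} x * ((w - x) * std_normal_density x) \<partial>lborel)"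
    by (intro Bochner_Integration.integral_cong) (auto simp: algebra_simps indicator_def)
  also have "... = 0 - w + (std_normal_density w + w * std_normal_cdf w)"
    using int int3 lo integral_std_normal_moment_odd[of 0] by (simp add: mult.commute)
  finally show "(\<integral>x. indicator {w<..} x * ((x - w) * std_normal_density x) \<partial>lborel) =
          std_normal_density w - w * (1 - std_normal_cdf w)" by (simp add: algebra_simps)
qed

text \<open>The Gaussian tail inequalities below follow from this criterion by differentiation.\<close>

lemma nonneg_of_decreasing_to_0:
  fixes g :: "real \<Rightarrow> real"
  assumes "\<And>x. (g has_real_derivative g' x) (at x)" "\<And>x. g' x \<le> 0" "(g \<longlongrightarrow> 0) at_top"
  shows "0 \<le> g w"
proof (rule tendsto_upperbound[OF assms(3)])
  show "\<forall>\<^sub>F x in at_top. g x \<le> g w"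
    using eventually_ge_at_top[of w]
  proof eventually_elim
    case (elim x)
    show ?case
      by (rule DERIV_nonpos_imp_nonincreasing[OF elim]) (use assms(1,2) in blast)
  qed
qed simp

lemma
  fixes w :: real
  defines "a \<equiv> std_normal_density w + w * std_normal_cdf w"
    and "b \<equiv> std_normal_density w - w * (1 - std_normal_cdf w)"
  shows std_normal_lower_excess_nonneg: "0 \<le> a"
    and std_normal_upper_excess_nonneg: "0 \<le> b"
    and std_normal_cdf_nonneg: "0 \<le> std_normal_cdf w"
    and std_normal_cdf_le_1: "std_normal_cdf w \<le> 1"
proof -
  show "0 \<le> a" "0 \<le> b"
    unfolding a_def b_def std_normal_lower_excess[symmetric] std_normal_upper_excess[symmetric]
    by (auto intro!: Bochner_Integration.integral_nonneg simp: indicator_def normal_density_nonneg)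
  have nn: "0 \<le> std_normal_cdf v" for v
    unfolding std_normal_cdf_def by (auto intro!: Bochner_Integration.integral_nonneg simp: normal_density_nonneg)
  show "0 \<le> std_normal_cdf w" by (rule nn)
  show "std_normal_cdf w \<le> 1" using nn[of "-w"] by (simp add: std_normal_cdf_minus)
qed

text \<open>The sharp lower bound on Mills' ratio: the derivative is minus twice the mean of \<open>(X - w)\<^sup>+\<close>.\<close>

lemma mills_lower: "0 \<le> (1 + w\<^sup>2) * (1 - std_normal_cdf w) - w * std_normal_density w"
proof (rule nonneg_of_decreasing_to_0[where w = w
      and g = "\<lambda>w. (1 + w\<^sup>2) * (1 - std_normal_cdf w) - w * std_normal_density w"
      and g' = "\<lambda>w. - 2 * (std_normal_density w - w * (1 - std_normal_cdf w))"])
  fix x :: real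
  show "((\<lambda>w. (1 + w\<^sup>2) * (1 - std_normal_cdf w) - w * std_normal_density w) has_real_derivative
      - 2 * (std_normal_density x - x * (1 - std_normal_cdf x))) (at x)"
    by (auto intro!: derivative_eq_intros std_normal_density_derivative std_normal_cdf_derivative
        simp: algebra_simps power2_eq_square)
  show "- 2 * (std_normal_density x - x * (1 - std_normal_cdf x)) \<le> 0"
    using std_normal_upper_excess_nonneg[of x] by simp
next
  have lim: "((\<lambda>w. (1 + w\<^sup>2) * (1 - std_normal_cdf w)) \<longlongrightarrow> 0) at_top"
  proof (rule tendsto_sandwich)
    show "\<forall>\<^sub>F w in at_top. 0 \<le> (1 + w\<^sup>2) * (1 - std_normal_cdf w)"
      using std_normal_cdf_le_1 by simp
    show "\<forall>\<^sub>F w in at_top. (1 + w\<^sup>2) * (1 - std_normal_cdf w) \<le> 2 * (w * std_normal_density w)"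
      using eventually_ge_at_top[of 1]
    proof eventually_elim
      case (elim w)
      have "(1 + w\<^sup>2) * (1 - std_normal_cdf w) \<le> (2 * w\<^sup>2) * (1 - std_normal_cdf w)"
        using elim std_normal_cdf_le_1[of w] by (intro mult_right_mono) auto
      also have "... = 2 * (w * (w * (1 - std_normal_cdf w)))" by (simp add: power2_eq_square)
      also have "... \<le> 2 * (w * std_normal_density w)"
        using elim std_normal_upper_excess_nonneg[of w] by (intro mult_left_mono) auto
      finally show ?case .
    qed
    show "((\<lambda>w. 2 * (w * std_normal_density w)) \<longlongrightarrow> 0) at_top"
      using tendsto_mult_right_zero[OF std_normal_density_mult_tendsto_0] .
  qed (rule tendsto_const)
  show "((\<lambda>w. (1 + w\<^sup>2) * (1 - std_normal_cdf w) - w * std_normal_density w) \<longlongrightarrow> 0) at_top"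
    using tendsto_diff[OF lim std_normal_density_mult_tendsto_0] by simp
qed

text \<open>
  The function \<open>b w = E (X - w)\<^sup>+\<close> has derivatives \<open>- P(X > w)\<close> and the normal density, so this is
  \<open>b * b'' \<le> (b')\<^sup>2\<close>, the log-concavity of \<open>b\<close>.
\<close>

lemma std_normal_upper_excess_log_concave:
  "std_normal_density w * (std_normal_density w - w * (1 - std_normal_cdf w)) \<le> (1 - std_normal_cdf w)\<^sup>2"
proof -
  let ?k = "\<lambda>w. (1 - std_normal_cdf w)\<^sup>2 - std_normal_density w * (std_normal_density w - w * (1 - std_normal_cdf w))"
  have "0 \<le> ?k w"
  proof (rule nonneg_of_decreasing_to_0[where w = w and g = ?k and
        g' = "\<lambda>w. - (std_normal_density w * ((1 + w\<^sup>2) * (1 - std_normal_cdf w) - w * std_normal_density w))"])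
    fix x :: real
    show "(?k has_real_derivative
        - (std_normal_density x * ((1 + x\<^sup>2) * (1 - std_normal_cdf x) - x * std_normal_density x))) (at x)"
      by (auto intro!: derivative_eq_intros std_normal_density_derivative std_normal_cdf_derivative
          simp: algebra_simps power2_eq_square)
    show "- (std_normal_density x * ((1 + x\<^sup>2) * (1 - std_normal_cdf x) - x * std_normal_density x)) \<le> 0"
      using mills_lower[of x] by (simp add: normal_density_nonneg)
  next
    have "((\<lambda>w. (1 - std_normal_cdf w)\<^sup>2 - std_normal_density w * std_normal_density w +
          w * std_normal_density w * (1 - std_normal_cdf w)) \<longlongrightarrow> (1 - 1)\<^sup>2 - 0 * 0 + 0 * (1 - 1)) at_top"
      by (intro tendsto_intros std_normal_cdf_tendsto_1 std_normal_density_tendsto_0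
          std_normal_density_mult_tendsto_0)
    then show "(?k \<longlongrightarrow> 0) at_top" by (simp add: algebra_simps)
  qed
  then show ?thesis by simp
qed

text \<open>
  This inequality is responsible for the constant 1 in the bound on the derivative of the Stein solution.
  By symmetry let \<open>0 \<le> w\<close>. With \<open>q\<close> the last factor divided by the density and \<open>m\<close> Mills' ratio,
  \<open>q = 1 - w * m\<close>, and log-concavity gives \<open>q \<le> m\<^sup>2\<close>; the claim becomes polynomial in \<open>sqrt q\<close>.
\<close>

lemma std_normal_excess_product_le: 
  "2 * (std_normal_density w + w * std_normal_cdf w) * (std_normal_density w - w * (1 - std_normal_cdf w))
     \<le> std_normal_density w"
proof -
  have pos: "2 * (std_normal_density w + w * std_normal_cdf w) * (std_normal_density w - w * (1 - std_normal_cdf w))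
     \<le> std_normal_density w" if w: "0 \<le> w" for w
  proof -
    define d where "d = std_normal_density w"
    define b where "b = d - w * (1 - std_normal_cdf w)"
    define q where "q = b / d"
    define m where "m = (1 - std_normal_cdf w) / d"
    define x where "x = sqrt q"
    have d: "0 < d" "d \<le> 1 / 2"
      using std_normal_density_le_half by (auto simp: d_def normal_density_pos)
    have b0: "0 \<le> b" using std_normal_upper_excess_nonneg[of w] by (simp add: b_def d_def)
    have q: "0 \<le> q" "q = 1 - w * m" using d b0 by (auto simp: q_def b_def m_def field_simps)
    have m: "0 \<le> m" using d std_normal_cdf_le_1 by (simp add: m_def)
    have "d * b \<le> (d * m)\<^sup>2"
      using std_normal_upper_excess_log_concave[of w] d by (simp add: b_def d_def[symmetric] m_def)
    then have "q \<le> m\<^sup>2" using d by (simp add: q_def field_simps power2_eq_square)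
    then have xm: "x \<le> m" unfolding x_def using m by (simp add: real_le_lsqrt)
    have x: "0 \<le> x" "x\<^sup>2 = q" using q by (auto simp: x_def)
    have "q \<le> 1" using q m w by simp
    then have x1: "x \<le> 1" by (simp add: x_def)
    have wx: "w * x \<le> 1 - x\<^sup>2"
      using mult_left_mono[OF xm w] q x by simp
    have "2 * (w * x) * x \<le> 2 * (1 - x\<^sup>2) * x" using wx x by (intro mult_right_mono) auto
    moreover have "2 * b * q \<le> x ^ 4"
    proof -
      have "2 * b = 2 * d * q" using d by (simp add: q_def)
      moreover have "2 * d * q \<le> 1 * q" using d q by (intro mult_right_mono) auto
      ultimately have "2 * b * q \<le> q * q" using q by (simp add: mult_right_mono)
      also have "... = x ^ 4" using x by (simp add: power2_eq_square power4_eq_xxxx flip: x(2))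
      finally show ?thesis .
    qed
    moreover have "0 \<le> (1 - x) ^ 3 * (1 + x)" using x x1 by simp
    ultimately have "2 * (w + b) * q \<le> 1"
      using x by (simp add: algebra_simps power2_eq_square power3_eq_cube power4_eq_xxxx flip: x(2))
    then have "2 * (w + b) * q * d \<le> 1 * d" using d by (intro mult_right_mono) auto
    moreover have "2 * (w + b) * q * d = 2 * (w + b) * b" using d by (simp add: q_def)
    moreover have "w + b = d + w * std_normal_cdf w" by (simp add: b_def algebra_simps)
    ultimately have "2 * (d + w * std_normal_cdf w) * b \<le> d" by (metis mult_1)
    then show ?thesis by (simp only: b_def d_def)
  qed
  show ?thesis
  proof (cases "0 \<le> w")
    case False
    have "std_normal_density (- w) = std_normal_density w" by (simp add: std_normal_density_def)
    then show ?thesis using pos[of "- w"] False by (simp add: std_normal_cdf_minus algebra_simps)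
  qed (rule pos)
qed

text \<open>
  The solution is \<open>G w\<close> divided by the density at \<open>w\<close>, where \<open>G w\<close> is the mean of \<open>h X - c\<close> over \<open>X \<le> w\<close>.
  Splitting \<open>h w - c\<close> at \<open>w\<close> as \<open>p w - r w\<close>, with \<open>\<bar>p\<bar> \<le> a\<close> and \<open>\<bar>r\<bar> \<le> b\<close> for the excesses \<open>a\<close> and \<open>b\<close>, turns
  \<open>f'\<close> times the density into \<open>p * b - r * a\<close>, which is at most \<open>2 * a * b\<close>. The function \<open>f' - h\<close> has
  derivative \<open>f w + w * f' w\<close>, and the same splitting bounds it by 1, so that \<open>f'\<close> is 2-Lipschitz.
\<close>

lemma stein_equation_solution:
  fixes h :: "real \<Rightarrow> real"
  assumes h: "1-lipschitz_on UNIV h"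
  defines "c \<equiv> \<integral>x. std_normal_density x * h x \<partial>lborel"
  obtains f f' :: "real \<Rightarrow> real"
  where "\<And>w. (f has_real_derivative f' w) (at w)"
    and "\<And>w. f' w - w * f w = h w - c"
    and "\<And>w. \<bar>f' w\<bar> \<le> 1"
    and "\<And>v w. \<bar>f' v - f' w\<bar> \<le> 2 * \<bar>v - w\<bar>"
proof -
  let ?d = std_normal_density and ?P = std_normal_cdf
  have lip: "\<bar>h x - h y\<bar> \<le> \<bar>x - y\<bar>" for x y
    using lipschitz_onD[OF h, of x y] by (simp add: dist_real_def)
  have cont: "continuous_on UNIV h" using h by (rule lipschitz_on_continuous_on)
  then have [measurable]: "h \<in> borel_measurable borel" by (rule borel_measurable_continuous_onI)
  have int_h: "integrable lborel (\<lambda>x. h x * ?d x)"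
  proof (rule Bochner_Integration.integrable_bound)
    show "integrable lborel (\<lambda>x. \<bar>h 0\<bar> * ?d x + ?d x * \<bar>x\<bar> ^ 1)"
      using integrable_std_normal_moment_abs[of 1] by auto
    have "\<bar>h x\<bar> * ?d x \<le> (\<bar>h 0\<bar> + \<bar>x\<bar>) * ?d x" for x
      using lip[of x 0] by (intro mult_right_mono) (auto simp: normal_density_nonneg)
    then show "AE x in lborel. norm (h x * ?d x) \<le> norm (\<bar>h 0\<bar> * ?d x + ?d x * \<bar>x\<bar> ^ 1)"
      by (auto simp: abs_mult normal_density_nonneg algebra_simps intro!: order_trans[OF _ abs_ge_self])
  qed measurable
  define H where "H = (\<lambda>x. h x - c)"
  have [measurable]: "H \<in> borel_measurable borel" by (simp add: H_def)
  have int_H: "integrable lborel (\<lambda>x. H x * ?d x)"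
    using int_h by (simp add: H_def left_diff_distrib)
  define G where "G w = (\<integral>x. indicator {..w} x * (H x * ?d x) \<partial>lborel)" for w
  define f where "f w = G w / ?d w" for w
  define f' where "f' w = w * f w + H w" for w
  have d_pos: "0 < ?d w" for w by (simp add: normal_density_pos)
  have G': "(G has_real_derivative H w * ?d w) (at w)" for w
    unfolding G_def[abs_def]
    by (rule has_real_derivative_integral_atMost[OF int_H])
       (auto simp: std_normal_density_def H_def intro!: continuous_intros cont)
  have f_deriv: "(f has_real_derivative f' w) (at w)" for w
    unfolding f_def[abs_def] f'_def using d_pos[of w]
    by (auto intro!: derivative_eq_intros G' std_normal_density_derivative simp: f_def field_simps)

  define p where "p w = (\<integral>x. indicator {..w} x * ((h w - h x) * ?d x) \<partial>lborel)" for w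
  define r where "r w = (\<integral>x. indicator {w<..} x * ((h x - h w) * ?d x) \<partial>lborel)" for w
  define a where "a w = ?d w + w * ?P w" for w
  define b where "b w = ?d w - w * (1 - ?P w)" for w
  have int_lin: "integrable lborel (\<lambda>x. (x - w) * ?d x)" "integrable lborel (\<lambda>x. (w - x) * ?d x)" for w
    using integrable_std_normal_density_ident by (auto simp: algebra_simps)
  have int_diff: "integrable lborel (\<lambda>x. (h w - h x) * ?d x)" "integrable lborel (\<lambda>x. (h x - h w) * ?d x)" for w
    using int_h by (auto simp: left_diff_distrib)
  have p_le: "\<bar>p w\<bar> \<le> a w" for w
  proof -
    have "\<bar>p w\<bar> \<le> (\<integral>x. indicator {..w} x * ((w - x) * ?d x) \<partial>lborel)"
      unfolding p_def using lip[of w]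
      by (intro integral_abs_bound[THEN order_trans] integral_mono integrable_abs
           integrable_std_normal_restrict int_diff int_lin)
         (auto simp: indicator_def abs_mult normal_density_nonneg intro!: mult_right_mono, metis abs_of_nonneg diff_ge_0_iff_ge)
    then show ?thesis by (simp add: std_normal_lower_excess a_def)
  qed
  have r_le: "\<bar>r w\<bar> \<le> b w" for w
  proof -
    have "\<bar>r w\<bar> \<le> (\<integral>x. indicator {w<..} x * ((x - w) * ?d x) \<partial>lborel)"
      unfolding r_def using lip[of _ w]
      by (intro integral_abs_bound[THEN order_trans] integral_mono integrable_abs
           integrable_std_normal_restrict int_diff int_lin)
         (auto simp: indicator_def abs_mult normal_density_nonneg intro!: mult_right_mono, metis abs_of_nonneg diff_ge_0_iff_ge less_imp_le)
    then show ?thesis by (simp add: std_normal_upper_excess b_def)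
  qed
  have H_eq: "H w = p w - r w" for w
  proof -
    have "p w - r w = (\<integral>x. indicator {..w} x * ((h w - h x) * ?d x) - indicator {w<..} x * ((h x - h w) * ?d x) \<partial>lborel)"
      unfolding p_def r_def
      by (intro Bochner_Integration.integral_diff[symmetric] integrable_std_normal_restrict int_diff) auto
    also have "... = (\<integral>x. h w * ?d x - ?d x * h x \<partial>lborel)"
      by (intro Bochner_Integration.integral_cong) (auto simp: indicator_def algebra_simps)
    also have "... = h w - c"
      using int_h by (simp add: c_def mult.commute)
    finally show ?thesis by (simp add: H_def)
  qed
  have G_eq: "G w = - (p w * (1 - ?P w)) - r w * ?P w" for w
  proof -
    have "G w = (\<integral>x. H w * (indicator {..w} x * ?d x) - indicator {..w} x * ((h w - h x) * ?d x) \<partial>lborel)"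
      unfolding G_def by (intro Bochner_Integration.integral_cong) (auto simp: H_def algebra_simps)
    also have "... = H w * ?P w - p w"
      unfolding p_def std_normal_cdf_def
      using integrable_std_normal_restrict[OF int_diff(1), of "{..w}" w]
        integrable_mult_indicator[of "{..w}" lborel ?d] by simp
    finally show ?thesis by (simp add: H_eq algebra_simps)
  qed
  have ab0: "0 \<le> a w" "0 \<le> b w" for w
    using std_normal_lower_excess_nonneg std_normal_upper_excess_nonneg by (auto simp: a_def b_def)
  have P01: "0 \<le> ?P w" "?P w \<le> 1" for w
    using std_normal_cdf_nonneg std_normal_cdf_le_1 by auto
  have bound: "\<bar>p w * s - r w * t\<bar> \<le> a w * \<bar>s\<bar> + b w * \<bar>t\<bar>" for w s t
    using mult_right_mono[OF p_le[of w], of "\<bar>s\<bar>"] mult_right_mono[OF r_le[of w], of "\<bar>t\<bar>"]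
      abs_triangle_ineq4[of "p w * s" "r w * t"] by (simp add: abs_mult)

  have f'_le: "\<bar>f' w\<bar> \<le> 1" for w
  proof -
    have "f' w * ?d w = p w * b w - r w * a w"
      using d_pos[of w] by (simp add: f'_def f_def G_eq H_eq a_def b_def field_simps)
    then have "\<bar>f' w\<bar> * ?d w = \<bar>p w * b w - r w * a w\<bar>"
      using d_pos[of w] by (metis abs_mult abs_of_pos)
    also have "... \<le> 2 * a w * b w" using bound[of w "b w" "a w"] ab0 by (simp add: mult_ac)
    also have "... \<le> 1 * ?d w" using std_normal_excess_product_le[of w] by (simp add: a_def b_def)
    finally show ?thesis using d_pos[of w] by (rule mult_right_le_imp_le)
  qed
  have slope: "\<bar>f w + w * f' w\<bar> \<le> 1" for w
  proof -
    have 1: "0 \<le> (1 - ?P w) - w * b w"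
      using mills_lower[of w] by (simp add: b_def algebra_simps power2_eq_square)
    have 2: "0 \<le> ?P w + w * a w"
      using mills_lower[of "- w"]
      by (simp add: a_def std_normal_cdf_minus algebra_simps power2_eq_square std_normal_density_def)
    have "(f w + w * f' w) * ?d w = p w * (w * b w - (1 - ?P w)) - r w * (?P w + w * a w)"
      using d_pos[of w] by (simp add: f'_def f_def G_eq H_eq a_def b_def field_simps power2_eq_square)
    then have "\<bar>f w + w * f' w\<bar> * ?d w = \<bar>p w * (w * b w - (1 - ?P w)) - r w * (?P w + w * a w)\<bar>"
      using d_pos[of w] by (metis abs_mult abs_of_pos)
    also have "... \<le> a w * \<bar>w * b w - (1 - ?P w)\<bar> + b w * \<bar>?P w + w * a w\<bar>" by (rule bound)
    also have "... = a w * ((1 - ?P w) - w * b w) + b w * (?P w + w * a w)"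
      using 1 2 by simp
    also have "... = 1 * ?d w" by (simp add: a_def b_def algebra_simps)
    finally show ?thesis using d_pos[of w] by (rule mult_right_le_imp_le)
  qed
  have lip': "\<bar>(f' v - h v) - (f' w - h w)\<bar> \<le> 1 * \<bar>v - w\<bar>" for v w
  proof -
    have "((\<lambda>w. f' w - h w) has_real_derivative (f x + x * f' x)) (at x)" for x
      unfolding f'_def H_def by (auto intro!: derivative_eq_intros f_deriv simp: f'_def H_def)
    then show ?thesis
      using field_differentiable_bound[of UNIV "\<lambda>w. f' w - h w" "\<lambda>x. f x + x * f' x" 1 v w] slope by auto
  qed
  show ?thesis
  proof (rule that[OF f_deriv _ f'_le])
    show "f' w - w * f w = h w - c" for w by (simp add: f'_def H_def)
    show "\<bar>f' v - f' w\<bar> \<le> 2 * \<bar>v - w\<bar>" for v w using lip'[of v w] lip[of v w] by (simp add: abs_le_iff)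
  qed
qed

lemma taylor_remainder_of_lipschitz_derivative:
  fixes f f' :: "real \<Rightarrow> real"
  assumes f: "\<And>x. (f has_real_derivative f' x) (at x)"
    and lip: "\<And>x y. \<bar>f' x - f' y\<bar> \<le> 2 * \<bar>x - y\<bar>"
  shows "\<bar>f (x + d) - f x - f' x * d\<bar> \<le> d\<^sup>2"
proof -
  have up: "g (x + d) - g x - g' x * d \<le> d\<^sup>2"
    if g: "\<And>x. (g has_real_derivative g' x) (at x)" and l: "\<And>x y. \<bar>g' x - g' y\<bar> \<le> 2 * \<bar>x - y\<bar>" and d: "0 \<le> d"
    for g g' :: "real \<Rightarrow> real" and x d
  proof -
    let ?k = "\<lambda>t. g t - g' x * (t - x) - (t - x)\<^sup>2"
    have "?k (x + d) \<le> ?k x"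
    proof (rule DERIV_nonpos_imp_nonincreasing[where f = ?k])
      fix t assume t: "x \<le> t" "t \<le> x + d"
      have "((\<lambda>t. g t - g' x * (t - x) - (t - x)\<^sup>2) has_real_derivative g' t - g' x - 2 * (t - x)) (at t)"
        by (auto intro!: derivative_eq_intros g)
      moreover have "g' t - g' x - 2 * (t - x) \<le> 0" using l[of t x] t by linarith
      ultimately show "\<exists>y. ((\<lambda>t. g t - g' x * (t - x) - (t - x)\<^sup>2) has_real_derivative y) (at t) \<and> y \<le> 0"
        by blast
    qed (use d in simp)
    then show ?thesis by simp
  qed
  have both: "\<bar>g (x + d) - g x - g' x * d\<bar> \<le> d\<^sup>2"
    if g: "\<And>x. (g has_real_derivative g' x) (at x)" and l: "\<And>x y. \<bar>g' x - g' y\<bar> \<le> 2 * \<bar>x - y\<bar>" and d: "0 \<le> d"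
    for g g' :: "real \<Rightarrow> real" and x d
  proof -
    have "(- g (x + d)) - (- g x) - (- g' x) * d \<le> d\<^sup>2"
      by (rule up[of "\<lambda>x. - g x" "\<lambda>x. - g' x"]) (use g l d in \<open>auto intro!: derivative_eq_intros simp: abs_minus_commute\<close>)
    with up[OF g l d, of x] show ?thesis by (simp add: abs_le_iff)
  qed
  show ?thesis
  proof (cases "0 \<le> d")
    case False
    have "((\<lambda>x. f (- x)) has_real_derivative - f' (- t)) (at t)" for t
      using DERIV_chain2[where g = uminus and x = t and s = UNIV, OF f] by (force intro!: derivative_eq_intros)
    note deriv = this
    have "\<bar>- f' (- s) - - f' (- t)\<bar> \<le> 2 * \<bar>s - t\<bar>" for s t
      using lip[of "- t" "- s"] by (simp add: algebra_simps)
    from both[OF deriv this, of "- d" "- x"] False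
    have "\<bar>f (- (- x + - d)) - f (- (- x)) - (- f' (- (- x))) * - d\<bar> \<le> (- d)\<^sup>2" by simp
    then show ?thesis by (simp add: add.commute)
  qed (use both f lip in blast)
qed

section \<open>Adding a Poisson number of random points\<close>

text \<open>
  Points of a finite measure space act on states, in an order that does not matter. In the application
  the states are point configurations, a point acts by being added, and \<open>\<nu>\<close> is the intensity inside a window.
\<close>

locale poisson_kicks = finite_measure \<nu> for \<nu> :: "'y measure" +
  fixes N :: "'s measure" and act :: "'s \<Rightarrow> 'y \<Rightarrow> 's"
  assumes act_measurable: "(\<lambda>(u, y). act u y) \<in> N \<Otimes>\<^sub>M \<nu> \<rightarrow>\<^sub>M N"
    and act_commute: "\<And>u x y. u \<in> space N \<Longrightarrow> x \<in> space \<nu> \<Longrightarrow> y \<in> space \<nu> \<Longrightarrow>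
      act (act u x) y = act (act u y) x"
begin

lemma measurable_act [measurable (raw)]:
  assumes "f \<in> X \<rightarrow>\<^sub>M N" "g \<in> X \<rightarrow>\<^sub>M \<nu>"
  shows "(\<lambda>x. act (f x) (g x)) \<in> X \<rightarrow>\<^sub>M N"
  using measurable_compose[OF measurable_Pair[OF assms] act_measurable] by simp

lemma act_in_space: "u \<in> space N \<Longrightarrow> y \<in> space \<nu> \<Longrightarrow> act u y \<in> space N"
  using measurable_space[OF act_measurable, of "(u, y)"] by (simp add: space_pair_measure)

definition step :: "('s \<Rightarrow> ennreal) \<Rightarrow> 's \<Rightarrow> ennreal" where
  "step h u = (\<integral>\<^sup>+y. h (act u y) \<partial>\<nu>)"

definition weight :: "real \<Rightarrow> nat \<Rightarrow> real" where
  "weight t n = exp (- (measure \<nu> (space \<nu>) * t)) * t ^ n / fact n"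

text \<open>
  The law of the state after the action of a Poisson number of points with mean \<open>t\<close> times the mass of
  \<open>\<nu>\<close>, written as a series over the number of points. The absolute value makes this a probability kernel
  for every real \<open>t\<close>, so that measurability in \<open>t\<close> needs no side condition.
\<close>

definition kern :: "real \<Rightarrow> 's \<Rightarrow> 's measure" where
  "kern t u = measure_of (space N) (sets N)
     (\<lambda>A. \<Sum>n. ennreal (weight \<bar>t\<bar> n) * (step ^^ n) (indicator A) u)"

lemma weight_nonneg: "0 \<le> t \<Longrightarrow> 0 \<le> weight t n"
  by (simp add: weight_def)

lemma measurable_step [measurable]:
  assumes [measurable]: "h \<in> borel_measurable N"
  shows "step h \<in> borel_measurable N"
  unfolding step_def[abs_def] by measurable

lemma measurable_step_pow [measurable]:
  "h \<in> borel_measurable N \<Longrightarrow> (step ^^ n) h \<in> borel_measurable N"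
  by (induction n) auto

lemma step_cong:
  "(\<And>u. u \<in> space N \<Longrightarrow> g u = h u) \<Longrightarrow> u \<in> space N \<Longrightarrow> step g u = step h u"
  unfolding step_def by (intro nn_integral_cong) (auto intro: act_in_space)

lemma step_pow_cong:
  assumes "\<And>u. u \<in> space N \<Longrightarrow> g u = h u" "u \<in> space N"
  shows "(step ^^ n) g u = (step ^^ n) h u"
  using assms(2) by (induction n arbitrary: u) (auto simp: assms(1) intro!: step_cong)

lemma measurable_act_section:
  assumes [measurable]: "h \<in> borel_measurable N" and "u \<in> space N"
  shows "(\<lambda>y. h (act u y)) \<in> borel_measurable \<nu>"
  using assms(2) by measurable

lemma step_cmult:
  "h \<in> borel_measurable N \<Longrightarrow> u \<in> space N \<Longrightarrow> step (\<lambda>u. c * h u) u = c * step h u"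
  unfolding step_def by (rule nn_integral_cmult) (rule measurable_act_section)

lemma step_add:
  "g \<in> borel_measurable N \<Longrightarrow> h \<in> borel_measurable N \<Longrightarrow> u \<in> space N \<Longrightarrow>
    step (\<lambda>u. g u + h u) u = step g u + step h u"
  unfolding step_def by (rule nn_integral_add) (auto intro: measurable_act_section)

lemma step_suminf:
  "(\<And>i. h i \<in> borel_measurable N) \<Longrightarrow> u \<in> space N \<Longrightarrow> step (\<lambda>u. \<Sum>i. h i u) u = (\<Sum>i. step (h i) u)"
  unfolding step_def by (rule nn_integral_suminf) (auto intro: measurable_act_section)

lemma step_SUP:
  assumes [measurable]: "\<And>i::nat. h i \<in> borel_measurable N"
    and mono: "\<And>i u. u \<in> space N \<Longrightarrow> h i u \<le> h (Suc i) u" and u: "u \<in> space N"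
  shows "step (\<lambda>u. SUP i. h i u) u = (SUP i. step (h i) u)"
  unfolding step_def
  by (rule nn_integral_monotone_convergence_SUP_AE)
     (use u in \<open>auto intro!: mono act_in_space AE_I2\<close>)

lemma step_const: "step (\<lambda>_. c) u = c * ennreal (measure \<nu> (space \<nu>))"
  by (simp add: step_def emeasure_eq_measure)

lemma step_pow_cmult:
  assumes [measurable]: "h \<in> borel_measurable N" and "u \<in> space N"
  shows "(step ^^ n) (\<lambda>u. c * h u) u = c * (step ^^ n) h u"
  using assms(2)
proof (induction n arbitrary: u)
  case (Suc n)
  have "(step ^^ Suc n) (\<lambda>u. c * h u) u = step (\<lambda>u. c * (step ^^ n) h u) u"
    using Suc by (auto intro!: step_cong)
  then show ?case using Suc.prems by (simp add: step_cmult)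
qed simp

lemma step_pow_add:
  assumes [measurable]: "g \<in> borel_measurable N" "h \<in> borel_measurable N" and "u \<in> space N"
  shows "(step ^^ n) (\<lambda>u. g u + h u) u = (step ^^ n) g u + (step ^^ n) h u"
  using assms(3)
proof (induction n arbitrary: u)
  case (Suc n)
  have "(step ^^ Suc n) (\<lambda>u. g u + h u) u = step (\<lambda>u. (step ^^ n) g u + (step ^^ n) h u) u"
    using Suc by (auto intro!: step_cong)
  then show ?case using Suc.prems by (simp add: step_add)
qed simp

lemma step_pow_suminf:
  assumes [measurable]: "\<And>i. h i \<in> borel_measurable N" and "u \<in> space N"
  shows "(step ^^ n) (\<lambda>u. \<Sum>i. h i u) u = (\<Sum>i. (step ^^ n) (h i) u)"
  using assms(2)
proof (induction n arbitrary: u)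
  case (Suc n)
  have "(step ^^ Suc n) (\<lambda>u. \<Sum>i. h i u) u = step (\<lambda>u. \<Sum>i. (step ^^ n) (h i) u) u"
    using Suc by (auto intro!: step_cong)
  then show ?case using Suc.prems by (simp add: step_suminf)
qed simp

lemma step_pow_mono:
  assumes "\<And>u. u \<in> space N \<Longrightarrow> g u \<le> h u" "u \<in> space N"
  shows "(step ^^ n) g u \<le> (step ^^ n) h u"
  using assms(2)
proof (induction n arbitrary: u)
  case (Suc n)
  then show ?case by (auto simp: step_def intro!: nn_integral_mono act_in_space)
qed (simp add: assms(1))

lemma step_pow_SUP:
  assumes [measurable]: "\<And>i::nat. h i \<in> borel_measurable N" and "incseq h" and "u \<in> space N"
  shows "(step ^^ n) (\<lambda>u. SUP i. h i u) u = (SUP i. (step ^^ n) (h i) u)"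
  using assms(3)
proof (induction n arbitrary: u)
  case (Suc n)
  have "(step ^^ Suc n) (\<lambda>u. SUP i. h i u) u = step (\<lambda>u. SUP i. (step ^^ n) (h i) u) u"
    using Suc by (auto intro!: step_cong)
  also have "... = (SUP i. step ((step ^^ n) (h i)) u)"
    using \<open>incseq h\<close> Suc.prems
    by (intro step_SUP step_pow_mono) (auto simp: incseq_Suc_iff le_fun_def)
  finally show ?case by simp
qed simp

lemma step_pow_const:
  "u \<in> space N \<Longrightarrow> (step ^^ n) (\<lambda>_. c) u = c * ennreal (measure \<nu> (space \<nu>)) ^ n"
proof (induction n arbitrary: u)
  case (Suc n)
  have "(step ^^ Suc n) (\<lambda>_. c) u = step (\<lambda>u. c * ennreal (measure \<nu> (space \<nu>)) ^ n) u"
    using Suc by (auto intro!: step_cong)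
  then show ?case by (simp add: step_const mult_ac)
qed simp

lemma weight_sums: "0 \<le> t \<Longrightarrow> (\<Sum>n. ennreal (weight t n) * ennreal (measure \<nu> (space \<nu>)) ^ n) = 1"
proof -
  assume t: "0 \<le> t"
  let ?m = "measure \<nu> (space \<nu>)"
  have "(\<Sum>n. ennreal (weight t n) * ennreal ?m ^ n) = (\<Sum>n. ennreal (exp (- (?m * t)) * ((?m * t) ^ n /\<^sub>R fact n)))"
    using t by (intro suminf_cong) (simp add: weight_def ennreal_power ennreal_mult[symmetric] power_mult_distrib field_simps)
  also have "... = ennreal (exp (- (?m * t)) * exp (?m * t))"
    using t by (intro suminf_ennreal_eq sums_mult exp_converges) auto
  also have "... = 1" by (simp add: exp_minus)
  finally show ?thesis .
qed

lemma space_kern [simp]: "space (kern t u) = space N"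
  and sets_kern [simp, measurable_cong]: "sets (kern t u) = sets N"
  by (simp_all add: kern_def sets.space_closed)

lemma emeasure_kern:
  assumes u: "u \<in> space N" and A: "A \<in> sets N"
  shows "emeasure (kern t u) A = (\<Sum>n. ennreal (weight \<bar>t\<bar> n) * (step ^^ n) (indicator A) u)"
  unfolding kern_def
proof (rule emeasure_measure_of_sigma)
  let ?\<mu> = "\<lambda>A. \<Sum>n. ennreal (weight \<bar>t\<bar> n) * (step ^^ n) (indicator A) u"
  have "(step ^^ n) (indicator {}) u = 0" for n
    using step_pow_const[OF u, of n 0] by (simp add: indicator_def[abs_def])
  then show "positive (sets N) ?\<mu>" by (simp add: positive_def)
  show "countably_additive (sets N) ?\<mu>"
  proof (rule countably_additiveI)
    fix B :: "nat \<Rightarrow> 's set" assume B: "range B \<subseteq> sets N" "disjoint_family B"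
    then have [measurable]: "B i \<in> sets N" for i by auto
    have "(step ^^ n) (indicator (\<Union>i. B i)) u = (\<Sum>i. (step ^^ n) (indicator (B i)) u)" for n
      using step_pow_suminf[of "\<lambda>i. indicator (B i)", OF _ u, of n]
      by (simp add: suminf_indicator[OF B(2)])
    then have "?\<mu> (\<Union>i. B i) = (\<Sum>n. \<Sum>i. ennreal (weight \<bar>t\<bar> n) * (step ^^ n) (indicator (B i)) u)"
      by simp
    also have "... = (\<integral>\<^sup>+n. (\<Sum>i. ennreal (weight \<bar>t\<bar> n) * (step ^^ n) (indicator (B i)) u) \<partial>count_space UNIV)"
      by (simp add: nn_integral_count_space_nat)
    also have "... = (\<Sum>i. \<integral>\<^sup>+n. ennreal (weight \<bar>t\<bar> n) * (step ^^ n) (indicator (B i)) u \<partial>count_space UNIV)"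
      by (rule nn_integral_suminf) auto
    finally show "(\<Sum>i. ?\<mu> (B i)) = ?\<mu> (\<Union>i. B i)"
      by (simp add: nn_integral_count_space_nat)
  qed
qed (use A in \<open>simp_all add: sets.sigma_algebra_axioms\<close>)

lemma nn_integral_kern:
  assumes \<sigma>: "\<sigma> \<in> space N" and h: "h \<in> borel_measurable N"
  shows "(\<integral>\<^sup>+\<tau>. h \<tau> \<partial>kern t \<sigma>) = (\<Sum>n. ennreal (weight \<bar>t\<bar> n) * (step ^^ n) h \<sigma>)"
  using h
proof (induction rule: borel_measurable_induct)
  case (cong f g)
  have 1: "integral\<^sup>N (kern t \<sigma>) f = integral\<^sup>N (kern t \<sigma>) g"
    by (rule nn_integral_cong) (simp add: cong(3))
  have 2: "(step ^^ n) f \<sigma> = (step ^^ n) g \<sigma>" for n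
    using cong \<sigma> by (auto intro: step_pow_cong)
  show ?case unfolding 1 2 by (rule cong(4))
next
  case (set A)
  then show ?case using \<sigma> by (simp add: emeasure_kern)
next
  case (mult u c)
  then show ?case using \<sigma>
    by (simp add: nn_integral_cmult step_pow_cmult mult.left_commute[of _ c])
next
  case (add u v)
  then show ?case using \<sigma>
    by (simp add: nn_integral_add step_pow_add distrib_left suminf_add[symmetric])
next
  case (seq U)
  have "(\<integral>\<^sup>+\<tau>. (SUP i. U i) \<tau> \<partial>kern t \<sigma>) = (SUP i. \<integral>\<^sup>+\<tau>. U i \<tau> \<partial>kern t \<sigma>)"
    unfolding SUP_apply using seq by (intro nn_integral_monotone_convergence_SUP) auto
  also have "... = (SUP i. \<Sum>n. ennreal (weight \<bar>t\<bar> n) * (step ^^ n) (U i) \<sigma>)"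
    using seq by simp
  also have "... = (\<Sum>n. SUP i. ennreal (weight \<bar>t\<bar> n) * (step ^^ n) (U i) \<sigma>)"
    using \<open>incseq U\<close> \<sigma>
    by (intro ennreal_suminf_SUP_eq[symmetric] incseq_SucI mult_left_mono step_pow_mono)
       (auto simp: incseq_Suc_iff le_fun_def)
  also have "... = (\<Sum>n. ennreal (weight \<bar>t\<bar> n) * (step ^^ n) (\<lambda>\<sigma>. SUP i. U i \<sigma>) \<sigma>)"
    using seq \<sigma> by (simp add: step_pow_SUP SUP_mult_left_ennreal)
  finally show ?case by (simp add: SUP_apply[abs_def])
qed

lemma prob_space_kern: "u \<in> space N \<Longrightarrow> prob_space (kern t u)"
  using nn_integral_kern[of u "\<lambda>_. 1" t]
  by (intro prob_spaceI) (simp add: step_pow_const weight_sums)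

lemma measurable_kern [measurable]: "(\<lambda>(t, u). kern t u) \<in> borel \<Otimes>\<^sub>M N \<rightarrow>\<^sub>M prob_algebra N"
proof (rule measurable_prob_algebraI)
  show "prob_space (case x of (t, u) \<Rightarrow> kern t u)" if "x \<in> space (borel \<Otimes>\<^sub>M N)" for x
    using that by (auto simp: space_pair_measure prob_space_kern)
  show "(\<lambda>(t, u). kern t u) \<in> borel \<Otimes>\<^sub>M N \<rightarrow>\<^sub>M subprob_algebra N"
  proof (rule measurable_subprob_algebra)
    fix A assume [measurable]: "A \<in> sets N"
    have "(\<lambda>(t, u). \<Sum>n. ennreal (weight \<bar>t\<bar> n) * (step ^^ n) (indicator A) u) \<in> borel_measurable (borel \<Otimes>\<^sub>M N)"
      unfolding weight_def by measurable
    then show "(\<lambda>x. emeasure (case x of (t, u) \<Rightarrow> kern t u) A) \<in> borel_measurable (borel \<Otimes>\<^sub>M N)"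
      by (rule measurable_cong[THEN iffD1, rotated]) (auto simp: space_pair_measure emeasure_kern)
  qed (auto simp: space_pair_measure prob_space_kern prob_space_imp_subprob_space)
qed

lemma measurable_nn_integral_kern [measurable (raw)]:
  assumes "(\<lambda>(x, \<tau>). h x \<tau>) \<in> borel_measurable (X \<Otimes>\<^sub>M N)" "f \<in> borel_measurable X" "g \<in> X \<rightarrow>\<^sub>M N"
  shows "(\<lambda>x. \<integral>\<^sup>+\<tau>. h x \<tau> \<partial>kern (f x) (g x)) \<in> borel_measurable X"
  by (rule nn_integral_measurable_subprob_algebra2[OF assms(1) measurable_prob_algebraD])
     (use assms in measurable)

lemma step_pow_act:
  assumes [measurable]: "h \<in> borel_measurable N" and "u \<in> space N" and y: "y \<in> space \<nu>"
  shows "(step ^^ n) (\<lambda>\<tau>. h (act \<tau> y)) u = (step ^^ n) h (act u y)"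
  using assms(2)
proof (induction n arbitrary: u)
  case (Suc n)
  have "(step ^^ Suc n) (\<lambda>\<tau>. h (act \<tau> y)) u = step (\<lambda>u. (step ^^ n) h (act u y)) u"
    using Suc by (auto intro!: step_cong)
  also have "... = (step ^^ Suc n) h (act u y)"
    using Suc.prems y by (auto simp: step_def act_commute intro!: nn_integral_cong)
  finally show ?case .
qed simp

lemma nn_integral_kern_act:
  assumes [measurable]: "h \<in> borel_measurable N" and u: "u \<in> space N" and y: "y \<in> space \<nu>"
  shows "(\<integral>\<^sup>+\<tau>. h (act \<tau> y) \<partial>kern t u) = (\<integral>\<^sup>+\<tau>. h \<tau> \<partial>kern t (act u y))"
proof -
  have [measurable]: "(\<lambda>\<tau>. h (act \<tau> y)) \<in> borel_measurable N" using y by measurable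
  show ?thesis using u y by (simp add: nn_integral_kern act_in_space step_pow_act)
qed

lemma nn_integral_kern_0:
  assumes "u \<in> space N" "h \<in> borel_measurable N"
  shows "(\<integral>\<^sup>+\<tau>. h \<tau> \<partial>kern 0 u) = h u"
proof -
  have "(\<Sum>n. ennreal (weight 0 n) * (step ^^ n) h u) = (\<Sum>n\<in>{0}. ennreal (weight 0 n) * (step ^^ n) h u)"
    by (intro suminf_finite) (auto simp: weight_def)
  then show ?thesis using assms by (simp add: nn_integral_kern weight_def)
qed

lemma suminf_suminf_diagonal_ennreal:
  fixes c :: "nat \<Rightarrow> nat \<Rightarrow> ennreal"
  shows "(\<Sum>a. \<Sum>b. c a b * g (a + b)) = (\<Sum>n. (\<Sum>a\<le>n. c a (n - a)) * g n)" (is "?l = _")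
proof -
  have shift: "(\<Sum>b. f b) = (\<Sum>n. if a \<le> n then f (n - a) else 0)" for f :: "nat \<Rightarrow> ennreal" and a :: nat
    using suminf_offset[of "\<lambda>n. if a \<le> n then f (n - a) else 0" a] by simp
  have "(\<Sum>b. c a b * g (a + b)) = (\<Sum>n. if a \<le> n then c a (n - a) * g n else 0)" for a
    unfolding shift[of "\<lambda>b. c a b * g (a + b)" a] by (intro suminf_cong) auto
  then have "?l = (\<Sum>a. \<Sum>n. if a \<le> n then c a (n - a) * g n else 0)"
    by (rule suminf_cong)
  also have "... = (\<integral>\<^sup>+a. (\<Sum>n. if a \<le> n then c a (n - a) * g n else 0) \<partial>count_space UNIV)"
    by (simp add: nn_integral_count_space_nat)
  also have "... = (\<Sum>n. \<integral>\<^sup>+a. (if a \<le> n then c a (n - a) * g n else 0) \<partial>count_space UNIV)"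
    by (rule nn_integral_suminf) auto
  also have "... = (\<Sum>n. \<Sum>a. if a \<le> n then c a (n - a) * g n else 0)"
    by (simp add: nn_integral_count_space_nat)
  also have "... = (\<Sum>n. \<Sum>a\<le>n. c a (n - a) * g n)"
    by (intro suminf_cong, subst suminf_finite[of "{.._}"]) auto
  finally show ?thesis by (simp add: sum_distrib_right)
qed

text \<open>
  The semigroup property: sums of independent Poisson numbers are Poisson, by the binomial formula
  along the diagonals of the double series.
\<close>

lemma nn_integral_kern_kern:
  assumes [measurable]: "h \<in> borel_measurable N" and u: "u \<in> space N" and s: "0 \<le> s" and t: "0 \<le> t"
  shows "(\<integral>\<^sup>+\<rho>. (\<integral>\<^sup>+\<tau>. h \<tau> \<partial>kern t \<rho>) \<partial>kern s u) = (\<integral>\<^sup>+\<tau>. h \<tau> \<partial>kern (s + t) u)" (is "?l = ?r")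
proof -
  let ?g = "\<lambda>n. (step ^^ n) h u"
  have "?l =
     (\<integral>\<^sup>+\<rho>. (\<Sum>b. ennreal (weight t b) * (step ^^ b) h \<rho>) \<partial>kern s u)"
    using t by (intro nn_integral_cong) (simp add: nn_integral_kern)
  also have "... = (\<Sum>a. ennreal (weight s a) * (\<Sum>b. ennreal (weight t b) * ?g (a + b)))"
    using u s by (simp add: nn_integral_kern step_pow_suminf step_pow_cmult funpow_add)
  also have "... = (\<Sum>a. \<Sum>b. (ennreal (weight s a) * ennreal (weight t b)) * ?g (a + b))"
    by (simp add: mult.assoc del: funpow.simps)
  also have "... = (\<Sum>n. (\<Sum>a\<le>n. ennreal (weight s a) * ennreal (weight t (n - a))) * ?g n)"
    by (rule suminf_suminf_diagonal_ennreal)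
  also have "... = (\<Sum>n. ennreal (weight (s + t) n) * ?g n)"
  proof (intro suminf_cong arg_cong2[where f = "(*)"] refl)
    fix n
    have "exp (- (measure \<nu> (space \<nu>) * (s + t))) = exp (- (measure \<nu> (space \<nu>) * s)) * exp (- (measure \<nu> (space \<nu>) * t))"
      by (simp add: exp_add[symmetric] algebra_simps)
    then have "(\<Sum>a\<le>n. weight s a * weight t (n - a)) =
       exp (- (measure \<nu> (space \<nu>) * (s + t))) * (\<Sum>a\<le>n. s ^ a / fact a * (t ^ (n - a) / fact (n - a)))"
      by (simp add: weight_def sum_distrib_left mult_ac)
    also have "(\<Sum>a\<le>n. s ^ a / fact a * (t ^ (n - a) / fact (n - a))) = (s + t) ^ n / fact n"
      by (simp add: binomial_ring sum_divide_distrib binomial_fact field_simps)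
    finally show "(\<Sum>a\<le>n. ennreal (weight s a) * ennreal (weight t (n - a))) = ennreal (weight (s + t) n)"
      using s t by (simp add: weight_def weight_nonneg ennreal_mult[symmetric] sum_ennreal)
  qed
  also have "... = ?r"
    using u s t by (simp add: nn_integral_kern)
  finally show ?thesis .
qed

end

section \<open>Covariances of coupled copies\<close>

context poisson_kicks
begin

lemma weight_derivative:
  "((\<lambda>t. weight t n) has_real_derivative
     (case n of 0 \<Rightarrow> 0 | Suc k \<Rightarrow> weight t k) - measure \<nu> (space \<nu>) * weight t n) (at t within X)"
proof (cases n)
  case 0
  then show ?thesis unfolding weight_def by (auto intro!: derivative_eq_intros)
next
  case (Suc k)
  have "((\<lambda>t. t ^ Suc k / fact (Suc k)) has_real_derivative real (Suc k) * t ^ k / fact (Suc k)) (at t within X)"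
    using DERIV_cdivide[OF DERIV_pow[of "Suc k" t X], of "fact (Suc k)"] by simp
  moreover have "real (Suc k) * t ^ k / fact (Suc k) = t ^ k / fact k"
    by (subst fact_Suc) (simp del: of_nat_Suc)
  ultimately have pow: "((\<lambda>t. t ^ Suc k / fact (Suc k)) has_real_derivative t ^ k / fact k) (at t within X)"
    by simp
  have exp: "((\<lambda>t. exp (- (measure \<nu> (space \<nu>) * t))) has_real_derivative
      - measure \<nu> (space \<nu>) * exp (- (measure \<nu> (space \<nu>) * t))) (at t within X)"
    by (auto intro!: derivative_eq_intros)
  from DERIV_mult[OF exp pow] show ?thesis
    by (simp add: Suc weight_def[abs_def] algebra_simps del: fact_Suc power_Suc)
qed

lemma continuous_on_weight [continuous_intros]:
  "continuous_on X f \<Longrightarrow> continuous_on X (\<lambda>x. weight (f x) n)"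
  unfolding weight_def by (intro continuous_intros) auto

text \<open>
  Up to powers of the mass of \<open>\<nu>\<close>, the probability that two copies receive \<open>a\<close> common points before time
  \<open>s\<close> and \<open>b\<close> and \<open>c\<close> separate points between \<open>s\<close> and \<open>t\<close>.
\<close>

definition weight3 :: "real \<Rightarrow> nat \<Rightarrow> nat \<Rightarrow> nat \<Rightarrow> real \<Rightarrow> real" where
  "weight3 t a b c s = weight s a * weight (t - s) b * weight (t - s) c"

lemma weight3_nonneg: "0 \<le> s \<Longrightarrow> s \<le> t \<Longrightarrow> 0 \<le> weight3 t a b c s"
  by (simp add: weight3_def weight_nonneg)

lemma continuous_on_weight3 [continuous_intros]: "continuous_on X (weight3 t a b c)"
  unfolding weight3_def by (intro continuous_intros)

lemma measurable_weight3 [measurable]: "weight3 t a b c \<in> borel_measurable borel"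
  unfolding weight3_def[abs_def] weight_def by measurable

text \<open>The derivative of a Poisson weight contains the weight with index lowered by one.\<close>

definition shift_down :: "(nat \<Rightarrow> 'b::zero) \<Rightarrow> nat \<Rightarrow> 'b" where
  "shift_down f n = (case n of 0 \<Rightarrow> 0 | Suc k \<Rightarrow> f k)"

lemma shift_down_simps [simp]: "shift_down f 0 = 0" "shift_down f (Suc n) = f n"
  by (simp_all add: shift_down_def)

lemma suminf_shift_down: "(\<Sum>n. shift_down f n) = (\<Sum>n. f n :: ennreal)"
  using suminf_offset[of "shift_down f" 1] by simp

lemma weight3_derivative:
  "(weight3 t a b c has_real_derivative
      (measure \<nu> (space \<nu>) * weight3 t a b c s + shift_down (\<lambda>a. weight3 t a b c s) a)
      - (shift_down (\<lambda>b. weight3 t a b c s) b + shift_down (\<lambda>c. weight3 t a b c s) c)) (at s within X)"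
proof -
  have w: "((\<lambda>s. weight (t - s) n) has_real_derivative
     - ((case n of 0 \<Rightarrow> 0 | Suc k \<Rightarrow> weight (t - s) k) - measure \<nu> (space \<nu>) * weight (t - s) n)) (at s within X)" for n
  proof -
    have "((\<lambda>s. t - s) has_real_derivative - 1) (at s within X)"
      by (auto intro!: derivative_eq_intros)
    from DERIV_chain2[where g = "\<lambda>s. t - s" and x = s and s = X, OF weight_derivative[where X = UNIV and n = n] this]
    show ?thesis by simp
  qed
  show ?thesis
    unfolding weight3_def[abs_def]
    by (rule derivative_eq_intros weight_derivative w refl)+
       (auto simp: shift_down_def algebra_simps split: nat.split)
qed

lemma shift_down_weight3_nonneg:
  assumes "0 \<le> s" "s \<le> t"
  shows "0 \<le> shift_down (\<lambda>a. weight3 t a b c s) a" "0 \<le> shift_down (\<lambda>b. weight3 t a b c s) b"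
    "0 \<le> shift_down (\<lambda>c. weight3 t a b c s) c"
  using assms by (auto simp: shift_down_def weight3_nonneg split: nat.split)

text \<open>
  The fundamental theorem of calculus for \<open>weight3\<close>, with the negative part of the derivative moved to
  the left: only nonnegative terms occur, so the identity can be summed over \<open>a\<close>, \<open>b\<close>, \<open>c\<close> without regard
  to convergence.
\<close>

lemma weight3_forward:
  assumes t: "0 \<le> t"
  shows "ennreal (weight3 t a b c t) +
      (\<integral>\<^sup>+s\<in>{0..t}. (shift_down (\<lambda>b. ennreal (weight3 t a b c s)) b + shift_down (\<lambda>c. ennreal (weight3 t a b c s)) c) \<partial>lborel) =
    ennreal (weight3 t a b c 0) +
      (\<integral>\<^sup>+s\<in>{0..t}. (ennreal (measure \<nu> (space \<nu>)) * ennreal (weight3 t a b c s) + shift_down (\<lambda>a. ennreal (weight3 t a b c s)) a) \<partial>lborel)"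
proof -
  let ?m = "measure \<nu> (space \<nu>)"
  define u where "u s = ?m * weight3 t a b c s + shift_down (\<lambda>a. weight3 t a b c s) a" for s
  define v where "v s = shift_down (\<lambda>b. weight3 t a b c s) b + shift_down (\<lambda>c. weight3 t a b c s) c" for s
  have cont: "continuous_on {0..t} u" "continuous_on {0..t} v"
    unfolding u_def v_def shift_down_def
    by (cases a; cases b; cases c; auto intro!: continuous_intros continuous_on_weight3)+
  have nonneg: "0 \<le> u s" "0 \<le> v s" if "0 \<le> s" "s \<le> t" for s
    using that by (auto simp: u_def v_def shift_down_weight3_nonneg weight3_nonneg)
  have int: "set_integrable lborel {0..t} u" "set_integrable lborel {0..t} v"
    using cont borel_integrable_atLeastAtMost' by blast+
  have ftc: "(\<integral>s. indicator {0..t} s * (u s - v s) \<partial>lborel) = weight3 t a b c t - weight3 t a b c 0"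
  proof -
    have "(weight3 t a b c has_vector_derivative (u s - v s)) (at s within {0..t})" for s
      unfolding u_def v_def has_real_derivative_iff_has_vector_derivative[symmetric] by (rule weight3_derivative)
    from integral_FTC_atLeastAtMost[OF t this continuous_on_diff[OF cont]] show ?thesis by simp
  qed
  have nn: "(\<integral>\<^sup>+s\<in>{0..t}. ennreal (w s) \<partial>lborel) = ennreal (\<integral>s. indicator {0..t} s * w s \<partial>lborel)"
    if "set_integrable lborel {0..t} w" "\<And>s. 0 \<le> s \<Longrightarrow> s \<le> t \<Longrightarrow> 0 \<le> w s" for w
    using that unfolding set_integrable_def
    by (subst nn_integral_eq_integral[symmetric])
       (auto intro!: nn_integral_cong AE_I2 simp: indicator_def)
  have I_nonneg: "0 \<le> (\<integral>s. indicator {0..t} s * u s \<partial>lborel)" "0 \<le> (\<integral>s. indicator {0..t} s * v s \<partial>lborel)"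
    using nonneg by (auto intro!: Bochner_Integration.integral_nonneg simp: indicator_def)
  have "(\<integral>s. indicator {0..t} s * (u s - v s) \<partial>lborel) =
      (\<integral>s. indicator {0..t} s * u s \<partial>lborel) - (\<integral>s. indicator {0..t} s * v s \<partial>lborel)"
    using int by (simp add: set_integrable_def right_diff_distrib)
  with ftc have "weight3 t a b c t + (\<integral>s. indicator {0..t} s * v s \<partial>lborel) =
      weight3 t a b c 0 + (\<integral>s. indicator {0..t} s * u s \<partial>lborel)" by simp
  then have "ennreal (weight3 t a b c t) + (\<integral>\<^sup>+s\<in>{0..t}. ennreal (v s) \<partial>lborel) =
      ennreal (weight3 t a b c 0) + (\<integral>\<^sup>+s\<in>{0..t}. ennreal (u s) \<partial>lborel)"
    using nn[OF int(1)] nn[OF int(2)] nonneg I_nonneg t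
    by (simp add: weight3_nonneg flip: ennreal_plus)
  moreover have "ennreal (v s) = shift_down (\<lambda>b. ennreal (weight3 t a b c s)) b + shift_down (\<lambda>c. ennreal (weight3 t a b c s)) c"
    if "s \<in> {0..t}" for s
    using that by (auto simp: v_def shift_down_def weight3_nonneg split: nat.split)
  moreover have "ennreal (u s) = ennreal ?m * ennreal (weight3 t a b c s) + shift_down (\<lambda>a. ennreal (weight3 t a b c s)) a"
    if "s \<in> {0..t}" for s
    using that by (auto simp: u_def shift_down_def weight3_nonneg ennreal_mult split: nat.split)
  ultimately show ?thesis
    by (smt (verit, best) indicator_simps(2) mult_zero_right nn_integral_cong)
qed

text \<open>
  The mean of the product of \<open>F\<close> and \<open>G\<close> at two copies that agree up to time \<open>s\<close> and are independent
  from \<open>s\<close> to \<open>t\<close>.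
\<close>

definition corr :: "real \<Rightarrow> real \<Rightarrow> ('s \<Rightarrow> ennreal) \<Rightarrow> ('s \<Rightarrow> ennreal) \<Rightarrow> 's \<Rightarrow> ennreal" where
  "corr t s F G u = (\<integral>\<^sup>+\<rho>. (\<integral>\<^sup>+\<tau>. F \<tau> \<partial>kern (t - s) \<rho>) * (\<integral>\<^sup>+\<tau>. G \<tau> \<partial>kern (t - s) \<rho>) \<partial>kern s u)"

definition moment3 :: "('s \<Rightarrow> ennreal) \<Rightarrow> ('s \<Rightarrow> ennreal) \<Rightarrow> 's \<Rightarrow> nat \<Rightarrow> nat \<Rightarrow> nat \<Rightarrow> ennreal" where
  "moment3 F G u a b c = (step ^^ a) (\<lambda>\<rho>. (step ^^ b) F \<rho> * (step ^^ c) G \<rho>) u"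

lemma suminf_mult_suminf_ennreal:
  fixes x y :: "nat \<Rightarrow> ennreal"
  shows "(\<Sum>b. x b) * (\<Sum>c. y c) = (\<Sum>b. \<Sum>c. x b * y c)"
  by simp

lemma product_kern_series:
  assumes "F \<in> borel_measurable N" "G \<in> borel_measurable N" "\<rho> \<in> space N" "0 \<le> r"
  shows "(\<integral>\<^sup>+\<tau>. F \<tau> \<partial>kern r \<rho>) * (\<integral>\<^sup>+\<tau>. G \<tau> \<partial>kern r \<rho>) =
    (\<Sum>b. \<Sum>c. ennreal (weight r b * weight r c) * ((step ^^ b) F \<rho> * (step ^^ c) G \<rho>))"
  using assms
  by (simp only: nn_integral_kern suminf_mult_suminf_ennreal)
     (simp add: weight_nonneg ennreal_mult mult_ac)

lemma corr_series:
  assumes [measurable]: "F \<in> borel_measurable N" "G \<in> borel_measurable N"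
    and u: "u \<in> space N" and s: "0 \<le> s" "s \<le> t"
  shows "corr t s F G u = (\<Sum>a. \<Sum>b. \<Sum>c. ennreal (weight3 t a b c s) * moment3 F G u a b c)" (is "_ = ?r")
proof -
  have "corr t s F G u = (\<integral>\<^sup>+\<rho>. (\<Sum>b. \<Sum>c. ennreal (weight (t - s) b * weight (t - s) c) *
       ((step ^^ b) F \<rho> * (step ^^ c) G \<rho>)) \<partial>kern s u)"
    unfolding corr_def using s by (intro nn_integral_cong product_kern_series) auto
  also have "... = (\<Sum>b. \<Sum>c. ennreal (weight (t - s) b * weight (t - s) c) *
       (\<integral>\<^sup>+\<rho>. (step ^^ b) F \<rho> * (step ^^ c) G \<rho> \<partial>kern s u))"
    by (simp add: nn_integral_suminf nn_integral_cmult)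
  also have "... = (\<Sum>b. \<Sum>c. ennreal (weight (t - s) b * weight (t - s) c) *
       (\<Sum>a. ennreal (weight s a) * moment3 F G u a b c))"
    using u s by (simp add: nn_integral_kern moment3_def)
  also have "... = (\<Sum>b. \<Sum>c. \<Sum>a. ennreal (weight3 t a b c s) * moment3 F G u a b c)"
    using s by (simp add: weight3_def weight_nonneg ennreal_mult mult_ac flip: ennreal_suminf_cmult)
  also have "... = ?r"
  proof -
    have swap: "(\<Sum>i. \<Sum>j. f i j) = (\<Sum>j. \<Sum>i. f i j)" for f :: "nat \<Rightarrow> nat \<Rightarrow> ennreal"
      using nn_integral_suminf[of "\<lambda>j i. f i j" "count_space UNIV"] by (simp add: nn_integral_count_space_nat)
    have "(\<Sum>b. \<Sum>c. \<Sum>a. ennreal (weight3 t a b c s) * moment3 F G u a b c) =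
      (\<Sum>b. \<Sum>a. \<Sum>c. ennreal (weight3 t a b c s) * moment3 F G u a b c)"
      by (intro suminf_cong swap)
    also have "... = ?r"
      by (rule swap)
    finally show ?thesis .
  qed
  finally show ?thesis .
qed

text \<open>
  Summation of \<open>weight3_forward\<close>: a lowered index in \<open>b\<close>, in \<open>c\<close> or in \<open>a\<close> becomes one more application of
  \<open>step\<close> to \<open>F\<close>, to \<open>G\<close>, or to the product of their means.
\<close>

lemma corr_forward:
  assumes [measurable]: "F \<in> borel_measurable N" "G \<in> borel_measurable N"
    and u: "u \<in> space N" and t: "0 \<le> t"
  shows "corr t t F G u + (\<integral>\<^sup>+s\<in>{0..t}. (corr t s (step F) G u + corr t s F (step G) u) \<partial>lborel) =
    corr t 0 F G u + (\<integral>\<^sup>+s\<in>{0..t}. (ennreal (measure \<nu> (space \<nu>)) * corr t s F G u +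
      (\<integral>\<^sup>+\<rho>. step (\<lambda>\<rho>. (\<integral>\<^sup>+\<tau>. F \<tau> \<partial>kern (t - s) \<rho>) * (\<integral>\<^sup>+\<tau>. G \<tau> \<partial>kern (t - s) \<rho>)) \<rho> \<partial>kern s u)) \<partial>lborel)" (is "?l = _")
proof -
  let ?p = "\<lambda>s. \<integral>\<^sup>+\<rho>. step (\<lambda>\<rho>. (\<integral>\<^sup>+\<tau>. F \<tau> \<partial>kern (t - s) \<rho>) * (\<integral>\<^sup>+\<tau>. G \<tau> \<partial>kern (t - s) \<rho>)) \<rho> \<partial>kern s u"
  let ?w = "\<lambda>a b c s. ennreal (weight3 t a b c s)" and ?M = "moment3 F G u"
  let ?m = "ennreal (measure \<nu> (space \<nu>))"
  have sd [simp]: "shift_down f n * x n = shift_down (\<lambda>k. f k * x (Suc k)) n" for f x :: "nat \<Rightarrow> ennreal" and n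
    by (simp add: shift_down_def split: nat.split)
  have step1: "corr t s (step F) G u = (\<Sum>a. \<Sum>b. \<Sum>c. shift_down (\<lambda>b. ?w a b c s) b * ?M a b c)"
    if "s \<in> {0..t}" for s
  proof -
    have "corr t s (step F) G u = (\<Sum>a. \<Sum>b. \<Sum>c. ?w a b c s * ?M a (Suc b) c)"
      using that u by (simp add: corr_series moment3_def funpow_swap1)
    also have "... = (\<Sum>a. \<Sum>b. shift_down (\<lambda>b. \<Sum>c. ?w a b c s * ?M a (Suc b) c) b)"
      by (simp add: suminf_shift_down)
    also have "... = (\<Sum>a. \<Sum>b. \<Sum>c. shift_down (\<lambda>b. ?w a b c s) b * ?M a b c)"
      by (intro suminf_cong) (simp add: shift_down_def split: nat.split)
    finally show ?thesis .
  qed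
  have step2: "corr t s F (step G) u = (\<Sum>a. \<Sum>b. \<Sum>c. shift_down (\<lambda>c. ?w a b c s) c * ?M a b c)"
    if "s \<in> {0..t}" for s
  proof -
    have "corr t s F (step G) u = (\<Sum>a. \<Sum>b. \<Sum>c. ?w a b c s * ?M a b (Suc c))"
      using that u by (simp add: corr_series moment3_def funpow_swap1)
    also have "... = (\<Sum>a. \<Sum>b. \<Sum>c. shift_down (\<lambda>c. ?w a b c s * ?M a b (Suc c)) c)"
      by (simp only: suminf_shift_down)
    also have "... = (\<Sum>a. \<Sum>b. \<Sum>c. shift_down (\<lambda>c. ?w a b c s) c * ?M a b c)"
      by (intro suminf_cong) (simp add: shift_down_def split: nat.split)
    finally show ?thesis .
  qed
  have step3: "?p s =
      (\<Sum>a. \<Sum>b. \<Sum>c. shift_down (\<lambda>a. ?w a b c s) a * ?M a b c)" if s: "s \<in> {0..t}" for s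
  proof -
    let ?K = "\<lambda>\<rho>. (\<integral>\<^sup>+\<tau>. F \<tau> \<partial>kern (t - s) \<rho>) * (\<integral>\<^sup>+\<tau>. G \<tau> \<partial>kern (t - s) \<rho>)"
    let ?S = "\<lambda>\<rho>. \<Sum>b. \<Sum>c. ennreal (weight (t - s) b * weight (t - s) c) * ((step ^^ b) F \<rho> * (step ^^ c) G \<rho>)"
    have "(\<integral>\<^sup>+\<rho>. step ?K \<rho> \<partial>kern s u) = (\<Sum>a. ennreal (weight s a) * (step ^^ a) (step ?K) u)"
      using s u by (simp add: nn_integral_kern)
    also have "... = (\<Sum>a. ennreal (weight s a) * (step ^^ Suc a) ?K u)"
      by (simp add: funpow_swap1)
    also have "... = (\<Sum>a. ennreal (weight s a) * (step ^^ Suc a) ?S u)"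
      using s u by (intro suminf_cong arg_cong2[where f = "(*)"] refl step_pow_cong product_kern_series) auto
    also have "... = (\<Sum>a. ennreal (weight s a) * (\<Sum>b. \<Sum>c. ennreal (weight (t - s) b * weight (t - s) c) * ?M (Suc a) b c))"
      using u by (simp add: step_pow_suminf step_pow_cmult moment3_def del: funpow.simps)
    also have "... = (\<Sum>a. \<Sum>b. \<Sum>c. ?w a b c s * ?M (Suc a) b c)"
      using s by (simp add: weight3_def weight_nonneg ennreal_mult mult_ac flip: ennreal_suminf_cmult)
    also have "... = (\<Sum>a. shift_down (\<lambda>a. \<Sum>b. \<Sum>c. ?w a b c s * ?M (Suc a) b c) a)"
      by (simp only: suminf_shift_down)
    also have "... = (\<Sum>a. \<Sum>b. \<Sum>c. shift_down (\<lambda>a. ?w a b c s) a * ?M a b c)"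
      by (intro suminf_cong) (simp add: shift_down_def split: nat.split)
    finally show ?thesis .
  qed
  have meas: "(\<lambda>s. shift_down (f s) n) \<in> borel_measurable borel"
    if "\<And>k. (\<lambda>s. f s k) \<in> borel_measurable borel" for f :: "real \<Rightarrow> nat \<Rightarrow> ennreal" and n
    using that by (cases n) (auto simp: shift_down_def)
  note [measurable] = meas
  have "?l =
    (\<Sum>a. \<Sum>b. \<Sum>c. ?w a b c t * ?M a b c) +
    (\<integral>\<^sup>+s. (\<Sum>a. \<Sum>b. \<Sum>c. ((shift_down (\<lambda>b. ?w a b c s) b + shift_down (\<lambda>c. ?w a b c s) c) * indicator {0..t} s) * ?M a b c) \<partial>lborel)"
    using u t
    by (intro arg_cong2[where f = "(+)"] nn_integral_cong)
       (auto simp: corr_series[of F G] step1 step2 distrib_right suminf_add[symmetric] simp del: sd split: split_indicator)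
  also have "... = (\<Sum>a. \<Sum>b. \<Sum>c. ?w a b c t * ?M a b c) +
    (\<Sum>a. \<Sum>b. \<Sum>c. (\<integral>\<^sup>+s\<in>{0..t}. (shift_down (\<lambda>b. ?w a b c s) b + shift_down (\<lambda>c. ?w a b c s) c) \<partial>lborel) * ?M a b c)"
    by (simp add: nn_integral_suminf nn_integral_multc del: sd)
  also have "... = (\<Sum>a. \<Sum>b. \<Sum>c. (?w a b c t +
     (\<integral>\<^sup>+s\<in>{0..t}. (shift_down (\<lambda>b. ?w a b c s) b + shift_down (\<lambda>c. ?w a b c s) c) \<partial>lborel)) * ?M a b c)"
    by (simp add: suminf_add distrib_right del: sd)
  also have "... = (\<Sum>a. \<Sum>b. \<Sum>c. (?w a b c 0 +
     (\<integral>\<^sup>+s\<in>{0..t}. (?m * ?w a b c s + shift_down (\<lambda>a. ?w a b c s) a) \<partial>lborel)) * ?M a b c)"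
    by (simp only: weight3_forward[OF t])
  also have "... = (\<Sum>a. \<Sum>b. \<Sum>c. ?w a b c 0 * ?M a b c) +
    (\<Sum>a. \<Sum>b. \<Sum>c. (\<integral>\<^sup>+s\<in>{0..t}. (?m * ?w a b c s + shift_down (\<lambda>a. ?w a b c s) a) \<partial>lborel) * ?M a b c)"
    by (simp add: suminf_add distrib_right del: sd)
  also have "... = (\<Sum>a. \<Sum>b. \<Sum>c. ?w a b c 0 * ?M a b c) +
    (\<integral>\<^sup>+s. (\<Sum>a. \<Sum>b. \<Sum>c. ((?m * ?w a b c s + shift_down (\<lambda>a. ?w a b c s) a) * indicator {0..t} s) * ?M a b c) \<partial>lborel)"
    by (simp add: nn_integral_suminf nn_integral_multc del: sd)
  also have "... = corr t 0 F G u + (\<integral>\<^sup>+s\<in>{0..t}. (?m * corr t s F G u +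
      ?p s) \<partial>lborel)"
    using u t
    by (intro arg_cong2[where f = "(+)"] nn_integral_cong)
       (auto simp: corr_series[of F G] step3 distrib_right mult.assoc suminf_add[symmetric] simp del: sd split: split_indicator)
  finally show ?thesis .
qed

text \<open>Both copies start from \<open>W\<close>, receive the same points up to time \<open>s\<close> and independent ones afterwards.\<close>

definition coup :: "'s measure \<Rightarrow> real \<Rightarrow> real \<Rightarrow> ('s \<times> 's) measure" where
  "coup W t s = (W \<bind> kern s) \<bind> (\<lambda>\<rho>. kern (t - s) \<rho> \<Otimes>\<^sub>M kern (t - s) \<rho>)"

lemma measurable_coup [measurable]:
  assumes [measurable]: "W \<in> space (prob_algebra N)"
  shows "coup W t \<in> borel \<rightarrow>\<^sub>M prob_algebra (N \<Otimes>\<^sub>M N)"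
  unfolding coup_def[abs_def] by measurable

lemma
  assumes W: "W \<in> space (prob_algebra N)"
  shows sets_coup [measurable_cong]: "sets (coup W t s) = sets (N \<Otimes>\<^sub>M N)"
    and prob_space_coup: "prob_space (coup W t s)"
  using measurable_space[OF measurable_coup[OF W], of s t] by (auto simp: space_prob_algebra)

lemma space_coup: "W \<in> space (prob_algebra N) \<Longrightarrow> space (coup W t s) = space N \<times> space N"
  using sets_eq_imp_space_eq[OF sets_coup] by (simp add: space_pair_measure)

lemma kern_sub [measurable]: "kern t \<in> N \<rightarrow>\<^sub>M subprob_algebra N"
  by (rule measurable_prob_algebraD) measurable

lemma nn_integral_bind_kern:
  assumes "W \<in> space (prob_algebra N)" "h \<in> borel_measurable N"
  shows "(\<integral>\<^sup>+\<tau>. h \<tau> \<partial>(W \<bind> kern t)) = (\<integral>\<^sup>+u. (\<integral>\<^sup>+\<tau>. h \<tau> \<partial>kern t u) \<partial>W)"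
proof -
  have "sets W = sets N" using assms(1) by (simp add: space_prob_algebra)
  then have "kern t \<in> W \<rightarrow>\<^sub>M subprob_algebra N" using kern_sub by (simp cong: measurable_cong_sets)
  then show ?thesis using nn_integral_bind[OF assms(2)] by blast
qed

lemma bind_kern_in_prob_algebra [measurable (raw)]:
  "W \<in> space (prob_algebra N) \<Longrightarrow> W \<bind> kern t \<in> space (prob_algebra N)"
  using prob_space_bind'[of W N "kern t" N] sets_bind'[of W N "kern t" N]
  by (simp add: space_prob_algebra)

lemma nn_integral_coup:
  assumes W: "W \<in> space (prob_algebra N)" and H[measurable]: "H \<in> borel_measurable (N \<Otimes>\<^sub>M N)"
  shows "(\<integral>\<^sup>+p. H p \<partial>coup W t s) =
    (\<integral>\<^sup>+\<rho>. (\<integral>\<^sup>+\<tau>. (\<integral>\<^sup>+\<tau>'. H (\<tau>, \<tau>') \<partial>kern (t - s) \<rho>) \<partial>kern (t - s) \<rho>) \<partial>(W \<bind> kern s))" (is "?l = ?r")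
proof -
  have sets: "sets (W \<bind> kern s) = sets N"
    using bind_kern_in_prob_algebra[OF W] by (simp add: space_prob_algebra)
  note [measurable_cong] = sets
  have "(\<lambda>\<rho>. kern (t - s) \<rho> \<Otimes>\<^sub>M kern (t - s) \<rho>) \<in> N \<rightarrow>\<^sub>M subprob_algebra (N \<Otimes>\<^sub>M N)"
    by (rule measurable_prob_algebraD) measurable
  then have "(\<lambda>\<rho>. kern (t - s) \<rho> \<Otimes>\<^sub>M kern (t - s) \<rho>) \<in> (W \<bind> kern s) \<rightarrow>\<^sub>M subprob_algebra (N \<Otimes>\<^sub>M N)"
    by (simp cong: measurable_cong_sets add: sets)
  then have "?l =
      (\<integral>\<^sup>+\<rho>. (\<integral>\<^sup>+p. H p \<partial>(kern (t - s) \<rho> \<Otimes>\<^sub>M kern (t - s) \<rho>)) \<partial>(W \<bind> kern s))"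
    unfolding coup_def by (rule nn_integral_bind[OF H])
  also have "... = ?r"
  proof (rule nn_integral_cong)
    fix \<rho> assume "\<rho> \<in> space (W \<bind> kern s)"
    then have "\<rho> \<in> space N" using sets_eq_imp_space_eq[OF sets] by simp
    then interpret prob_space "kern (t - s) \<rho>" by (rule prob_space_kern)
    show "(\<integral>\<^sup>+p. H p \<partial>(kern (t - s) \<rho> \<Otimes>\<^sub>M kern (t - s) \<rho>)) =
      (\<integral>\<^sup>+\<tau>. (\<integral>\<^sup>+\<tau>'. H (\<tau>, \<tau>') \<partial>kern (t - s) \<rho>) \<partial>kern (t - s) \<rho>)"
      by (rule nn_integral_fst[symmetric]) measurable
  qed
  finally show ?thesis .
qed

lemma nn_integral_coup_product:
  assumes W: "W \<in> space (prob_algebra N)" and [measurable]: "F \<in> borel_measurable N" "G \<in> borel_measurable N"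
  shows "(\<integral>\<^sup>+p. F (fst p) * G (snd p) \<partial>coup W t s) = (\<integral>\<^sup>+u. corr t s F G u \<partial>W)"
    and "(\<integral>\<^sup>+p. F (fst p) * G (snd p) \<partial>coup W t s) =
      (\<integral>\<^sup>+\<rho>. (\<integral>\<^sup>+\<tau>. F \<tau> \<partial>kern (t - s) \<rho>) * (\<integral>\<^sup>+\<tau>. G \<tau> \<partial>kern (t - s) \<rho>) \<partial>(W \<bind> kern s))"
proof -
  show "(\<integral>\<^sup>+p. F (fst p) * G (snd p) \<partial>coup W t s) =
      (\<integral>\<^sup>+\<rho>. (\<integral>\<^sup>+\<tau>. F \<tau> \<partial>kern (t - s) \<rho>) * (\<integral>\<^sup>+\<tau>. G \<tau> \<partial>kern (t - s) \<rho>) \<partial>(W \<bind> kern s))"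
    by (simp add: nn_integral_coup[OF W] nn_integral_cmult nn_integral_multc)
  also have "... = (\<integral>\<^sup>+u. corr t s F G u \<partial>W)"
    unfolding corr_def by (rule nn_integral_bind_kern[OF W]) measurable
  finally show "(\<integral>\<^sup>+p. F (fst p) * G (snd p) \<partial>coup W t s) = (\<integral>\<^sup>+u. corr t s F G u \<partial>W)" .
qed

lemma nn_integral_coup_marginal:
  assumes W: "W \<in> space (prob_algebra N)" and [measurable]: "h \<in> borel_measurable N" and s: "0 \<le> s" "s \<le> t"
  shows "(\<integral>\<^sup>+p. h (fst p) \<partial>coup W t s) = (\<integral>\<^sup>+\<tau>. h \<tau> \<partial>(W \<bind> kern t))" (is ?fst)
    and "(\<integral>\<^sup>+p. h (snd p) \<partial>coup W t s) = (\<integral>\<^sup>+\<tau>. h \<tau> \<partial>(W \<bind> kern t))" (is ?snd)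
proof -
  have spW: "space W = space N" using W by (auto simp: space_prob_algebra dest: sets_eq_imp_space_eq)
  have eq: "(\<integral>\<^sup>+u. corr t s F G u \<partial>W) = (\<integral>\<^sup>+\<tau>. h \<tau> \<partial>(W \<bind> kern t))"
    if "F = h \<and> G = (\<lambda>_. 1) \<or> F = (\<lambda>_. 1) \<and> G = h" for F G
  proof -
    have "corr t s F G u = (\<integral>\<^sup>+\<tau>. h \<tau> \<partial>kern t u)" if u: "u \<in> space N" for u
    proof -
      have "corr t s F G u = (\<integral>\<^sup>+\<rho>. (\<integral>\<^sup>+\<tau>. h \<tau> \<partial>kern (t - s) \<rho>) \<partial>kern s u)"
        using that \<open>F = h \<and> G = (\<lambda>_. 1) \<or> F = (\<lambda>_. 1) \<and> G = h\<close>
        by (auto simp: corr_def prob_space.emeasure_space_1[OF prob_space_kern, simplified] intro!: nn_integral_cong)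
      then show ?thesis using nn_integral_kern_kern[of h u s "t - s"] u s by simp
    qed
    then show ?thesis using spW
      by (subst nn_integral_bind_kern[OF W]) (auto intro!: nn_integral_cong)
  qed
  show ?fst using nn_integral_coup_product(1)[OF W, of h "\<lambda>_. 1" t s] eq[of h "\<lambda>_. 1"] by simp
  show ?snd using nn_integral_coup_product(1)[OF W, of "\<lambda>_. 1" h t s] eq[of "\<lambda>_. 1" h] by simp
qed

lemma distr_coup:
  assumes W: "W \<in> space (prob_algebra N)" and s: "0 \<le> s" "s \<le> t"
  shows "distr (coup W t s) N fst = W \<bind> kern t" "distr (coup W t s) N snd = W \<bind> kern t"
proof -
  note [measurable_cong] = sets_coup[OF W]
  have sets: "sets (W \<bind> kern t) = sets N"
    using bind_kern_in_prob_algebra[OF W] by (simp add: space_prob_algebra)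
  have [measurable]: "fst \<in> coup W t s \<rightarrow>\<^sub>M N" "snd \<in> coup W t s \<rightarrow>\<^sub>M N" by measurable
  have "emeasure (distr (coup W t s) N f) A = (\<integral>\<^sup>+p. indicator A (f p) \<partial>coup W t s)"
    if "A \<in> sets N" "f \<in> coup W t s \<rightarrow>\<^sub>M N" for f A
    using that nn_integral_distr[OF that(2), of "indicator A"] by simp
  then show "distr (coup W t s) N fst = W \<bind> kern t" "distr (coup W t s) N snd = W \<bind> kern t"
    using nn_integral_coup_marginal[OF W _ s, of "indicator A" for A] sets
    by (auto intro!: measure_eqI simp: sets)
qed

lemma nn_integral_coup_step:
  assumes W: "W \<in> space (prob_algebra N)" and [measurable]: "F \<in> borel_measurable N" "G \<in> borel_measurable N"
  shows "(\<integral>\<^sup>+p. step F (fst p) * G (snd p) \<partial>coup W t s) =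
      (\<integral>\<^sup>+y. (\<integral>\<^sup>+p. F (act (fst p) y) * G (snd p) \<partial>coup W t s) \<partial>\<nu>)"
    and "(\<integral>\<^sup>+p. F (fst p) * step G (snd p) \<partial>coup W t s) =
      (\<integral>\<^sup>+y. (\<integral>\<^sup>+p. F (fst p) * G (act (snd p) y) \<partial>coup W t s) \<partial>\<nu>)"
proof -
  note [measurable_cong] = sets_coup[OF W]
  interpret coup: prob_space "coup W t s" by (rule prob_space_coup[OF W])
  interpret pair_sigma_finite \<nu> "coup W t s" by standard
  have [measurable]: "(\<lambda>y. F (act (fst p) y)) \<in> borel_measurable \<nu>" "(\<lambda>y. G (act (snd p) y)) \<in> borel_measurable \<nu>"
    if "p \<in> space (coup W t s)" for p
    using that by (auto simp: space_coup[OF W] intro!: measurable_act_section)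
  have "(\<integral>\<^sup>+p. step F (fst p) * G (snd p) \<partial>coup W t s) =
      (\<integral>\<^sup>+p. (\<integral>\<^sup>+y. F (act (fst p) y) * G (snd p) \<partial>\<nu>) \<partial>coup W t s)"
    by (intro nn_integral_cong) (simp add: step_def nn_integral_multc)
  also have "... = (\<integral>\<^sup>+y. (\<integral>\<^sup>+p. F (act (fst p) y) * G (snd p) \<partial>coup W t s) \<partial>\<nu>)"
    by (rule Fubini') measurable
  finally show "(\<integral>\<^sup>+p. step F (fst p) * G (snd p) \<partial>coup W t s) =
      (\<integral>\<^sup>+y. (\<integral>\<^sup>+p. F (act (fst p) y) * G (snd p) \<partial>coup W t s) \<partial>\<nu>)" .
  have "(\<integral>\<^sup>+p. F (fst p) * step G (snd p) \<partial>coup W t s) =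
      (\<integral>\<^sup>+p. (\<integral>\<^sup>+y. F (fst p) * G (act (snd p) y) \<partial>\<nu>) \<partial>coup W t s)"
    by (intro nn_integral_cong) (simp add: step_def nn_integral_cmult)
  also have "... = (\<integral>\<^sup>+y. (\<integral>\<^sup>+p. F (fst p) * G (act (snd p) y) \<partial>coup W t s) \<partial>\<nu>)"
    by (rule Fubini') measurable
  finally show "(\<integral>\<^sup>+p. F (fst p) * step G (snd p) \<partial>coup W t s) =
      (\<integral>\<^sup>+y. (\<integral>\<^sup>+p. F (fst p) * G (act (snd p) y) \<partial>coup W t s) \<partial>\<nu>)" .
qed

lemma nn_integral_step_kern_product:
  assumes W: "W \<in> space (prob_algebra N)" and [measurable]: "F \<in> borel_measurable N" "G \<in> borel_measurable N"
  shows "(\<integral>\<^sup>+\<rho>. step (\<lambda>\<rho>. (\<integral>\<^sup>+\<tau>. F \<tau> \<partial>kern (t - s) \<rho>) * (\<integral>\<^sup>+\<tau>. G \<tau> \<partial>kern (t - s) \<rho>)) \<rho> \<partial>(W \<bind> kern s)) =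
      (\<integral>\<^sup>+y. (\<integral>\<^sup>+p. F (act (fst p) y) * G (act (snd p) y) \<partial>coup W t s) \<partial>\<nu>)" (is "_ = ?r")
proof -
  have in_prob: "W \<bind> kern s \<in> space (prob_algebra N)" by (rule bind_kern_in_prob_algebra[OF W])
  then have sets[measurable_cong]: "sets (W \<bind> kern s) = sets N" and "prob_space (W \<bind> kern s)"
    by (auto simp: space_prob_algebra)
  then interpret W1: prob_space "W \<bind> kern s" by simp
  interpret pair_sigma_finite \<nu> "W \<bind> kern s" by standard
  let ?K = "\<lambda>\<rho>. (\<integral>\<^sup>+\<tau>. F \<tau> \<partial>kern (t - s) \<rho>) * (\<integral>\<^sup>+\<tau>. G \<tau> \<partial>kern (t - s) \<rho>)"
  have "(\<integral>\<^sup>+\<rho>. step ?K \<rho> \<partial>(W \<bind> kern s)) = (\<integral>\<^sup>+y. (\<integral>\<^sup>+\<rho>. ?K (act \<rho> y) \<partial>(W \<bind> kern s)) \<partial>\<nu>)"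
    unfolding step_def by (rule Fubini') measurable
  also have "... = ?r"
  proof (rule nn_integral_cong)
    fix y assume y: "y \<in> space \<nu>"
    have [measurable]: "(\<lambda>\<tau>. F (act \<tau> y)) \<in> borel_measurable N" "(\<lambda>\<tau>. G (act \<tau> y)) \<in> borel_measurable N"
      using y by measurable
    have "(\<integral>\<^sup>+\<rho>. ?K (act \<rho> y) \<partial>(W \<bind> kern s)) =
       (\<integral>\<^sup>+\<rho>. (\<integral>\<^sup>+\<tau>. F (act \<tau> y) \<partial>kern (t - s) \<rho>) * (\<integral>\<^sup>+\<tau>. G (act \<tau> y) \<partial>kern (t - s) \<rho>) \<partial>(W \<bind> kern s))"
      using y sets_eq_imp_space_eq[OF sets] by (intro nn_integral_cong) (simp add: nn_integral_kern_act)
    then show "(\<integral>\<^sup>+\<rho>. ?K (act \<rho> y) \<partial>(W \<bind> kern s)) =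
       (\<integral>\<^sup>+p. F (act (fst p) y) * G (act (snd p) y) \<partial>coup W t s)"
      using nn_integral_coup_product(2)[OF W, of "\<lambda>\<tau>. F (act \<tau> y)" "\<lambda>\<tau>. G (act \<tau> y)"] by simp
  qed
  finally show ?thesis .
qed

text \<open>
  Every integral over \<open>y\<close> adds one point: to one copy on the left, to both or to none on the right. For
  bounded functions the difference of both sides is an integrated product of increments.
\<close>

lemma coup_forward:
  assumes W: "W \<in> space (prob_algebra N)"
    and [measurable]: "F \<in> borel_measurable N" "G \<in> borel_measurable N" and t: "0 \<le> t"
  shows "(\<integral>\<^sup>+p. F (fst p) * G (snd p) \<partial>coup W t t) +
      (\<integral>\<^sup>+s\<in>{0..t}. (\<integral>\<^sup>+y. (\<integral>\<^sup>+p. F (act (fst p) y) * G (snd p) + F (fst p) * G (act (snd p) y) \<partial>coup W t s) \<partial>\<nu>) \<partial>lborel) =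
    (\<integral>\<^sup>+p. F (fst p) * G (snd p) \<partial>coup W t 0) +
      (\<integral>\<^sup>+s\<in>{0..t}. (\<integral>\<^sup>+y. (\<integral>\<^sup>+p. F (fst p) * G (snd p) + F (act (fst p) y) * G (act (snd p) y) \<partial>coup W t s) \<partial>\<nu>) \<partial>lborel)"
proof -
  have sets[measurable_cong]: "sets W = sets N" and "prob_space W" using W by (auto simp: space_prob_algebra)
  then interpret W: prob_space W by simp
  interpret pair_sigma_finite W lborel by standard
  note [measurable_cong] = sets_coup[OF W]
  have spW: "space W = space N" using sets by (rule sets_eq_imp_space_eq)
  have [measurable]: "(\<lambda>y. F (act \<tau> y)) \<in> borel_measurable \<nu>" "(\<lambda>y. G (act \<tau> y)) \<in> borel_measurable \<nu>"
    if "\<tau> \<in> space N" for \<tau>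
    using that by (auto intro!: measurable_act_section)
  have [measurable]: "(\<lambda>\<tau>. F (act \<tau> y)) \<in> borel_measurable N" "(\<lambda>\<tau>. G (act \<tau> y)) \<in> borel_measurable N"
    if "y \<in> space \<nu>" for y using that by measurable
  let ?K = "\<lambda>s \<rho>. (\<integral>\<^sup>+\<tau>. F \<tau> \<partial>kern (t - s) \<rho>) * (\<integral>\<^sup>+\<tau>. G \<tau> \<partial>kern (t - s) \<rho>)"
  have corr_meas [measurable]: "(\<lambda>(\<sigma>, s). corr t s A B \<sigma>) \<in> borel_measurable (N \<Otimes>\<^sub>M lborel)"
    if [measurable]: "A \<in> borel_measurable N" "B \<in> borel_measurable N" for A B
    unfolding corr_def by measurable
  have K_meas [measurable]: "(\<lambda>(\<sigma>, s). \<integral>\<^sup>+\<rho>. step (?K s) \<rho> \<partial>kern s \<sigma>) \<in> borel_measurable (N \<Otimes>\<^sub>M lborel)"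
    unfolding step_def by measurable
  have cm [measurable]: "corr t s A B \<in> borel_measurable N"
    if "A \<in> borel_measurable N" "B \<in> borel_measurable N" for A B s
    using that unfolding corr_def[abs_def] by measurable
  have lhs: "(\<integral>\<^sup>+y. (\<integral>\<^sup>+p. F (act (fst p) y) * G (snd p) + F (fst p) * G (act (snd p) y) \<partial>coup W t s) \<partial>\<nu>) =
     (\<integral>\<^sup>+\<sigma>. (corr t s (step F) G \<sigma> + corr t s F (step G) \<sigma>) \<partial>W)" for s
  proof -
    interpret coup: prob_space "coup W t s" by (rule prob_space_coup[OF W])
    have "(\<integral>\<^sup>+y. (\<integral>\<^sup>+p. F (act (fst p) y) * G (snd p) + F (fst p) * G (act (snd p) y) \<partial>coup W t s) \<partial>\<nu>) =
      (\<integral>\<^sup>+y. ((\<integral>\<^sup>+p. F (act (fst p) y) * G (snd p) \<partial>coup W t s) + (\<integral>\<^sup>+p. F (fst p) * G (act (snd p) y) \<partial>coup W t s)) \<partial>\<nu>)"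
      by (intro nn_integral_cong nn_integral_add) measurable
    also have "... = (\<integral>\<^sup>+y. (\<integral>\<^sup>+p. F (act (fst p) y) * G (snd p) \<partial>coup W t s) \<partial>\<nu>) +
        (\<integral>\<^sup>+y. (\<integral>\<^sup>+p. F (fst p) * G (act (snd p) y) \<partial>coup W t s) \<partial>\<nu>)"
      by (intro nn_integral_add) measurable
    also have "... = (\<integral>\<^sup>+\<sigma>. corr t s (step F) G \<sigma> \<partial>W) + (\<integral>\<^sup>+\<sigma>. corr t s F (step G) \<sigma> \<partial>W)"
      by (simp add: nn_integral_coup_step[OF W, symmetric] nn_integral_coup_product(1)[OF W])
    finally show ?thesis by (simp add: nn_integral_add)
  qed
  have rhs: "(\<integral>\<^sup>+y. (\<integral>\<^sup>+p. F (fst p) * G (snd p) + F (act (fst p) y) * G (act (snd p) y) \<partial>coup W t s) \<partial>\<nu>) =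
     (\<integral>\<^sup>+\<sigma>. (ennreal (measure \<nu> (space \<nu>)) * corr t s F G \<sigma> + (\<integral>\<^sup>+\<rho>. step (?K s) \<rho> \<partial>kern s \<sigma>)) \<partial>W)" for s
  proof -
    interpret coup: prob_space "coup W t s" by (rule prob_space_coup[OF W])
    have "(\<integral>\<^sup>+y. (\<integral>\<^sup>+p. F (fst p) * G (snd p) + F (act (fst p) y) * G (act (snd p) y) \<partial>coup W t s) \<partial>\<nu>) =
      (\<integral>\<^sup>+y. ((\<integral>\<^sup>+p. F (fst p) * G (snd p) \<partial>coup W t s) + (\<integral>\<^sup>+p. F (act (fst p) y) * G (act (snd p) y) \<partial>coup W t s)) \<partial>\<nu>)"
      by (intro nn_integral_cong nn_integral_add) measurable
    also have "... = (\<integral>\<^sup>+y. (\<integral>\<^sup>+p. F (fst p) * G (snd p) \<partial>coup W t s) \<partial>\<nu>) +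
        (\<integral>\<^sup>+y. (\<integral>\<^sup>+p. F (act (fst p) y) * G (act (snd p) y) \<partial>coup W t s) \<partial>\<nu>)"
      by (intro nn_integral_add) measurable
    also have "... = ennreal (measure \<nu> (space \<nu>)) * (\<integral>\<^sup>+\<sigma>. corr t s F G \<sigma> \<partial>W) +
        (\<integral>\<^sup>+\<sigma>. (\<integral>\<^sup>+\<rho>. step (?K s) \<rho> \<partial>kern s \<sigma>) \<partial>W)"
      by (simp add: nn_integral_step_kern_product[OF W, symmetric] nn_integral_coup_product(1)[OF W]
          nn_integral_bind_kern[OF W] emeasure_eq_measure mult.commute)
    finally show ?thesis by (simp add: nn_integral_add nn_integral_cmult)
  qed
  have swap: "(\<integral>\<^sup>+s\<in>{0..t}. (\<integral>\<^sup>+\<sigma>. u \<sigma> s \<partial>W) \<partial>lborel) = (\<integral>\<^sup>+\<sigma>. (\<integral>\<^sup>+s\<in>{0..t}. u \<sigma> s \<partial>lborel) \<partial>W)"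
    if [measurable]: "(\<lambda>(\<sigma>, s). u \<sigma> s) \<in> borel_measurable (N \<Otimes>\<^sub>M lborel)" for u
  proof -
    have [measurable]: "(\<lambda>\<sigma>. u \<sigma> s) \<in> borel_measurable N" for s by measurable
    have "(\<integral>\<^sup>+s\<in>{0..t}. (\<integral>\<^sup>+\<sigma>. u \<sigma> s \<partial>W) \<partial>lborel) = (\<integral>\<^sup>+s. (\<integral>\<^sup>+\<sigma>. u \<sigma> s * indicator {0..t} s \<partial>W) \<partial>lborel)"
      by (intro nn_integral_cong) (simp add: nn_integral_multc)
    also have "... = (\<integral>\<^sup>+\<sigma>. (\<integral>\<^sup>+s\<in>{0..t}. u \<sigma> s \<partial>lborel) \<partial>W)"
      by (rule Fubini') measurable
    finally show ?thesis .
  qed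
  have "(\<integral>\<^sup>+\<sigma>. (corr t t F G \<sigma> + (\<integral>\<^sup>+s\<in>{0..t}. (corr t s (step F) G \<sigma> + corr t s F (step G) \<sigma>) \<partial>lborel)) \<partial>W) =
    (\<integral>\<^sup>+\<sigma>. (corr t 0 F G \<sigma> + (\<integral>\<^sup>+s\<in>{0..t}. (ennreal (measure \<nu> (space \<nu>)) * corr t s F G \<sigma> +
      (\<integral>\<^sup>+\<rho>. step (?K s) \<rho> \<partial>kern s \<sigma>)) \<partial>lborel)) \<partial>W)"
    using spW t by (intro nn_integral_cong corr_forward) auto
  moreover have "(\<integral>\<^sup>+s\<in>{0..t}. (\<integral>\<^sup>+\<sigma>. (corr t s (step F) G \<sigma> + corr t s F (step G) \<sigma>) \<partial>W) \<partial>lborel) =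
      (\<integral>\<^sup>+\<sigma>. (\<integral>\<^sup>+s\<in>{0..t}. (corr t s (step F) G \<sigma> + corr t s F (step G) \<sigma>) \<partial>lborel) \<partial>W)"
    by (rule swap) measurable
  moreover have "(\<integral>\<^sup>+s\<in>{0..t}. (\<integral>\<^sup>+\<sigma>. (ennreal (measure \<nu> (space \<nu>)) * corr t s F G \<sigma> +
        (\<integral>\<^sup>+\<rho>. step (?K s) \<rho> \<partial>kern s \<sigma>)) \<partial>W) \<partial>lborel) =
      (\<integral>\<^sup>+\<sigma>. (\<integral>\<^sup>+s\<in>{0..t}. (ennreal (measure \<nu> (space \<nu>)) * corr t s F G \<sigma> +
        (\<integral>\<^sup>+\<rho>. step (?K s) \<rho> \<partial>kern s \<sigma>)) \<partial>lborel) \<partial>W)"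
    by (rule swap) measurable
  ultimately show ?thesis
    unfolding lhs rhs nn_integral_coup_product(1)[OF W assms(2,3)]
    by (simp only:) (simp add: nn_integral_add[symmetric] del: nn_integral_add)
qed

end

lemma measurable_lebesgue_integral_kernel [measurable (raw)]:
  fixes f :: "'x \<Rightarrow> 'y \<Rightarrow> real"
  assumes f: "(\<lambda>(x, y). f x y) \<in> borel_measurable (X \<Otimes>\<^sub>M Y)"
    and L: "L \<in> X \<rightarrow>\<^sub>M prob_algebra Y"
  shows "(\<lambda>x. \<integral>y. f x y \<partial>L x) \<in> borel_measurable X"
proof -
  have L': "L \<in> X \<rightarrow>\<^sub>M subprob_algebra Y" using L by (rule measurable_prob_algebraD)
  have sets: "sets (L x) = sets Y" if "x \<in> space X" for x
    using measurable_space[OF L that] by (simp add: space_prob_algebra)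
  have fx: "f x \<in> borel_measurable (L x)" if "x \<in> space X" for x
    using measurable_compose[OF measurable_Pair1'[OF that, of Y] f] sets[OF that] by (simp cong: measurable_cong_sets)
  have m: "(\<lambda>x. \<integral>\<^sup>+y. ennreal (g (f x y)) \<partial>L x) \<in> borel_measurable X"
    if "g \<in> borel_measurable borel" for g :: "real \<Rightarrow> real"
  proof (rule nn_integral_measurable_subprob_algebra2[OF _ L'])
    have "(\<lambda>z. ennreal (g (case z of (x, y) \<Rightarrow> f x y))) \<in> borel_measurable (X \<Otimes>\<^sub>M Y)"
      using measurable_compose[OF f that] by measurable
    then show "(\<lambda>(x, y). ennreal (g (f x y))) \<in> borel_measurable (X \<Otimes>\<^sub>M Y)"
      by (simp add: case_prod_beta)
  qed
  have "(\<integral>y. f x y \<partial>L x) = (if (\<integral>\<^sup>+y. ennreal \<bar>f x y\<bar> \<partial>L x) < \<infinity>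
      then enn2real (\<integral>\<^sup>+y. ennreal (f x y) \<partial>L x) - enn2real (\<integral>\<^sup>+y. ennreal (- f x y) \<partial>L x) else 0)"
    if "x \<in> space X" for x
    using fx[OF that] by (auto simp: integrable_iff_bounded real_lebesgue_integral_def not_integrable_integral_eq)
  moreover have "(\<lambda>x. if (\<integral>\<^sup>+y. ennreal \<bar>f x y\<bar> \<partial>L x) < \<infinity>
      then enn2real (\<integral>\<^sup>+y. ennreal (f x y) \<partial>L x) - enn2real (\<integral>\<^sup>+y. ennreal (- f x y) \<partial>L x) else 0) \<in> borel_measurable X"
    using m[of "\<lambda>x. x"] m[of uminus] m[of abs] by measurable
  ultimately show ?thesis by (simp cong: measurable_cong)
qed

lemma (in finite_measure) nn_integral_eq_integral_bounded:
  fixes f :: "'a \<Rightarrow> real"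
  assumes "f \<in> borel_measurable M" "\<And>x. x \<in> space M \<Longrightarrow> 0 \<le> f x" "\<And>x. x \<in> space M \<Longrightarrow> f x \<le> c"
  shows "(\<integral>\<^sup>+x. ennreal (f x) \<partial>M) = ennreal (\<integral>x. f x \<partial>M)"
  using assms by (intro nn_integral_eq_integral integrable_const_bound[where B = c]) auto

lemma (in finite_measure) integral_bounds:
  fixes f :: "'a \<Rightarrow> real"
  assumes "f \<in> borel_measurable M" "\<And>x. x \<in> space M \<Longrightarrow> 0 \<le> f x" "\<And>x. x \<in> space M \<Longrightarrow> f x \<le> c"
  shows "0 \<le> (\<integral>x. f x \<partial>M)" "(\<integral>x. f x \<partial>M) \<le> c * measure M (space M)"
proof -
  show "0 \<le> (\<integral>x. f x \<partial>M)" using assms by (intro integral_nonneg_AE) auto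
  have "(\<integral>x. f x \<partial>M) \<le> (\<integral>x. c \<partial>M)"
    using assms by (intro integral_mono integrable_const_bound[where B = c and f = f]) auto
  then show "(\<integral>x. f x \<partial>M) \<le> c * measure M (space M)" by (simp add: mult.commute)
qed

context poisson_kicks
begin

text \<open>
  All terms of \<open>coup_forward\<close> are finite here, and subtracting them leaves the expanded product
  \<open>(F(y) - F) * (G(y) - G)\<close>, where \<open>F(y)\<close> is \<open>F\<close> after the action of \<open>y\<close>.
\<close>

lemma coup_covariance_nonneg:
  fixes F G :: "'s \<Rightarrow> real"
  assumes W: "W \<in> space (prob_algebra N)" and [measurable]: "F \<in> borel_measurable N" "G \<in> borel_measurable N"
    and t: "0 \<le> t"
    and F: "\<And>u. u \<in> space N \<Longrightarrow> 0 \<le> F u \<and> F u \<le> C" and G: "\<And>u. u \<in> space N \<Longrightarrow> 0 \<le> G u \<and> G u \<le> C"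
  shows "(\<integral>p. F (fst p) * G (snd p) \<partial>coup W t t) - (\<integral>p. F (fst p) * G (snd p) \<partial>coup W t 0) =
    (\<integral>s. indicator {0..t} s * (\<integral>y. (\<integral>p. (F (act (fst p) y) - F (fst p)) * (G (act (snd p) y) - G (snd p)) \<partial>coup W t s) \<partial>\<nu>) \<partial>lborel)"
proof -
  let ?c = "\<lambda>s. \<integral>p. F (fst p) * G (snd p) \<partial>coup W t s"
  let ?D = "\<lambda>y p. (F (act (fst p) y) - F (fst p)) * (G (act (snd p) y) - G (snd p))"
  let ?J = "\<lambda>H s. \<integral>y. (\<integral>p. H y p \<partial>coup W t s) \<partial>\<nu>"
  let ?n = "\<lambda>H s. \<integral>\<^sup>+y. (\<integral>\<^sup>+p. ennreal (H y p) \<partial>coup W t s) \<partial>\<nu>"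
  note [measurable_cong] = sets_coup[OF W]
  have coup[measurable]: "coup W t \<in> borel \<rightarrow>\<^sub>M prob_algebra (N \<Otimes>\<^sub>M N)" by (rule measurable_coup[OF W])
  have [measurable]: "(\<lambda>\<tau>. F (act \<tau> y)) \<in> borel_measurable N" "(\<lambda>\<tau>. G (act \<tau> y)) \<in> borel_measurable N"
    if "y \<in> space \<nu>" for y using that by measurable
  define A where "A y p = F (act (fst p) y) * G (snd p) + F (fst p) * G (act (snd p) y)" for y p
  define B where "B y p = F (fst p) * G (snd p) + F (act (fst p) y) * G (act (snd p) y)" for y p
  let ?F = "\<lambda>u. ennreal (F u)" and ?G = "\<lambda>u. ennreal (G u)"
  have main: "(\<integral>\<^sup>+s\<in>{0..t}. (\<integral>\<^sup>+y. (\<integral>\<^sup>+p. ennreal (H y p) \<partial>coup W t s) \<partial>\<nu>) \<partial>lborel) =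
        ennreal (\<integral>s. indicator {0..t} s * ?J H s \<partial>lborel)"
      "0 \<le> (\<integral>s. indicator {0..t} s * ?J H s \<partial>lborel)"
      "integrable lborel (\<lambda>s. indicator {0..t} s * ?J H s)"
      "\<And>s. integrable \<nu> (\<lambda>y. \<integral>p. H y p \<partial>coup W t s)"
      "\<And>s y. y \<in> space \<nu> \<Longrightarrow> integrable (coup W t s) (H y)"
    if [measurable]: "(\<lambda>(y, p). H y p) \<in> borel_measurable (\<nu> \<Otimes>\<^sub>M (N \<Otimes>\<^sub>M N))"
      and H: "\<And>y p. y \<in> space \<nu> \<Longrightarrow> p \<in> space N \<times> space N \<Longrightarrow> 0 \<le> H y p \<and> H y p \<le> c" for H c
  proof -
    have Hy[measurable]: "H y \<in> borel_measurable (N \<Otimes>\<^sub>M N)" if "y \<in> space \<nu>" for y using that by measurable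
    let ?h = "\<lambda>s y. \<integral>p. H y p \<partial>coup W t s"
    have h_meas[measurable]: "(\<lambda>(s, y). ?h s y) \<in> borel_measurable (borel \<Otimes>\<^sub>M \<nu>)" by measurable
    have hs_meas[measurable]: "?h s \<in> borel_measurable \<nu>" for s by measurable
    have h: "(\<integral>\<^sup>+p. ennreal (H y p) \<partial>coup W t s) = ennreal (?h s y)" "0 \<le> ?h s y" "?h s y \<le> c"
      and int1: "integrable (coup W t s) (H y)"
      if y: "y \<in> space \<nu>" for s y
    proof -
      interpret coup: prob_space "coup W t s" by (rule prob_space_coup[OF W])
      have b: "0 \<le> H y p" "H y p \<le> c" if "p \<in> space (coup W t s)" for p
        using H[OF y] that by (auto simp: space_coup[OF W])
      show "(\<integral>\<^sup>+p. ennreal (H y p) \<partial>coup W t s) = ennreal (?h s y)"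
        using y b by (intro coup.nn_integral_eq_integral_bounded[where c = c]) measurable
      show "0 \<le> ?h s y" "?h s y \<le> c"
        using coup.integral_bounds[of "H y" c] y b by (auto simp: coup.prob_space)
      show "integrable (coup W t s) (H y)"
        using y b by (intro coup.integrable_const_bound[where B = c]) auto
    qed
    show "integrable (coup W t s) (H y)" if "y \<in> space \<nu>" for s y using int1 that by blast
    have h2: "(\<integral>\<^sup>+y. (\<integral>\<^sup>+p. ennreal (H y p) \<partial>coup W t s) \<partial>\<nu>) = ennreal (\<integral>y. ?h s y \<partial>\<nu>)"
        "0 \<le> (\<integral>y. ?h s y \<partial>\<nu>)" "(\<integral>y. ?h s y \<partial>\<nu>) \<le> c * measure \<nu> (space \<nu>)" for s
    proof -
      have "(\<integral>\<^sup>+y. (\<integral>\<^sup>+p. ennreal (H y p) \<partial>coup W t s) \<partial>\<nu>) = (\<integral>\<^sup>+y. ennreal (?h s y) \<partial>\<nu>)"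
        using h by (intro nn_integral_cong) auto
      also have "... = ennreal (\<integral>y. ?h s y \<partial>\<nu>)"
        using h by (intro nn_integral_eq_integral_bounded[where c = c] hs_meas) auto
      finally show "(\<integral>\<^sup>+y. (\<integral>\<^sup>+p. ennreal (H y p) \<partial>coup W t s) \<partial>\<nu>) = ennreal (\<integral>y. ?h s y \<partial>\<nu>)" .
      show "0 \<le> (\<integral>y. ?h s y \<partial>\<nu>)" "(\<integral>y. ?h s y \<partial>\<nu>) \<le> c * measure \<nu> (space \<nu>)"
        using integral_bounds[OF hs_meas, of s c] h by auto
    qed
    show "integrable \<nu> (?h s)" for s
      using h by (intro integrable_const_bound[where B = c] hs_meas) auto
    have [measurable]: "(\<lambda>s. \<integral>y. ?h s y \<partial>\<nu>) \<in> borel_measurable borel" by measurable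
    have eq: "(\<integral>\<^sup>+s\<in>{0..t}. (\<integral>\<^sup>+y. (\<integral>\<^sup>+p. ennreal (H y p) \<partial>coup W t s) \<partial>\<nu>) \<partial>lborel) =
        (\<integral>\<^sup>+s. ennreal (indicator {0..t} s * (\<integral>y. ?h s y \<partial>\<nu>)) \<partial>lborel)"
      by (intro nn_integral_cong) (auto simp: h2 indicator_def)
    show int: "integrable lborel (\<lambda>s. indicator {0..t} s * (\<integral>y. ?h s y \<partial>\<nu>))"
    proof (rule Bochner_Integration.integrable_bound)
      show "integrable lborel (\<lambda>s. indicator {0..t} s * (c * measure \<nu> (space \<nu>)))"
        using t by (intro integrable_mult_left) (auto simp: emeasure_lborel_Icc_eq)
      have "\<bar>indicator {0..t} s * (\<integral>y. ?h s y \<partial>\<nu>)\<bar> \<le> \<bar>indicator {0..t} s * (c * measure \<nu> (space \<nu>))\<bar>" for s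
        using h2(2,3)[of s] by (auto simp: indicator_def)
      then show "AE s in lborel. norm (indicator {0..t} s * (\<integral>y. ?h s y \<partial>\<nu>)) \<le>
          norm (indicator {0..t} s * (c * measure \<nu> (space \<nu>)))" by simp
    qed measurable
    show "(\<integral>\<^sup>+s\<in>{0..t}. (\<integral>\<^sup>+y. (\<integral>\<^sup>+p. ennreal (H y p) \<partial>coup W t s) \<partial>\<nu>) \<partial>lborel) =
        ennreal (\<integral>s. indicator {0..t} s * (\<integral>y. ?h s y \<partial>\<nu>) \<partial>lborel)"
      unfolding eq using h2(2) by (intro nn_integral_eq_integral int) auto
    show "0 \<le> (\<integral>s. indicator {0..t} s * (\<integral>y. ?h s y \<partial>\<nu>) \<partial>lborel)"
      using h2(2) by (intro Bochner_Integration.integral_nonneg) auto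
  qed
  have FG: "0 \<le> F u * G u'" "F u * G u' \<le> C * C" if "u \<in> space N" "u' \<in> space N" for u u'
    using F[OF that(1)] G[OF that(2)] by (auto intro: mult_mono)
  have A: "0 \<le> A y p \<and> A y p \<le> C * C + C * C" and B: "0 \<le> B y p \<and> B y p \<le> C * C + C * C"
    if y: "y \<in> space \<nu>" and p: "p \<in> space N \<times> space N" for y p
    using y p by (auto simp only: A_def B_def mem_Times_iff intro!: add_mono add_nonneg_nonneg FG act_in_space)
  have A_meas: "(\<lambda>(y, p). A y p) \<in> borel_measurable (\<nu> \<Otimes>\<^sub>M (N \<Otimes>\<^sub>M N))"
    unfolding A_def by measurable
  have B_meas: "(\<lambda>(y, p). B y p) \<in> borel_measurable (\<nu> \<Otimes>\<^sub>M (N \<Otimes>\<^sub>M N))"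
    unfolding B_def by measurable
  note IA = main[OF A_meas A] and IB = main[OF B_meas B]
  have XY: "(\<integral>\<^sup>+p. ?F (fst p) * ?G (snd p) \<partial>coup W t s) = ennreal (?c s)"
      "0 \<le> ?c s" for s
  proof -
    interpret coup: prob_space "coup W t s" by (rule prob_space_coup[OF W])
    have "(\<integral>\<^sup>+p. ?F (fst p) * ?G (snd p) \<partial>coup W t s) = (\<integral>\<^sup>+p. ennreal (F (fst p) * G (snd p)) \<partial>coup W t s)"
      using F G by (intro nn_integral_cong) (auto simp: space_coup[OF W] ennreal_mult)
    also have "... = ennreal (?c s)"
      using FG by (intro coup.nn_integral_eq_integral_bounded[where c = "C * C"]) (auto simp: space_coup[OF W])
    finally show "(\<integral>\<^sup>+p. ?F (fst p) * ?G (snd p) \<partial>coup W t s) = ennreal (?c s)" .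
    show "0 \<le> ?c s"
      using FG by (intro integral_nonneg_AE AE_I2) (auto simp: space_coup[OF W])
  qed
  have "(\<integral>\<^sup>+s\<in>{0..t}. (\<integral>\<^sup>+y. (\<integral>\<^sup>+p. ?F (act (fst p) y) * ?G (snd p) + ?F (fst p) * ?G (act (snd p) y) \<partial>coup W t s) \<partial>\<nu>) \<partial>lborel) =
     (\<integral>\<^sup>+s\<in>{0..t}. (\<integral>\<^sup>+y. (\<integral>\<^sup>+p. ennreal (A y p) \<partial>coup W t s) \<partial>\<nu>) \<partial>lborel)"
    by (intro nn_integral_cong arg_cong2[where f = "(*)"] refl)
       (auto simp: space_coup[OF W] A_def F G act_in_space ennreal_mult ennreal_plus)
  moreover have "(\<integral>\<^sup>+s\<in>{0..t}. (\<integral>\<^sup>+y. (\<integral>\<^sup>+p. ?F (fst p) * ?G (snd p) + ?F (act (fst p) y) * ?G (act (snd p) y) \<partial>coup W t s) \<partial>\<nu>) \<partial>lborel) =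
     (\<integral>\<^sup>+s\<in>{0..t}. (\<integral>\<^sup>+y. (\<integral>\<^sup>+p. ennreal (B y p) \<partial>coup W t s) \<partial>\<nu>) \<partial>lborel)"
    by (intro nn_integral_cong arg_cong2[where f = "(*)"] refl)
       (auto simp: space_coup[OF W] B_def F G act_in_space ennreal_mult ennreal_plus)
  ultimately have "ennreal (?c t) +
      ennreal (\<integral>s. indicator {0..t} s * ?J A s \<partial>lborel) =
    ennreal (?c 0) +
      ennreal (\<integral>s. indicator {0..t} s * ?J B s \<partial>lborel)"
    using coup_forward[OF W, of ?F ?G t] t IA(1) IB(1) XY(1) by simp
  then have "?c t +
      (\<integral>s. indicator {0..t} s * ?J A s \<partial>lborel) =
    ?c 0 +
      (\<integral>s. indicator {0..t} s * ?J B s \<partial>lborel)"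
    using XY(2) IA(2) IB(2) by (simp flip: ennreal_plus)
  then have "?c t - ?c 0 =
      (\<integral>s. indicator {0..t} s * ?J B s \<partial>lborel) -
      (\<integral>s. indicator {0..t} s * ?J A s \<partial>lborel)" by simp
  also have "... = (\<integral>s. indicator {0..t} s * ?J B s -
      indicator {0..t} s * ?J A s \<partial>lborel)"
    by (rule Bochner_Integration.integral_diff[OF IB(3) IA(3), symmetric])
  also have "... = (\<integral>s. indicator {0..t} s * ?J ?D s \<partial>lborel)"
  proof (rule Bochner_Integration.integral_cong[OF refl])
    fix s :: real
    have "?J B s - ?J A s =
       (\<integral>y. (\<integral>p. B y p \<partial>coup W t s) - (\<integral>p. A y p \<partial>coup W t s) \<partial>\<nu>)"
      by (rule Bochner_Integration.integral_diff[OF IB(4) IA(4), symmetric])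
    also have "... = (\<integral>y. (\<integral>p. B y p - A y p \<partial>coup W t s) \<partial>\<nu>)"
      by (intro Bochner_Integration.integral_cong refl Bochner_Integration.integral_diff[symmetric] IB(5) IA(5))
    also have "... = ?J ?D s"
      by (simp add: A_def B_def algebra_simps)
    finally show "indicator {0..t} s * ?J B s -
      indicator {0..t} s * ?J A s =
      indicator {0..t} s * ?J ?D s"
      by (simp flip: right_diff_distrib)
  qed
  finally show ?thesis .
qed

lemma integral_coup_marginal:
  fixes h :: "'s \<Rightarrow> real"
  assumes W: "W \<in> space (prob_algebra N)" and [measurable]: "h \<in> borel_measurable N" and s: "0 \<le> s" "s \<le> t"
  shows "(\<integral>p. h (fst p) \<partial>coup W t s) = (\<integral>\<tau>. h \<tau> \<partial>(W \<bind> kern t))"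
    and "(\<integral>p. h (snd p) \<partial>coup W t s) = (\<integral>\<tau>. h \<tau> \<partial>(W \<bind> kern t))"
proof -
  note [measurable_cong] = sets_coup[OF W]
  show "(\<integral>p. h (fst p) \<partial>coup W t s) = (\<integral>\<tau>. h \<tau> \<partial>(W \<bind> kern t))"
    by (subst distr_coup(1)[OF W s, symmetric], subst integral_distr) auto
  show "(\<integral>p. h (snd p) \<partial>coup W t s) = (\<integral>\<tau>. h \<tau> \<partial>(W \<bind> kern t))"
    by (subst distr_coup(2)[OF W s, symmetric], subst integral_distr) auto
qed

text \<open>
  A constant added to \<open>F\<close> or \<open>G\<close> leaves the increments unchanged, and it cancels on the left because the
  marginals of \<open>coup W t s\<close> do not depend on \<open>s\<close>. So the functions may be taken nonnegative.
\<close>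

theorem coup_covariance:
  fixes F G :: "'s \<Rightarrow> real"
  assumes W: "W \<in> space (prob_algebra N)" and [measurable]: "F \<in> borel_measurable N" "G \<in> borel_measurable N"
    and t: "0 \<le> t"
    and F: "\<And>u. u \<in> space N \<Longrightarrow> \<bar>F u\<bar> \<le> C" and G: "\<And>u. u \<in> space N \<Longrightarrow> \<bar>G u\<bar> \<le> C"
  shows "(\<integral>p. F (fst p) * G (snd p) \<partial>coup W t t) - (\<integral>p. F (fst p) * G (snd p) \<partial>coup W t 0) =
    (\<integral>s. indicator {0..t} s * (\<integral>y. (\<integral>p. (F (act (fst p) y) - F (fst p)) * (G (act (snd p) y) - G (snd p)) \<partial>coup W t s) \<partial>\<nu>) \<partial>lborel)"
proof -
  note [measurable_cong] = sets_coup[OF W]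
  have shift: "(\<integral>p. (F (fst p) + C) * (G (snd p) + C) \<partial>coup W t s) =
     (\<integral>p. F (fst p) * G (snd p) \<partial>coup W t s) + C * (\<integral>\<tau>. G \<tau> \<partial>(W \<bind> kern t)) + C * (\<integral>\<tau>. F \<tau> \<partial>(W \<bind> kern t)) + C * C"
    if s: "0 \<le> s" "s \<le> t" for s
  proof -
    interpret coup: prob_space "coup W t s" by (rule prob_space_coup[OF W])
    have "\<bar>F a\<bar> * \<bar>G b\<bar> \<le> C * C" if "a \<in> space N" "b \<in> space N" for a b
      using F[OF that(1)] G[OF that(2)] by (intro mult_mono) auto
    then have int: "integrable (coup W t s) (\<lambda>p. F (fst p))" "integrable (coup W t s) (\<lambda>p. G (snd p))"
      "integrable (coup W t s) (\<lambda>p. F (fst p) * G (snd p))"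
      using F G by - (rule coup.integrable_const_bound[where B = C] coup.integrable_const_bound[where B = "C * C"],
          auto simp: space_coup[OF W] abs_mult intro!: AE_I2)+
    have "(\<integral>p. (F (fst p) + C) * (G (snd p) + C) \<partial>coup W t s) =
      (\<integral>p. F (fst p) * G (snd p) + C * G (snd p) + C * F (fst p) + C * C \<partial>coup W t s)"
      by (intro Bochner_Integration.integral_cong) (auto simp: algebra_simps)
    also have "... = (\<integral>p. F (fst p) * G (snd p) \<partial>coup W t s) + C * (\<integral>p. G (snd p) \<partial>coup W t s) + C * (\<integral>p. F (fst p) \<partial>coup W t s) + C * C"
      using int by (simp add: coup.prob_space)
    finally show ?thesis using integral_coup_marginal[OF W _ s] by simp
  qed
  have "(\<integral>p. (F (fst p) + C) * (G (snd p) + C) \<partial>coup W t t) - (\<integral>p. (F (fst p) + C) * (G (snd p) + C) \<partial>coup W t 0) =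
    (\<integral>s. indicator {0..t} s * (\<integral>y. (\<integral>p. ((F (act (fst p) y) + C) - (F (fst p) + C)) *
       ((G (act (snd p) y) + C) - (G (snd p) + C)) \<partial>coup W t s) \<partial>\<nu>) \<partial>lborel)"
    by (rule coup_covariance_nonneg[OF W, where C = "2 * C"]) (use F G t in \<open>force simp: abs_le_iff\<close>)+
  then show ?thesis using t by (simp add: shift)
qed

end

section \<open>Poincare inequalities for Poisson kernels and coupled copies\<close>

lemma integral_bind_bounded:
  fixes f :: "'y \<Rightarrow> real"
  assumes W: "W \<in> space (prob_algebra X)" and K: "K \<in> X \<rightarrow>\<^sub>M prob_algebra Y"
    and [measurable]: "f \<in> borel_measurable Y" and f: "\<And>y. y \<in> space Y \<Longrightarrow> \<bar>f y\<bar> \<le> C"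
  shows "(\<integral>y. f y \<partial>(W \<bind> K)) = (\<integral>x. (\<integral>y. f y \<partial>K x) \<partial>W)" (is "_ = ?r")
proof -
  have sW: "sets W = sets X" and "prob_space W" using W by (auto simp: space_prob_algebra)
  then interpret W: prob_space W by simp
  have spW: "space W = space X" using sW by (rule sets_eq_imp_space_eq)
  have KW: "K \<in> W \<rightarrow>\<^sub>M prob_algebra Y" using K sW by (simp cong: measurable_cong_sets)
  interpret B: prob_space "W \<bind> K" by (rule prob_space_bind'[OF W K])
  have sB: "sets (W \<bind> K) = sets Y" by (rule sets_bind'[OF W K])
  have spB: "space (W \<bind> K) = space Y" using sB by (rule sets_eq_imp_space_eq)
  have Kx: "prob_space (K x)" "sets (K x) = sets Y" "space (K x) = space Y" if "x \<in> space W" for x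
    using measurable_space[OF KW that] sets_eq_imp_space_eq[of "K x" Y] by (auto simp: space_prob_algebra)
  have [measurable]: "f \<in> borel_measurable (W \<bind> K)" using sB by (simp cong: measurable_cong_sets)
  have fKx: "f \<in> borel_measurable (K x)" if "x \<in> space W" for x
    using Kx(2)[OF that] by (simp cong: measurable_cong_sets)
  let ?g = "\<lambda>y. f y + C"
  have g: "0 \<le> ?g y \<and> ?g y \<le> 2 * C" if "y \<in> space Y" for y using f[OF that] by (simp add: abs_le_iff)
  have m: "(\<lambda>x. \<integral>y. ?g y \<partial>K x) \<in> borel_measurable W"
    by (rule measurable_lebesgue_integral_kernel[OF _ KW]) measurable
  have int_Kx: "integrable (K x) f" if "x \<in> space W" for x
    using Kx[OF that] fKx[OF that] f by (intro finite_measure.integrable_const_bound[of _ _ C] prob_space.finite_measure) auto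
  have gx: "(\<integral>y. ?g y \<partial>K x) = (\<integral>y. f y \<partial>K x) + C" if "x \<in> space W" for x
    using int_Kx[OF that] Kx(1)[OF that] by (simp add: prob_space.prob_space finite_measure.integrable_const prob_space.finite_measure)
  have bnd: "\<bar>\<integral>y. f y \<partial>K x\<bar> \<le> C" if "x \<in> space W" for x
  proof -
    interpret prob_space "K x" using Kx(1)[OF that] .
    have "\<bar>\<integral>y. f y \<partial>K x\<bar> \<le> (\<integral>y. \<bar>f y\<bar> \<partial>K x)" by (rule integral_abs_bound)
    also have "... \<le> C" using int_Kx[OF that] f Kx(3)[OF that] by (intro integral_le_const) auto
    finally show ?thesis .
  qed
  have mf: "(\<lambda>x. \<integral>y. f y \<partial>K x) \<in> borel_measurable W"
    by (rule measurable_lebesgue_integral_kernel[OF _ KW]) measurable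
  have "ennreal (\<integral>y. ?g y \<partial>(W \<bind> K)) = (\<integral>\<^sup>+y. ennreal (?g y) \<partial>(W \<bind> K))"
    using g by (intro B.nn_integral_eq_integral_bounded[symmetric, where c = "2 * C"]) (auto simp: spB)
  also have "... = (\<integral>\<^sup>+x. (\<integral>\<^sup>+y. ennreal (?g y) \<partial>K x) \<partial>W)"
    by (rule nn_integral_bind[OF _ measurable_prob_algebraD[OF KW]]) measurable
  also have "... = (\<integral>\<^sup>+x. ennreal (\<integral>y. ?g y \<partial>K x) \<partial>W)"
    using Kx g fKx
    by (intro nn_integral_cong finite_measure.nn_integral_eq_integral_bounded[where c = "2 * C"] prob_space.finite_measure) auto
  also have "... = ennreal (\<integral>x. (\<integral>y. ?g y \<partial>K x) \<partial>W)"
    using bnd by (intro W.nn_integral_eq_integral_bounded[where c = "2 * C"] m) (force simp: gx abs_le_iff)+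
  finally have "(\<integral>y. ?g y \<partial>(W \<bind> K)) = (\<integral>x. (\<integral>y. ?g y \<partial>K x) \<partial>W)"
    using g by (subst (asm) ennreal_inj) (auto intro!: integral_nonneg_AE AE_I2 simp: spB spW Kx)
  also have "... = (\<integral>x. (\<integral>y. f y \<partial>K x) + C \<partial>W)"
    by (intro Bochner_Integration.integral_cong) (auto simp: gx)
  also have "... = ?r + C"
    using bnd by (subst Bochner_Integration.integral_add)
      (auto intro!: W.integrable_const_bound[where B = C] mf AE_I2 simp: W.prob_space)
  finally show ?thesis
    using f by (subst (asm) Bochner_Integration.integral_add)
      (auto intro!: B.integrable_const_bound[where B = C] AE_I2 simp: B.prob_space[unfolded spB] spB)
qed

lemma (in prob_space) ennreal_square_integral_le:
  fixes f :: "'a \<Rightarrow> real"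
  assumes [measurable]: "f \<in> borel_measurable M"
  shows "ennreal ((\<integral>x. f x \<partial>M)\<^sup>2) \<le> (\<integral>\<^sup>+x. ennreal ((f x)\<^sup>2) \<partial>M)"
proof (cases "integrable M f")
  case True
  have "ennreal \<bar>\<integral>x. f x \<partial>M\<bar> \<le> (\<integral>\<^sup>+x. ennreal \<bar>f x\<bar> \<partial>M)"
    using True integral_norm_bound_ennreal[of M f] by simp
  then have "(ennreal \<bar>\<integral>x. f x \<partial>M\<bar>)\<^sup>2 \<le> (\<integral>\<^sup>+x. ennreal \<bar>f x\<bar> * 1 \<partial>M)\<^sup>2"
    by (intro power_mono) auto
  also have "... \<le> (\<integral>\<^sup>+x. (ennreal \<bar>f x\<bar>)\<^sup>2 \<partial>M) * (\<integral>\<^sup>+x. 1\<^sup>2 \<partial>M)"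
    by (rule Cauchy_Schwarz_nn_integral) measurable
  also have "... = (\<integral>\<^sup>+x. ennreal ((f x)\<^sup>2) \<partial>M)"
    by (simp add: emeasure_space_1 ennreal_power)
  finally show ?thesis by (simp add: ennreal_power)
qed (simp add: not_integrable_integral_eq)

context poisson_kicks
begin

lemma abs_integral_kern_le:
  fixes h :: "'s \<Rightarrow> real"
  assumes "u \<in> space N" "h \<in> borel_measurable N" "\<And>\<tau>. \<tau> \<in> space N \<Longrightarrow> \<bar>h \<tau>\<bar> \<le> C"
  shows "\<bar>\<integral>\<tau>. h \<tau> \<partial>kern t u\<bar> \<le> C"
proof -
  interpret prob_space "kern t u" by (rule prob_space_kern[OF assms(1)])
  have "integrable (kern t u) h" using assms by (intro integrable_const_bound[where B = C]) auto
  then have "(\<integral>\<tau>. \<bar>h \<tau>\<bar> \<partial>kern t u) \<le> C" using assms by (intro integral_le_const) auto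
  then show ?thesis using integral_abs_bound[of "kern t u" h] by linarith
qed

lemma integral_kern_act:
  fixes h :: "'s \<Rightarrow> real"
  assumes [measurable]: "h \<in> borel_measurable N" and u: "u \<in> space N" and y: "y \<in> space \<nu>"
  shows "(\<integral>\<tau>. h (act \<tau> y) \<partial>kern t u) = (\<integral>\<tau>. h \<tau> \<partial>kern t (act u y))"
proof -
  have [measurable]: "(\<lambda>\<tau>. act \<tau> y) \<in> N \<rightarrow>\<^sub>M N" using y by measurable
  have "kern t (act u y) = distr (kern t u) N (\<lambda>\<tau>. act \<tau> y)"
  proof (rule measure_eqI)
    fix A assume "A \<in> sets (kern t (act u y))"
    then have A[measurable]: "A \<in> sets N" by simp
    have "emeasure (kern t (act u y)) A = (\<integral>\<^sup>+\<tau>. indicator A (act \<tau> y) \<partial>kern t u)"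
      using nn_integral_kern_act[of "indicator A" u y t] u y by simp
    also have "... = emeasure (distr (kern t u) N (\<lambda>\<tau>. act \<tau> y)) A"
      using nn_integral_distr[of "\<lambda>\<tau>. act \<tau> y" "kern t u" N "indicator A"] by simp
    finally show "emeasure (kern t (act u y)) A = emeasure (distr (kern t u) N (\<lambda>\<tau>. act \<tau> y)) A" .
  qed simp
  then show ?thesis by (simp add: integral_distr)
qed

lemma kern_0: "u \<in> space N \<Longrightarrow> kern 0 u = return N u"
  by (rule measure_eqI) (simp_all add: nn_integral_kern_0 nn_integral_return flip: nn_integral_indicator)

lemma bind_kern_0: "W \<in> space (prob_algebra N) \<Longrightarrow> W \<bind> kern 0 = W"
proof -
  assume W: "W \<in> space (prob_algebra N)"
  then have sW: "sets W = sets N" by (simp add: space_prob_algebra)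
  have "sets (W \<bind> kern 0) = sets N"
    using bind_kern_in_prob_algebra[OF W] by (simp add: space_prob_algebra)
  with sW have "sets (W \<bind> kern 0) = sets W" by simp
  then show ?thesis
  proof (rule measure_eqI)
    fix A assume "A \<in> sets (W \<bind> kern 0)"
    then have [measurable]: "A \<in> sets N" and "A \<in> sets W" using sW \<open>sets (W \<bind> kern 0) = sets W\<close> by auto
    have "emeasure (W \<bind> kern 0) A = (\<integral>\<^sup>+\<tau>. indicator A \<tau> \<partial>(W \<bind> kern 0))"
      using \<open>A \<in> sets (W \<bind> kern 0)\<close> by simp
    also have "... = (\<integral>\<^sup>+u. (\<integral>\<^sup>+\<tau>. indicator A \<tau> \<partial>kern 0 u) \<partial>W)"
      by (rule nn_integral_bind_kern[OF W]) measurable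
    also have "... = (\<integral>\<^sup>+u. indicator A u \<partial>W)"
      using sets_eq_imp_space_eq[OF sW] by (intro nn_integral_cong nn_integral_kern_0) auto
    finally show "emeasure (W \<bind> kern 0) A = emeasure W A" using \<open>A \<in> sets W\<close> by simp
  qed
qed

lemma integral_coup_product:
  fixes F G :: "'s \<Rightarrow> real"
  assumes W: "W \<in> space (prob_algebra N)" and [measurable]: "F \<in> borel_measurable N" "G \<in> borel_measurable N"
    and F: "\<And>u. u \<in> space N \<Longrightarrow> \<bar>F u\<bar> \<le> C" and G: "\<And>u. u \<in> space N \<Longrightarrow> \<bar>G u\<bar> \<le> C"
  shows "(\<integral>p. F (fst p) * G (snd p) \<partial>coup W t s) =
    (\<integral>\<rho>. (\<integral>\<tau>. F \<tau> \<partial>kern (t - s) \<rho>) * (\<integral>\<tau>. G \<tau> \<partial>kern (t - s) \<rho>) \<partial>(W \<bind> kern s))" (is "?l = ?r")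
proof -
  have W1: "W \<bind> kern s \<in> space (prob_algebra N)" by (rule bind_kern_in_prob_algebra[OF W])
  have spW1: "space (W \<bind> kern s) = space N" using W1 by (auto simp: space_prob_algebra dest: sets_eq_imp_space_eq)
  have FG: "\<bar>F a * G b\<bar> \<le> C * C" if "a \<in> space N" "b \<in> space N" for a b
    using F[OF that(1)] G[OF that(2)] unfolding abs_mult by (intro mult_mono) auto
  have "?l =
      (\<integral>\<rho>. (\<integral>p. F (fst p) * G (snd p) \<partial>(kern (t - s) \<rho> \<Otimes>\<^sub>M kern (t - s) \<rho>)) \<partial>(W \<bind> kern s))"
    unfolding coup_def
    by (rule integral_bind_bounded[OF W1, where C = "C * C" and Y = "N \<Otimes>\<^sub>M N"])
       (measurable, use FG in \<open>auto simp: space_pair_measure\<close>)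
  also have "... = ?r"
  proof (rule Bochner_Integration.integral_cong[OF refl])
    fix \<rho> assume "\<rho> \<in> space (W \<bind> kern s)"
    then interpret K: prob_space "kern (t - s) \<rho>" by (intro prob_space_kern) (simp add: spW1)
    interpret KK: pair_prob_space "kern (t - s) \<rho>" "kern (t - s) \<rho>" ..
    have "integrable (kern (t - s) \<rho> \<Otimes>\<^sub>M kern (t - s) \<rho>) (\<lambda>p. F (fst p) * G (snd p))"
      by (rule KK.integrable_const_bound[where B = "C * C"]) (use FG in \<open>auto simp: space_pair_measure intro!: AE_I2\<close>)
    from KK.integral_fst'[OF this]
    show "(\<integral>p. F (fst p) * G (snd p) \<partial>(kern (t - s) \<rho> \<Otimes>\<^sub>M kern (t - s) \<rho>)) =
       (\<integral>\<tau>. F \<tau> \<partial>kern (t - s) \<rho>) * (\<integral>\<tau>. G \<tau> \<partial>kern (t - s) \<rho>)"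
      by simp
  qed
  finally show ?thesis .
qed

lemma integral_coup_endpoints:
  fixes F G :: "'s \<Rightarrow> real"
  assumes W: "W \<in> space (prob_algebra N)" and [measurable]: "F \<in> borel_measurable N" "G \<in> borel_measurable N"
    and F: "\<And>u. u \<in> space N \<Longrightarrow> \<bar>F u\<bar> \<le> C" and G: "\<And>u. u \<in> space N \<Longrightarrow> \<bar>G u\<bar> \<le> C"
  shows "(\<integral>p. F (fst p) * G (snd p) \<partial>coup W t t) = (\<integral>\<tau>. F \<tau> * G \<tau> \<partial>(W \<bind> kern t))"
    and "(\<integral>p. F (fst p) * G (snd p) \<partial>coup W t 0) = (\<integral>u. (\<integral>\<tau>. F \<tau> \<partial>kern t u) * (\<integral>\<tau>. G \<tau> \<partial>kern t u) \<partial>W)"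
proof -
  have W1: "W \<bind> kern t \<in> space (prob_algebra N)" by (rule bind_kern_in_prob_algebra[OF W])
  then have "space (W \<bind> kern t) = space N" by (auto simp: space_prob_algebra dest: sets_eq_imp_space_eq)
  then show "(\<integral>p. F (fst p) * G (snd p) \<partial>coup W t t) = (\<integral>\<tau>. F \<tau> * G \<tau> \<partial>(W \<bind> kern t))"
    by (subst integral_coup_product[OF W _ _ F G])
       (auto intro!: Bochner_Integration.integral_cong simp: kern_0 integral_return)
  show "(\<integral>p. F (fst p) * G (snd p) \<partial>coup W t 0) = (\<integral>u. (\<integral>\<tau>. F \<tau> \<partial>kern t u) * (\<integral>\<tau>. G \<tau> \<partial>kern t u) \<partial>W)"
    by (subst integral_coup_product[OF W _ _ F G]) (auto simp: bind_kern_0[OF W])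
qed

text \<open>
  The covariance formula with both functions equal to \<open>h\<close>. The mean of a product of increments at the two
  copies is at most the mean squared increment, since both copies have the same law.
\<close>

theorem poincare_kern:
  fixes h :: "'s \<Rightarrow> real"
  assumes W: "W \<in> space (prob_algebra N)" and [measurable]: "h \<in> borel_measurable N" and t: "0 \<le> t"
    and h: "\<And>u. u \<in> space N \<Longrightarrow> \<bar>h u\<bar> \<le> C"
  shows "(\<integral>\<^sup>+\<tau>. ennreal ((h \<tau>)\<^sup>2) \<partial>(W \<bind> kern t)) \<le> (\<integral>\<^sup>+u. ennreal ((\<integral>\<tau>. h \<tau> \<partial>kern t u)\<^sup>2) \<partial>W) +
    ennreal t * (\<integral>\<^sup>+y. (\<integral>\<^sup>+\<tau>. ennreal ((h (act \<tau> y) - h \<tau>)\<^sup>2) \<partial>(W \<bind> kern t)) \<partial>\<nu>)" (is "?l \<le> _")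
proof -
  let ?m = "\<lambda>u. \<integral>\<tau>. h \<tau> \<partial>kern t u"
  note [measurable_cong] = sets_coup[OF W]
  have sW[measurable_cong]: "sets W = sets N" and "prob_space W" using W by (auto simp: space_prob_algebra)
  then interpret W: prob_space W by simp
  have spW: "space W = space N" using sW by (rule sets_eq_imp_space_eq)
  have W1: "W \<bind> kern t \<in> space (prob_algebra N)" by (rule bind_kern_in_prob_algebra[OF W])
  then have sW1[measurable_cong]: "sets (W \<bind> kern t) = sets N" and "prob_space (W \<bind> kern t)"
    by (auto simp: space_prob_algebra)
  then interpret W1: prob_space "W \<bind> kern t" by simp
  have spW1: "space (W \<bind> kern t) = space N" using sW1 by (rule sets_eq_imp_space_eq)
  have [measurable]: "(\<lambda>\<tau>. h (act \<tau> y)) \<in> borel_measurable N" if "y \<in> space \<nu>" for y using that by measurable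
  have C: "0 \<le> C" using W.not_empty h spW by (metis abs_ge_zero all_not_in_conv order_trans)
  have sq: "x\<^sup>2 \<le> c\<^sup>2" if "\<bar>x\<bar> \<le> c" for x c :: real
    using power_mono[OF that, of 2] by simp
  have hh: "(h u)\<^sup>2 \<le> C\<^sup>2" if "u \<in> space N" for u by (rule sq[OF h[OF that]])
  have dd: "\<bar>h (act u y) - h u\<bar> \<le> 2 * C" "(h (act u y) - h u)\<^sup>2 \<le> (2 * C)\<^sup>2" if "u \<in> space N" "y \<in> space \<nu>" for u y
  proof -
    show "\<bar>h (act u y) - h u\<bar> \<le> 2 * C"
      using h[OF that(1)] h[OF act_in_space[OF that]] by linarith
    then show "(h (act u y) - h u)\<^sup>2 \<le> (2 * C)\<^sup>2" by (rule sq)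
  qed
  define v where "v y = (\<integral>\<tau>. (h (act \<tau> y) - h \<tau>)\<^sup>2 \<partial>(W \<bind> kern t))" for y
  have v_meas[measurable]: "v \<in> borel_measurable \<nu>"
    unfolding v_def by (rule measurable_lebesgue_integral_kernel[where Y = N]) (use W1 in measurable)
  have v: "0 \<le> v y" "v y \<le> (2 * C)\<^sup>2"
      "(\<integral>\<^sup>+\<tau>. ennreal ((h (act \<tau> y) - h \<tau>)\<^sup>2) \<partial>(W \<bind> kern t)) = ennreal (v y)" if y: "y \<in> space \<nu>" for y
  proof -
    show "0 \<le> v y" by (simp add: v_def)
    show "v y \<le> (2 * C)\<^sup>2"
      using W1.integral_bounds(2)[of "\<lambda>\<tau>. (h (act \<tau> y) - h \<tau>)\<^sup>2" "(2 * C)\<^sup>2"] y dd(2)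
      by (simp add: v_def spW1 W1.prob_space[unfolded spW1])
    show "(\<integral>\<^sup>+\<tau>. ennreal ((h (act \<tau> y) - h \<tau>)\<^sup>2) \<partial>(W \<bind> kern t)) = ennreal (v y)"
      unfolding v_def using y dd(2) by (intro W1.nn_integral_eq_integral_bounded[where c = "(2 * C)\<^sup>2"]) (auto simp: spW1)
  qed
  have int_v: "integrable \<nu> v" using v by (intro integrable_const_bound[where B = "(2 * C)\<^sup>2"]) auto
  let ?e = "\<lambda>s y. \<integral>\<omega>. (h (act (fst \<omega>) y) - h (fst \<omega>)) * (h (act (snd \<omega>) y) - h (snd \<omega>)) \<partial>coup W t s"
  have e_le: "?e s y \<le> v y" if s: "s \<in> {0..t}" and y: "y \<in> space \<nu>" for s y
  proof -
    interpret coup: prob_space "coup W t s" by (rule prob_space_coup[OF W])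
    have b: "\<bar>(h (act a y) - h a) * (h (act b y) - h b)\<bar> \<le> 2 * C * (2 * C)" if "a \<in> space N" "b \<in> space N" for a b
      using dd(1)[OF that(1) y] dd(1)[OF that(2) y] C unfolding abs_mult by (intro mult_mono) auto
    have int: "integrable (coup W t s) (\<lambda>\<omega>. (h (act (fst \<omega>) y) - h (fst \<omega>)) * (h (act (snd \<omega>) y) - h (snd \<omega>)))"
    proof (rule coup.integrable_const_bound[where B = "2 * C * (2 * C)"])
      show "AE \<omega> in coup W t s. norm ((h (act (fst \<omega>) y) - h (fst \<omega>)) * (h (act (snd \<omega>) y) - h (snd \<omega>))) \<le> 2 * C * (2 * C)"
        unfolding real_norm_def by (intro AE_I2 b) (auto simp: space_coup[OF W])
    qed (use y in measurable)
    have int1: "integrable (coup W t s) (\<lambda>\<omega>. (h (act (fst \<omega>) y) - h (fst \<omega>))\<^sup>2)"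
       "integrable (coup W t s) (\<lambda>\<omega>. (h (act (snd \<omega>) y) - h (snd \<omega>))\<^sup>2)"
      using dd(2) y by (auto intro!: coup.integrable_const_bound[where B = "(2 * C)\<^sup>2"] simp: space_coup[OF W])
    have "?e s y \<le> (\<integral>\<omega>. ((h (act (fst \<omega>) y) - h (fst \<omega>))\<^sup>2 + (h (act (snd \<omega>) y) - h (snd \<omega>))\<^sup>2) / 2 \<partial>coup W t s)"
    proof (rule integral_mono)
      have "p * q \<le> (p\<^sup>2 + q\<^sup>2) / 2" for p q :: real using sum_squares_bound[of p q] by simp
      then show "(h (act (fst \<omega>) y) - h (fst \<omega>)) * (h (act (snd \<omega>) y) - h (snd \<omega>)) \<le>
        ((h (act (fst \<omega>) y) - h (fst \<omega>))\<^sup>2 + (h (act (snd \<omega>) y) - h (snd \<omega>))\<^sup>2) / 2" for \<omega> .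
    qed (use int int1 in auto)
    also have "... = ((\<integral>\<omega>. (h (act (fst \<omega>) y) - h (fst \<omega>))\<^sup>2 \<partial>coup W t s) + (\<integral>\<omega>. (h (act (snd \<omega>) y) - h (snd \<omega>))\<^sup>2 \<partial>coup W t s)) / 2"
      using int1 by simp
    also have "... = v y"
      using integral_coup_marginal[OF W, of "\<lambda>\<tau>. (h (act \<tau> y) - h \<tau>)\<^sup>2" s t] s y by (simp add: v_def)
    finally show ?thesis .
  qed
  have id: "(\<integral>\<tau>. h \<tau> * h \<tau> \<partial>(W \<bind> kern t)) - (\<integral>u. ?m u * ?m u \<partial>W) =
      (\<integral>s. indicator {0..t} s * (\<integral>y. ?e s y \<partial>\<nu>) \<partial>lborel)"
    using coup_covariance[OF W _ _ t h h] integral_coup_endpoints[OF W _ _ h h, where t = t] by simp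
  have "(\<integral>s. indicator {0..t} s * (\<integral>y. ?e s y \<partial>\<nu>) \<partial>lborel) \<le> (\<integral>s. indicator {0..t} s * (\<integral>y. v y \<partial>\<nu>) \<partial>lborel)"
  proof (rule integral_mono')
    show "integrable lborel (\<lambda>s. indicator {0..t} s * (\<integral>y. v y \<partial>\<nu>))"
      using t by (intro integrable_mult_left) (auto simp: emeasure_lborel_Icc_eq)
    show "indicator {0..t} s * (\<integral>y. ?e s y \<partial>\<nu>) \<le> indicator {0..t} s * (\<integral>y. v y \<partial>\<nu>)" for s :: real
      using e_le v int_v by (auto simp: indicator_def intro!: integral_mono')
    show "0 \<le> indicator {0..t} s * (\<integral>y. v y \<partial>\<nu>)" for s :: real
      using v by (auto intro!: mult_nonneg_nonneg integral_nonneg_AE)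
  qed
  also have "... = t * (\<integral>y. v y \<partial>\<nu>)" using t by simp
  finally have le: "(\<integral>\<tau>. (h \<tau>)\<^sup>2 \<partial>(W \<bind> kern t)) \<le> (\<integral>u. (?m u)\<^sup>2 \<partial>W) + t * (\<integral>y. v y \<partial>\<nu>)"
    using id by (simp add: power2_eq_square)
  have Ph: "(?m u)\<^sup>2 \<le> C\<^sup>2" if "u \<in> space N" for u
    by (rule sq[OF abs_integral_kern_le[OF that assms(2) h]])
  have Ph_meas[measurable]: "(\<lambda>u. \<integral>\<tau>. h \<tau> \<partial>kern t u) \<in> borel_measurable N"
    by (rule measurable_lebesgue_integral_kernel[where Y = N]) measurable
  have "?l = ennreal (\<integral>\<tau>. (h \<tau>)\<^sup>2 \<partial>(W \<bind> kern t))"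
    using hh by (intro W1.nn_integral_eq_integral_bounded[where c = "C\<^sup>2"]) (auto simp: spW1)
  also have "... \<le> ennreal ((\<integral>u. (?m u)\<^sup>2 \<partial>W) + t * (\<integral>y. v y \<partial>\<nu>))"
    using le by (rule ennreal_leI)
  also have "... = ennreal (\<integral>u. (?m u)\<^sup>2 \<partial>W) + ennreal t * ennreal (\<integral>y. v y \<partial>\<nu>)"
    using t v by (subst ennreal_plus) (auto simp: ennreal_mult' intro!: integral_nonneg_AE mult_nonneg_nonneg)
  also have "ennreal (\<integral>u. (?m u)\<^sup>2 \<partial>W) = (\<integral>\<^sup>+u. ennreal ((?m u)\<^sup>2) \<partial>W)"
    using Ph by (intro W.nn_integral_eq_integral_bounded[symmetric, where c = "C\<^sup>2"]) (auto simp: spW)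
  also have "ennreal (\<integral>y. v y \<partial>\<nu>) = (\<integral>\<^sup>+y. (\<integral>\<^sup>+\<tau>. ennreal ((h (act \<tau> y) - h \<tau>)\<^sup>2) \<partial>(W \<bind> kern t)) \<partial>\<nu>)"
    using v by (subst nn_integral_eq_integral_bounded[symmetric, where c = "(2 * C)\<^sup>2"]) (auto intro!: nn_integral_cong)
  finally show ?thesis .
qed

end

context poisson_kicks
begin

lemma integrable_kern_bounded:
  fixes h :: "'s \<Rightarrow> real"
  assumes "u \<in> space N" "h \<in> borel_measurable N" "\<And>\<tau>. \<tau> \<in> space N \<Longrightarrow> \<bar>h \<tau>\<bar> \<le> C"
  shows "integrable (kern t u) h"
proof -
  interpret prob_space "kern t u" by (rule prob_space_kern[OF assms(1)])
  show ?thesis using assms by (intro integrable_const_bound[where B = C]) auto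
qed

lemma integral_kern_act_diff:
  fixes h :: "'s \<Rightarrow> real"
  assumes [measurable]: "h \<in> borel_measurable N" and u: "u \<in> space N" and y: "y \<in> space \<nu>"
    and h: "\<And>\<tau>. \<tau> \<in> space N \<Longrightarrow> \<bar>h \<tau>\<bar> \<le> C"
  shows "(\<integral>\<tau>. h \<tau> \<partial>kern t (act u y)) - (\<integral>\<tau>. h \<tau> \<partial>kern t u) = (\<integral>\<tau>. h (act \<tau> y) - h \<tau> \<partial>kern t u)"
proof -
  have [measurable]: "(\<lambda>\<tau>. h (act \<tau> y)) \<in> borel_measurable N" using y by measurable
  have "integrable (kern t u) (\<lambda>\<tau>. h (act \<tau> y))" "integrable (kern t u) h"
    using h u y by (auto intro!: integrable_kern_bounded[where C = C] act_in_space)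
  then show ?thesis by (simp add: integral_kern_act[OF _ u y, symmetric])
qed

lemma poincare_kern_at:
  fixes h :: "'s \<Rightarrow> real"
  assumes u: "u \<in> space N" and [measurable]: "h \<in> borel_measurable N" and t: "0 \<le> t"
    and h: "\<And>u. u \<in> space N \<Longrightarrow> \<bar>h u\<bar> \<le> C"
  shows "(\<integral>\<^sup>+\<tau>. ennreal ((h \<tau>)\<^sup>2) \<partial>kern t u) \<le> ennreal ((\<integral>\<tau>. h \<tau> \<partial>kern t u)\<^sup>2) +
    ennreal t * (\<integral>\<^sup>+y. (\<integral>\<^sup>+\<tau>. ennreal ((h (act \<tau> y) - h \<tau>)\<^sup>2) \<partial>kern t u) \<partial>\<nu>)"
proof -
  have "return N u \<in> space (prob_algebra N)"
    using u by (simp add: space_prob_algebra prob_space_return)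
  moreover have "return N u \<bind> kern t = kern t u" by (rule bind_return[OF kern_sub u])
  moreover have "(\<integral>\<^sup>+u'. ennreal ((\<integral>\<tau>. h \<tau> \<partial>kern t u')\<^sup>2) \<partial>return N u) = ennreal ((\<integral>\<tau>. h \<tau> \<partial>kern t u)\<^sup>2)"
    using u by (intro nn_integral_return) auto
  ultimately show ?thesis using poincare_kern[of "return N u" h t C] t h by simp
qed

definition pair_mean :: "real \<Rightarrow> ('s \<times> 's \<Rightarrow> real) \<Rightarrow> 's \<Rightarrow> real" where
  "pair_mean r H \<rho> = (\<integral>\<tau>. (\<integral>\<tau>'. H (\<tau>, \<tau>') \<partial>kern r \<rho>) \<partial>kern r \<rho>)"

lemma measurable_pair_mean [measurable]:
  assumes [measurable]: "H \<in> borel_measurable (N \<Otimes>\<^sub>M N)"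
  shows "pair_mean r H \<in> borel_measurable N"
  unfolding pair_mean_def[abs_def] by measurable

lemma abs_pair_mean_le:
  assumes H[measurable]: "H \<in> borel_measurable (N \<Otimes>\<^sub>M N)" and \<rho>: "\<rho> \<in> space N"
    and C: "\<And>\<tau> \<tau>'. \<tau> \<in> space N \<Longrightarrow> \<tau>' \<in> space N \<Longrightarrow> \<bar>H (\<tau>, \<tau>')\<bar> \<le> C"
  shows "\<bar>pair_mean r H \<rho>\<bar> \<le> C"
  unfolding pair_mean_def
proof (rule abs_integral_kern_le[OF \<rho>])
  show "(\<lambda>\<tau>. \<integral>\<tau>'. H (\<tau>, \<tau>') \<partial>kern r \<rho>) \<in> borel_measurable N" using \<rho> by measurable
  show "\<bar>\<integral>\<tau>'. H (\<tau>, \<tau>') \<partial>kern r \<rho>\<bar> \<le> C" if "\<tau> \<in> space N" for \<tau>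
    using that \<rho> C by (intro abs_integral_kern_le) auto
qed

text \<open>A shift of the initial state shifts both independent copies at once; Jensen's inequality does the rest.\<close>

lemma pair_mean_act_diff:
  assumes H[measurable]: "H \<in> borel_measurable (N \<Otimes>\<^sub>M N)" and \<rho>: "\<rho> \<in> space N" and y: "y \<in> space \<nu>"
    and C: "\<And>\<tau> \<tau>'. \<tau> \<in> space N \<Longrightarrow> \<tau>' \<in> space N \<Longrightarrow> \<bar>H (\<tau>, \<tau>')\<bar> \<le> C"
  shows "ennreal ((pair_mean r H (act \<rho> y) - pair_mean r H \<rho>)\<^sup>2) \<le>
    (\<integral>\<^sup>+\<tau>. (\<integral>\<^sup>+\<tau>'. ennreal ((H (act \<tau> y, act \<tau>' y) - H (\<tau>, \<tau>'))\<^sup>2) \<partial>kern r \<rho>) \<partial>kern r \<rho>)" (is "?l \<le> ?r")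
proof -
  interpret K: prob_space "kern r \<rho>" by (rule prob_space_kern[OF \<rho>])
  have [measurable]: "(\<lambda>(\<tau>, \<tau>'). H (act \<tau> y, act \<tau>' y)) \<in> borel_measurable (N \<Otimes>\<^sub>M N)"
    "(\<lambda>(\<tau>, \<tau>'). H (\<tau>, act \<tau>' y)) \<in> borel_measurable (N \<Otimes>\<^sub>M N)" using y by measurable
  have [measurable]: "(\<lambda>\<tau>. act \<tau> y) \<in> N \<rightarrow>\<^sub>M N" using y by measurable
  let ?k = "\<lambda>\<tau>. \<integral>\<tau>'. H (\<tau>, act \<tau>' y) \<partial>kern r \<rho>"
  have k_meas[measurable]: "?k \<in> borel_measurable N" using \<rho> y by measurable
  have k_bnd: "\<bar>?k \<tau>\<bar> \<le> C" if "\<tau> \<in> space N" for \<tau>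
    using that \<rho> y C by (intro abs_integral_kern_le) (auto intro: act_in_space)
  have g_meas[measurable]: "(\<lambda>\<tau>. \<integral>\<tau>'. H (\<tau>, \<tau>') \<partial>kern r \<rho>) \<in> borel_measurable N" using \<rho> by measurable
  have g_bnd: "\<bar>\<integral>\<tau>'. H (\<tau>, \<tau>') \<partial>kern r \<rho>\<bar> \<le> C" if "\<tau> \<in> space N" for \<tau>
    using that \<rho> C by (intro abs_integral_kern_le) auto
  have "pair_mean r H (act \<rho> y) = (\<integral>\<tau>. ?k \<tau> \<partial>kern r (act \<rho> y))"
    unfolding pair_mean_def
    by (rule Bochner_Integration.integral_cong[OF refl], rule integral_kern_act[symmetric])
       (use \<rho> y in auto)
  also have "... = (\<integral>\<tau>. ?k (act \<tau> y) \<partial>kern r \<rho>)"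
    using \<rho> y by (intro integral_kern_act[symmetric]) auto
  finally have "pair_mean r H (act \<rho> y) - pair_mean r H \<rho> =
      (\<integral>\<tau>. ?k (act \<tau> y) \<partial>kern r \<rho>) - (\<integral>\<tau>. (\<integral>\<tau>'. H (\<tau>, \<tau>') \<partial>kern r \<rho>) \<partial>kern r \<rho>)"
    by (simp add: pair_mean_def)
  also have "... = (\<integral>\<tau>. ?k (act \<tau> y) - (\<integral>\<tau>'. H (\<tau>, \<tau>') \<partial>kern r \<rho>) \<partial>kern r \<rho>)"
    using \<rho> y k_bnd g_bnd
    by (intro Bochner_Integration.integral_diff[symmetric] integrable_kern_bounded[where C = C])
       (auto intro: act_in_space)
  also have "... = (\<integral>\<tau>. (\<integral>\<tau>'. H (act \<tau> y, act \<tau>' y) - H (\<tau>, \<tau>') \<partial>kern r \<rho>) \<partial>kern r \<rho>)"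
    using \<rho> y C
    by (intro Bochner_Integration.integral_cong refl Bochner_Integration.integral_diff[symmetric]
        integrable_kern_bounded[where C = C]) (auto intro: act_in_space)
  finally have "?l =
      ennreal ((\<integral>\<tau>. (\<integral>\<tau>'. H (act \<tau> y, act \<tau>' y) - H (\<tau>, \<tau>') \<partial>kern r \<rho>) \<partial>kern r \<rho>)\<^sup>2)" by simp
  also have "... \<le> (\<integral>\<^sup>+\<tau>. ennreal ((\<integral>\<tau>'. H (act \<tau> y, act \<tau>' y) - H (\<tau>, \<tau>') \<partial>kern r \<rho>)\<^sup>2) \<partial>kern r \<rho>)"
    using \<rho> y by (intro K.ennreal_square_integral_le) measurable
  also have "... \<le> ?r"
    using y by (intro nn_integral_mono K.ennreal_square_integral_le) measurable
  finally show ?thesis .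
qed

text \<open>Tensorization: the inequality for one copy is applied to each coordinate with the other one fixed.\<close>

lemma poincare_kern_pair:
  assumes H[measurable]: "H \<in> borel_measurable (N \<Otimes>\<^sub>M N)" and \<rho>: "\<rho> \<in> space N" and r: "0 \<le> r"
    and C: "\<And>\<tau> \<tau>'. \<tau> \<in> space N \<Longrightarrow> \<tau>' \<in> space N \<Longrightarrow> \<bar>H (\<tau>, \<tau>')\<bar> \<le> C"
  shows "(\<integral>\<^sup>+\<tau>. (\<integral>\<^sup>+\<tau>'. ennreal ((H (\<tau>, \<tau>'))\<^sup>2) \<partial>kern r \<rho>) \<partial>kern r \<rho>) \<le> ennreal ((pair_mean r H \<rho>)\<^sup>2) +
    ennreal r * (\<integral>\<^sup>+y. (\<integral>\<^sup>+\<tau>. (\<integral>\<^sup>+\<tau>'. ennreal ((H (act \<tau> y, \<tau>') - H (\<tau>, \<tau>'))\<^sup>2) +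
       ennreal ((H (\<tau>, act \<tau>' y) - H (\<tau>, \<tau>'))\<^sup>2) \<partial>kern r \<rho>) \<partial>kern r \<rho>) \<partial>\<nu>)" (is "?l \<le> _")
proof -
  let ?b = "\<lambda>\<tau> y. \<integral>\<^sup>+\<tau>'. ennreal ((H (\<tau>, act \<tau>' y) - H (\<tau>, \<tau>'))\<^sup>2) \<partial>kern r \<rho>"
  interpret K: prob_space "kern r \<rho>" by (rule prob_space_kern[OF \<rho>])
  interpret pair_sigma_finite \<nu> "kern r \<rho>" ..
  let ?g = "\<lambda>\<tau>. \<integral>\<tau>'. H (\<tau>, \<tau>') \<partial>kern r \<rho>"
  have g_meas[measurable]: "?g \<in> borel_measurable N" using \<rho> by measurable
  have g_bnd: "\<bar>?g \<tau>\<bar> \<le> C" if "\<tau> \<in> space N" for \<tau>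
    using that \<rho> C by (intro abs_integral_kern_le) auto
  have [measurable]: "(\<lambda>\<tau>. H (act \<tau> y, \<tau>')) \<in> borel_measurable N" if "y \<in> space \<nu>" "\<tau>' \<in> space N" for y \<tau>'
    using that by measurable
  have m1[measurable]: "(\<lambda>(\<tau>, y). \<integral>\<^sup>+\<tau>'. ennreal ((H (\<tau>, act \<tau>' y) - H (\<tau>, \<tau>'))\<^sup>2) \<partial>kern r \<rho>) \<in> borel_measurable (N \<Otimes>\<^sub>M \<nu>)"
    using \<rho> by measurable
  have m2[measurable]: "(\<lambda>(\<tau>, y). \<integral>\<^sup>+\<tau>'. ennreal ((H (act \<tau> y, \<tau>') - H (\<tau>, \<tau>'))\<^sup>2) \<partial>kern r \<rho>) \<in> borel_measurable (N \<Otimes>\<^sub>M \<nu>)"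
    using \<rho> by measurable
  have m3[measurable]: "(\<lambda>\<tau>. \<integral>\<^sup>+y. ?b \<tau> y \<partial>\<nu>) \<in> borel_measurable N"
    by measurable
  have g_diff: "ennreal ((?g (act \<tau> y) - ?g \<tau>)\<^sup>2) \<le> (\<integral>\<^sup>+\<tau>'. ennreal ((H (act \<tau> y, \<tau>') - H (\<tau>, \<tau>'))\<^sup>2) \<partial>kern r \<rho>)"
    if \<tau>: "\<tau> \<in> space N" and y: "y \<in> space \<nu>" for \<tau> y
  proof -
    have "?g (act \<tau> y) - ?g \<tau> = (\<integral>\<tau>'. H (act \<tau> y, \<tau>') - H (\<tau>, \<tau>') \<partial>kern r \<rho>)"
      using \<rho> \<tau> y C act_in_space[OF \<tau> y]
      by (intro Bochner_Integration.integral_diff[symmetric] integrable_kern_bounded[where C = C]) auto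
    then show ?thesis
      using K.ennreal_square_integral_le[of "\<lambda>\<tau>'. H (act \<tau> y, \<tau>') - H (\<tau>, \<tau>')"] \<tau> act_in_space[OF \<tau> y] by simp
  qed
  have "?l \<le>
     (\<integral>\<^sup>+\<tau>. (ennreal ((?g \<tau>)\<^sup>2) + ennreal r * (\<integral>\<^sup>+y. ?b \<tau> y \<partial>\<nu>)) \<partial>kern r \<rho>)"
    using \<rho> r C by (intro nn_integral_mono poincare_kern_at) auto
  also have "... = (\<integral>\<^sup>+\<tau>. ennreal ((?g \<tau>)\<^sup>2) \<partial>kern r \<rho>) +
      ennreal r * (\<integral>\<^sup>+\<tau>. (\<integral>\<^sup>+y. ?b \<tau> y \<partial>\<nu>) \<partial>kern r \<rho>)"
    using r by (simp add: nn_integral_add nn_integral_cmult)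
  also have "(\<integral>\<^sup>+\<tau>. (\<integral>\<^sup>+y. ?b \<tau> y \<partial>\<nu>) \<partial>kern r \<rho>) =
      (\<integral>\<^sup>+y. (\<integral>\<^sup>+\<tau>. ?b \<tau> y \<partial>kern r \<rho>) \<partial>\<nu>)"
    by (rule Fubini') measurable
  also have "(\<integral>\<^sup>+\<tau>. ennreal ((?g \<tau>)\<^sup>2) \<partial>kern r \<rho>) \<le> ennreal ((pair_mean r H \<rho>)\<^sup>2) +
      ennreal r * (\<integral>\<^sup>+y. (\<integral>\<^sup>+\<tau>. ennreal ((?g (act \<tau> y) - ?g \<tau>)\<^sup>2) \<partial>kern r \<rho>) \<partial>\<nu>)"
    unfolding pair_mean_def by (rule poincare_kern_at[OF \<rho> g_meas r g_bnd])
  also have "(\<integral>\<^sup>+y. (\<integral>\<^sup>+\<tau>. ennreal ((?g (act \<tau> y) - ?g \<tau>)\<^sup>2) \<partial>kern r \<rho>) \<partial>\<nu>) \<le>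
      (\<integral>\<^sup>+y. (\<integral>\<^sup>+\<tau>. (\<integral>\<^sup>+\<tau>'. ennreal ((H (act \<tau> y, \<tau>') - H (\<tau>, \<tau>'))\<^sup>2) \<partial>kern r \<rho>) \<partial>kern r \<rho>) \<partial>\<nu>)"
    by (intro nn_integral_mono) (auto intro!: g_diff)
  also have "ennreal ((pair_mean r H \<rho>)\<^sup>2) +
      ennreal r * (\<integral>\<^sup>+y. (\<integral>\<^sup>+\<tau>. (\<integral>\<^sup>+\<tau>'. ennreal ((H (act \<tau> y, \<tau>') - H (\<tau>, \<tau>'))\<^sup>2) \<partial>kern r \<rho>) \<partial>kern r \<rho>) \<partial>\<nu>) +
      ennreal r * (\<integral>\<^sup>+y. (\<integral>\<^sup>+\<tau>. ?b \<tau> y \<partial>kern r \<rho>) \<partial>\<nu>) =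
    ennreal ((pair_mean r H \<rho>)\<^sup>2) + ennreal r *
      (\<integral>\<^sup>+y. ((\<integral>\<^sup>+\<tau>. (\<integral>\<^sup>+\<tau>'. ennreal ((H (act \<tau> y, \<tau>') - H (\<tau>, \<tau>'))\<^sup>2) \<partial>kern r \<rho>) \<partial>kern r \<rho>) +
       (\<integral>\<^sup>+\<tau>. ?b \<tau> y \<partial>kern r \<rho>)) \<partial>\<nu>)"
    using \<rho> by (subst nn_integral_add) (measurable, simp add: distrib_left add.assoc)
  also have "(\<integral>\<^sup>+y. ((\<integral>\<^sup>+\<tau>. (\<integral>\<^sup>+\<tau>'. ennreal ((H (act \<tau> y, \<tau>') - H (\<tau>, \<tau>'))\<^sup>2) \<partial>kern r \<rho>) \<partial>kern r \<rho>) +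
       (\<integral>\<^sup>+\<tau>. ?b \<tau> y \<partial>kern r \<rho>)) \<partial>\<nu>) =
    (\<integral>\<^sup>+y. (\<integral>\<^sup>+\<tau>. (\<integral>\<^sup>+\<tau>'. ennreal ((H (act \<tau> y, \<tau>') - H (\<tau>, \<tau>'))\<^sup>2) +
       ennreal ((H (\<tau>, act \<tau>' y) - H (\<tau>, \<tau>'))\<^sup>2) \<partial>kern r \<rho>) \<partial>kern r \<rho>) \<partial>\<nu>)"
  proof (rule nn_integral_cong)
    fix y assume y: "y \<in> space \<nu>"
    have [measurable]: "(\<lambda>(\<tau>, \<tau>'). H (act \<tau> y, \<tau>')) \<in> borel_measurable (N \<Otimes>\<^sub>M N)"
      "(\<lambda>(\<tau>, \<tau>'). H (\<tau>, act \<tau>' y)) \<in> borel_measurable (N \<Otimes>\<^sub>M N)" using y by measurable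
    have "(\<integral>\<^sup>+\<tau>. (\<integral>\<^sup>+\<tau>'. ennreal ((H (act \<tau> y, \<tau>') - H (\<tau>, \<tau>'))\<^sup>2) +
         ennreal ((H (\<tau>, act \<tau>' y) - H (\<tau>, \<tau>'))\<^sup>2) \<partial>kern r \<rho>) \<partial>kern r \<rho>) =
      (\<integral>\<^sup>+\<tau>. (\<integral>\<^sup>+\<tau>'. ennreal ((H (act \<tau> y, \<tau>') - H (\<tau>, \<tau>'))\<^sup>2) \<partial>kern r \<rho>) +
         ?b \<tau> y \<partial>kern r \<rho>)"
      by (intro nn_integral_cong nn_integral_add) measurable
    also have "... = (\<integral>\<^sup>+\<tau>. (\<integral>\<^sup>+\<tau>'. ennreal ((H (act \<tau> y, \<tau>') - H (\<tau>, \<tau>'))\<^sup>2) \<partial>kern r \<rho>) \<partial>kern r \<rho>) +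
         (\<integral>\<^sup>+\<tau>. ?b \<tau> y \<partial>kern r \<rho>)"
      using \<rho> y by (intro nn_integral_add) measurable
    finally show "(\<integral>\<^sup>+\<tau>. (\<integral>\<^sup>+\<tau>'. ennreal ((H (act \<tau> y, \<tau>') - H (\<tau>, \<tau>'))\<^sup>2) \<partial>kern r \<rho>) \<partial>kern r \<rho>) +
         (\<integral>\<^sup>+\<tau>. ?b \<tau> y \<partial>kern r \<rho>) =
      (\<integral>\<^sup>+\<tau>. (\<integral>\<^sup>+\<tau>'. ennreal ((H (act \<tau> y, \<tau>') - H (\<tau>, \<tau>'))\<^sup>2) +
         ennreal ((H (\<tau>, act \<tau>' y) - H (\<tau>, \<tau>'))\<^sup>2) \<partial>kern r \<rho>) \<partial>kern r \<rho>)" ..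
  qed
  finally show ?thesis by (simp add: add_right_mono mult_left_mono)
qed

definition coup_mean :: "real \<Rightarrow> real \<Rightarrow> ('s \<times> 's \<Rightarrow> real) \<Rightarrow> 's \<Rightarrow> real" where
  "coup_mean t s H u = (\<integral>\<rho>. pair_mean (t - s) H \<rho> \<partial>kern s u)"

lemma measurable_coup_mean [measurable]:
  assumes [measurable]: "H \<in> borel_measurable (N \<Otimes>\<^sub>M N)"
  shows "coup_mean t s H \<in> borel_measurable N"
  unfolding coup_mean_def[abs_def] by measurable

lemma abs_coup_mean_le:
  assumes [measurable]: "H \<in> borel_measurable (N \<Otimes>\<^sub>M N)" and "u \<in> space N"
    and "\<And>\<tau> \<tau>'. \<tau> \<in> space N \<Longrightarrow> \<tau>' \<in> space N \<Longrightarrow> \<bar>H (\<tau>, \<tau>')\<bar> \<le> C"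
  shows "\<bar>coup_mean t s H u\<bar> \<le> C"
  unfolding coup_mean_def using assms by (intro abs_integral_kern_le abs_pair_mean_le) auto

text \<open>As for \<open>pair_mean_act_diff\<close>, a point added at the start is added to both copies.\<close>

lemma coup_mean_act_diff:
  assumes W: "W \<in> space (prob_algebra N)"
    and H[measurable]: "H \<in> borel_measurable (N \<Otimes>\<^sub>M N)" and y: "y \<in> space \<nu>"
    and C: "\<And>\<tau> \<tau>'. \<tau> \<in> space N \<Longrightarrow> \<tau>' \<in> space N \<Longrightarrow> \<bar>H (\<tau>, \<tau>')\<bar> \<le> C"
  shows "(\<integral>\<^sup>+u. ennreal ((coup_mean t s H (act u y) - coup_mean t s H u)\<^sup>2) \<partial>W) \<le>
    (\<integral>\<^sup>+p. ennreal ((H (act (fst p) y, act (snd p) y) - H p)\<^sup>2) \<partial>coup W t s)" (is "?l \<le> ?r")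
proof -
  have spW: "space W = space N" using W by (auto simp: space_prob_algebra dest: sets_eq_imp_space_eq)
  let ?J = "\<lambda>\<rho>. (\<integral>\<^sup>+\<tau>. (\<integral>\<^sup>+\<tau>'. ennreal ((H (act \<tau> y, act \<tau>' y) - H (\<tau>, \<tau>'))\<^sup>2) \<partial>kern (t - s) \<rho>) \<partial>kern (t - s) \<rho>)"
  have [measurable]: "(\<lambda>(\<tau>, \<tau>'). H (act \<tau> y, act \<tau>' y)) \<in> borel_measurable (N \<Otimes>\<^sub>M N)"
      "(\<lambda>p. H (act (fst p) y, act (snd p) y)) \<in> borel_measurable (N \<Otimes>\<^sub>M N)"
      "(\<lambda>\<tau>. act \<tau> y) \<in> N \<rightarrow>\<^sub>M N" using y by measurable
  have "?l \<le>
      (\<integral>\<^sup>+u. (\<integral>\<^sup>+\<rho>. ?J \<rho> \<partial>kern s u) \<partial>W)"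
  proof (rule nn_integral_mono)
    fix u assume "u \<in> space W"
    then have u: "u \<in> space N" by (simp add: spW)
    then interpret K: prob_space "kern s u" by (rule prob_space_kern)
    have "coup_mean t s H (act u y) - coup_mean t s H u =
        (\<integral>\<rho>. pair_mean (t - s) H (act \<rho> y) - pair_mean (t - s) H \<rho> \<partial>kern s u)"
      unfolding coup_mean_def using u y C
      by (intro integral_kern_act_diff[where C = C] abs_pair_mean_le) auto
    then have "ennreal ((coup_mean t s H (act u y) - coup_mean t s H u)\<^sup>2) \<le>
        (\<integral>\<^sup>+\<rho>. ennreal ((pair_mean (t - s) H (act \<rho> y) - pair_mean (t - s) H \<rho>)\<^sup>2) \<partial>kern s u)"
      by (simp only:) (intro K.ennreal_square_integral_le, measurable)
    also have "... \<le> (\<integral>\<^sup>+\<rho>. ?J \<rho> \<partial>kern s u)"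
      using y C by (intro nn_integral_mono pair_mean_act_diff) auto
    finally show "ennreal ((coup_mean t s H (act u y) - coup_mean t s H u)\<^sup>2) \<le> (\<integral>\<^sup>+\<rho>. ?J \<rho> \<partial>kern s u)" .
  qed
  also have "... = (\<integral>\<^sup>+\<rho>. ?J \<rho> \<partial>(W \<bind> kern s))"
    by (rule nn_integral_bind_kern[OF W, symmetric]) measurable
  also have "... = ?r"
    by (subst nn_integral_coup[OF W]) auto
  finally show ?thesis .
qed

text \<open>
  The independent parts contribute the increments in one coordinate, with weight \<open>t - s\<close>; the common part
  contributes joint increments, with weight \<open>s\<close>; what remains is the conditional mean given the initial state.
\<close>

theorem poincare_coup:
  assumes W: "W \<in> space (prob_algebra N)" and s: "0 \<le> s" "s \<le> t"
    and H[measurable]: "H \<in> borel_measurable (N \<Otimes>\<^sub>M N)"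
    and C: "\<And>\<tau> \<tau>'. \<tau> \<in> space N \<Longrightarrow> \<tau>' \<in> space N \<Longrightarrow> \<bar>H (\<tau>, \<tau>')\<bar> \<le> C"
  shows "(\<integral>\<^sup>+p. ennreal ((H p)\<^sup>2) \<partial>coup W t s) \<le> (\<integral>\<^sup>+u. ennreal ((coup_mean t s H u)\<^sup>2) \<partial>W) +
    ennreal s * (\<integral>\<^sup>+y. (\<integral>\<^sup>+p. ennreal ((H (act (fst p) y, act (snd p) y) - H p)\<^sup>2) \<partial>coup W t s) \<partial>\<nu>) +
    ennreal (t - s) * (\<integral>\<^sup>+y. (\<integral>\<^sup>+p. ennreal ((H (act (fst p) y, snd p) - H p)\<^sup>2) +
       ennreal ((H (fst p, act (snd p) y) - H p)\<^sup>2) \<partial>coup W t s) \<partial>\<nu>)" (is "?l \<le> _")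
proof -
  have W1: "W \<bind> kern s \<in> space (prob_algebra N)" by (rule bind_kern_in_prob_algebra[OF W])
  then have sW1[measurable_cong]: "sets (W \<bind> kern s) = sets N" and "prob_space (W \<bind> kern s)"
    by (auto simp: space_prob_algebra)
  then interpret W1: prob_space "W \<bind> kern s" by simp
  have spW1: "space (W \<bind> kern s) = space N" using sW1 by (rule sets_eq_imp_space_eq)
  interpret pair_sigma_finite \<nu> "W \<bind> kern s" ..
  let ?r = "t - s"
  let ?E = "\<lambda>y \<rho>. (\<integral>\<^sup>+\<tau>. (\<integral>\<^sup>+\<tau>'. ennreal ((H (act \<tau> y, \<tau>') - H (\<tau>, \<tau>'))\<^sup>2) +
       ennreal ((H (\<tau>, act \<tau>' y) - H (\<tau>, \<tau>'))\<^sup>2) \<partial>kern ?r \<rho>) \<partial>kern ?r \<rho>)"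
  have m[measurable]: "(\<lambda>(\<rho>, y). ?E y \<rho>) \<in> borel_measurable (N \<Otimes>\<^sub>M \<nu>)" by measurable
  have m1[measurable]: "(\<lambda>\<rho>. \<integral>\<^sup>+y. ?E y \<rho> \<partial>\<nu>) \<in> borel_measurable N" by measurable
  have "?l =
     (\<integral>\<^sup>+\<rho>. (\<integral>\<^sup>+\<tau>. (\<integral>\<^sup>+\<tau>'. ennreal ((H (\<tau>, \<tau>'))\<^sup>2) \<partial>kern ?r \<rho>) \<partial>kern ?r \<rho>) \<partial>(W \<bind> kern s))"
    by (subst nn_integral_coup[OF W]) auto
  also have "... \<le> (\<integral>\<^sup>+\<rho>. (ennreal ((pair_mean ?r H \<rho>)\<^sup>2) + ennreal ?r * (\<integral>\<^sup>+y. ?E y \<rho> \<partial>\<nu>)) \<partial>(W \<bind> kern s))"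
    using s C by (intro nn_integral_mono poincare_kern_pair) (auto simp: spW1)
  also have "... = (\<integral>\<^sup>+\<rho>. ennreal ((pair_mean ?r H \<rho>)\<^sup>2) \<partial>(W \<bind> kern s)) +
      ennreal ?r * (\<integral>\<^sup>+\<rho>. (\<integral>\<^sup>+y. ?E y \<rho> \<partial>\<nu>) \<partial>(W \<bind> kern s))"
    by (subst nn_integral_add) (measurable, subst nn_integral_cmult, measurable)
  also have "(\<integral>\<^sup>+\<rho>. (\<integral>\<^sup>+y. ?E y \<rho> \<partial>\<nu>) \<partial>(W \<bind> kern s)) = (\<integral>\<^sup>+y. (\<integral>\<^sup>+\<rho>. ?E y \<rho> \<partial>(W \<bind> kern s)) \<partial>\<nu>)"
    by (rule Fubini') measurable
  also have "... = (\<integral>\<^sup>+y. (\<integral>\<^sup>+p. ennreal ((H (act (fst p) y, snd p) - H p)\<^sup>2) +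
       ennreal ((H (fst p, act (snd p) y) - H p)\<^sup>2) \<partial>coup W t s) \<partial>\<nu>)"
  proof (rule nn_integral_cong)
    fix y assume "y \<in> space \<nu>"
    then have [measurable]: "(\<lambda>\<tau>. act \<tau> y) \<in> N \<rightarrow>\<^sub>M N" by measurable
    show "(\<integral>\<^sup>+\<rho>. ?E y \<rho> \<partial>(W \<bind> kern s)) = (\<integral>\<^sup>+p. ennreal ((H (act (fst p) y, snd p) - H p)\<^sup>2) +
       ennreal ((H (fst p, act (snd p) y) - H p)\<^sup>2) \<partial>coup W t s)"
      by (subst nn_integral_coup[OF W]) auto
  qed
  also have "(\<integral>\<^sup>+\<rho>. ennreal ((pair_mean ?r H \<rho>)\<^sup>2) \<partial>(W \<bind> kern s)) \<le>
     (\<integral>\<^sup>+u. ennreal ((coup_mean t s H u)\<^sup>2) \<partial>W) +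
     ennreal s * (\<integral>\<^sup>+y. (\<integral>\<^sup>+\<rho>. ennreal ((pair_mean ?r H (act \<rho> y) - pair_mean ?r H \<rho>)\<^sup>2) \<partial>(W \<bind> kern s)) \<partial>\<nu>)"
    unfolding coup_mean_def using s C by (intro poincare_kern[OF W, where C = C] abs_pair_mean_le) auto
  also have "(\<integral>\<^sup>+y. (\<integral>\<^sup>+\<rho>. ennreal ((pair_mean ?r H (act \<rho> y) - pair_mean ?r H \<rho>)\<^sup>2) \<partial>(W \<bind> kern s)) \<partial>\<nu>) \<le>
     (\<integral>\<^sup>+y. (\<integral>\<^sup>+p. ennreal ((H (act (fst p) y, act (snd p) y) - H p)\<^sup>2) \<partial>coup W t s) \<partial>\<nu>)"
  proof (rule nn_integral_mono)
    fix y assume y: "y \<in> space \<nu>"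
    then have [measurable]: "(\<lambda>\<tau>. act \<tau> y) \<in> N \<rightarrow>\<^sub>M N" by measurable
    have "(\<integral>\<^sup>+\<rho>. ennreal ((pair_mean ?r H (act \<rho> y) - pair_mean ?r H \<rho>)\<^sup>2) \<partial>(W \<bind> kern s)) \<le>
      (\<integral>\<^sup>+\<rho>. (\<integral>\<^sup>+\<tau>. (\<integral>\<^sup>+\<tau>'. ennreal ((H (act \<tau> y, act \<tau>' y) - H (\<tau>, \<tau>'))\<^sup>2) \<partial>kern ?r \<rho>) \<partial>kern ?r \<rho>) \<partial>(W \<bind> kern s))"
      using y C by (intro nn_integral_mono pair_mean_act_diff) (auto simp: spW1)
    also have "... = (\<integral>\<^sup>+p. ennreal ((H (act (fst p) y, act (snd p) y) - H p)\<^sup>2) \<partial>coup W t s)"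
      by (subst nn_integral_coup[OF W]) auto
    finally show "(\<integral>\<^sup>+\<rho>. ennreal ((pair_mean ?r H (act \<rho> y) - pair_mean ?r H \<rho>)\<^sup>2) \<partial>(W \<bind> kern s)) \<le>
       (\<integral>\<^sup>+p. ennreal ((H (act (fst p) y, act (snd p) y) - H p)\<^sup>2) \<partial>coup W t s)" .
  qed
  finally show ?thesis by (simp add: add_right_mono mult_left_mono)
qed

end

section \<open>The Mecke equation and conditioning on an empty window\<close>

lemma measurable_emeasure_point_algebra [measurable]:
  assumes "A \<in> sets L"
  shows "(\<lambda>\<mu>. emeasure \<mu> A) \<in> borel_measurable (point_algebra L)"
  unfolding point_algebra_def
  by (rule measurable_SUP1[OF assms]) (auto intro: measurable_vimage_algebra1)

lemma measurable_point_algebraI: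
  assumes "\<And>x. x \<in> space X \<Longrightarrow> f x \<in> point_measures L"
    and "\<And>A. A \<in> sets L \<Longrightarrow> (\<lambda>x. emeasure (f x) A) \<in> borel_measurable X"
  shows "f \<in> X \<rightarrow>\<^sub>M point_algebra L"
  unfolding point_algebra_def
proof (rule measurable_SUP2)
  show "f \<in> X \<rightarrow>\<^sub>M vimage_algebra (point_measures L) (\<lambda>\<mu>. emeasure \<mu> A) borel" if "A \<in> sets L" for A
    using assms that by (intro measurable_vimage_algebra2) auto
qed auto

lemma sets_point_measure: "\<mu> \<in> space (point_algebra L) \<Longrightarrow> sets \<mu> = sets L"
  by (simp add: space_point_algebra point_measures_def)

lemma point_measure_cases:
  assumes "\<mu> \<in> space (point_algebra L)" "A \<in> sets L"
  obtains "emeasure \<mu> A = \<infinity>" | n :: nat where "emeasure \<mu> A = of_nat n"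
  using assms by (auto simp: space_point_algebra point_measures_def)

lemma emeasure_add_dirac_point:
  "\<mu> \<in> space (point_algebra L) \<Longrightarrow> A \<in> sets L \<Longrightarrow> emeasure (add_dirac \<mu> x) A = emeasure \<mu> A + indicator A x"
  by (simp add: emeasure_add_dirac sets_point_measure)

lemma measurable_add_dirac_pair:
  "(\<lambda>(\<mu>, x). add_dirac \<mu> x) \<in> point_algebra L \<Otimes>\<^sub>M L \<rightarrow>\<^sub>M point_algebra L"
proof (rule measurable_point_algebraI)
  show "(case p of (\<mu>, x) \<Rightarrow> add_dirac \<mu> x) \<in> point_measures L" if "p \<in> space (point_algebra L \<Otimes>\<^sub>M L)" for p
    using that by (auto simp: space_pair_measure space_point_algebra add_dirac_in_point_measures)
  fix A assume [measurable]: "A \<in> sets L"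
  have "(\<lambda>(\<mu>, x). emeasure \<mu> A + indicator A x) \<in> borel_measurable (point_algebra L \<Otimes>\<^sub>M L)"
    by measurable
  then show "(\<lambda>p. emeasure (case p of (\<mu>, x) \<Rightarrow> add_dirac \<mu> x) A) \<in> borel_measurable (point_algebra L \<Otimes>\<^sub>M L)"
    by (rule measurable_cong[THEN iffD1, rotated]) (auto simp: space_pair_measure emeasure_add_dirac_point)
qed

lemma measurable_add_dirac [measurable (raw)]:
  assumes "f \<in> X \<rightarrow>\<^sub>M point_algebra L" "g \<in> X \<rightarrow>\<^sub>M L"
  shows "(\<lambda>x. add_dirac (f x) (g x)) \<in> X \<rightarrow>\<^sub>M point_algebra L"
  using measurable_compose[OF measurable_Pair[OF assms] measurable_add_dirac_pair] by simp

lemma add_dirac_commute: "add_dirac (add_dirac \<mu> x) y = add_dirac (add_dirac \<mu> y) x"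
  by (rule measure_eqI) (auto simp: emeasure_add_dirac add_ac)

lemma point_algebra_cong: "sets L = sets L' \<Longrightarrow> point_algebra L = point_algebra L'"
  by (simp add: point_algebra_def point_measures_def)

text \<open>A density keeps the underlying measurable space, so that all windows share one space of configurations.\<close>

definition restricted :: "'a measure \<Rightarrow> 'a set \<Rightarrow> 'a measure" where
  "restricted L B = density L (indicator B)"

lemma sets_restricted [simp, measurable_cong]: "sets (restricted L B) = sets L"
  and space_restricted [simp]: "space (restricted L B) = space L"
  by (simp_all add: restricted_def)

lemma emeasure_restricted:
  "A \<in> sets L \<Longrightarrow> B \<in> sets L \<Longrightarrow> emeasure (restricted L B) A = emeasure L (A \<inter> B)"
  by (simp add: restricted_def emeasure_density Int_commute flip: indicator_inter_arith)

lemma nn_integral_restricted: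
  "f \<in> borel_measurable L \<Longrightarrow> B \<in> sets L \<Longrightarrow> (\<integral>\<^sup>+x. f x \<partial>restricted L B) = (\<integral>\<^sup>+x\<in>B. f x \<partial>L)"
  by (simp add: restricted_def nn_integral_density mult.commute)

lemma point_algebra_restricted [simp]: "point_algebra (restricted L B) = point_algebra L"
  by (rule point_algebra_cong) simp

lemma finite_measure_restricted:
  assumes "B \<in> sets L" "emeasure L B < \<infinity>"
  shows "finite_measure (restricted L B)"
  using assms by (intro finite_measureI) (auto simp: emeasure_restricted)

lemma measure_restricted_space:
  assumes "B \<in> sets L"
  shows "measure (restricted L B) (space L) = measure L B"
proof -
  have "space L \<inter> B = B" using sets.sets_into_space[OF assms] by auto
  then show ?thesis by (simp add: measure_def emeasure_restricted assms)
qed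

lemma sigma_finite_restricted:
  assumes "sigma_finite_measure L" "B \<in> sets L"
  shows "sigma_finite_measure (restricted L B)"
proof -
  obtain A where A: "countable A" "A \<subseteq> sets L" "\<Union>A = space L" "\<forall>a\<in>A. emeasure L a \<noteq> \<infinity>"
    using sigma_finite_measure.sigma_finite_countable[OF assms(1)] by blast
  have "emeasure (restricted L B) a \<noteq> \<infinity>" if "a \<in> A" for a
  proof -
    have "emeasure (restricted L B) a = emeasure L (a \<inter> B)" using A that assms by (auto simp: emeasure_restricted)
    also have "... \<le> emeasure L a" using A that by (intro emeasure_mono) auto
    finally show ?thesis using A that by (auto simp: top_unique)
  qed
  then show ?thesis using A by unfold_locales (auto intro!: exI[of _ A])
qed

lemma poisson_kicks_restricted:
  assumes "B \<in> sets L" "emeasure L B < \<infinity>"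
  shows "poisson_kicks (restricted L B) (point_algebra L) add_dirac"
proof -
  interpret finite_measure "restricted L B" by (rule finite_measure_restricted[OF assms])
  show ?thesis
    by unfold_locales (auto intro: add_dirac_commute measurable_add_dirac_pair
        cong: measurable_cong_sets simp: measurable_add_dirac_pair)
qed

text \<open>
  The Mecke equation is only required on sets of finite intensity, where the sum of \<open>h\<close> over the points of
  \<open>\<mu>\<close> in \<open>B\<close> is \<open>h \<mu> * emeasure \<mu> B\<close> because \<open>h\<close> depends on \<open>\<mu>\<close> alone.
\<close>

definition mecke :: "'a measure \<Rightarrow> 'a measure measure \<Rightarrow> bool" where
  "mecke L Q \<longleftrightarrow> sigma_finite_measure L \<and> Q \<in> space (prob_algebra (point_algebra L)) \<and>
     (\<forall>B\<in>sets L. emeasure L B < \<infinity> \<longrightarrow> (\<forall>h\<in>borel_measurable (point_algebra L).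
        (\<integral>\<^sup>+\<mu>. h \<mu> * emeasure \<mu> B \<partial>Q) = (\<integral>\<^sup>+x\<in>B. (\<integral>\<^sup>+\<mu>. h (add_dirac \<mu> x) \<partial>Q) \<partial>L)))"

text \<open>
  The law of the process conditioned to have no point in \<open>B\<close>; the factor is the reciprocal of the
  probability of that event.
\<close>

definition void_law :: "'a measure \<Rightarrow> 'a measure measure \<Rightarrow> 'a set \<Rightarrow> 'a measure measure" where
  "void_law L Q B = density Q (\<lambda>\<mu>. ennreal (exp (measure L B)) * indicator {\<mu>. emeasure \<mu> B = 0} \<mu>)"

locale mecke_process =
  fixes L :: "'a measure" and Q :: "'a measure measure"
  assumes mecke: "mecke L Q"
begin

sublocale L: sigma_finite_measure L
  using mecke by (simp add: mecke_def)

lemma Q_prob_algebra: "Q \<in> space (prob_algebra (point_algebra L))"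
  using mecke by (simp add: mecke_def)

lemma sets_Q [measurable_cong]: "sets Q = sets (point_algebra L)"
  using Q_prob_algebra by (simp add: space_prob_algebra)

lemma space_Q: "space Q = space (point_algebra L)"
  using sets_Q by (rule sets_eq_imp_space_eq)

sublocale Q: prob_space Q
  using Q_prob_algebra by (simp add: space_prob_algebra)

lemma mecke_equation:
  "B \<in> sets L \<Longrightarrow> emeasure L B < \<infinity> \<Longrightarrow> h \<in> borel_measurable (point_algebra L) \<Longrightarrow>
    (\<integral>\<^sup>+\<mu>. h \<mu> * emeasure \<mu> B \<partial>Q) = (\<integral>\<^sup>+x\<in>B. (\<integral>\<^sup>+\<mu>. h (add_dirac \<mu> x) \<partial>Q) \<partial>L)"
  using mecke by (simp add: mecke_def)

end

locale mecke_window = mecke_process L Q for L :: "'a measure" and Q +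
  fixes B :: "'a set"
  assumes B_sets [measurable]: "B \<in> sets L" and B_finite: "emeasure L B < \<infinity>"
begin

sublocale poisson_kicks "restricted L B" "point_algebra L" add_dirac
  by (rule poisson_kicks_restricted[OF B_sets B_finite])

lemma mass_eq: "measure (restricted L B) (space (restricted L B)) = measure L B"
  by (simp add: measure_restricted_space)

text \<open>
  The Mecke equation on the event of exactly \<open>Suc n\<close> points in \<open>B\<close>, where \<open>emeasure \<mu> B\<close> is a constant:
  removing one of them leaves \<open>n\<close> points.
\<close>

lemma count_recursion:
  assumes [measurable]: "h \<in> borel_measurable (point_algebra L)"
  shows "of_nat (Suc n) * (\<integral>\<^sup>+\<mu>. h \<mu> * indicator {\<mu>. emeasure \<mu> B = of_nat (Suc n)} \<mu> \<partial>Q) =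
    (\<integral>\<^sup>+\<mu>. step h \<mu> * indicator {\<mu>. emeasure \<mu> B = of_nat n} \<mu> \<partial>Q)"
proof -
  interpret pair_sigma_finite "restricted L B" Q ..
  let ?I = "\<lambda>n \<mu>. indicator {\<mu>. emeasure \<mu> B = of_nat n} \<mu> :: ennreal"
  have "of_nat (Suc n) * (\<integral>\<^sup>+\<mu>. h \<mu> * ?I (Suc n) \<mu> \<partial>Q) = (\<integral>\<^sup>+\<mu>. (h \<mu> * ?I (Suc n) \<mu>) * emeasure \<mu> B \<partial>Q)"
    by (subst nn_integral_cmult[symmetric], measurable, intro nn_integral_cong)
       (auto split: split_indicator simp: mult_ac)
  also have "... = (\<integral>\<^sup>+x\<in>B. (\<integral>\<^sup>+\<mu>. h (add_dirac \<mu> x) * ?I (Suc n) (add_dirac \<mu> x) \<partial>Q) \<partial>L)"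
    by (rule mecke_equation[OF B_sets B_finite]) auto
  also have "... = (\<integral>\<^sup>+x. (\<integral>\<^sup>+\<mu>. h (add_dirac \<mu> x) * ?I (Suc n) (add_dirac \<mu> x) \<partial>Q) \<partial>restricted L B)"
    by (rule nn_integral_restricted[symmetric]) measurable
  also have "... = (\<integral>\<^sup>+x. (\<integral>\<^sup>+\<mu>. h (add_dirac \<mu> x) * ?I n \<mu> \<partial>Q) \<partial>restricted L B)"
  proof -
    have "(\<integral>\<^sup>+x\<in>B. (\<integral>\<^sup>+\<mu>. h (add_dirac \<mu> x) * ?I (Suc n) (add_dirac \<mu> x) \<partial>Q) \<partial>L) =
      (\<integral>\<^sup>+x\<in>B. (\<integral>\<^sup>+\<mu>. h (add_dirac \<mu> x) * ?I n \<mu> \<partial>Q) \<partial>L)"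
    proof (intro nn_integral_cong)
      fix x
      have "?I (Suc n) (add_dirac \<mu> x) = ?I n \<mu>" if "x \<in> B" "\<mu> \<in> space Q" for \<mu>
      proof -
        have "emeasure (add_dirac \<mu> x) B = emeasure \<mu> B + 1"
          using that by (simp add: space_Q emeasure_add_dirac_point)
        moreover have "emeasure \<mu> B + 1 = of_nat (Suc n) \<longleftrightarrow> emeasure \<mu> B = of_nat n"
          by (simp add: add.commute[of _ 1] ennreal_add_left_cancel)
        ultimately show ?thesis by (simp add: indicator_def)
      qed
      then show "(\<integral>\<^sup>+\<mu>. h (add_dirac \<mu> x) * ?I (Suc n) (add_dirac \<mu> x) \<partial>Q) * indicator B x =
        (\<integral>\<^sup>+\<mu>. h (add_dirac \<mu> x) * ?I n \<mu> \<partial>Q) * indicator B x"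
        by (cases "x \<in> B") (auto intro!: nn_integral_cong)
    qed
    then show ?thesis by (subst (1 2) nn_integral_restricted) measurable
  qed
  also have "... = (\<integral>\<^sup>+\<mu>. (\<integral>\<^sup>+x. h (add_dirac \<mu> x) * ?I n \<mu> \<partial>restricted L B) \<partial>Q)"
    by (rule Fubini'[symmetric]) measurable
  also have "... = (\<integral>\<^sup>+\<mu>. step h \<mu> * ?I n \<mu> \<partial>Q)"
    unfolding step_def
    by (intro nn_integral_cong nn_integral_multc measurable_act_section) (auto simp: space_Q)
  finally show ?thesis .
qed

lemma count_iterate:
  assumes "h \<in> borel_measurable (point_algebra L)"
  shows "(\<integral>\<^sup>+\<mu>. h \<mu> * indicator {\<mu>. emeasure \<mu> B = of_nat n} \<mu> \<partial>Q) =
    ennreal (1 / fact n) * (\<integral>\<^sup>+\<mu>. (step ^^ n) h \<mu> * indicator {\<mu>. emeasure \<mu> B = 0} \<mu> \<partial>Q)"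
  using assms
proof (induction n arbitrary: h)
  case (Suc n)
  have "ennreal (1 / real (Suc n)) * of_nat (Suc n) = 1"
    by (simp add: ennreal_of_nat_eq_real_of_nat del: of_nat_Suc flip: ennreal_mult)
  then have "(\<integral>\<^sup>+\<mu>. h \<mu> * indicator {\<mu>. emeasure \<mu> B = of_nat (Suc n)} \<mu> \<partial>Q) =
      ennreal (1 / real (Suc n)) * (of_nat (Suc n) * (\<integral>\<^sup>+\<mu>. h \<mu> * indicator {\<mu>. emeasure \<mu> B = of_nat (Suc n)} \<mu> \<partial>Q))"
    by (simp only: mult.assoc[symmetric] mult_1)
  also have "... = ennreal (1 / real (Suc n)) * (\<integral>\<^sup>+\<mu>. step h \<mu> * indicator {\<mu>. emeasure \<mu> B = of_nat n} \<mu> \<partial>Q)"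
    by (simp only: count_recursion[OF Suc.prems])
  also have "... = ennreal (1 / real (Suc n)) * (ennreal (1 / fact n) *
      (\<integral>\<^sup>+\<mu>. (step ^^ n) (step h) \<mu> * indicator {\<mu>. emeasure \<mu> B = 0} \<mu> \<partial>Q))"
    using Suc by simp
  also have "... = ennreal (1 / fact (Suc n)) *
      (\<integral>\<^sup>+\<mu>. (step ^^ n) (step h) \<mu> * indicator {\<mu>. emeasure \<mu> B = 0} \<mu> \<partial>Q)"
    by (simp add: mult.assoc[symmetric] del: of_nat_Suc flip: ennreal_mult)
  finally show ?case by (simp add: funpow_swap1)
qed simp

lemma AE_count_finite: "AE \<mu> in Q. \<exists>n. emeasure \<mu> B = of_nat n"
proof -
  have "(\<integral>\<^sup>+\<mu>. 1 * emeasure \<mu> B \<partial>Q) = (\<integral>\<^sup>+x\<in>B. (\<integral>\<^sup>+\<mu>. 1 \<partial>Q) \<partial>L)"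
    by (rule mecke_equation[OF B_sets B_finite]) auto
  also have "... = emeasure L B" by (simp add: Q.emeasure_space_1)
  finally have "(\<integral>\<^sup>+\<mu>. emeasure \<mu> B \<partial>Q) \<noteq> \<infinity>" using B_finite by simp
  then have "AE \<mu> in Q. emeasure \<mu> B \<noteq> \<infinity>" by (intro nn_integral_PInf_AE) measurable
  then show ?thesis
    using AE_space
  proof eventually_elim
    case (elim \<mu>)
    then show ?case using point_measure_cases[OF _ B_sets, of \<mu>] by (auto simp: space_Q)
  qed
qed

lemma nn_integral_count_series:
  assumes [measurable]: "h \<in> borel_measurable (point_algebra L)"
  shows "(\<integral>\<^sup>+\<mu>. h \<mu> \<partial>Q) = (\<Sum>n. ennreal (1 / fact n) * (\<integral>\<^sup>+\<mu>. (step ^^ n) h \<mu> * indicator {\<mu>. emeasure \<mu> B = 0} \<mu> \<partial>Q))" (is "?l = _")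
proof -
  have "?l = (\<integral>\<^sup>+\<mu>. (\<Sum>n. h \<mu> * indicator {\<mu>. emeasure \<mu> B = of_nat n} \<mu>) \<partial>Q)"
  proof (rule nn_integral_cong_AE)
    show "AE \<mu> in Q. h \<mu> = (\<Sum>n. h \<mu> * indicator {\<mu>. emeasure \<mu> B = of_nat n} \<mu>)"
      using AE_count_finite
    proof eventually_elim
      case (elim \<mu>)
      then obtain k where k: "emeasure \<mu> B = of_nat k" by blast
      have "(\<Sum>n. h \<mu> * indicator {\<mu>. emeasure \<mu> B = of_nat n} \<mu>) = (\<Sum>n\<in>{k}. h \<mu> * indicator {\<mu>. emeasure \<mu> B = of_nat n} \<mu>)"
        using k by (intro suminf_finite) (auto simp: indicator_def)
      then show ?case using k by simp
    qed
  qed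
  also have "... = (\<Sum>n. (\<integral>\<^sup>+\<mu>. h \<mu> * indicator {\<mu>. emeasure \<mu> B = of_nat n} \<mu> \<partial>Q))"
    by (rule nn_integral_suminf) measurable
  finally show ?thesis by (simp only: count_iterate[OF assms])
qed

text \<open>The series over the number of points in \<open>B\<close>, applied to the constant 1, sums to an exponential.\<close>

lemma void_probability: "(\<integral>\<^sup>+\<mu>. indicator {\<mu>. emeasure \<mu> B = 0} \<mu> \<partial>Q) = ennreal (exp (- measure L B))"
proof -
  let ?v = "\<integral>\<^sup>+\<mu>. indicator {\<mu>. emeasure \<mu> B = 0} \<mu> \<partial>Q" and ?m = "measure L B"
  have "1 = (\<Sum>n. ennreal (1 / fact n) * (\<integral>\<^sup>+\<mu>. (step ^^ n) (\<lambda>_. 1) \<mu> * indicator {\<mu>. emeasure \<mu> B = 0} \<mu> \<partial>Q))"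
    using nn_integral_count_series[of "\<lambda>_. 1"] by (simp add: Q.emeasure_space_1)
  also have "... = (\<Sum>n. ?v * ennreal (?m ^ n / fact n))"
  proof (rule suminf_cong)
    fix n
    have "(\<integral>\<^sup>+\<mu>. (step ^^ n) (\<lambda>_. 1) \<mu> * indicator {\<mu>. emeasure \<mu> B = 0} \<mu> \<partial>Q) =
        (\<integral>\<^sup>+\<mu>. ennreal (?m ^ n) * indicator {\<mu>. emeasure \<mu> B = 0} \<mu> \<partial>Q)"
      by (intro nn_integral_cong) (simp add: step_pow_const space_Q mass_eq[simplified] ennreal_power)
    also have "... = ennreal (?m ^ n) * ?v" by (rule nn_integral_cmult) measurable
    finally show "ennreal (1 / fact n) * (\<integral>\<^sup>+\<mu>. (step ^^ n) (\<lambda>_. 1) \<mu> * indicator {\<mu>. emeasure \<mu> B = 0} \<mu> \<partial>Q) =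
        ?v * ennreal (?m ^ n / fact n)"
      by (simp add: mult.assoc[symmetric] mult.commute[of ?v] flip: ennreal_mult)
  qed
  also have "... = ?v * ennreal (exp ?m)"
  proof -
    have "(\<lambda>n. ?m ^ n / fact n) sums exp ?m" using exp_converges[of ?m] by (simp add: field_simps)
    then have "(\<Sum>n. ennreal (?m ^ n / fact n)) = ennreal (exp ?m)" by (intro suminf_ennreal_eq) auto
    then show ?thesis by simp
  qed
  finally have eq: "1 = ?v * ennreal (exp ?m)" .
  have "ennreal (exp ?m) * ennreal (exp (- ?m)) = 1"
    by (simp add: exp_minus flip: ennreal_mult)
  then have "?v = ?v * ennreal (exp ?m) * ennreal (exp (- ?m))" by (simp only: mult.assoc mult_1_right)
  then show ?thesis by (simp only: eq[symmetric] mult_1)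
qed

abbreviation void :: "'a measure measure" where "void \<equiv> void_law L Q B"

lemma nn_integral_void:
  assumes [measurable]: "h \<in> borel_measurable (point_algebra L)"
  shows "(\<integral>\<^sup>+\<mu>. h \<mu> \<partial>void) = ennreal (exp (measure L B)) * (\<integral>\<^sup>+\<mu>. h \<mu> * indicator {\<mu>. emeasure \<mu> B = 0} \<mu> \<partial>Q)" (is "?l = ?r")
proof -
  have "?l = (\<integral>\<^sup>+\<mu>. ennreal (exp (measure L B)) * indicator {\<mu>. emeasure \<mu> B = 0} \<mu> * h \<mu> \<partial>Q)"
    unfolding void_law_def by (rule nn_integral_density) measurable
  also have "... = (\<integral>\<^sup>+\<mu>. ennreal (exp (measure L B)) * (h \<mu> * indicator {\<mu>. emeasure \<mu> B = 0} \<mu>) \<partial>Q)"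
    by (intro nn_integral_cong) (simp add: mult_ac)
  also have "... = ?r"
    by (rule nn_integral_cmult) measurable
  finally show ?thesis .
qed

lemma void_prob_algebra: "void \<in> space (prob_algebra (point_algebra L))"
proof -
  have "prob_space void"
  proof (rule prob_spaceI)
    have "emeasure void (space void) = (\<integral>\<^sup>+\<mu>. 1 \<partial>void)" by simp
    also have "... = 1"
      by (subst nn_integral_void) (auto simp: void_probability exp_minus simp flip: ennreal_mult)
    finally show "emeasure void (space void) = 1" .
  qed
  then show ?thesis by (simp add: space_prob_algebra void_law_def sets_Q)
qed

lemma AE_void: "AE \<mu> in void. emeasure \<mu> B = 0"
  unfolding void_law_def by (subst AE_density) (auto split: split_indicator)

text \<open>
  Throwing a Poisson number of independent points into an emptied window restores the process: both sides
  have the same expansion in the number of points in \<open>B\<close>.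
\<close>

lemma void_bind_kern: "void \<bind> kern 1 = Q"
proof (rule measure_eqI)
  have s: "sets (void \<bind> kern 1) = sets (point_algebra L)"
    using bind_kern_in_prob_algebra[OF void_prob_algebra] by (simp add: space_prob_algebra)
  then show "sets (void \<bind> kern 1) = sets Q" by (simp add: sets_Q)
  fix A assume "A \<in> sets (void \<bind> kern 1)"
  then have A[measurable]: "A \<in> sets (point_algebra L)" using s by simp
  let ?h = "indicator A :: _ \<Rightarrow> ennreal"
  have sv: "space void = space (point_algebra L)"
    using void_prob_algebra by (auto simp: space_prob_algebra dest: sets_eq_imp_space_eq)
  have "emeasure (void \<bind> kern 1) A = (\<integral>\<^sup>+\<mu>. (\<integral>\<^sup>+\<tau>. ?h \<tau> \<partial>kern 1 \<mu>) \<partial>void)"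
    using nn_integral_bind_kern[OF void_prob_algebra, of ?h 1] s A by simp
  also have "... = (\<integral>\<^sup>+\<mu>. (\<Sum>n. ennreal (weight 1 n) * (step ^^ n) ?h \<mu>) \<partial>void)"
    by (intro nn_integral_cong) (simp add: sv nn_integral_kern del: nn_integral_indicator)
  also have "... = (\<Sum>n. ennreal (weight 1 n) * (\<integral>\<^sup>+\<mu>. (step ^^ n) ?h \<mu> \<partial>void))"
  proof -
    have [measurable_cong]: "sets void = sets (point_algebra L)"
      using void_prob_algebra by (simp add: space_prob_algebra)
    show ?thesis by (simp add: nn_integral_suminf nn_integral_cmult)
  qed
  also have "... = (\<Sum>n. ennreal (1 / fact n) * (\<integral>\<^sup>+\<mu>. (step ^^ n) ?h \<mu> * indicator {\<mu>. emeasure \<mu> B = 0} \<mu> \<partial>Q))"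
  proof (rule suminf_cong)
    fix n
    have "ennreal (weight 1 n) * ennreal (exp (measure L B)) = ennreal (1 / fact n)"
      by (simp add: weight_def mass_eq[simplified] exp_minus flip: ennreal_mult)
    then show "ennreal (weight 1 n) * (\<integral>\<^sup>+\<mu>. (step ^^ n) ?h \<mu> \<partial>void) =
      ennreal (1 / fact n) * (\<integral>\<^sup>+\<mu>. (step ^^ n) ?h \<mu> * indicator {\<mu>. emeasure \<mu> B = 0} \<mu> \<partial>Q)"
      by (simp add: nn_integral_void mult.assoc[symmetric])
  qed
  also have "... = emeasure Q A"
    using nn_integral_count_series[of ?h] by (simp add: sets_Q)
  finally show "emeasure (void \<bind> kern 1) A = emeasure Q A" .
qed

text \<open>
  Adding a point outside \<open>B\<close> does not affect the conditioning, so the Mecke equation survives there. Results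
  on Mecke processes thus apply to the exterior of a window.
\<close>

lemma mecke_void: "mecke (restricted L (space L - B)) void"
  unfolding mecke_def
proof (intro conjI ballI impI)
  show "sigma_finite_measure (restricted L (space L - B))"
    by (rule sigma_finite_restricted[OF L.sigma_finite_measure_axioms]) simp
  show "void \<in> space (prob_algebra (point_algebra (restricted L (space L - B))))"
    using void_prob_algebra by simp
  fix A and h :: "'a measure \<Rightarrow> ennreal"
  assume "A \<in> sets (restricted L (space L - B))" and fin: "emeasure (restricted L (space L - B)) A < \<infinity>"
    and "h \<in> borel_measurable (point_algebra (restricted L (space L - B)))"
  then have A[measurable]: "A \<in> sets L" and h[measurable]: "h \<in> borel_measurable (point_algebra L)" by auto
  have "A \<inter> (space L - B) = A - B" using sets.sets_into_space[OF A] by auto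
  then have fin': "emeasure L (A - B) < \<infinity>" using fin by (simp add: emeasure_restricted)
  have sv[measurable_cong]: "sets void = sets (point_algebra L)"
    using void_prob_algebra by (simp add: space_prob_algebra)
  let ?I = "\<lambda>\<mu>. indicator {\<mu>. emeasure \<mu> B = 0} \<mu> :: ennreal"
  have "(\<integral>\<^sup>+\<mu>. h \<mu> * emeasure \<mu> A \<partial>void) = (\<integral>\<^sup>+\<mu>. h \<mu> * emeasure \<mu> (A - B) \<partial>void)"
  proof (rule nn_integral_cong_AE)
    show "AE \<mu> in void. h \<mu> * emeasure \<mu> A = h \<mu> * emeasure \<mu> (A - B)"
      using AE_void AE_space
    proof eventually_elim
      case (elim \<mu>)
      then have "sets \<mu> = sets L" using sets_eq_imp_space_eq[OF sv] by (simp add: sets_point_measure)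
      then have "emeasure \<mu> (A - B) = emeasure \<mu> A"
        using elim by (intro emeasure_Diff_null_set) (auto simp: null_sets_def)
      then show ?case by simp
    qed
  qed
  also have "... = ennreal (exp (measure L B)) * (\<integral>\<^sup>+\<mu>. h \<mu> * ?I \<mu> * emeasure \<mu> (A - B) \<partial>Q)"
    by (subst nn_integral_void) (auto simp: mult_ac)
  also have "(\<integral>\<^sup>+\<mu>. h \<mu> * ?I \<mu> * emeasure \<mu> (A - B) \<partial>Q) =
     (\<integral>\<^sup>+x\<in>A - B. (\<integral>\<^sup>+\<mu>. h (add_dirac \<mu> x) * ?I (add_dirac \<mu> x) \<partial>Q) \<partial>L)"
    by (rule mecke_equation[OF _ fin']) auto
  also have "... = (\<integral>\<^sup>+x\<in>A - B. (\<integral>\<^sup>+\<mu>. h (add_dirac \<mu> x) * ?I \<mu> \<partial>Q) \<partial>L)"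
  proof (intro nn_integral_cong)
    fix x
    have "?I (add_dirac \<mu> x) = ?I \<mu>" if "x \<in> A - B" "\<mu> \<in> space Q" for \<mu>
      using that by (simp add: space_Q emeasure_add_dirac_point indicator_def)
    then show "(\<integral>\<^sup>+\<mu>. h (add_dirac \<mu> x) * ?I (add_dirac \<mu> x) \<partial>Q) * indicator (A - B) x =
      (\<integral>\<^sup>+\<mu>. h (add_dirac \<mu> x) * ?I \<mu> \<partial>Q) * indicator (A - B) x"
      by (cases "x \<in> A - B") (auto intro!: nn_integral_cong)
  qed
  also have "ennreal (exp (measure L B)) * \<dots> = (\<integral>\<^sup>+x\<in>A - B. (\<integral>\<^sup>+\<mu>. h (add_dirac \<mu> x) \<partial>void) \<partial>L)" (is "_ = ?r1")
  proof -
    have "ennreal (exp (measure L B)) * (\<integral>\<^sup>+x\<in>A - B. (\<integral>\<^sup>+\<mu>. h (add_dirac \<mu> x) * ?I \<mu> \<partial>Q) \<partial>L) =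
      (\<integral>\<^sup>+x. ennreal (exp (measure L B)) * ((\<integral>\<^sup>+\<mu>. h (add_dirac \<mu> x) * ?I \<mu> \<partial>Q) * indicator (A - B) x) \<partial>L)"
      by (rule nn_integral_cmult[symmetric]) measurable
    also have "... = ?r1"
      by (intro nn_integral_cong) (auto simp: nn_integral_void mult.assoc split: split_indicator)
    finally show ?thesis .
  qed
  also have "... = (\<integral>\<^sup>+x\<in>A. (\<integral>\<^sup>+\<mu>. h (add_dirac \<mu> x) \<partial>void) \<partial>restricted L (space L - B))"
  proof -
    have [measurable]: "(\<lambda>x. \<integral>\<^sup>+\<mu>. h (add_dirac \<mu> x) \<partial>void) \<in> borel_measurable L"
      using void_prob_algebra
      by (intro nn_integral_measurable_subprob_algebra2[where N = "point_algebra L"])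
         (measurable, auto simp: space_prob_algebra space_subprob_algebra intro: prob_space_imp_subprob_space)
    show ?thesis
      using sets.sets_into_space[OF A]
      by (subst nn_integral_restricted) (auto intro!: nn_integral_cong split: split_indicator)
  qed
  finally show "(\<integral>\<^sup>+\<mu>. h \<mu> * emeasure \<mu> A \<partial>void) =
    (\<integral>\<^sup>+x\<in>A. (\<integral>\<^sup>+\<mu>. h (add_dirac \<mu> x) \<partial>void) \<partial>restricted L (space L - B))" .
qed

end

section \<open>The Mecke equation for Poisson processes\<close>

text \<open>A family of events generates everything as soon as it makes all counts measurable.\<close>

lemma sets_point_algebra_generated:
  assumes "G \<subseteq> sets (point_algebra L)"
    and gen: "\<And>A. A \<in> sets L \<Longrightarrow> (\<lambda>\<mu>. emeasure \<mu> A) \<in> borel_measurable (sigma (point_measures L) G)"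
  shows "sets (point_algebra L) = sigma_sets (point_measures L) G"
proof
  have G: "G \<subseteq> Pow (point_measures L)"
    using assms(1) sets.space_closed[of "point_algebra L"] by (auto simp: space_point_algebra)
  show "sigma_sets (point_measures L) G \<subseteq> sets (point_algebra L)"
    using sets.sigma_sets_subset[OF assms(1)] by (simp add: space_point_algebra)
  have id: "(\<lambda>\<mu>. \<mu>) \<in> sigma (point_measures L) G \<rightarrow>\<^sub>M point_algebra L"
    by (rule measurable_point_algebraI) (use gen G in \<open>auto simp: space_measure_of_conv\<close>)
  show "sets (point_algebra L) \<subseteq> sigma_sets (point_measures L) G"
  proof
    fix S assume S: "S \<in> sets (point_algebra L)"
    have "(\<lambda>\<mu>. \<mu>) -` S \<inter> space (sigma (point_measures L) G) \<in> sets (sigma (point_measures L) G)"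
      by (rule measurable_sets[OF id S])
    moreover have "S \<subseteq> point_measures L" using sets.sets_into_space[OF S] by (simp add: space_point_algebra)
    ultimately show "S \<in> sigma_sets (point_measures L) G" using G by (simp add: space_measure_of_conv Int_absorb2)
  qed
qed

text \<open>The Mecke equation for a single Poisson variable, from \<open>k * l^k / fact k = l * l^(k - 1) / fact (k - 1)\<close>.\<close>

lemma nn_integral_poisson_shift:
  fixes D :: "ennreal measure" and l :: real
  assumes D: "prob_space D" "sets D = sets borel" and l: "0 \<le> l"
    and pois: "\<And>k::nat. measure D {of_nat k} = l ^ k / fact k * exp (- l)"
    and g: "g \<in> borel_measurable borel"
  shows "(\<integral>\<^sup>+y. g y * y \<partial>D) = ennreal l * (\<integral>\<^sup>+y. g (y + 1) \<partial>D)" (is "?l = ?r")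
proof -
  interpret D: prob_space D by fact
  note [measurable_cong] = D(2) and [measurable] = g
  let ?p = "\<lambda>k. l ^ k / fact k * exp (- l)"
  have em: "emeasure D {of_nat k} = ennreal (?p k)" for k :: nat
    using pois[of k] by (simp add: D.emeasure_eq_measure)
  have "(\<lambda>k. ?p k) sums (exp l * exp (- l))"
    using exp_converges[of l] by (intro sums_mult2) (simp add: field_simps)
  then have "(\<Sum>k. ennreal (?p k)) = ennreal (exp l * exp (- l))"
    using l by (intro suminf_ennreal_eq) auto
  then have "(\<Sum>k. emeasure D {of_nat k}) = 1"
    unfolding em by (simp add: exp_minus)
  moreover have "(\<Sum>k. emeasure D {of_nat k}) = emeasure D (\<Union>k::nat. {of_nat k})"
    by (rule suminf_emeasure) (auto simp: disjoint_family_on_def D(2))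
  ultimately have "emeasure D (range of_nat) = 1" by (simp add: UNION_singleton_eq_range)
  then have ae: "AE y in D. y \<in> range of_nat"
    by (intro D.AE_prob_1) (simp add: D.emeasure_eq_measure)
  have series: "(\<integral>\<^sup>+y. f y \<partial>D) = (\<Sum>k. f (of_nat k) * ennreal (?p k))" if [measurable]: "f \<in> borel_measurable borel" for f
  proof -
    have "(\<integral>\<^sup>+y. f y \<partial>D) = (\<integral>\<^sup>+y. (\<Sum>k. f (of_nat k) * indicator {of_nat k} y) \<partial>D)"
    proof (rule nn_integral_cong_AE)
      show "AE y in D. f y = (\<Sum>k. f (of_nat k) * indicator {of_nat k} y)"
        using ae
      proof eventually_elim
        case (elim y)
        then obtain k :: nat where k: "y = of_nat k" by auto
        have "(\<Sum>j. f (of_nat j) * indicator {of_nat j} y) = (\<Sum>j\<in>{k}. f (of_nat j) * indicator {of_nat j} y)"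
          using k by (intro suminf_finite) (auto simp: indicator_def)
        then show ?case using k by simp
      qed
    qed
    also have "... = (\<Sum>k. \<integral>\<^sup>+y. f (of_nat k) * indicator {of_nat k} y \<partial>D)"
      by (rule nn_integral_suminf) measurable
    also have "... = (\<Sum>k. f (of_nat k) * ennreal (?p k))"
      by (intro suminf_cong) (simp add: nn_integral_cmult_indicator D(2) em)
    finally show ?thesis .
  qed
  have "?l = (\<Sum>k. g (of_nat k) * of_nat k * ennreal (?p k))"
    by (subst series) (auto simp: mult.assoc)
  also have "... = (\<Sum>k. g (of_nat (Suc k)) * of_nat (Suc k) * ennreal (?p (Suc k)))"
    using suminf_offset[of "\<lambda>k. g (of_nat k) * of_nat k * ennreal (?p k)" 1] by simp
  also have "... = (\<Sum>k. ennreal l * (g (of_nat k + 1) * ennreal (?p k)))"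
  proof (rule suminf_cong)
    fix k
    have "real (Suc k) * ?p (Suc k) = l * ?p k"
      by (subst fact_Suc) (simp add: divide_simps del: of_nat_Suc)
    then have "of_nat (Suc k) * ennreal (?p (Suc k)) = ennreal l * ennreal (?p k)"
      using l by (simp add: ennreal_of_nat_eq_real_of_nat del: of_nat_Suc fact_Suc power_Suc flip: ennreal_mult)
    then show "g (of_nat (Suc k)) * of_nat (Suc k) * ennreal (?p (Suc k)) = ennreal l * (g (of_nat k + 1) * ennreal (?p k))"
      by (simp only: mult.assoc mult.left_commute[of "ennreal l"] of_nat_Suc add.commute)
  qed
  also have "... = ?r"
    by (subst series) auto
  finally show ?thesis .
qed

text \<open>A labelling with labels below \<open>n\<close> encodes a measurable partition into \<open>n\<close> possibly empty cells.\<close>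

definition cell :: "'a measure \<Rightarrow> ('a \<Rightarrow> nat) \<Rightarrow> nat \<Rightarrow> 'a set" where
  "cell L \<kappa> i = \<kappa> -` {i} \<inter> space L"

definition counts :: "'a measure \<Rightarrow> ('a \<Rightarrow> nat) \<Rightarrow> nat \<Rightarrow> 'a measure \<Rightarrow> nat \<Rightarrow> ennreal" where
  "counts L \<kappa> n \<mu> = (\<lambda>i\<in>{..<n}. emeasure \<mu> (cell L \<kappa> i))"

lemma cell_sets: "\<kappa> \<in> L \<rightarrow>\<^sub>M count_space UNIV \<Longrightarrow> cell L \<kappa> i \<in> sets L"
  unfolding cell_def by (rule measurable_sets) auto

lemma measurable_counts [measurable]:
  assumes "\<kappa> \<in> L \<rightarrow>\<^sub>M count_space UNIV"
  shows "counts L \<kappa> n \<in> point_algebra L \<rightarrow>\<^sub>M (\<Pi>\<^sub>M i\<in>{..<n}. borel)"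
  unfolding counts_def
  by (intro measurable_restrict measurable_emeasure_point_algebra cell_sets assms)

lemma emeasure_finite_union_cells:
  assumes \<mu>: "sets \<mu> = sets L" and \<kappa>: "\<kappa> \<in> L \<rightarrow>\<^sub>M count_space UNIV" and "finite I"
  shows "emeasure \<mu> (\<Union>i\<in>I. cell L \<kappa> i) = (\<Sum>i\<in>I. emeasure \<mu> (cell L \<kappa> i))"
proof -
  have "cell L \<kappa> ` I \<subseteq> sets \<mu>" using cell_sets[OF \<kappa>] by (auto simp: \<mu>)
  moreover have "disjoint_family_on (cell L \<kappa>) I" by (auto simp: disjoint_family_on_def cell_def)
  ultimately show ?thesis using \<open>finite I\<close> by (intro sum_emeasure[symmetric])
qed

text \<open>The labelling \<open>\<kappa> x * m + \<kappa>' x\<close> encodes the common refinement of two partitions.\<close>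

lemma counts_refine:
  assumes \<mu>: "sets \<mu> = sets L" and [measurable]: "\<kappa> \<in> L \<rightarrow>\<^sub>M count_space UNIV" "\<kappa>' \<in> L \<rightarrow>\<^sub>M count_space UNIV"
    and \<kappa>: "\<And>x. x \<in> space L \<Longrightarrow> \<kappa> x < n" and \<kappa>': "\<And>x. x \<in> space L \<Longrightarrow> \<kappa>' x < m"
  shows "counts L \<kappa> n \<mu> = (\<lambda>i\<in>{..<n}. \<Sum>j<m. counts L (\<lambda>x. \<kappa> x * m + \<kappa>' x) (n * m) \<mu> (i * m + j))"
    and "counts L \<kappa>' m \<mu> = (\<lambda>j\<in>{..<m}. \<Sum>i<n. counts L (\<lambda>x. \<kappa> x * m + \<kappa>' x) (n * m) \<mu> (i * m + j))"
proof -
  let ?\<kappa> = "\<lambda>x. \<kappa> x * m + \<kappa>' x"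
  have \<kappa>m: "?\<kappa> \<in> L \<rightarrow>\<^sub>M count_space UNIV" by measurable
  have less: "i * m + j < n * m" if "i < n" "j < m" for i j
  proof -
    have "i * m + j < Suc i * m" using that by simp
    also have "... \<le> n * m" using that by (intro mult_le_mono1) simp
    finally show ?thesis .
  qed
  have eq: "a * m + b = i * m + j \<longleftrightarrow> a = i \<and> b = j" if "b < m" "j < m" for a b i j
    using that by (metis div_mult_self3 div_less mod_mult_self3 mod_less add.right_neutral less_nat_zero_code)
  have "emeasure \<mu> (cell L \<kappa> i) = (\<Sum>j<m. emeasure \<mu> (cell L ?\<kappa> (i * m + j)))" for i
  proof -
    have "cell L \<kappa> i = (\<Union>k\<in>(\<lambda>j. i * m + j) ` {..<m}. cell L ?\<kappa> k)"
      using \<kappa>' by (auto simp: cell_def eq)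
    then have "emeasure \<mu> (cell L \<kappa> i) = (\<Sum>k\<in>(\<lambda>j. i * m + j) ` {..<m}. emeasure \<mu> (cell L ?\<kappa> k))"
      by (simp only: emeasure_finite_union_cells[OF \<mu> \<kappa>m] finite_imageI finite_lessThan)
    then show ?thesis by (simp add: sum.reindex inj_on_def)
  qed
  then show "counts L \<kappa> n \<mu> = (\<lambda>i\<in>{..<n}. \<Sum>j<m. counts L ?\<kappa> (n * m) \<mu> (i * m + j))"
    by (auto simp: counts_def less intro!: restrict_ext sum.cong)
  have "emeasure \<mu> (cell L \<kappa>' j) = (\<Sum>i<n. emeasure \<mu> (cell L ?\<kappa> (i * m + j)))" if "j < m" for j
  proof -
    have "cell L \<kappa>' j = (\<Union>k\<in>(\<lambda>i. i * m + j) ` {..<n}. cell L ?\<kappa> k)"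
      using \<kappa> \<kappa>' that by (auto simp: cell_def eq)
    then have "emeasure \<mu> (cell L \<kappa>' j) = (\<Sum>k\<in>(\<lambda>i. i * m + j) ` {..<n}. emeasure \<mu> (cell L ?\<kappa> k))"
      by (simp only: emeasure_finite_union_cells[OF \<mu> \<kappa>m] finite_imageI finite_lessThan)
    then show ?thesis using that by (simp add: sum.reindex inj_on_def)
  qed
  then show "counts L \<kappa>' m \<mu> = (\<lambda>j\<in>{..<m}. \<Sum>i<n. counts L ?\<kappa> (n * m) \<mu> (i * m + j))"
    by (auto simp: counts_def less intro!: restrict_ext sum.cong)
qed

definition count_events :: "'a measure \<Rightarrow> 'a measure set set" where
  "count_events L = {{\<mu>\<in>point_measures L. counts L \<kappa> n \<mu> \<in> E} | \<kappa> n E.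
     \<kappa> \<in> L \<rightarrow>\<^sub>M count_space UNIV \<and> (\<forall>x\<in>space L. \<kappa> x < n) \<and> E \<in> sets (\<Pi>\<^sub>M i\<in>{..<n}. borel)}"

lemma count_eventsI:
  "\<kappa> \<in> L \<rightarrow>\<^sub>M count_space UNIV \<Longrightarrow> (\<And>x. x \<in> space L \<Longrightarrow> \<kappa> x < n) \<Longrightarrow> E \<in> sets (\<Pi>\<^sub>M i\<in>{..<n}. borel) \<Longrightarrow>
    {\<mu>\<in>point_measures L. counts L \<kappa> n \<mu> \<in> E} \<in> count_events L"
  unfolding count_events_def by blast

text \<open>The reason why count events are stable under intersection and may be refined by any given partition.\<close>

lemma count_events_refine:
  assumes \<kappa>[measurable]: "\<kappa> \<in> L \<rightarrow>\<^sub>M count_space UNIV" "\<And>x. x \<in> space L \<Longrightarrow> \<kappa> x < n" and E: "E \<in> sets (\<Pi>\<^sub>M i\<in>{..<n}. borel)"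
    and \<kappa>'[measurable]: "\<kappa>' \<in> L \<rightarrow>\<^sub>M count_space UNIV" "\<And>x. x \<in> space L \<Longrightarrow> \<kappa>' x < m" and E': "E' \<in> sets (\<Pi>\<^sub>M i\<in>{..<m}. borel)"
  obtains E'' where "E'' \<in> sets (\<Pi>\<^sub>M i\<in>{..<n * m}. borel)"
    and "{\<mu>\<in>point_measures L. counts L \<kappa> n \<mu> \<in> E} \<inter> {\<mu>\<in>point_measures L. counts L \<kappa>' m \<mu> \<in> E'} =
      {\<mu>\<in>point_measures L. counts L (\<lambda>x. \<kappa> x * m + \<kappa>' x) (n * m) \<mu> \<in> E''}"
proof -
  let ?P = "\<Pi>\<^sub>M i\<in>{..<n * m}. (borel :: ennreal measure)"
  let ?R = "\<lambda>v. \<lambda>i\<in>{..<n}. \<Sum>j<m. v (i * m + j) :: ennreal"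
  let ?R' = "\<lambda>v. \<lambda>j\<in>{..<m}. \<Sum>i<n. v (i * m + j) :: ennreal"
  have less: "i * m + j < n * m" if "i < n" "j < m" for i j
  proof -
    have "i * m + j < Suc i * m" using that by simp
    also have "... \<le> n * m" using that by (intro mult_le_mono1) simp
    finally show ?thesis .
  qed
  have R: "?R \<in> ?P \<rightarrow>\<^sub>M (\<Pi>\<^sub>M i\<in>{..<n}. borel)" "?R' \<in> ?P \<rightarrow>\<^sub>M (\<Pi>\<^sub>M i\<in>{..<m}. borel)"
    by (intro measurable_restrict borel_measurable_sum measurable_component_singleton; simp add: less)+
  define E'' where "E'' = (?R -` E \<inter> space ?P) \<inter> (?R' -` E' \<inter> space ?P)"
  show thesis
  proof
    show "E'' \<in> sets ?P" unfolding E''_def by (intro sets.Int measurable_sets[OF R(1) E] measurable_sets[OF R(2) E'])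
    have "counts L (\<lambda>x. \<kappa> x * m + \<kappa>' x) (n * m) \<mu> \<in> space ?P" for \<mu>
      by (simp add: counts_def space_PiM)
    moreover have "sets \<mu> = sets L" if "\<mu> \<in> point_measures L" for \<mu> using that by (simp add: point_measures_def)
    ultimately show "{\<mu>\<in>point_measures L. counts L \<kappa> n \<mu> \<in> E} \<inter> {\<mu>\<in>point_measures L. counts L \<kappa>' m \<mu> \<in> E'} =
      {\<mu>\<in>point_measures L. counts L (\<lambda>x. \<kappa> x * m + \<kappa>' x) (n * m) \<mu> \<in> E''}"
      using counts_refine[OF _ \<kappa>(1) \<kappa>'(1) \<kappa>(2) \<kappa>'(2)] unfolding E''_def by auto
  qed
qed

lemma Int_stable_count_events: "Int_stable (count_events L)"
proof (rule Int_stableI)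
  fix S T assume "S \<in> count_events L" "T \<in> count_events L"
  then obtain \<kappa> n E \<kappa>' m E' where
    S: "S = {\<mu>\<in>point_measures L. counts L \<kappa> n \<mu> \<in> E}" and \<kappa>: "\<kappa> \<in> L \<rightarrow>\<^sub>M count_space UNIV" "\<And>x. x \<in> space L \<Longrightarrow> \<kappa> x < n"
      "E \<in> sets (\<Pi>\<^sub>M i\<in>{..<n}. borel)" and
    T: "T = {\<mu>\<in>point_measures L. counts L \<kappa>' m \<mu> \<in> E'}" and \<kappa>': "\<kappa>' \<in> L \<rightarrow>\<^sub>M count_space UNIV" "\<And>x. x \<in> space L \<Longrightarrow> \<kappa>' x < m"
      "E' \<in> sets (\<Pi>\<^sub>M i\<in>{..<m}. borel)"
    unfolding count_events_def by blast
  obtain E'' where E'': "E'' \<in> sets (\<Pi>\<^sub>M i\<in>{..<n * m}. borel)"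
    "S \<inter> T = {\<mu>\<in>point_measures L. counts L (\<lambda>x. \<kappa> x * m + \<kappa>' x) (n * m) \<mu> \<in> E''}"
    unfolding S T by (rule count_events_refine[OF \<kappa> \<kappa>'])
  have "\<kappa> x * m + \<kappa>' x < n * m" if "x \<in> space L" for x
  proof -
    have "\<kappa> x * m + \<kappa>' x < Suc (\<kappa> x) * m" using \<kappa>'(2)[OF that] by simp
    also have "... \<le> n * m" using \<kappa>(2)[OF that] by (intro mult_le_mono1) simp
    finally show ?thesis .
  qed
  moreover have "(\<lambda>x. \<kappa> x * m + \<kappa>' x) \<in> L \<rightarrow>\<^sub>M count_space UNIV" using \<kappa>(1) \<kappa>'(1) by measurable
  ultimately show "S \<inter> T \<in> count_events L" unfolding E''(2) using E''(1) by (intro count_eventsI)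
qed

lemma count_events_sets: "count_events L \<subseteq> sets (point_algebra L)"
proof
  fix S assume "S \<in> count_events L"
  then obtain \<kappa> n E where S: "S = {\<mu>\<in>point_measures L. counts L \<kappa> n \<mu> \<in> E}" and [measurable]: "\<kappa> \<in> L \<rightarrow>\<^sub>M count_space UNIV"
      and E: "E \<in> sets (\<Pi>\<^sub>M i\<in>{..<n}. borel)"
    unfolding count_events_def by blast
  have "S = counts L \<kappa> n -` E \<inter> space (point_algebra L)" by (auto simp: S space_point_algebra)
  also have "... \<in> sets (point_algebra L)" by (rule measurable_sets[OF _ E]) measurable
  finally show "S \<in> sets (point_algebra L)" .
qed

lemma sets_point_algebra_count_events: "sets (point_algebra L) = sigma_sets (point_measures L) (count_events L)"
proof (rule sets_point_algebra_generated[OF count_events_sets])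
  fix A assume A[measurable]: "A \<in> sets L"
  let ?\<kappa> = "\<lambda>x. if x \<in> A then 1 else 0 :: nat"
  have \<kappa>: "?\<kappa> \<in> L \<rightarrow>\<^sub>M count_space UNIV" by measurable
  have cellA: "cell L ?\<kappa> (Suc 0) = A" using sets.sets_into_space[OF A] by (auto simp: cell_def)
  have G: "count_events L \<subseteq> Pow (point_measures L)"
    using count_events_sets[of L] sets.space_closed[of "point_algebra L"] by (auto simp: space_point_algebra)
  show "(\<lambda>\<mu>. emeasure \<mu> A) \<in> borel_measurable (sigma (point_measures L) (count_events L))"
  proof (rule measurableI)
    fix S :: "ennreal set" assume S: "S \<in> sets borel"
    let ?E = "(\<lambda>v. v 1) -` S \<inter> space (\<Pi>\<^sub>M i\<in>{..<2::nat}. (borel :: ennreal measure))"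
    have "?E \<in> sets (\<Pi>\<^sub>M i\<in>{..<2}. borel)"
      by (rule measurable_sets[OF _ S]) (rule measurable_component_singleton, simp)
    then have "{\<mu>\<in>point_measures L. counts L ?\<kappa> 2 \<mu> \<in> ?E} \<in> count_events L"
      using \<kappa> by (intro count_eventsI) auto
    moreover have "{\<mu>\<in>point_measures L. counts L ?\<kappa> 2 \<mu> \<in> ?E} = (\<lambda>\<mu>. emeasure \<mu> A) -` S \<inter> point_measures L"
      by (auto simp: counts_def cellA space_PiM)
    ultimately show "(\<lambda>\<mu>. emeasure \<mu> A) -` S \<inter> space (sigma (point_measures L) (count_events L))
        \<in> sets (sigma (point_measures L) (count_events L))"
      using G by (auto simp: space_measure_of_conv)
  qed auto
qed

text \<open>
  The counts of different cells are independent, so the Poisson shift may be applied to the count of one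
  cell with the others fixed.
\<close>

lemma poisson_process_cell_equation:
  assumes M: "prob_space M" and pp: "poisson_process M L \<eta>"
    and \<kappa>[measurable]: "\<kappa> \<in> L \<rightarrow>\<^sub>M count_space UNIV" and k: "k < n" and fin: "emeasure L (cell L \<kappa> k) < \<infinity>"
    and f[measurable]: "f \<in> borel_measurable (\<Pi>\<^sub>M i\<in>{..<n}. borel)"
  shows "(\<integral>\<^sup>+\<omega>. f (counts L \<kappa> n (\<eta> \<omega>)) * emeasure (\<eta> \<omega>) (cell L \<kappa> k) \<partial>M) =
    emeasure L (cell L \<kappa> k) * (\<integral>\<^sup>+\<omega>. f ((counts L \<kappa> n (\<eta> \<omega>))(k := counts L \<kappa> n (\<eta> \<omega>) k + 1)) \<partial>M)" (is "?l = _")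
proof -
  interpret M: prob_space M by fact
  have \<eta>[measurable]: "\<eta> \<in> M \<rightarrow>\<^sub>M point_algebra L" using pp by (simp add: poisson_process_def)
  define X where "X i \<omega> = emeasure (\<eta> \<omega>) (cell L \<kappa> i)" for i \<omega>
  have X[measurable]: "X i \<in> borel_measurable M" for i
    unfolding X_def using cell_sets[OF \<kappa>, of i] by measurable
  have "cell L \<kappa> ` {..<n} \<subseteq> sets L" "disjoint_family_on (cell L \<kappa>) {..<n}"
    using cell_sets[OF \<kappa>] by (auto simp: disjoint_family_on_def cell_def)
  then have "M.indep_vars (\<lambda>_. borel) X {..<n}"
    using pp unfolding poisson_process_def X_def[abs_def] by blast
  then have distr: "distr M (\<Pi>\<^sub>M i\<in>{..<n}. borel) (\<lambda>\<omega>. \<lambda>i\<in>{..<n}. X i \<omega>) = (\<Pi>\<^sub>M i\<in>{..<n}. distr M borel (X i))"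
    using k by (subst (asm) M.indep_vars_iff_distr_eq_PiM) auto
  have counts_X: "counts L \<kappa> n (\<eta> \<omega>) = (\<lambda>i\<in>{..<n}. X i \<omega>)" for \<omega> by (simp add: counts_def X_def)
  define D where "D i = distr M borel (X i)" for i
  interpret D: product_prob_space D
    by (auto intro!: product_prob_spaceI M.prob_space_distr simp: D_def)
  have sD[measurable_cong]: "sets (D i) = sets borel" for i by (simp add: D_def)
  let ?P = "\<Pi>\<^sub>M i\<in>{..<n}. D i"
  have sP[measurable_cong]: "sets ?P = sets (\<Pi>\<^sub>M i\<in>{..<n}. (borel::ennreal measure))" by (intro sets_PiM_cong) (auto simp: sD)
  have E_P: "(\<integral>\<^sup>+\<omega>. h (counts L \<kappa> n (\<eta> \<omega>)) \<partial>M) = (\<integral>\<^sup>+v. h v \<partial>?P)"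
    if [measurable]: "h \<in> borel_measurable (\<Pi>\<^sub>M i\<in>{..<n}. borel)" for h
    unfolding D_def distr[symmetric] counts_X by (subst nn_integral_distr) auto
  let ?I = "{..<n} - {k}"
  have I: "insert k ?I = {..<n}" "k \<notin> ?I" "finite ?I" using k by auto
  have split: "(\<integral>\<^sup>+v. h v \<partial>?P) = (\<integral>\<^sup>+v. (\<integral>\<^sup>+y. h (v(k := y)) \<partial>D k) \<partial>PiM ?I D)"
    if "h \<in> borel_measurable (\<Pi>\<^sub>M i\<in>{..<n}. borel)" for h
    using D.product_nn_integral_insert[OF I(3,2), of h] that unfolding I(1) by (simp cong: measurable_cong_sets add: sP)
  have upd[measurable]: "(\<lambda>v. v(k := v k + 1)) \<in> (\<Pi>\<^sub>M i\<in>{..<n}. borel) \<rightarrow>\<^sub>M (\<Pi>\<^sub>M i\<in>{..<n}. (borel::ennreal measure))"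
    using k by (intro measurable_fun_upd[where J = "{..<n}"] borel_measurable_add measurable_component_singleton) auto
  have pk: "(\<integral>\<^sup>+y. g y * y \<partial>D k) = emeasure L (cell L \<kappa> k) * (\<integral>\<^sup>+y. g (y + 1) \<partial>D k)"
    if g: "g \<in> borel_measurable borel" for g
  proof -
    have "(\<integral>\<^sup>+y. g y * y \<partial>D k) = ennreal (measure L (cell L \<kappa> k)) * (\<integral>\<^sup>+y. g (y + 1) \<partial>D k)"
    proof (rule nn_integral_poisson_shift[OF _ _ _ _ g])
      show "prob_space (D k)" "sets (D k) = sets borel" by (auto simp: D_def intro!: M.prob_space_distr)
      fix j :: nat
      have "measure (D k) {of_nat j} = measure M {\<omega>\<in>space M. emeasure (\<eta> \<omega>) (cell L \<kappa> k) = of_nat j}"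
        unfolding D_def by (subst measure_distr) (auto simp: X_def intro!: arg_cong[where f = "measure M"])
      moreover have "\<forall>A\<in>sets L. emeasure L A < \<infinity> \<longrightarrow> (\<forall>j::nat. measure M {\<omega>\<in>space M. emeasure (\<eta> \<omega>) A = of_nat j} =
          measure L A ^ j / fact j * exp (- measure L A))"
        using pp unfolding poisson_process_def by blast
      ultimately show "measure (D k) {of_nat j} = measure L (cell L \<kappa> k) ^ j / fact j * exp (- measure L (cell L \<kappa> k))"
        using fin cell_sets[OF \<kappa>, of k] by simp
    qed simp
    then show ?thesis using fin by (simp add: emeasure_eq_ennreal_measure)
  qed
  have "?l =
     (\<integral>\<^sup>+\<omega>. (\<lambda>v. f v * v k) (counts L \<kappa> n (\<eta> \<omega>)) \<partial>M)"
    using k by (simp add: counts_def)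
  also have "... = (\<integral>\<^sup>+v. f v * v k \<partial>?P)" using k by (intro E_P) measurable
  also have "... = (\<integral>\<^sup>+v. (\<integral>\<^sup>+y. f (v(k := y)) * y \<partial>D k) \<partial>PiM ?I D)"
    using k by (subst split) auto
  also have "... = (\<integral>\<^sup>+v. emeasure L (cell L \<kappa> k) * (\<integral>\<^sup>+y. f (v(k := y + 1)) \<partial>D k) \<partial>PiM ?I D)"
  proof (intro nn_integral_cong pk)
    fix v assume "v \<in> space (PiM ?I D)"
    then have "v \<in> space (\<Pi>\<^sub>M i\<in>?I. (borel::ennreal measure))" by (auto simp: space_PiM D_def)
    then have "(\<lambda>y. v(k := y)) \<in> borel \<rightarrow>\<^sub>M (\<Pi>\<^sub>M i\<in>{..<n}. (borel::ennreal measure))"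
      using I by (intro measurable_fun_upd[where J = ?I]) auto
    then show "(\<lambda>y. f (v(k := y))) \<in> borel_measurable borel" by measurable
  qed
  also have "... = emeasure L (cell L \<kappa> k) * (\<integral>\<^sup>+v. (\<integral>\<^sup>+y. f (v(k := y + 1)) \<partial>D k) \<partial>PiM ?I D)"
  proof (rule nn_integral_cmult)
    have "(\<lambda>p. (fst p)(k := snd p + 1)) \<in> PiM ?I D \<Otimes>\<^sub>M D k \<rightarrow>\<^sub>M (\<Pi>\<^sub>M i\<in>{..<n}. (borel::ennreal measure))"
      using I by (intro measurable_fun_upd[where J = ?I])
        (auto simp: sD cong: measurable_cong_sets sets_PiM_cong intro!: measurable_compose[OF measurable_fst] measurable_ident_sets sets_PiM_cong)
    then have "(\<lambda>(v, y). f (v(k := y + 1))) \<in> borel_measurable (PiM ?I D \<Otimes>\<^sub>M D k)"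
      using measurable_compose[OF _ f] by (simp add: case_prod_beta)
    then show "(\<lambda>v. \<integral>\<^sup>+y. f (v(k := y + 1)) \<partial>D k) \<in> borel_measurable (PiM ?I D)"
      by (rule D.M.borel_measurable_nn_integral)
  qed
  also have "(\<integral>\<^sup>+v. (\<integral>\<^sup>+y. f (v(k := y + 1)) \<partial>D k) \<partial>PiM ?I D) = (\<integral>\<^sup>+v. f (v(k := v k + 1)) \<partial>?P)"
    by (subst split) (auto intro: measurable_compose[OF upd f])
  also have "... = (\<integral>\<^sup>+\<omega>. f ((counts L \<kappa> n (\<eta> \<omega>))(k := counts L \<kappa> n (\<eta> \<omega>) k + 1)) \<partial>M)"
    by (rule E_P[symmetric]) (rule measurable_compose[OF upd f])
  finally show ?thesis .
qed

lemma counts_add_dirac: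
  assumes \<mu>: "sets \<mu> = sets L" and \<kappa>: "\<kappa> \<in> L \<rightarrow>\<^sub>M count_space UNIV" and x: "x \<in> cell L \<kappa> k" and k: "k < n"
  shows "counts L \<kappa> n (add_dirac \<mu> x) = (counts L \<kappa> n \<mu>)(k := counts L \<kappa> n \<mu> k + 1)"
proof
  fix i
  have "emeasure (add_dirac \<mu> x) (cell L \<kappa> i) = emeasure \<mu> (cell L \<kappa> i) + indicator (cell L \<kappa> i) x"
    using \<mu> cell_sets[OF \<kappa>] by (intro emeasure_add_dirac) simp
  then show "counts L \<kappa> n (add_dirac \<mu> x) i = ((counts L \<kappa> n \<mu>)(k := counts L \<kappa> n \<mu> k + 1)) i"
    using x k by (auto simp: counts_def cell_def indicator_def)
qed

text \<open>
  Both sides define measures in the event tested, so it suffices to test events determined by the counts of a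
  finite partition. Refining this partition by \<open>B\<close> makes \<open>B\<close> a disjoint union of cells, and each cell is
  covered by the cell equation.
\<close>

theorem mecke_of_poisson_process:
  fixes L :: "'a measure"
  assumes M: "prob_space M" and L: "sigma_finite_measure L" and pp: "poisson_process M L \<eta>"
  shows "mecke L (distr M (point_algebra L) \<eta>)"
  unfolding mecke_def
proof (intro conjI ballI impI)
  interpret M: prob_space M by fact
  have \<eta>[measurable]: "\<eta> \<in> M \<rightarrow>\<^sub>M point_algebra L" using pp by (simp add: poisson_process_def)
  let ?N = "point_algebra L"
  let ?Q = "distr M ?N \<eta>"
  show "sigma_finite_measure L" by fact
  show Q: "?Q \<in> space (prob_algebra ?N)" by (simp add: space_prob_algebra M.prob_space_distr)
  interpret Q: prob_space ?Q by (rule M.prob_space_distr) measurable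
  fix B and h :: "'a measure \<Rightarrow> ennreal"
  assume B[measurable]: "B \<in> sets L" and fin: "emeasure L B < \<infinity>" and h[measurable]: "h \<in> borel_measurable ?N"
  interpret LB: finite_measure "restricted L B" by (rule finite_measure_restricted[OF B fin])
  interpret pair_sigma_finite "restricted L B" ?Q ..
  define N1 where "N1 = density ?Q (\<lambda>\<mu>. emeasure \<mu> B)"
  define N2 where "N2 = distr (restricted L B \<Otimes>\<^sub>M ?Q) ?N (\<lambda>(x, \<mu>). add_dirac \<mu> x)"
  have ad[measurable]: "(\<lambda>(x, \<mu>). add_dirac \<mu> x) \<in> restricted L B \<Otimes>\<^sub>M ?Q \<rightarrow>\<^sub>M ?N" by measurable
  have int1: "(\<integral>\<^sup>+\<mu>. g \<mu> \<partial>N1) = (\<integral>\<^sup>+\<mu>. g \<mu> * emeasure \<mu> B \<partial>?Q)" if [measurable]: "g \<in> borel_measurable ?N" for g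
    unfolding N1_def by (subst nn_integral_density) (auto simp: mult.commute)
  have int2: "(\<integral>\<^sup>+\<mu>. g \<mu> \<partial>N2) = (\<integral>\<^sup>+x\<in>B. (\<integral>\<^sup>+\<mu>. g (add_dirac \<mu> x) \<partial>?Q) \<partial>L)" if [measurable]: "g \<in> borel_measurable ?N" for g
  proof -
    have "(\<integral>\<^sup>+\<mu>. g \<mu> \<partial>N2) = (\<integral>\<^sup>+p. g (case p of (x, \<mu>) \<Rightarrow> add_dirac \<mu> x) \<partial>(restricted L B \<Otimes>\<^sub>M ?Q))"
      unfolding N2_def by (rule nn_integral_distr) measurable
    also have "... = (\<integral>\<^sup>+x. (\<integral>\<^sup>+\<mu>. g (add_dirac \<mu> x) \<partial>?Q) \<partial>restricted L B)"
      by (subst Q.nn_integral_fst[symmetric]) auto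
    also have "... = (\<integral>\<^sup>+x\<in>B. (\<integral>\<^sup>+\<mu>. g (add_dirac \<mu> x) \<partial>?Q) \<partial>L)"
      by (rule nn_integral_restricted) measurable
    finally show ?thesis .
  qed
  have int2_meas: "(\<lambda>x. \<integral>\<^sup>+\<mu>. g (add_dirac \<mu> x) \<partial>?Q) \<in> borel_measurable L" if [measurable]: "g \<in> borel_measurable ?N" for g :: "'a measure \<Rightarrow> ennreal"
    by measurable
  have "N1 = N2"
  proof (rule measure_eqI_generator_eq[OF Int_stable_count_events, where \<Omega> = "point_measures L" and A = "\<lambda>_. point_measures L"])
    show "count_events L \<subseteq> Pow (point_measures L)"
      using count_events_sets[of L] sets.space_closed[of ?N] by (auto simp: space_point_algebra)
    show "sets N1 = sigma_sets (point_measures L) (count_events L)" "sets N2 = sigma_sets (point_measures L) (count_events L)"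
      by (simp_all add: N1_def N2_def sets_point_algebra_count_events)
    have "{\<mu>\<in>point_measures L. counts L (\<lambda>_. 0) 1 \<mu> \<in> space (\<Pi>\<^sub>M i\<in>{..<1::nat}. (borel::ennreal measure))} \<in> count_events L"
      by (rule count_eventsI) auto
    moreover have "{\<mu>\<in>point_measures L. counts L (\<lambda>_. 0) 1 \<mu> \<in> space (\<Pi>\<^sub>M i\<in>{..<1::nat}. (borel::ennreal measure))} = point_measures L"
      by (auto simp: counts_def space_PiM)
    ultimately show "range (\<lambda>_::nat. point_measures L) \<subseteq> count_events L" by simp
    show eq: "emeasure N1 S = emeasure N2 S" if S_in: "S \<in> count_events L" for S
    proof -
      obtain \<kappa> n E where S: "S = {\<mu>\<in>point_measures L. counts L \<kappa> n \<mu> \<in> E}"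
        and \<kappa>[measurable]: "\<kappa> \<in> L \<rightarrow>\<^sub>M count_space UNIV" and \<kappa>n: "\<And>x. x \<in> space L \<Longrightarrow> \<kappa> x < n"
        and E: "E \<in> sets (\<Pi>\<^sub>M i\<in>{..<n}. borel)"
        using S_in unfolding count_events_def by blast
      let ?b = "\<lambda>x. if x \<in> B then 1 else 0 :: nat"
      have b[measurable]: "?b \<in> L \<rightarrow>\<^sub>M count_space UNIV" by measurable
      have all: "space (\<Pi>\<^sub>M i\<in>{..<2::nat}. (borel::ennreal measure)) \<in> sets (\<Pi>\<^sub>M i\<in>{..<2}. borel)" by auto
      let ?\<kappa> = "\<lambda>x. \<kappa> x * 2 + ?b x"
      obtain E'' where E''[measurable]: "E'' \<in> sets (\<Pi>\<^sub>M i\<in>{..<n * 2}. borel)"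
        and S2: "S \<inter> {\<mu>\<in>point_measures L. counts L ?b 2 \<mu> \<in> space (\<Pi>\<^sub>M i\<in>{..<2::nat}. (borel::ennreal measure))} =
          {\<mu>\<in>point_measures L. counts L ?\<kappa> (n * 2) \<mu> \<in> E''}"
        unfolding S by (rule count_events_refine[OF \<kappa> \<kappa>n E b _ all]) auto
      have "{\<mu>\<in>point_measures L. counts L ?b 2 \<mu> \<in> space (\<Pi>\<^sub>M i\<in>{..<2::nat}. (borel::ennreal measure))} = point_measures L"
        by (auto simp: counts_def space_PiM)
      with S2 have S2: "S = {\<mu>\<in>point_measures L. counts L ?\<kappa> (n * 2) \<mu> \<in> E''}" using S by auto
      have S_sets[measurable]: "S \<in> sets ?N" using S_in count_events_sets by blast
      have \<kappa>2: "?\<kappa> \<in> L \<rightarrow>\<^sub>M count_space UNIV" by measurable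
      \<comment> \<open>The odd labels of the refinement are the pieces of \<open>B\<close>.\<close>
      define C where "C i = cell L ?\<kappa> (Suc (i * 2))" for i
      have C_sets[measurable]: "C i \<in> sets L" for i unfolding C_def by (rule cell_sets[OF \<kappa>2])
      have odd: "\<kappa> x * 2 + ?b x = Suc (i * 2) \<longleftrightarrow> \<kappa> x = i \<and> x \<in> B" for x i
        by (cases "x \<in> B") (simp_all, presburger)
      have B_eq: "B = (\<Union>i<n. C i)"
        unfolding C_def cell_def vimage_def by (simp only: mem_Collect_eq singleton_iff odd) (use sets.sets_into_space[OF B] \<kappa>n in auto)
      have disj: "disjoint_family_on C {..<n}" by (auto simp: disjoint_family_on_def C_def cell_def)
      have finC: "emeasure L (C i) < \<infinity>" if "i < n" for i
      proof (rule le_less_trans[OF emeasure_mono fin])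
        show "C i \<subseteq> B" by (subst B_eq) (use that in blast)
      qed simp
      have f: "indicator E'' \<in> borel_measurable (\<Pi>\<^sub>M i\<in>{..<n * 2}. (borel::ennreal measure))" by measurable
      have in_pm: "\<eta> \<omega> \<in> point_measures L" if "\<omega> \<in> space M" for \<omega>
        using measurable_space[OF \<eta> that] by (simp add: space_point_algebra)
      have s\<eta>: "sets (\<eta> \<omega>) = sets L" if "\<omega> \<in> space M" for \<omega>
        using in_pm[OF that] by (simp add: point_measures_def)
      have "emeasure N1 S = (\<integral>\<^sup>+\<mu>. indicator S \<mu> \<partial>N1)" by (simp add: N1_def)
      also have "... = (\<integral>\<^sup>+\<mu>. indicator S \<mu> * emeasure \<mu> B \<partial>?Q)" by (rule int1) measurable
      also have "... = (\<integral>\<^sup>+\<omega>. indicator S (\<eta> \<omega>) * emeasure (\<eta> \<omega>) B \<partial>M)" by (rule nn_integral_distr) measurable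
      also have "... = (\<integral>\<^sup>+\<omega>. (\<Sum>i<n. indicator E'' (counts L ?\<kappa> (n * 2) (\<eta> \<omega>)) * emeasure (\<eta> \<omega>) (C i)) \<partial>M)"
      proof (rule nn_integral_cong)
        fix \<omega> assume \<omega>: "\<omega> \<in> space M"
        have "emeasure (\<eta> \<omega>) B = (\<Sum>i<n. emeasure (\<eta> \<omega>) (C i))"
        proof -
          have "C ` {..<n} \<subseteq> sets (\<eta> \<omega>)" unfolding s\<eta>[OF \<omega>] using C_sets by blast
          from sum_emeasure[OF this disj finite_lessThan] show ?thesis by (simp only: B_eq[symmetric])
        qed
        moreover have "indicator S (\<eta> \<omega>) = (indicator E'' (counts L ?\<kappa> (n * 2) (\<eta> \<omega>)) :: ennreal)"
          unfolding S2 using in_pm[OF \<omega>] by (simp add: indicator_def)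
        ultimately show "indicator S (\<eta> \<omega>) * emeasure (\<eta> \<omega>) B =
            (\<Sum>i<n. indicator E'' (counts L ?\<kappa> (n * 2) (\<eta> \<omega>)) * emeasure (\<eta> \<omega>) (C i))"
          by (simp add: sum_distrib_left)
      qed
      also have "... = (\<Sum>i<n. \<integral>\<^sup>+\<omega>. indicator E'' (counts L ?\<kappa> (n * 2) (\<eta> \<omega>)) * emeasure (\<eta> \<omega>) (C i) \<partial>M)"
        by (rule nn_integral_sum) measurable
      also have "... = (\<Sum>i<n. emeasure L (C i) * (\<integral>\<^sup>+\<omega>. indicator E'' ((counts L ?\<kappa> (n * 2) (\<eta> \<omega>))(Suc (i * 2) := counts L ?\<kappa> (n * 2) (\<eta> \<omega>) (Suc (i * 2)) + 1)) \<partial>M))"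
        by (intro sum.cong refl) (simp only: C_def, rule poisson_process_cell_equation[OF M pp \<kappa>2 _ finC[unfolded C_def] f], auto)
      also have "... = (\<Sum>i<n. \<integral>\<^sup>+x. (\<integral>\<^sup>+\<mu>. indicator S (add_dirac \<mu> x) \<partial>?Q) * indicator (C i) x \<partial>L)"
      proof (rule sum.cong[OF refl])
        fix i assume i: "i \<in> {..<n}"
        let ?c = "\<integral>\<^sup>+\<omega>. indicator E'' ((counts L ?\<kappa> (n * 2) (\<eta> \<omega>))(Suc (i * 2) := counts L ?\<kappa> (n * 2) (\<eta> \<omega>) (Suc (i * 2)) + 1)) \<partial>M"
        have e1: "(\<integral>\<^sup>+x. (\<integral>\<^sup>+\<mu>. indicator S (add_dirac \<mu> x) \<partial>?Q) * indicator (C i) x \<partial>L) = (\<integral>\<^sup>+x. ?c * indicator (C i) x \<partial>L)"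
        proof (rule nn_integral_cong)
          fix x assume x: "x \<in> space L"
          show "(\<integral>\<^sup>+\<mu>. indicator S (add_dirac \<mu> x) \<partial>?Q) * indicator (C i) x = ?c * indicator (C i) x"
          proof (cases "x \<in> C i")
            case True
            have "(\<integral>\<^sup>+\<mu>. indicator S (add_dirac \<mu> x) \<partial>?Q) = (\<integral>\<^sup>+\<omega>. indicator S (add_dirac (\<eta> \<omega>) x) \<partial>M)"
              using x by (intro nn_integral_distr) measurable
            also have "... = ?c"
            proof (rule nn_integral_cong)
              fix \<omega> assume \<omega>: "\<omega> \<in> space M"
              have "add_dirac (\<eta> \<omega>) x \<in> point_measures L" by (rule add_dirac_in_point_measures[OF in_pm[OF \<omega>]])
              then show "indicator S (add_dirac (\<eta> \<omega>) x) = (indicator E'' ((counts L ?\<kappa> (n * 2) (\<eta> \<omega>))(Suc (i * 2) := counts L ?\<kappa> (n * 2) (\<eta> \<omega>) (Suc (i * 2)) + 1)) :: ennreal)"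
                using counts_add_dirac[OF s\<eta>[OF \<omega>] \<kappa>2 True[unfolded C_def], of "n * 2"] i unfolding S2 by (simp add: indicator_def)
            qed
            finally show ?thesis by simp
          qed simp
        qed
        show "emeasure L (C i) * ?c = (\<integral>\<^sup>+x. (\<integral>\<^sup>+\<mu>. indicator S (add_dirac \<mu> x) \<partial>?Q) * indicator (C i) x \<partial>L)"
          unfolding e1 nn_integral_cmult_indicator[OF C_sets] by (rule mult.commute)
      qed
      also have "... = (\<integral>\<^sup>+x\<in>B. (\<integral>\<^sup>+\<mu>. indicator S (add_dirac \<mu> x) \<partial>?Q) \<partial>L)"
      proof -
        define u where "u x = (\<integral>\<^sup>+\<mu>. indicator S (add_dirac \<mu> x) \<partial>?Q)" for x
        have [measurable]: "u \<in> borel_measurable L" unfolding u_def by (rule int2_meas[OF borel_measurable_indicator[OF S_sets]])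
        have "(\<Sum>i<n. \<integral>\<^sup>+x. u x * indicator (C i) x \<partial>L) = (\<integral>\<^sup>+x. (\<Sum>i<n. u x * indicator (C i) x) \<partial>L)"
          by (subst nn_integral_sum) auto
        also have "... = (\<integral>\<^sup>+x. u x * indicator B x \<partial>L)"
        proof (rule nn_integral_cong)
          fix x
          have "(\<Sum>i<n. indicator (C i) x) = (indicator B x :: ennreal)"
            using indicator_UN_disjoint[OF finite_lessThan disj, of x, symmetric] by (simp only: B_eq[symmetric])
          then show "(\<Sum>i<n. u x * indicator (C i) x) = u x * indicator B x"
            by (simp only: sum_distrib_left[symmetric])
        qed
        finally show ?thesis unfolding u_def .
      qed
      also have "... = (\<integral>\<^sup>+\<mu>. indicator S \<mu> \<partial>N2)" by (rule int2[symmetric]) measurable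
      also have "... = emeasure N2 S" by (simp add: N2_def)
      finally show ?thesis .
    qed
    have "emeasure N1 (point_measures L) = (\<integral>\<^sup>+\<mu>. 1 \<partial>N2)"
      using eq[of "point_measures L"] \<open>range (\<lambda>_::nat. point_measures L) \<subseteq> count_events L\<close>
      by (simp add: N2_def space_point_algebra)
    also have "... = emeasure L B"
      using int2[of "\<lambda>_. 1"] Q.emeasure_space_1 by simp
    finally show "emeasure N1 (point_measures L) \<noteq> \<infinity>" using fin by simp
  qed auto
  then show "(\<integral>\<^sup>+\<mu>. h \<mu> * emeasure \<mu> B \<partial>?Q) = (\<integral>\<^sup>+x\<in>B. (\<integral>\<^sup>+\<mu>. h (add_dirac \<mu> x) \<partial>?Q) \<partial>L)"
    unfolding int1[OF h, symmetric] int2[OF h, symmetric] by (rule arg_cong)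
qed

section \<open>Conditional means given the exterior of growing windows\<close>

text \<open>
  The points outside \<open>B\<close> are distributed as under \<open>void_law\<close>, and the kernel fills in the points of \<open>B\<close>.
  Thus this is the second moment of the conditional mean of \<open>F\<close> given the process outside \<open>B\<close>.
\<close>

definition window_form :: "'a measure \<Rightarrow> 'a measure measure \<Rightarrow> 'a set \<Rightarrow> ('a measure \<Rightarrow> real) \<Rightarrow> ennreal" where
  "window_form L Q B F = (\<integral>\<^sup>+u. ennreal ((\<integral>\<tau>. F \<tau> \<partial>poisson_kicks.kern (restricted L B) (point_algebra L) add_dirac 1 u)\<^sup>2) \<partial>void_law L Q B)"

lemma ennreal_square_add_le: "ennreal ((x + y)\<^sup>2) \<le> 2 * ennreal (x\<^sup>2) + 2 * ennreal (y\<^sup>2)"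
proof -
  have "(x + y)\<^sup>2 \<le> 2 * x\<^sup>2 + 2 * y\<^sup>2" using sum_squares_bound[of x y] by (simp add: power2_sum)
  then have "ennreal ((x + y)\<^sup>2) \<le> ennreal (2 * x\<^sup>2 + 2 * y\<^sup>2)" by (rule ennreal_leI)
  then show ?thesis by (simp add: ennreal_plus ennreal_mult)
qed

context mecke_window
begin

lemma sets_void [measurable_cong]: "sets void = sets (point_algebra L)"
  and prob_space_void: "prob_space void"
  using void_prob_algebra by (auto simp: space_prob_algebra)

lemma space_void: "space void = space (point_algebra L)"
  using sets_void by (rule sets_eq_imp_space_eq)

lemma nn_integral_Q_kern:
  "h \<in> borel_measurable (point_algebra L) \<Longrightarrow> (\<integral>\<^sup>+\<tau>. h \<tau> \<partial>Q) = (\<integral>\<^sup>+u. (\<integral>\<^sup>+\<tau>. h \<tau> \<partial>kern 1 u) \<partial>void)"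
  using nn_integral_bind_kern[OF void_prob_algebra, of h 1] by (simp add: void_bind_kern)

lemma window_form_le:
  assumes [measurable]: "F \<in> borel_measurable (point_algebra L)"
  shows "window_form L Q B F \<le> (\<integral>\<^sup>+\<tau>. ennreal ((F \<tau>)\<^sup>2) \<partial>Q)"
proof -
  have "window_form L Q B F \<le> (\<integral>\<^sup>+u. (\<integral>\<^sup>+\<tau>. ennreal ((F \<tau>)\<^sup>2) \<partial>kern 1 u) \<partial>void)"
    unfolding window_form_def
  proof (rule nn_integral_mono)
    fix u assume "u \<in> space void"
    then interpret K: prob_space "kern 1 u" by (intro prob_space_kern) (simp add: space_void)
    show "ennreal ((\<integral>\<tau>. F \<tau> \<partial>kern 1 u)\<^sup>2) \<le> (\<integral>\<^sup>+\<tau>. ennreal ((F \<tau>)\<^sup>2) \<partial>kern 1 u)"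
      by (rule K.ennreal_square_integral_le) measurable
  qed
  then show ?thesis by (simp add: nn_integral_Q_kern)
qed

lemma AE_integrable_kern:
  fixes F :: "'a measure \<Rightarrow> real"
  assumes [measurable]: "F \<in> borel_measurable (point_algebra L)" and "integrable Q F"
  shows "AE u in void. integrable (kern 1 u) F"
proof -
  have "(\<integral>\<^sup>+u. (\<integral>\<^sup>+\<tau>. ennreal \<bar>F \<tau>\<bar> \<partial>kern 1 u) \<partial>void) \<noteq> \<infinity>"
    using assms(2) nn_integral_Q_kern[of "\<lambda>\<tau>. ennreal \<bar>F \<tau>\<bar>"] by (simp add: integrable_iff_bounded)
  then have "AE u in void. (\<integral>\<^sup>+\<tau>. ennreal \<bar>F \<tau>\<bar> \<partial>kern 1 u) \<noteq> \<infinity>"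
    by (intro nn_integral_PInf_AE) measurable
  then show ?thesis
    by eventually_elim (simp add: integrable_iff_bounded less_top)
qed

lemma window_form_add:
  fixes F G :: "'a measure \<Rightarrow> real"
  assumes [measurable]: "F \<in> borel_measurable (point_algebra L)" "G \<in> borel_measurable (point_algebra L)"
    and "integrable Q F" "integrable Q G"
  shows "window_form L Q B (\<lambda>\<mu>. F \<mu> + G \<mu>) \<le> 2 * window_form L Q B F + 2 * window_form L Q B G" (is "?l \<le> ?r")
proof -
  have "?l \<le>
    (\<integral>\<^sup>+u. (2 * ennreal ((\<integral>\<tau>. F \<tau> \<partial>kern 1 u)\<^sup>2) + 2 * ennreal ((\<integral>\<tau>. G \<tau> \<partial>kern 1 u)\<^sup>2)) \<partial>void)"
    unfolding window_form_def
  proof (rule nn_integral_mono_AE)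
    show "AE u in void. ennreal ((\<integral>\<tau>. F \<tau> + G \<tau> \<partial>kern 1 u)\<^sup>2) \<le>
       2 * ennreal ((\<integral>\<tau>. F \<tau> \<partial>kern 1 u)\<^sup>2) + 2 * ennreal ((\<integral>\<tau>. G \<tau> \<partial>kern 1 u)\<^sup>2)"
      using AE_integrable_kern[OF assms(1,3)] AE_integrable_kern[OF assms(2,4)]
      by eventually_elim (simp add: ennreal_square_add_le)
  qed
  also have "... = ?r"
    unfolding window_form_def by (simp add: nn_integral_add nn_integral_cmult)
  finally show ?thesis .
qed

lemma window_form_cmult:
  assumes [measurable]: "F \<in> borel_measurable (point_algebra L)"
  shows "window_form L Q B (\<lambda>\<mu>. c * F \<mu>) = ennreal (c\<^sup>2) * window_form L Q B F" (is "?l = ?r")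
proof -
  have "?l = (\<integral>\<^sup>+u. ennreal (c\<^sup>2) * ennreal ((\<integral>\<tau>. F \<tau> \<partial>kern 1 u)\<^sup>2) \<partial>void)"
    unfolding window_form_def by (intro nn_integral_cong) (simp add: power_mult_distrib ennreal_mult)
  also have "... = ?r"
    unfolding window_form_def by (rule nn_integral_cmult) measurable
  finally show ?thesis .
qed

definition local :: "('a measure \<Rightarrow> 'b) \<Rightarrow> bool" where
  "local h \<longleftrightarrow> (\<forall>\<mu>\<in>space (point_algebra L). \<forall>\<mu>'\<in>space (point_algebra L).
     (\<forall>A\<in>sets L. A \<subseteq> B \<longrightarrow> emeasure \<mu> A = emeasure \<mu>' A) \<longrightarrow> h \<mu> = h \<mu>')"

lemma local_step: "local h \<Longrightarrow> local (step h)"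
  unfolding local_def step_def
  by (intro ballI impI nn_integral_cong) (metis act_in_space emeasure_add_dirac_point space_restricted)

lemma local_integral_kern_const:
  fixes F :: "'a measure \<Rightarrow> real"
  assumes [measurable]: "F \<in> borel_measurable (point_algebra L)" and l: "local F"
    and F: "\<And>\<mu>. \<mu> \<in> space (point_algebra L) \<Longrightarrow> 0 \<le> F \<mu> \<and> F \<mu> \<le> C"
    and \<mu>: "\<mu> \<in> space (point_algebra L)" "emeasure \<mu> B = 0" and \<mu>': "\<mu>' \<in> space (point_algebra L)" "emeasure \<mu>' B = 0"
  shows "(\<integral>\<tau>. F \<tau> \<partial>kern 1 \<mu>) = (\<integral>\<tau>. F \<tau> \<partial>kern 1 \<mu>')"
proof -
  have "emeasure \<nu> A = 0" if "\<nu> \<in> space (point_algebra L)" "emeasure \<nu> B = 0" "A \<in> sets L" "A \<subseteq> B" for \<nu> A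
  proof -
    have "emeasure \<nu> A \<le> emeasure \<nu> B" using that by (intro emeasure_mono) (auto simp: sets_point_measure)
    then show ?thesis using that by simp
  qed
  then have same: "\<forall>A\<in>sets L. A \<subseteq> B \<longrightarrow> emeasure \<mu> A = emeasure \<mu>' A" using \<mu> \<mu>' by simp
  have "local (\<lambda>\<mu>. ennreal (F \<mu>))" using l unfolding local_def by metis
  then have "local ((step ^^ n) (\<lambda>\<mu>. ennreal (F \<mu>)))" for n by (induction n) (auto intro: local_step)
  then have "(step ^^ n) (\<lambda>\<mu>. ennreal (F \<mu>)) \<mu> = (step ^^ n) (\<lambda>\<mu>. ennreal (F \<mu>)) \<mu>'" for n
    using same \<mu> \<mu>' unfolding local_def by blast
  then have "(\<integral>\<^sup>+\<tau>. ennreal (F \<tau>) \<partial>kern 1 \<mu>) = (\<integral>\<^sup>+\<tau>. ennreal (F \<tau>) \<partial>kern 1 \<mu>')"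
    using \<mu> \<mu>' by (simp add: nn_integral_kern)
  moreover have "(\<integral>\<^sup>+\<tau>. ennreal (F \<tau>) \<partial>kern 1 \<nu>) = ennreal (\<integral>\<tau>. F \<tau> \<partial>kern 1 \<nu>)"
    "0 \<le> (\<integral>\<tau>. F \<tau> \<partial>kern 1 \<nu>)" if "\<nu> \<in> space (point_algebra L)" for \<nu>
  proof -
    interpret K: prob_space "kern 1 \<nu>" by (rule prob_space_kern[OF that])
    show "(\<integral>\<^sup>+\<tau>. ennreal (F \<tau>) \<partial>kern 1 \<nu>) = ennreal (\<integral>\<tau>. F \<tau> \<partial>kern 1 \<nu>)"
      using F by (intro K.nn_integral_eq_integral_bounded[where c = C]) auto
    show "0 \<le> (\<integral>\<tau>. F \<tau> \<partial>kern 1 \<nu>)" using F by (intro integral_nonneg_AE AE_I2) auto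
  qed
  ultimately show ?thesis using \<mu> \<mu>' by (metis ennreal_inj)
qed

lemma integral_Q_kern:
  fixes F :: "'a measure \<Rightarrow> real"
  assumes "F \<in> borel_measurable (point_algebra L)" "\<And>\<mu>. \<mu> \<in> space (point_algebra L) \<Longrightarrow> \<bar>F \<mu>\<bar> \<le> C"
  shows "(\<integral>\<tau>. F \<tau> \<partial>Q) = (\<integral>u. (\<integral>\<tau>. F \<tau> \<partial>kern 1 u) \<partial>void)" (is "_ = ?r")
proof -
  have "kern 1 \<in> point_algebra L \<rightarrow>\<^sub>M prob_algebra (point_algebra L)" by measurable
  then have "(\<integral>\<tau>. F \<tau> \<partial>(void \<bind> kern 1)) = ?r"
    using assms by (rule integral_bind_bounded[OF void_prob_algebra])
  then show ?thesis by (simp add: void_bind_kern)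
qed

text \<open>
  Filling an empty window gives a local functional the same mean whatever the exterior is, so its conditional
  mean given the exterior is constant.
\<close>

lemma window_form_local_eq_0:
  fixes F :: "'a measure \<Rightarrow> real"
  assumes [measurable]: "F \<in> borel_measurable (point_algebra L)" and l: "local F"
    and F: "\<And>\<mu>. \<mu> \<in> space (point_algebra L) \<Longrightarrow> 0 \<le> F \<mu> \<and> F \<mu> \<le> C"
  shows "window_form L Q B (\<lambda>\<mu>. F \<mu> - (\<integral>\<tau>. F \<tau> \<partial>Q)) = 0"
proof -
  interpret void: prob_space void by (rule prob_space_void)
  have "\<exists>\<mu>. \<mu> \<in> space (point_algebra L) \<and> emeasure \<mu> B = 0"
  proof (rule ccontr)
    assume "\<not> ?thesis"
    then have "AE \<mu> in void. False"
      by (intro AE_mp[OF AE_void AE_I2]) (auto simp: space_void)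
    then show False by simp
  qed
  then obtain \<mu>0 where \<mu>0: "\<mu>0 \<in> space (point_algebra L)" "emeasure \<mu>0 B = 0" by blast
  define c where "c = (\<integral>\<tau>. F \<tau> \<partial>kern 1 \<mu>0)"
  have c: "(\<integral>\<tau>. F \<tau> \<partial>kern 1 u) = c" if "u \<in> space (point_algebra L)" "emeasure u B = 0" for u
    unfolding c_def by (rule local_integral_kern_const[OF assms(1) l F that \<mu>0])
  have ae: "AE u in void. u \<in> space (point_algebra L) \<and> emeasure u B = 0"
    using AE_void AE_space by eventually_elim (simp add: space_void)
  have "(\<integral>\<tau>. F \<tau> \<partial>Q) = (\<integral>u. (\<integral>\<tau>. F \<tau> \<partial>kern 1 u) \<partial>void)"
    using F by (intro integral_Q_kern[where C = C]) auto
  also have "... = (\<integral>u. c \<partial>void)"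
    by (intro integral_cong_AE) (use ae in \<open>auto simp: c\<close>)
  also have "... = c" by (simp add: void.prob_space)
  finally have mean: "(\<integral>\<tau>. F \<tau> \<partial>Q) = c" .
  have "window_form L Q B (\<lambda>\<mu>. F \<mu> - c) = (\<integral>\<^sup>+u. 0 \<partial>void)"
    unfolding window_form_def
  proof (rule nn_integral_cong_AE)
    show "AE u in void. ennreal ((\<integral>\<tau>. F \<tau> - c \<partial>kern 1 u)\<^sup>2) = 0"
      using ae
    proof eventually_elim
      case (elim u)
      then interpret K: prob_space "kern 1 u" by (intro prob_space_kern) simp
      have "integrable (kern 1 u) F" using F elim by (intro integrable_kern_bounded[where C = C]) auto
      then have "(\<integral>\<tau>. F \<tau> - c \<partial>kern 1 u) = (\<integral>\<tau>. F \<tau> \<partial>kern 1 u) - (\<integral>\<tau>. c \<partial>kern 1 u)"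
        by (intro Bochner_Integration.integral_diff) auto
      also have "... = 0" using c elim by (simp add: K.prob_space[unfolded space_kern])
      finally show ?case by simp
    qed
  qed
  then show ?thesis by (simp add: mean)
qed

theorem window_variance_decomposition:
  fixes h :: "'a measure \<Rightarrow> real"
  assumes [measurable]: "h \<in> borel_measurable (point_algebra L)" and h: "\<And>\<mu>. \<mu> \<in> space (point_algebra L) \<Longrightarrow> \<bar>h \<mu>\<bar> \<le> C"
  shows "(\<integral>\<^sup>+\<tau>. ennreal ((h \<tau>)\<^sup>2) \<partial>Q) \<le> window_form L Q B h + (\<integral>\<^sup>+z. (\<integral>\<^sup>+\<tau>. ennreal ((diff_op z h \<tau>)\<^sup>2) \<partial>Q) \<partial>L)" (is "?l \<le> _")
proof -
  let ?e = "\<lambda>z. \<integral>\<^sup>+\<tau>. ennreal ((diff_op z h \<tau>)\<^sup>2) \<partial>Q"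
  have "?l \<le> window_form L Q B h +
      (\<integral>\<^sup>+z. ?e z \<partial>restricted L B)"
    using poincare_kern[OF void_prob_algebra, of h 1 C] h by (simp add: void_bind_kern window_form_def diff_op_def)
  also have "(\<integral>\<^sup>+z. ?e z \<partial>restricted L B) =
      (\<integral>\<^sup>+z\<in>B. ?e z \<partial>L)"
    unfolding diff_op_def by (rule nn_integral_restricted) measurable
  also have "... \<le> (\<integral>\<^sup>+z. ?e z \<partial>L)"
    by (intro nn_integral_mono) (simp split: split_indicator)
  finally show ?thesis by (simp add: add_left_mono)
qed

end

context mecke_process
begin

lemma mecke_window: "B \<in> sets L \<Longrightarrow> emeasure L B < \<infinity> \<Longrightarrow> mecke_window L Q B"
  by unfold_locales auto

text \<open>
  Conditional means given the exterior of \<open>B n\<close> converge to the mean in \<open>L\<^sup>2\<close>. The following closure properties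
  prepare an approximation of square integrable functionals by local ones.
\<close>

definition vanishing :: "(nat \<Rightarrow> 'a set) \<Rightarrow> ('a measure \<Rightarrow> real) \<Rightarrow> bool" where
  "vanishing B F \<longleftrightarrow> F \<in> borel_measurable (point_algebra L) \<and> integrable Q (\<lambda>\<mu>. (F \<mu>)\<^sup>2) \<and>
     (\<lambda>n. window_form L Q (B n) (\<lambda>\<mu>. F \<mu> - (\<integral>\<tau>. F \<tau> \<partial>Q))) \<longlonglongrightarrow> 0"

lemma integrable_of_square:
  "F \<in> borel_measurable (point_algebra L) \<Longrightarrow> integrable Q (\<lambda>\<mu>. (F \<mu> :: real)\<^sup>2) \<Longrightarrow> integrable Q F"
  by (rule Q.square_integrable_imp_integrable) (auto simp: measurable_cong_sets[OF sets_Q refl])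

lemma centered_square_le:
  assumes "F \<in> borel_measurable (point_algebra L)"
  shows "(\<integral>\<^sup>+\<mu>. ennreal ((F \<mu> - (\<integral>\<tau>. F \<tau> \<partial>Q))\<^sup>2) \<partial>Q) \<le> (\<integral>\<^sup>+\<mu>. ennreal ((F \<mu>)\<^sup>2) \<partial>Q)"
proof (cases "integrable Q (\<lambda>\<mu>. (F \<mu>)\<^sup>2)")
  case True
  then have int: "integrable Q F" by (rule integrable_of_square[OF assms])
  have int2: "integrable Q (\<lambda>\<mu>. (F \<mu> - (\<integral>\<tau>. F \<tau> \<partial>Q))\<^sup>2)"
    using int True by (simp add: power2_diff)
  have "(\<integral>\<mu>. (F \<mu> - (\<integral>\<tau>. F \<tau> \<partial>Q))\<^sup>2 \<partial>Q) \<le> (\<integral>\<mu>. (F \<mu>)\<^sup>2 \<partial>Q)"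
    using Q.variance_eq[OF int True] by simp
  then show ?thesis using True int2 by (simp add: nn_integral_eq_integral ennreal_leI)
next
  case False
  then have "(\<integral>\<^sup>+\<mu>. ennreal ((F \<mu>)\<^sup>2) \<partial>Q) = \<infinity>"
    using assms by (simp add: integrable_iff_bounded measurable_cong_sets[OF sets_Q refl] not_less top_unique)
  then show ?thesis by simp
qed

end

locale mecke_exhaustion = mecke_process L Q for L :: "'a measure" and Q +
  fixes B :: "nat \<Rightarrow> 'a set"
  assumes B_sets: "\<And>n. B n \<in> sets L" and B_finite: "\<And>n. emeasure L (B n) < \<infinity>"
    and B_incseq: "incseq B" and B_exhausts: "(\<Union>n. B n) = space L"
begin

lemma win: "mecke_window L Q (B n)"
  by (rule mecke_window[OF B_sets B_finite])

lemma vanishingD: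
  assumes "vanishing B F"
  shows "F \<in> borel_measurable (point_algebra L)" "integrable Q (\<lambda>\<mu>. (F \<mu>)\<^sup>2)" "integrable Q F"
    "(\<lambda>n. window_form L Q (B n) (\<lambda>\<mu>. F \<mu> - (\<integral>\<tau>. F \<tau> \<partial>Q))) \<longlonglongrightarrow> 0"
proof -
  show 1: "F \<in> borel_measurable (point_algebra L)" "integrable Q (\<lambda>\<mu>. (F \<mu>)\<^sup>2)"
    "(\<lambda>n. window_form L Q (B n) (\<lambda>\<mu>. F \<mu> - (\<integral>\<tau>. F \<tau> \<partial>Q))) \<longlonglongrightarrow> 0"
    using assms unfolding vanishing_def by blast+
  show "integrable Q F" by (rule integrable_of_square[OF 1(1,2)])
qed

lemma vanishing_add:
  assumes F: "vanishing B F" and G: "vanishing B G"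
  shows "vanishing B (\<lambda>\<mu>. F \<mu> + G \<mu>)"
proof -
  note F = vanishingD[OF F] and G = vanishingD[OF G]
  note [measurable] = F(1) G(1)
  have sq: "integrable Q (\<lambda>\<mu>. (F \<mu> + G \<mu>)\<^sup>2)"
  proof (rule Bochner_Integration.integrable_bound)
    show "integrable Q (\<lambda>\<mu>. 2 * (F \<mu>)\<^sup>2 + 2 * (G \<mu>)\<^sup>2)" using F G by auto
    have "(x + y)\<^sup>2 \<le> 2 * x\<^sup>2 + 2 * y\<^sup>2" for x y :: real using sum_squares_bound[of x y] by (simp add: power2_sum)
    then show "AE \<mu> in Q. norm ((F \<mu> + G \<mu>)\<^sup>2) \<le> norm (2 * (F \<mu>)\<^sup>2 + 2 * (G \<mu>)\<^sup>2)" by simp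
  qed measurable
  let ?f = "\<lambda>F n. window_form L Q (B n) (\<lambda>\<mu>. F \<mu> - (\<integral>\<tau>. F \<tau> \<partial>Q))"
  have le: "?f (\<lambda>\<mu>. F \<mu> + G \<mu>) n \<le> 2 * ?f F n + 2 * ?f G n" for n
  proof -
    interpret mecke_window L Q "B n" by (rule win)
    have "?f (\<lambda>\<mu>. F \<mu> + G \<mu>) n = window_form L Q (B n) (\<lambda>\<mu>. (F \<mu> - (\<integral>\<tau>. F \<tau> \<partial>Q)) + (G \<mu> - (\<integral>\<tau>. G \<tau> \<partial>Q)))"
      using F(3) G(3) by (simp add: algebra_simps)
    also have "... \<le> 2 * ?f F n + 2 * ?f G n" using F(3) G(3) by (intro window_form_add) auto
    finally show ?thesis .
  qed
  have "(\<lambda>n. 2 * ?f F n + 2 * ?f G n) \<longlonglongrightarrow> 2 * 0 + 2 * 0"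
    using F(4) G(4) by (intro tendsto_add ennreal_tendsto_cmult) auto
  then have "(\<lambda>n. 2 * ?f F n + 2 * ?f G n) \<longlonglongrightarrow> 0" by simp
  then have "?f (\<lambda>\<mu>. F \<mu> + G \<mu>) \<longlonglongrightarrow> 0"
    by (rule tendsto_sandwich[OF _ _ tendsto_const, rotated 2]) (use le in auto)
  then show ?thesis using sq by (simp add: vanishing_def)
qed

lemma vanishing_cmult:
  assumes F: "vanishing B F"
  shows "vanishing B (\<lambda>\<mu>. c * F \<mu>)"
proof -
  note F = vanishingD[OF F]
  note [measurable] = F(1)
  have "window_form L Q (B n) (\<lambda>\<mu>. c * F \<mu> - (\<integral>\<tau>. c * F \<tau> \<partial>Q)) =
      ennreal (c\<^sup>2) * window_form L Q (B n) (\<lambda>\<mu>. F \<mu> - (\<integral>\<tau>. F \<tau> \<partial>Q))" for n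
  proof -
    interpret mecke_window L Q "B n" by (rule win)
    show ?thesis using window_form_cmult[of "\<lambda>\<mu>. F \<mu> - (\<integral>\<tau>. F \<tau> \<partial>Q)" c] by (simp add: right_diff_distrib)
  qed
  moreover have "(\<lambda>n. ennreal (c\<^sup>2) * window_form L Q (B n) (\<lambda>\<mu>. F \<mu> - (\<integral>\<tau>. F \<tau> \<partial>Q))) \<longlonglongrightarrow> ennreal (c\<^sup>2) * 0"
    using F(4) by (intro ennreal_tendsto_cmult) auto
  ultimately show ?thesis using F(2) by (simp add: vanishing_def power_mult_distrib)
qed

lemma vanishing_const: "vanishing B (\<lambda>_. c)"
proof -
  have "window_form L Q (B n) (\<lambda>_. 0) = 0" for n by (simp add: window_form_def)
  then show ?thesis by (simp add: vanishing_def Q.prob_space)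
qed

lemma vanishing_sum: "(\<And>i. i \<in> I \<Longrightarrow> vanishing B (F i)) \<Longrightarrow> vanishing B (\<lambda>\<mu>. \<Sum>i\<in>I. F i \<mu>)"
  by (induction I rule: infinite_finite_induct) (auto intro: vanishing_add simp: vanishing_const)

lemma vanishing_cong:
  assumes "vanishing B F" "\<And>\<mu>. \<mu> \<in> space (point_algebra L) \<Longrightarrow> F \<mu> = G \<mu>"
  shows "vanishing B G"
proof -
  have m: "G \<in> borel_measurable (point_algebra L)"
    using assms(1) measurable_cong[of "point_algebra L" F G] assms(2) by (simp add: vanishing_def)
  have "(\<integral>\<tau>. F \<tau> \<partial>Q) = (\<integral>\<tau>. G \<tau> \<partial>Q)" "integrable Q (\<lambda>\<mu>. (F \<mu>)\<^sup>2) \<longleftrightarrow> integrable Q (\<lambda>\<mu>. (G \<mu>)\<^sup>2)"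
    using assms(2) by (auto intro!: Bochner_Integration.integral_cong Bochner_Integration.integrable_cong simp: space_Q)
  moreover have "window_form L Q (B n) (\<lambda>\<mu>. F \<mu> - c) = window_form L Q (B n) (\<lambda>\<mu>. G \<mu> - c)" for n c
  proof -
    interpret mecke_window L Q "B n" by (rule win)
    show ?thesis unfolding window_form_def
      by (intro nn_integral_cong arg_cong[where f = ennreal] arg_cong[where f = "\<lambda>x. x\<^sup>2"] Bochner_Integration.integral_cong)
         (auto simp: assms(2))
  qed
  ultimately show ?thesis using assms(1) m by (simp add: vanishing_def)
qed

lemma vanishing_approximation:
  assumes F: "F \<in> borel_measurable (point_algebra L)" "integrable Q (\<lambda>\<mu>. (F \<mu>)\<^sup>2)"
    and G: "\<And>i. vanishing B (G i)" and lim: "(\<lambda>i. \<integral>\<^sup>+\<mu>. ennreal ((F \<mu> - G i \<mu>)\<^sup>2) \<partial>Q) \<longlonglongrightarrow> 0"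
  shows "vanishing B F"
proof -
  note [measurable] = F(1)
  have int: "integrable Q F" by (rule integrable_of_square[OF F])
  let ?f = "\<lambda>F n. window_form L Q (B n) (\<lambda>\<mu>. F \<mu> - (\<integral>\<tau>. F \<tau> \<partial>Q))"
  have "?f F \<longlonglongrightarrow> 0"
  proof (rule order_tendstoI)
    fix e :: ennreal assume e: "0 < e"
    obtain r :: real where r: "0 < r" "ennreal r \<le> e"
    proof (cases e)
      case (real r)
      then show ?thesis using e that[of r] by simp
    next
      case top
      then show ?thesis using that[of 1] by simp
    qed
    have r8: "0 < ennreal (r / 8)" using r by simp
    obtain i where i: "(\<integral>\<^sup>+\<mu>. ennreal ((F \<mu> - G i \<mu>)\<^sup>2) \<partial>Q) < ennreal (r / 8)"
      using order_tendstoD(2)[OF lim r8] eventually_happens[of _ sequentially] by fastforce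
    note Gi = vanishingD[OF G[of i]]
    note [measurable] = Gi(1)
    have le: "?f F n \<le> 2 * (\<integral>\<^sup>+\<mu>. ennreal ((F \<mu> - G i \<mu>)\<^sup>2) \<partial>Q) + 2 * ?f (G i) n" for n
    proof -
      interpret mecke_window L Q "B n" by (rule win)
      let ?D = "\<lambda>\<mu>. F \<mu> - G i \<mu>"
      have "?f F n = window_form L Q (B n) (\<lambda>\<mu>. (?D \<mu> - (\<integral>\<tau>. ?D \<tau> \<partial>Q)) + (G i \<mu> - (\<integral>\<tau>. G i \<tau> \<partial>Q)))"
        using int Gi(3) by (simp add: algebra_simps)
      also have "... \<le> 2 * ?f ?D n + 2 * ?f (G i) n" using int Gi(3) by (intro window_form_add) auto
      also have "?f ?D n \<le> (\<integral>\<^sup>+\<mu>. ennreal ((?D \<mu> - (\<integral>\<tau>. ?D \<tau> \<partial>Q))\<^sup>2) \<partial>Q)" by (rule window_form_le) measurable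
      also have "... \<le> (\<integral>\<^sup>+\<mu>. ennreal ((?D \<mu>)\<^sup>2) \<partial>Q)" by (rule centered_square_le) measurable
      finally show ?thesis by (simp add: add_right_mono mult_left_mono)
    qed
    have "\<forall>\<^sub>F n in sequentially. ?f (G i) n < ennreal (r / 8)" using order_tendstoD(2)[OF Gi(4) r8] .
    then show "\<forall>\<^sub>F n in sequentially. ?f F n < e"
    proof eventually_elim
      case (elim n)
      have "?f F n \<le> 2 * ennreal (r / 8) + 2 * ennreal (r / 8)"
        using i elim by (intro order_trans[OF le] add_mono mult_left_mono) auto
      also have "... = ennreal (r / 2)" using r by (simp flip: ennreal_mult ennreal_plus ennreal_numeral)
      also have "... < ennreal r" using r by (simp add: ennreal_less_iff)
      finally show ?case using r(2) by (rule less_le_trans)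
    qed
  qed simp
  then show ?thesis using F by (simp add: vanishing_def)
qed

end

context mecke_exhaustion
begin

text \<open>An intersection-stable generator of \<open>point_algebra L\<close>.\<close>

definition local_events :: "'a measure set set" where
  "local_events = {S \<in> sets (point_algebra L). \<exists>n. mecke_window.local L (B n) (\<lambda>\<mu>. \<mu> \<in> S)}"

lemma local_iff:
  "mecke_window.local L (B n) h \<longleftrightarrow> (\<forall>\<mu>\<in>space (point_algebra L). \<forall>\<mu>'\<in>space (point_algebra L).
     (\<forall>A\<in>sets L. A \<subseteq> B n \<longrightarrow> emeasure \<mu> A = emeasure \<mu>' A) \<longrightarrow> h \<mu> = h \<mu>')"
  by (rule mecke_window.local_def[OF win])

lemma local_mono: "m \<le> n \<Longrightarrow> mecke_window.local L (B m) h \<Longrightarrow> mecke_window.local L (B n) h"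
  using incseqD[OF B_incseq, of m n] unfolding local_iff by (meson order_trans)

lemma Int_stable_local_events: "Int_stable local_events"
proof (rule Int_stableI)
  fix S T assume "S \<in> local_events" "T \<in> local_events"
  then obtain m n where S: "S \<in> sets (point_algebra L)" "mecke_window.local L (B m) (\<lambda>\<mu>. \<mu> \<in> S)"
    and T: "T \<in> sets (point_algebra L)" "mecke_window.local L (B n) (\<lambda>\<mu>. \<mu> \<in> T)"
    by (auto simp: local_events_def)
  have "mecke_window.local L (B (max m n)) (\<lambda>\<mu>. \<mu> \<in> S)" "mecke_window.local L (B (max m n)) (\<lambda>\<mu>. \<mu> \<in> T)"
    by (rule local_mono[OF max.cobounded1 S(2)], rule local_mono[OF max.cobounded2 T(2)])
  then have "mecke_window.local L (B (max m n)) (\<lambda>\<mu>. \<mu> \<in> S \<inter> T)"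
    unfolding local_iff Int_iff by metis
  then show "S \<inter> T \<in> local_events" using S T by (auto simp: local_events_def)
qed

lemma sets_point_algebra_local_events: "sets (point_algebra L) = sigma_sets (point_measures L) local_events"
proof (rule sets_point_algebra_generated)
  show G: "local_events \<subseteq> sets (point_algebra L)" by (auto simp: local_events_def)
  have G': "local_events \<subseteq> Pow (point_measures L)"
    using G sets.space_closed[of "point_algebra L"] by (auto simp: space_point_algebra)
  have space: "space (sigma (point_measures L) local_events) = point_measures L"
    using G' by (simp add: space_measure_of_conv)
  fix A assume A: "A \<in> sets L"
  have AB[measurable]: "A \<inter> B n \<in> sets L" for n using A B_sets by auto
  have "(\<lambda>\<mu>. emeasure \<mu> (A \<inter> B n)) \<in> borel_measurable (sigma (point_measures L) local_events)" for n
  proof (rule measurableI)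
    fix E :: "ennreal set" assume E[measurable]: "E \<in> sets borel"
    let ?S = "(\<lambda>\<mu>. emeasure \<mu> (A \<inter> B n)) -` E \<inter> space (point_algebra L)"
    have "?S \<in> sets (point_algebra L)" by measurable
    moreover have "mecke_window.local L (B n) (\<lambda>\<mu>. \<mu> \<in> ?S)"
      unfolding local_iff using AB[of n] by auto
    ultimately have "?S \<in> local_events" by (auto simp: local_events_def)
    then show "(\<lambda>\<mu>. emeasure \<mu> (A \<inter> B n)) -` E \<inter> space (sigma (point_measures L) local_events)
        \<in> sets (sigma (point_measures L) local_events)"
      using G' by (auto simp: space space_point_algebra)
  qed auto
  then have "(\<lambda>\<mu>. SUP n. emeasure \<mu> (A \<inter> B n)) \<in> borel_measurable (sigma (point_measures L) local_events)"
    by measurable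
  moreover have "emeasure \<mu> A = (SUP n. emeasure \<mu> (A \<inter> B n))" if "\<mu> \<in> point_measures L" for \<mu>
  proof -
    have \<mu>: "sets \<mu> = sets L" using that by (simp add: point_measures_def)
    have "(SUP n. emeasure \<mu> (A \<inter> B n)) = emeasure \<mu> (\<Union>n. A \<inter> B n)"
      using B_incseq AB by (intro SUP_emeasure_incseq) (auto simp: \<mu> incseq_def)
    also have "(\<Union>n. A \<inter> B n) = A" using B_exhausts sets.sets_into_space[OF A] by auto
    finally show ?thesis ..
  qed
  ultimately show "(\<lambda>\<mu>. emeasure \<mu> A) \<in> borel_measurable (sigma (point_measures L) local_events)"
    by (subst measurable_cong[where g = "\<lambda>\<mu>. SUP n. emeasure \<mu> (A \<inter> B n)"]) (auto simp: space)
qed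

lemma vanishing_indicator_local:
  assumes "S \<in> local_events"
  shows "vanishing B (indicator S)"
proof -
  obtain n where S[measurable]: "S \<in> sets (point_algebra L)" and l: "mecke_window.local L (B n) (\<lambda>\<mu>. \<mu> \<in> S)"
    using assms by (auto simp: local_events_def)
  have "window_form L Q (B m) (\<lambda>\<mu>. indicator S \<mu> - (\<integral>\<tau>. indicator S \<tau> \<partial>Q)) = 0" if "n \<le> m" for m
  proof -
    interpret W: mecke_window L Q "B m" by (rule win)
    have "W.local (\<lambda>\<mu>. \<mu> \<in> S)" using local_mono[OF that l] .
    then have "W.local (indicator S :: _ \<Rightarrow> real)"
      unfolding W.local_def
    proof (intro ballI impI)
      fix \<mu> \<mu>' assume "\<mu> \<in> space (point_algebra L)" "\<mu>' \<in> space (point_algebra L)"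
        "\<forall>A\<in>sets L. A \<subseteq> B m \<longrightarrow> emeasure \<mu> A = emeasure \<mu>' A"
      then have "(\<mu> \<in> S) = (\<mu>' \<in> S)" using \<open>W.local (\<lambda>\<mu>. \<mu> \<in> S)\<close> unfolding W.local_def by blast
      then show "indicator S \<mu> = (indicator S \<mu>' :: real)" by (simp only: indicator_def)
    qed
    then show ?thesis by (intro W.window_form_local_eq_0[where C = 1]) auto
  qed
  then have "(\<lambda>m. window_form L Q (B m) (\<lambda>\<mu>. indicator S \<mu> - (\<integral>\<tau>. indicator S \<tau> \<partial>Q))) \<longlonglongrightarrow> 0"
    by (intro tendsto_eventually) (auto simp: eventually_sequentially)
  moreover have "integrable Q (\<lambda>\<mu>. (indicator S \<mu> :: real)\<^sup>2)"
    by (intro Q.integrable_const_bound[where B = 1] AE_I2) (auto simp: indicator_def)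
  ultimately show ?thesis by (simp add: vanishing_def)
qed

lemma vanishing_indicator:
  assumes "S \<in> sets (point_algebra L)"
  shows "vanishing B (indicator S)"
proof -
  have G: "local_events \<subseteq> Pow (point_measures L)"
    using sets.space_closed[of "point_algebra L"] by (auto simp: space_point_algebra local_events_def)
  have "S \<in> sigma_sets (point_measures L) local_events"
    using assms by (simp add: sets_point_algebra_local_events)
  with Int_stable_local_events G show ?thesis
  proof (induction rule: sigma_sets_induct_disjoint)
    case (basic A)
    then show ?case by (rule vanishing_indicator_local)
  next
    case empty
    show ?case using vanishing_const[of 0] by (rule vanishing_cong) simp
  next
    case (compl A)
    have "vanishing B (\<lambda>\<mu>. 1 + (-1) * indicator A \<mu>)"
      by (intro vanishing_add vanishing_const vanishing_cmult compl)
    then show ?case by (rule vanishing_cong) (auto simp: space_point_algebra indicator_def)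
  next
    case (union A)
    have [measurable]: "A i \<in> sets (point_algebra L)" for i
      using union by (auto simp: sets_point_algebra_local_events)
    let ?U = "\<Union>i. A i" and ?s = "\<lambda>k \<mu>. \<Sum>i<k. indicator (A i) \<mu> :: real"
    have s: "?s k \<mu> = indicator (\<Union>i<k. A i) \<mu>" for k \<mu>
      using union(1) by (intro indicator_UN_disjoint[symmetric]) (auto simp: disjoint_family_on_def)
    show ?case
    proof (rule vanishing_approximation[where G = ?s])
      show "vanishing B (?s k)" for k by (rule vanishing_sum) (rule union)
      show "integrable Q (\<lambda>\<mu>. (indicator ?U \<mu> :: real)\<^sup>2)"
        by (intro Q.integrable_const_bound[where B = 1] AE_I2) (auto simp: indicator_def)
      have "(\<lambda>k. \<integral>\<^sup>+\<mu>. ennreal ((indicator ?U \<mu> - indicator (\<Union>i<k. A i) \<mu>)\<^sup>2) \<partial>Q) \<longlonglongrightarrow> (\<integral>\<^sup>+\<mu>. 0 \<partial>Q)"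
      proof (rule nn_integral_dominated_convergence[where w = "\<lambda>_. 1"])
        show "AE \<mu> in Q. (\<lambda>k. ennreal ((indicator ?U \<mu> - indicator (\<Union>i<k. A i) \<mu>)\<^sup>2)) \<longlonglongrightarrow> 0"
        proof (rule AE_I2)
          fix \<mu>
          show "(\<lambda>k. ennreal ((indicator ?U \<mu> - indicator (\<Union>i<k. A i) \<mu>)\<^sup>2)) \<longlonglongrightarrow> 0"
          proof (cases "\<mu> \<in> ?U")
            case True
            then obtain j where j: "\<mu> \<in> A j" by blast
            have "\<forall>\<^sub>F k in sequentially. ennreal ((indicator ?U \<mu> - indicator (\<Union>i<k. A i) \<mu>)\<^sup>2) = 0"
              using eventually_gt_at_top[of j] by eventually_elim (use j in \<open>auto simp: indicator_def\<close>)
            then show ?thesis by (rule tendsto_eventually)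
          qed (auto simp: indicator_def)
        qed
        show "AE \<mu> in Q. ennreal ((indicator ?U \<mu> - indicator (\<Union>i<k. A i) \<mu>)\<^sup>2) \<le> 1" for k
          by (intro AE_I2) (auto simp: indicator_def)
      qed (auto simp: Q.emeasure_space_1)
      then show "(\<lambda>k. \<integral>\<^sup>+\<mu>. ennreal ((indicator ?U \<mu> - ?s k \<mu>)\<^sup>2) \<partial>Q) \<longlonglongrightarrow> 0"
        by (simp add: s)
    qed measurable
  qed
qed

text \<open>
  The property holds for local events by \<open>window_form_local_eq_0\<close>, hence for all events by Dynkin's theorem,
  hence for simple functions, and it passes to \<open>L\<^sup>2\<close> limits.
\<close>

theorem vanishing_square_integrable:
  assumes F[measurable]: "F \<in> borel_measurable (point_algebra L)" and F2: "integrable Q (\<lambda>\<mu>. (F \<mu>)\<^sup>2)"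
  shows "vanishing B F"
proof -
  obtain s where s: "\<And>i. simple_function (point_algebra L) (s i)"
    and lim: "\<And>\<mu>. \<mu> \<in> space (point_algebra L) \<Longrightarrow> (\<lambda>i. s i \<mu>) \<longlonglongrightarrow> F \<mu>"
    and bnd: "\<And>i \<mu>. \<mu> \<in> space (point_algebra L) \<Longrightarrow> dist (s i \<mu>) 0 \<le> 2 * dist (F \<mu>) 0"
    using borel_measurable_implies_sequence_metric[OF F, of 0] by blast
  have [measurable]: "s i \<in> borel_measurable (point_algebra L)" for i
    by (rule borel_measurable_simple_function[OF s])
  show ?thesis
  proof (rule vanishing_approximation[OF F F2, where G = s])
    show "vanishing B (s i)" for i
    proof -
      let ?Y = "s i ` space (point_algebra L)"
      have fin: "finite ?Y" using s[of i] by (simp add: simple_function_def)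
      have "vanishing B (\<lambda>\<mu>. \<Sum>y\<in>?Y. y * indicator (s i -` {y} \<inter> space (point_algebra L)) \<mu>)"
        by (intro vanishing_sum vanishing_cmult vanishing_indicator) measurable
      then show ?thesis
      proof (rule vanishing_cong)
        fix \<mu> assume \<mu>: "\<mu> \<in> space (point_algebra L)"
        have "(\<Sum>y\<in>?Y. y * indicator (s i -` {y} \<inter> space (point_algebra L)) \<mu>) = (\<Sum>y\<in>?Y. if y = s i \<mu> then y else 0)"
          using \<mu> by (intro sum.cong) (auto simp: indicator_def)
        also have "... = s i \<mu>" using \<mu> fin by (simp add: sum.delta)
        finally show "(\<Sum>y\<in>?Y. y * indicator (s i -` {y} \<inter> space (point_algebra L)) \<mu>) = s i \<mu>" .
      qed
    qed
    have "(\<lambda>i. \<integral>\<^sup>+\<mu>. ennreal ((F \<mu> - s i \<mu>)\<^sup>2) \<partial>Q) \<longlonglongrightarrow> (\<integral>\<^sup>+\<mu>. 0 \<partial>Q)"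
    proof (rule nn_integral_dominated_convergence[where w = "\<lambda>\<mu>. ennreal (9 * (F \<mu>)\<^sup>2)"])
      show "AE \<mu> in Q. (\<lambda>i. ennreal ((F \<mu> - s i \<mu>)\<^sup>2)) \<longlonglongrightarrow> 0"
      proof (rule AE_I2)
        fix \<mu> assume "\<mu> \<in> space Q"
        then have "(\<lambda>i. (F \<mu> - s i \<mu>)\<^sup>2) \<longlonglongrightarrow> (F \<mu> - F \<mu>)\<^sup>2"
          by (intro tendsto_intros lim) (simp add: space_Q)
        from tendsto_ennrealI[OF this] show "(\<lambda>i. ennreal ((F \<mu> - s i \<mu>)\<^sup>2)) \<longlonglongrightarrow> 0"
          by (simp only: diff_self zero_power2 ennreal_0)
      qed
      show "AE \<mu> in Q. ennreal ((F \<mu> - s i \<mu>)\<^sup>2) \<le> ennreal (9 * (F \<mu>)\<^sup>2)" for i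
      proof (rule AE_I2)
        fix \<mu> assume "\<mu> \<in> space Q"
        then have "\<bar>F \<mu> - s i \<mu>\<bar> \<le> 3 * \<bar>F \<mu>\<bar>" using bnd[of \<mu> i] by (simp add: space_Q dist_real_def)
        then have "\<bar>F \<mu> - s i \<mu>\<bar>\<^sup>2 \<le> (3 * \<bar>F \<mu>\<bar>)\<^sup>2" by (intro power_mono) auto
        then show "ennreal ((F \<mu> - s i \<mu>)\<^sup>2) \<le> ennreal (9 * (F \<mu>)\<^sup>2)" by (intro ennreal_leI) (simp add: power_mult_distrib)
      qed
      show "(\<integral>\<^sup>+\<mu>. ennreal (9 * (F \<mu>)\<^sup>2) \<partial>Q) < \<infinity>"
        using F2 by (simp add: integrable_iff_bounded ennreal_mult nn_integral_cmult ennreal_mult_less_top)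
    qed measurable
    then show "(\<lambda>i. \<integral>\<^sup>+\<mu>. ennreal ((F \<mu> - s i \<mu>)\<^sup>2) \<partial>Q) \<longlonglongrightarrow> 0" by simp
  qed
qed

text \<open>The bound of \<open>window_variance_decomposition\<close> has two terms, and the first one vanishes for growing windows.\<close>

lemma poincare_exhaustion:
  fixes h :: "'a measure \<Rightarrow> real"
  assumes [measurable]: "h \<in> borel_measurable (point_algebra L)" and h: "\<And>\<mu>. \<mu> \<in> space (point_algebra L) \<Longrightarrow> \<bar>h \<mu>\<bar> \<le> C"
  shows "(\<integral>\<^sup>+\<mu>. ennreal ((h \<mu> - (\<integral>\<tau>. h \<tau> \<partial>Q))\<^sup>2) \<partial>Q) \<le> (\<integral>\<^sup>+z. (\<integral>\<^sup>+\<mu>. ennreal ((diff_op z h \<mu>)\<^sup>2) \<partial>Q) \<partial>L)"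
proof -
  let ?c = "\<integral>\<tau>. h \<tau> \<partial>Q" and ?E = "\<integral>\<^sup>+z. (\<integral>\<^sup>+\<mu>. ennreal ((diff_op z h \<mu>)\<^sup>2) \<partial>Q) \<partial>L"
  have "\<bar>h \<mu>\<bar>\<^sup>2 \<le> C\<^sup>2" if "\<mu> \<in> space Q" for \<mu> using that by (intro power_mono h) (auto simp: space_Q)
  then have "integrable Q (\<lambda>\<mu>. (h \<mu>)\<^sup>2)" by (intro Q.integrable_const_bound[where B = "C\<^sup>2"]) auto
  from vanishing_square_integrable[OF assms(1) this]
  have lim: "(\<lambda>n. window_form L Q (B n) (\<lambda>\<mu>. h \<mu> - ?c)) \<longlonglongrightarrow> 0" by (rule vanishingD(4))
  have "(\<lambda>n. window_form L Q (B n) (\<lambda>\<mu>. h \<mu> - ?c) + ?E) \<longlonglongrightarrow> 0 + ?E"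
    by (intro tendsto_add lim tendsto_const)
  moreover have "(\<integral>\<^sup>+\<mu>. ennreal ((h \<mu> - ?c)\<^sup>2) \<partial>Q) \<le> window_form L Q (B n) (\<lambda>\<mu>. h \<mu> - ?c) + ?E" for n
  proof -
    interpret W: mecke_window L Q "B n" by (rule win)
    have "\<bar>h \<mu> - ?c\<bar> \<le> C + \<bar>?c\<bar>" if "\<mu> \<in> space (point_algebra L)" for \<mu> using h[OF that] by linarith
    then show ?thesis using W.window_variance_decomposition[of "\<lambda>\<mu>. h \<mu> - ?c" "C + \<bar>?c\<bar>"]
      by (simp add: diff_op_def)
  qed
  ultimately show ?thesis by (intro LIMSEQ_le_const[where X = "\<lambda>n. window_form L Q (B n) (\<lambda>\<mu>. h \<mu> - ?c) + ?E"]) auto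
qed

end

lemma (in mecke_process) exhaustion_exists: "\<exists>B. mecke_exhaustion L Q B"
proof -
  obtain A :: "nat \<Rightarrow> 'a set" where A: "range A \<subseteq> sets L" "(\<Union>i. A i) = space L" "\<And>i. emeasure L (A i) \<noteq> \<infinity>" "incseq A"
    using L.sigma_finite_incseq by blast
  have "mecke_exhaustion L Q A"
    by unfold_locales (use A in \<open>auto simp: top.not_eq_extremum\<close>)
  then show ?thesis by blast
qed

theorem (in mecke_process) poincare:
  fixes h :: "'a measure \<Rightarrow> real"
  assumes "h \<in> borel_measurable (point_algebra L)" and "\<And>\<mu>. \<mu> \<in> space (point_algebra L) \<Longrightarrow> \<bar>h \<mu>\<bar> \<le> C"
  shows "(\<integral>\<^sup>+\<mu>. ennreal ((h \<mu> - (\<integral>\<tau>. h \<tau> \<partial>Q))\<^sup>2) \<partial>Q) \<le> (\<integral>\<^sup>+z. (\<integral>\<^sup>+\<mu>. ennreal ((diff_op z h \<mu>)\<^sup>2) \<partial>Q) \<partial>L)"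
  using exhaustion_exists mecke_exhaustion.poincare_exhaustion[OF _ assms] by blast

section \<open>Two coupled Poisson processes\<close>

definition clamp_real :: "real \<Rightarrow> real \<Rightarrow> real" where
  "clamp_real k x = max (- k) (min k x)"

lemma clamp_real_bounds:
  assumes "0 \<le> k"
  shows "\<bar>clamp_real k x\<bar> \<le> k" "\<bar>clamp_real k x\<bar> \<le> \<bar>x\<bar>" "\<bar>clamp_real k x - clamp_real k y\<bar> \<le> \<bar>x - y\<bar>"
  using assms by (auto simp: clamp_real_def)

lemma measurable_clamp_real [measurable]: "clamp_real k \<in> borel_measurable borel"
  unfolding clamp_real_def[abs_def] by measurable

lemma clamp_real_tendsto: "(\<lambda>n. clamp_real (real n) x) \<longlonglongrightarrow> x"
proof (rule tendsto_eventually)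
  obtain m where m: "\<bar>x\<bar> \<le> real m" using real_arch_simple by blast
  show "\<forall>\<^sub>F n in sequentially. clamp_real (real n) x = x"
    using eventually_ge_at_top[of m]
  proof eventually_elim
    case (elim n)
    then have "\<bar>x\<bar> \<le> real n" using m by (meson of_nat_le_iff order_trans)
    then show ?case by (auto simp: clamp_real_def)
  qed
qed

context mecke_window
begin

abbreviation coupling :: "real \<Rightarrow> ('a measure \<times> 'a measure) measure" where
  "coupling s \<equiv> coup void 1 s"

lemmas sets_coupling [measurable_cong] = sets_coup[OF void_prob_algebra, of 1]
lemmas space_coupling = space_coup[OF void_prob_algebra, of 1]
lemmas prob_space_coupling = prob_space_coup[OF void_prob_algebra, of 1]

lemma distr_coupling:
  assumes "0 \<le> s" "s \<le> 1"
  shows "distr (coupling s) (point_algebra L) fst = Q" "distr (coupling s) (point_algebra L) snd = Q"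
  using distr_coup[OF void_prob_algebra assms] by (simp_all add: void_bind_kern)

lemma coupling_marginal:
  assumes s: "0 \<le> s" "s \<le> 1" and [measurable]: "h \<in> borel_measurable (point_algebra L)"
  shows "(\<integral>\<^sup>+p. h (fst p) \<partial>coupling s) = (\<integral>\<^sup>+\<tau>. h \<tau> \<partial>Q)" "(\<integral>\<^sup>+p. h (snd p) \<partial>coupling s) = (\<integral>\<^sup>+\<tau>. h \<tau> \<partial>Q)"
  using nn_integral_coup_marginal[OF void_prob_algebra assms(3) s] by (simp_all add: void_bind_kern)

lemma coupling_marginal_real:
  fixes h :: "'a measure \<Rightarrow> real"
  assumes s: "0 \<le> s" "s \<le> 1" and [measurable]: "h \<in> borel_measurable (point_algebra L)"
  shows "(\<integral>p. h (fst p) \<partial>coupling s) = (\<integral>\<tau>. h \<tau> \<partial>Q)" "(\<integral>p. h (snd p) \<partial>coupling s) = (\<integral>\<tau>. h \<tau> \<partial>Q)"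
    and "integrable (coupling s) (\<lambda>p. h (fst p)) \<longleftrightarrow> integrable Q h" "integrable (coupling s) (\<lambda>p. h (snd p)) \<longleftrightarrow> integrable Q h"
proof -
  show "(\<integral>p. h (fst p) \<partial>coupling s) = (\<integral>\<tau>. h \<tau> \<partial>Q)" "(\<integral>p. h (snd p) \<partial>coupling s) = (\<integral>\<tau>. h \<tau> \<partial>Q)"
    using integral_coup_marginal[OF void_prob_algebra assms(3) s] by (simp_all add: void_bind_kern)
  show "integrable (coupling s) (\<lambda>p. h (fst p)) \<longleftrightarrow> integrable Q h"
    by (subst distr_coupling(1)[OF s, symmetric], subst integrable_distr_eq) auto
  show "integrable (coupling s) (\<lambda>p. h (snd p)) \<longleftrightarrow> integrable Q h"
    by (subst distr_coupling(2)[OF s, symmetric], subst integrable_distr_eq) auto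
qed

lemma coupling_product:
  fixes a b :: "'a measure \<Rightarrow> real"
  assumes s: "0 \<le> s" "s \<le> 1"
    and [measurable]: "a \<in> borel_measurable (point_algebra L)" "b \<in> borel_measurable (point_algebra L)"
    and a2: "integrable Q (\<lambda>\<tau>. (a \<tau>)\<^sup>2)" and b2: "integrable Q (\<lambda>\<tau>. (b \<tau>)\<^sup>2)"
  shows "integrable (coupling s) (\<lambda>p. a (fst p) * b (snd p))"
    and "\<bar>\<integral>p. a (fst p) * b (snd p) \<partial>coupling s\<bar> \<le> ((\<integral>\<tau>. (a \<tau>)\<^sup>2 \<partial>Q) + (\<integral>\<tau>. (b \<tau>)\<^sup>2 \<partial>Q)) / 2"
proof -
  let ?s = "(\<integral>\<tau>. (a \<tau>)\<^sup>2 \<partial>Q) + (\<integral>\<tau>. (b \<tau>)\<^sup>2 \<partial>Q)"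
  have ab: "\<bar>x * y\<bar> \<le> (x\<^sup>2 + y\<^sup>2) / 2" for x y :: real
    using sum_squares_bound[of "\<bar>x\<bar>" "\<bar>y\<bar>"] by (simp add: abs_mult)
  have int2: "integrable (coupling s) (\<lambda>p. ((a (fst p))\<^sup>2 + (b (snd p))\<^sup>2) / 2)"
    using a2 b2 coupling_marginal_real(3)[OF s, of "\<lambda>\<tau>. (a \<tau>)\<^sup>2"] coupling_marginal_real(4)[OF s, of "\<lambda>\<tau>. (b \<tau>)\<^sup>2"] by simp
  show int: "integrable (coupling s) (\<lambda>p. a (fst p) * b (snd p))"
    by (rule Bochner_Integration.integrable_bound[OF int2]) (use ab in \<open>auto intro!: AE_I2 order_trans[OF ab]\<close>)
  have "(\<integral>p. \<bar>a (fst p) * b (snd p)\<bar> \<partial>coupling s) \<le> (\<integral>p. ((a (fst p))\<^sup>2 + (b (snd p))\<^sup>2) / 2 \<partial>coupling s)"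
    using int int2 ab by (intro integral_mono integrable_abs) auto
  also have "... = ?s / 2"
    using a2 b2 coupling_marginal_real[OF s, of "\<lambda>\<tau>. (a \<tau>)\<^sup>2"] coupling_marginal_real[OF s, of "\<lambda>\<tau>. (b \<tau>)\<^sup>2"] by simp
  finally have le: "(\<integral>p. \<bar>a (fst p) * b (snd p)\<bar> \<partial>coupling s) \<le> ?s / 2" .
  show "\<bar>\<integral>p. a (fst p) * b (snd p) \<partial>coupling s\<bar> \<le> ?s / 2"
    using le integral_abs_bound[of "coupling s" "\<lambda>p. a (fst p) * b (snd p)"] by linarith
qed

text \<open>
  For \<open>s = 0\<close> the copies are conditionally independent given the exterior, so the mean of the product is
  the mean of a product of conditional means.
\<close>

lemma window_correlation_bounded:
  fixes F G :: "'a measure \<Rightarrow> real"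
  assumes [measurable]: "F \<in> borel_measurable (point_algebra L)" "G \<in> borel_measurable (point_algebra L)"
    and F: "\<And>\<mu>. \<mu> \<in> space (point_algebra L) \<Longrightarrow> \<bar>F \<mu>\<bar> \<le> C" and G: "\<And>\<mu>. \<mu> \<in> space (point_algebra L) \<Longrightarrow> \<bar>G \<mu>\<bar> \<le> C"
  shows "ennreal ((\<integral>p. F (fst p) * G (snd p) \<partial>coupling 0)\<^sup>2) \<le> window_form L Q B F * (\<integral>\<^sup>+\<tau>. ennreal ((G \<tau>)\<^sup>2) \<partial>Q)" (is "_ \<le> ?r")
proof -
  let ?P = "\<lambda>F u. \<integral>\<tau>. F \<tau> \<partial>kern 1 u"
  let ?c = "\<integral>p. F (fst p) * G (snd p) \<partial>coupling 0"
  have c: "?c = (\<integral>u. ?P F u * ?P G u \<partial>void)"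
    using integral_coup_endpoints(2)[OF void_prob_algebra assms(1,2) F G] by simp
  have "ennreal \<bar>?c\<bar> \<le> (\<integral>\<^sup>+u. ennreal \<bar>?P F u * ?P G u\<bar> \<partial>void)"
  proof (cases "integrable void (\<lambda>u. ?P F u * ?P G u)")
    case True
    then show ?thesis using integral_norm_bound_ennreal[OF True] by (simp add: c)
  qed (simp add: c not_integrable_integral_eq)
  then have "(ennreal \<bar>?c\<bar>)\<^sup>2 \<le> (\<integral>\<^sup>+u. ennreal \<bar>?P F u\<bar> * ennreal \<bar>?P G u\<bar> \<partial>void)\<^sup>2"
    by (intro power_mono) (auto simp: abs_mult ennreal_mult)
  also have "... \<le> (\<integral>\<^sup>+u. (ennreal \<bar>?P F u\<bar>)\<^sup>2 \<partial>void) * (\<integral>\<^sup>+u. (ennreal \<bar>?P G u\<bar>)\<^sup>2 \<partial>void)"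
    by (rule Cauchy_Schwarz_nn_integral) measurable
  also have "... = window_form L Q B F * window_form L Q B G"
    by (simp add: window_form_def ennreal_power)
  also have "... \<le> ?r"
    by (intro mult_left_mono window_form_le) auto
  finally show ?thesis by (simp add: ennreal_power)
qed

lemma clamp_L2_tendsto:
  assumes [measurable]: "F \<in> borel_measurable (point_algebra L)" and F2: "integrable Q (\<lambda>\<tau>. (F \<tau>)\<^sup>2)"
  shows "(\<lambda>k. \<integral>\<^sup>+\<tau>. ennreal ((clamp_real (real k) (F \<tau>) - F \<tau>)\<^sup>2) \<partial>Q) \<longlonglongrightarrow> 0"
proof -
  have "(\<lambda>k. \<integral>\<^sup>+\<tau>. ennreal ((clamp_real (real k) (F \<tau>) - F \<tau>)\<^sup>2) \<partial>Q) \<longlonglongrightarrow> (\<integral>\<^sup>+\<tau>. 0 \<partial>Q)"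
  proof (rule nn_integral_dominated_convergence[where w = "\<lambda>\<tau>. ennreal (4 * (F \<tau>)\<^sup>2)"])
    show "AE \<tau> in Q. (\<lambda>k. ennreal ((clamp_real (real k) (F \<tau>) - F \<tau>)\<^sup>2)) \<longlonglongrightarrow> 0"
    proof (rule AE_I2)
      fix \<tau>
      have "(\<lambda>k. (clamp_real (real k) (F \<tau>) - F \<tau>)\<^sup>2) \<longlonglongrightarrow> (F \<tau> - F \<tau>)\<^sup>2"
        by (intro tendsto_intros clamp_real_tendsto)
      from tendsto_ennrealI[OF this] show "(\<lambda>k. ennreal ((clamp_real (real k) (F \<tau>) - F \<tau>)\<^sup>2)) \<longlonglongrightarrow> 0"
        by (simp only: diff_self zero_power2 ennreal_0)
    qed
    show "AE \<tau> in Q. ennreal ((clamp_real (real k) (F \<tau>) - F \<tau>)\<^sup>2) \<le> ennreal (4 * (F \<tau>)\<^sup>2)" for k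
    proof (rule AE_I2)
      fix \<tau>
      have "\<bar>clamp_real (real k) (F \<tau>) - F \<tau>\<bar> \<le> 2 * \<bar>F \<tau>\<bar>" using clamp_real_bounds(2)[of "real k" "F \<tau>"] by linarith
      then have "\<bar>clamp_real (real k) (F \<tau>) - F \<tau>\<bar>\<^sup>2 \<le> (2 * \<bar>F \<tau>\<bar>)\<^sup>2" by (intro power_mono) auto
      then show "ennreal ((clamp_real (real k) (F \<tau>) - F \<tau>)\<^sup>2) \<le> ennreal (4 * (F \<tau>)\<^sup>2)"
        by (intro ennreal_leI) (simp add: power_mult_distrib)
    qed
    show "(\<integral>\<^sup>+\<tau>. ennreal (4 * (F \<tau>)\<^sup>2) \<partial>Q) < \<infinity>"
      using F2 by (simp add: integrable_iff_bounded ennreal_mult nn_integral_cmult ennreal_mult_less_top)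
  qed measurable
  then show ?thesis by simp
qed

lemma coupling_product_tendsto:
  fixes a b :: "'a measure \<Rightarrow> real" and a' b' :: "nat \<Rightarrow> 'a measure \<Rightarrow> real"
  assumes s: "0 \<le> s" "s \<le> 1"
    and [measurable]: "a \<in> borel_measurable (point_algebra L)" "b \<in> borel_measurable (point_algebra L)"
      "\<And>k. a' k \<in> borel_measurable (point_algebra L)" "\<And>k. b' k \<in> borel_measurable (point_algebra L)"
      "d \<in> borel_measurable (point_algebra L)" "d' \<in> borel_measurable (point_algebra L)"
    and d2: "integrable Q (\<lambda>\<tau>. (d \<tau>)\<^sup>2)" and d'2: "integrable Q (\<lambda>\<tau>. (d' \<tau>)\<^sup>2)"
    and le: "\<And>k \<tau>. \<bar>a' k \<tau>\<bar> \<le> d \<tau>" "\<And>k \<tau>. \<bar>b' k \<tau>\<bar> \<le> d' \<tau>"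
    and lim: "\<And>\<tau>. (\<lambda>k. a' k \<tau>) \<longlonglongrightarrow> a \<tau>" "\<And>\<tau>. (\<lambda>k. b' k \<tau>) \<longlonglongrightarrow> b \<tau>"
  shows "(\<lambda>k. \<integral>p. a' k (fst p) * b' k (snd p) \<partial>coupling s) \<longlonglongrightarrow> (\<integral>p. a (fst p) * b (snd p) \<partial>coupling s)"
proof (rule integral_dominated_convergence[where w = "\<lambda>p. d (fst p) * d' (snd p)"])
  show "integrable (coupling s) (\<lambda>p. d (fst p) * d' (snd p))"
    by (rule coupling_product(1)[OF s]) (use d2 d'2 in auto)
  show "AE p in coupling s. (\<lambda>k. a' k (fst p) * b' k (snd p)) \<longlonglongrightarrow> a (fst p) * b (snd p)"
    by (intro AE_I2 tendsto_mult lim)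
  show "AE p in coupling s. norm (a' k (fst p) * b' k (snd p)) \<le> d (fst p) * d' (snd p)" for k
    using le order_trans[OF abs_ge_zero le(1)] by (intro AE_I2) (auto simp: abs_mult intro!: mult_mono)
qed measurable

text \<open>Truncation costs the factor 2, which is harmless because the right-hand side will tend to zero.\<close>

theorem window_correlation_le:
  fixes F G :: "'a measure \<Rightarrow> real"
  assumes [measurable]: "F \<in> borel_measurable (point_algebra L)" "G \<in> borel_measurable (point_algebra L)"
    and F2: "integrable Q (\<lambda>\<tau>. (F \<tau>)\<^sup>2)" and G2: "integrable Q (\<lambda>\<tau>. (G \<tau>)\<^sup>2)"
  shows "ennreal ((\<integral>p. F (fst p) * G (snd p) \<partial>coupling 0)\<^sup>2) \<le>
    (\<integral>\<^sup>+\<tau>. ennreal ((G \<tau>)\<^sup>2) \<partial>Q) * (2 * window_form L Q B F)"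
proof -
  let ?F = "\<lambda>k \<tau>. clamp_real (real k) (F \<tau>)" and ?G = "\<lambda>k \<tau>. clamp_real (real k) (G \<tau>)"
  let ?I = "\<integral>\<^sup>+\<tau>. ennreal ((G \<tau>)\<^sup>2) \<partial>Q"
  let ?d = "\<lambda>k. \<integral>\<^sup>+\<tau>. ennreal ((?F k \<tau> - F \<tau>)\<^sup>2) \<partial>Q"
  have I: "?I < top" using G2 by (simp add: integrable_iff_bounded)
  have intF: "integrable Q F" by (rule integrable_of_square) (use F2 in auto)
  have "ennreal ((\<integral>p. ?F k (fst p) * ?G k (snd p) \<partial>coupling 0)\<^sup>2) \<le> ?I * (2 * window_form L Q B F + 2 * ?d k)" for k
  proof -
    have int_k: "integrable Q (?F k)"
      by (rule Q.integrable_const_bound[where B = "real k"]) (auto simp: clamp_real_bounds)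
    have "ennreal ((\<integral>p. ?F k (fst p) * ?G k (snd p) \<partial>coupling 0)\<^sup>2) \<le> window_form L Q B (?F k) * (\<integral>\<^sup>+\<tau>. ennreal ((?G k \<tau>)\<^sup>2) \<partial>Q)"
      by (rule window_correlation_bounded[where C = "real k"]) (auto simp: clamp_real_bounds)
    also have "... \<le> (2 * window_form L Q B F + 2 * ?d k) * ?I"
    proof (rule mult_mono)
      have "window_form L Q B (?F k) = window_form L Q B (\<lambda>\<tau>. F \<tau> + (?F k \<tau> - F \<tau>))" by simp
      also have "... \<le> 2 * window_form L Q B F + 2 * window_form L Q B (\<lambda>\<tau>. ?F k \<tau> - F \<tau>)"
        by (rule window_form_add) (use intF int_k in auto)
      also have "... \<le> 2 * window_form L Q B F + 2 * ?d k"
        by (intro add_left_mono mult_left_mono window_form_le) auto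
      finally show "window_form L Q B (?F k) \<le> 2 * window_form L Q B F + 2 * ?d k" .
      show "(\<integral>\<^sup>+\<tau>. ennreal ((?G k \<tau>)\<^sup>2) \<partial>Q) \<le> ?I"
        using clamp_real_bounds(2)[of "real k"] by (intro nn_integral_mono ennreal_leI) (simp add: abs_le_square_iff)
    qed auto
    finally show ?thesis by (simp add: mult.commute)
  qed
  moreover have "(\<lambda>k. ?I * (2 * window_form L Q B F + 2 * ?d k)) \<longlonglongrightarrow> ?I * (2 * window_form L Q B F + 2 * 0)"
    using I by (intro ennreal_tendsto_cmult tendsto_add tendsto_const clamp_L2_tendsto F2) auto
  moreover have "(\<lambda>k. ennreal ((\<integral>p. ?F k (fst p) * ?G k (snd p) \<partial>coupling 0)\<^sup>2)) \<longlonglongrightarrow>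
      ennreal ((\<integral>p. F (fst p) * G (snd p) \<partial>coupling 0)\<^sup>2)"
    by (intro tendsto_ennrealI tendsto_power
        coupling_product_tendsto[where d = "\<lambda>\<tau>. \<bar>F \<tau>\<bar>" and d' = "\<lambda>\<tau>. \<bar>G \<tau>\<bar>"] clamp_real_tendsto)
       (use F2 G2 in \<open>auto simp: clamp_real_bounds\<close>)
  ultimately show ?thesis
    by (intro LIMSEQ_le[of "\<lambda>k. ennreal ((\<integral>p. ?F k (fst p) * ?G k (snd p) \<partial>coupling 0)\<^sup>2)" _
        "\<lambda>k. ?I * (2 * window_form L Q B F + 2 * ?d k)"]) auto
qed

text \<open>
  The formula for bounded functions is applied to truncations of \<open>F\<close>. Truncation does not increase increments,
  and neither does \<open>f\<close>, so the second moments of \<open>diff_op y F\<close> dominate the passage to the limit.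
\<close>

theorem coupling_covariance:
  fixes F :: "'a measure \<Rightarrow> real" and f :: "real \<Rightarrow> real"
  assumes F[measurable]: "F \<in> borel_measurable (point_algebra L)" and F2: "integrable Q (\<lambda>\<tau>. (F \<tau>)\<^sup>2)"
    and DF: "(\<integral>\<^sup>+y. (\<integral>\<^sup>+\<tau>. ennreal ((diff_op y F \<tau>)\<^sup>2) \<partial>Q) \<partial>restricted L B) < \<infinity>"
    and f: "1-lipschitz_on UNIV f"
  shows "(\<integral>\<tau>. f (F \<tau>) * F \<tau> \<partial>Q) - (\<integral>p. f (F (fst p)) * F (snd p) \<partial>coupling 0) =
    (\<integral>s. indicator {0..1} s * (\<integral>y. (\<integral>p. diff_op y (\<lambda>\<tau>. f (F \<tau>)) (fst p) * diff_op y F (snd p) \<partial>coupling s) \<partial>restricted L B) \<partial>lborel)"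
proof -
  let ?d = "\<lambda>y. diff_op y F"
  have lip: "\<bar>f x - f y\<bar> \<le> \<bar>x - y\<bar>" for x y
    using lipschitz_onD[OF f, of x y] by (simp add: dist_real_def)
  have [measurable]: "f \<in> borel_measurable borel"
    using lipschitz_on_continuous_on[OF f] by (rule borel_measurable_continuous_onI)
  have f_lim: "(\<lambda>k. f (u k)) \<longlonglongrightarrow> f x" if "u \<longlonglongrightarrow> x" for u :: "nat \<Rightarrow> real" and x
    using continuous_on_tendsto_compose[OF lipschitz_on_continuous_on[OF f] that] by simp
  define Fk where "Fk k \<tau> = clamp_real (real k) (F \<tau>)" for k \<tau>
  have [measurable]: "Fk k \<in> borel_measurable (point_algebra L)" for k unfolding Fk_def by measurable
  have Fk_lim: "(\<lambda>k. Fk k \<tau>) \<longlonglongrightarrow> F \<tau>" for \<tau> unfolding Fk_def by (rule clamp_real_tendsto)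
  have Fk_le: "\<bar>Fk k \<tau>\<bar> \<le> real k" "\<bar>Fk k \<tau>\<bar> \<le> \<bar>F \<tau>\<bar>" for k \<tau> by (simp_all add: Fk_def clamp_real_bounds)
  have fFk_le: "\<bar>f (Fk k \<tau>)\<bar> \<le> \<bar>f 0\<bar> + real k" "\<bar>f (Fk k \<tau>)\<bar> \<le> \<bar>f 0\<bar> + \<bar>F \<tau>\<bar>" for k \<tau>
    using lip[of "Fk k \<tau>" 0] Fk_le[of k \<tau>] by linarith+
  have diff_le: "\<bar>diff_op y (Fk k) \<tau>\<bar> \<le> \<bar>?d y \<tau>\<bar>" "\<bar>diff_op y (\<lambda>\<tau>. f (Fk k \<tau>)) \<tau>\<bar> \<le> \<bar>?d y \<tau>\<bar>" for k y \<tau>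
  proof -
    show 1: "\<bar>diff_op y (Fk k) \<tau>\<bar> \<le> \<bar>?d y \<tau>\<bar>" by (simp add: diff_op_def Fk_def clamp_real_bounds)
    have "\<bar>diff_op y (\<lambda>\<tau>. f (Fk k \<tau>)) \<tau>\<bar> \<le> \<bar>diff_op y (Fk k) \<tau>\<bar>" by (simp add: diff_op_def lip)
    with 1 show "\<bar>diff_op y (\<lambda>\<tau>. f (Fk k \<tau>)) \<tau>\<bar> \<le> \<bar>?d y \<tau>\<bar>" by simp
  qed
  have [measurable]: "(\<lambda>(\<tau>, y). diff_op y g \<tau>) \<in> borel_measurable (point_algebra L \<Otimes>\<^sub>M L)"
    if "g \<in> borel_measurable (point_algebra L)" for g :: "'a measure \<Rightarrow> real"
    using that unfolding diff_op_def by measurable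
  have dm[measurable]: "diff_op y g \<in> borel_measurable (point_algebra L)"
    if "g \<in> borel_measurable (point_algebra L)" "y \<in> space L" for g :: "'a measure \<Rightarrow> real" and y
    using that unfolding diff_op_def[abs_def] by measurable
  let ?\<nu> = "restricted L B"
  define v where "v y = (\<integral>\<tau>. (?d y \<tau>)\<^sup>2 \<partial>Q)" for y
  have [measurable]: "v \<in> borel_measurable ?\<nu>"
    unfolding v_def by (rule measurable_lebesgue_integral_kernel[where Y = "point_algebra L"]) (use Q_prob_algebra in measurable)
  have "AE y in ?\<nu>. (\<integral>\<^sup>+\<tau>. ennreal ((?d y \<tau>)\<^sup>2) \<partial>Q) \<noteq> \<infinity>"
    using DF by (intro nn_integral_PInf_AE) auto
  then have good: "AE y in ?\<nu>. y \<in> space L \<and> integrable Q (\<lambda>\<tau>. (?d y \<tau>)\<^sup>2)"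
    using AE_space by eventually_elim (auto simp: integrable_iff_bounded less_top)
  have int_v: "integrable ?\<nu> v"
  proof (rule integrableI_bounded)
    have "(\<integral>\<^sup>+y. ennreal (norm (v y)) \<partial>?\<nu>) = (\<integral>\<^sup>+y. (\<integral>\<^sup>+\<tau>. ennreal ((?d y \<tau>)\<^sup>2) \<partial>Q) \<partial>?\<nu>)"
    proof (rule nn_integral_cong_AE)
      show "AE y in ?\<nu>. ennreal (norm (v y)) = (\<integral>\<^sup>+\<tau>. ennreal ((?d y \<tau>)\<^sup>2) \<partial>Q)"
        using good by eventually_elim (simp add: v_def nn_integral_eq_integral)
    qed
    then show "(\<integral>\<^sup>+y. ennreal (norm (v y)) \<partial>?\<nu>) < \<infinity>" using DF by simp
  qed measurable
  define ek where "ek k s y = (\<integral>p. diff_op y (\<lambda>\<tau>. f (Fk k \<tau>)) (fst p) * diff_op y (Fk k) (snd p) \<partial>coupling s)" for k s y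
  define e where "e s y = (\<integral>p. diff_op y (\<lambda>\<tau>. f (F \<tau>)) (fst p) * ?d y (snd p) \<partial>coupling s)" for s y
  note [measurable] = measurable_coup[OF void_prob_algebra, of 1]
  have [measurable]: "(\<lambda>(s, y). ek k s y) \<in> borel_measurable (borel \<Otimes>\<^sub>M ?\<nu>)" "(\<lambda>(s, y). e s y) \<in> borel_measurable (borel \<Otimes>\<^sub>M ?\<nu>)" for k
    unfolding ek_def e_def diff_op_def by measurable
  have [measurable]: "ek k s \<in> borel_measurable ?\<nu>" "e s \<in> borel_measurable ?\<nu>" for k s by measurable
  have [measurable]: "(\<lambda>s. \<integral>y. ek k s y \<partial>?\<nu>) \<in> borel_measurable borel" "(\<lambda>s. \<integral>y. e s y \<partial>?\<nu>) \<in> borel_measurable borel" for k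
    by measurable
  have ek_le: "AE y in ?\<nu>. \<bar>ek k s y\<bar> \<le> v y" if s: "0 \<le> s" "s \<le> 1" for k s
    using good
  proof eventually_elim
    case (elim y)
    have sq: "integrable Q (\<lambda>\<tau>. (diff_op y (Fk k) \<tau>)\<^sup>2)" "integrable Q (\<lambda>\<tau>. (diff_op y (\<lambda>\<tau>. f (Fk k \<tau>)) \<tau>)\<^sup>2)"
      using elim diff_le by (auto intro!: Bochner_Integration.integrable_bound[of Q "\<lambda>\<tau>. (?d y \<tau>)\<^sup>2"] simp: abs_le_square_iff)
    have le: "(\<integral>\<tau>. (diff_op y (Fk k) \<tau>)\<^sup>2 \<partial>Q) \<le> v y" "(\<integral>\<tau>. (diff_op y (\<lambda>\<tau>. f (Fk k \<tau>)) \<tau>)\<^sup>2 \<partial>Q) \<le> v y"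
      unfolding v_def using elim sq diff_le by (auto intro!: integral_mono simp: abs_le_square_iff[symmetric])
    have "\<bar>ek k s y\<bar> \<le> ((\<integral>\<tau>. (diff_op y (\<lambda>\<tau>. f (Fk k \<tau>)) \<tau>)\<^sup>2 \<partial>Q) + (\<integral>\<tau>. (diff_op y (Fk k) \<tau>)\<^sup>2 \<partial>Q)) / 2"
      unfolding ek_def using sq elim by (intro coupling_product(2)[OF s]) auto
    then show ?case using le by simp
  qed
  have e_lim: "AE y in ?\<nu>. (\<lambda>k. ek k s y) \<longlonglongrightarrow> e s y" if s: "0 \<le> s" "s \<le> 1" for s
    using good
  proof eventually_elim
    case (elim y)
    show ?case
      unfolding ek_def e_def
      by (rule coupling_product_tendsto[OF s, where d = "\<lambda>\<tau>. \<bar>?d y \<tau>\<bar>" and d' = "\<lambda>\<tau>. \<bar>?d y \<tau>\<bar>"])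
         (use elim diff_le in \<open>auto simp: diff_op_def intro!: tendsto_diff f_lim Fk_lim\<close>)
  qed
  have inner_lim: "(\<lambda>k. \<integral>y. ek k s y \<partial>?\<nu>) \<longlonglongrightarrow> (\<integral>y. e s y \<partial>?\<nu>)" if s: "0 \<le> s" "s \<le> 1" for s
    by (rule integral_dominated_convergence[where w = v]) (use int_v ek_le[OF s] e_lim[OF s] in auto)
  have inner_le: "\<bar>\<integral>y. ek k s y \<partial>?\<nu>\<bar> \<le> (\<integral>y. v y \<partial>?\<nu>)" if s: "0 \<le> s" "s \<le> 1" for k s
  proof -
    have int: "integrable ?\<nu> (ek k s)"
      by (rule Bochner_Integration.integrable_bound[OF int_v]) (use ek_le[OF s, of k] in \<open>auto elim!: eventually_mono\<close>)
    have "\<bar>\<integral>y. ek k s y \<partial>?\<nu>\<bar> \<le> (\<integral>y. \<bar>ek k s y\<bar> \<partial>?\<nu>)" by (rule integral_abs_bound)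
    also have "... \<le> (\<integral>y. v y \<partial>?\<nu>)" using int int_v ek_le[OF s, of k] by (intro integral_mono_AE) auto
    finally show ?thesis .
  qed
  have rhs: "(\<lambda>k. \<integral>s. indicator {0..1} s * (\<integral>y. ek k s y \<partial>?\<nu>) \<partial>lborel) \<longlonglongrightarrow> (\<integral>s. indicator {0..1} s * (\<integral>y. e s y \<partial>?\<nu>) \<partial>lborel)"
  proof (rule integral_dominated_convergence[where w = "\<lambda>s. indicator {0..1} s * (\<integral>y. v y \<partial>?\<nu>)"])
    show "integrable lborel (\<lambda>s::real. indicator {0..1} s * (\<integral>y. v y \<partial>?\<nu>))"
      by (intro integrable_mult_left) (auto simp: emeasure_lborel_Icc_eq)
    show "AE s in lborel. (\<lambda>k. indicator {0..1} s * (\<integral>y. ek k s y \<partial>?\<nu>)) \<longlonglongrightarrow> indicator {0..1} s * (\<integral>y. e s y \<partial>?\<nu>)"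
      using inner_lim by (intro AE_I2) (auto simp: indicator_def)
    show "AE s in lborel. norm (indicator {0..1} s * (\<integral>y. ek k s y \<partial>?\<nu>)) \<le> indicator {0..1} s * (\<integral>y. v y \<partial>?\<nu>)" for k
      using inner_le by (intro AE_I2) (auto simp: indicator_def)
  qed measurable
  have fb2: "integrable Q (\<lambda>\<tau>. (\<bar>f 0\<bar> + \<bar>F \<tau>\<bar>)\<^sup>2)"
    using F2 integrable_of_square[OF F F2] by (simp add: power2_sum)
  have lhs2: "(\<lambda>k. \<integral>p. f (Fk k (fst p)) * Fk k (snd p) \<partial>coupling 0) \<longlonglongrightarrow> (\<integral>p. f (F (fst p)) * F (snd p) \<partial>coupling 0)"
    by (rule coupling_product_tendsto[where d = "\<lambda>\<tau>. \<bar>f 0\<bar> + \<bar>F \<tau>\<bar>" and d' = "\<lambda>\<tau>. \<bar>F \<tau>\<bar>"])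
       (use F2 fb2 fFk_le Fk_le Fk_lim f_lim in auto)
  have lhs1: "(\<lambda>k. \<integral>\<tau>. f (Fk k \<tau>) * Fk k \<tau> \<partial>Q) \<longlonglongrightarrow> (\<integral>\<tau>. f (F \<tau>) * F \<tau> \<partial>Q)"
  proof (rule integral_dominated_convergence[where w = "\<lambda>\<tau>. (\<bar>f 0\<bar> + \<bar>F \<tau>\<bar>) * \<bar>F \<tau>\<bar>"])
    show "integrable Q (\<lambda>\<tau>. (\<bar>f 0\<bar> + \<bar>F \<tau>\<bar>) * \<bar>F \<tau>\<bar>)"
      using F2 integrable_of_square[OF F F2] by (simp add: distrib_right power2_eq_square[symmetric] abs_mult_self_eq)
    show "AE \<tau> in Q. norm (f (Fk k \<tau>) * Fk k \<tau>) \<le> (\<bar>f 0\<bar> + \<bar>F \<tau>\<bar>) * \<bar>F \<tau>\<bar>" for k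
      using fFk_le Fk_le by (intro AE_I2) (auto simp: abs_mult intro!: mult_mono)
    show "AE \<tau> in Q. (\<lambda>k. f (Fk k \<tau>) * Fk k \<tau>) \<longlonglongrightarrow> f (F \<tau>) * F \<tau>"
      by (intro AE_I2 tendsto_mult f_lim Fk_lim)
  qed measurable
  have eq: "(\<integral>\<tau>. f (Fk k \<tau>) * Fk k \<tau> \<partial>Q) - (\<integral>p. f (Fk k (fst p)) * Fk k (snd p) \<partial>coupling 0) =
     (\<integral>s. indicator {0..1} s * (\<integral>y. ek k s y \<partial>?\<nu>) \<partial>lborel)" for k
  proof -
    have b: "\<bar>f (Fk k \<tau>)\<bar> \<le> \<bar>f 0\<bar> + real k" "\<bar>Fk k \<tau>\<bar> \<le> \<bar>f 0\<bar> + real k" for \<tau>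
      using fFk_le(1)[of k \<tau>] Fk_le(1)[of k \<tau>] by auto
    have "(\<integral>p. f (Fk k (fst p)) * Fk k (snd p) \<partial>coupling 1) - (\<integral>p. f (Fk k (fst p)) * Fk k (snd p) \<partial>coupling 0) =
      (\<integral>s. indicator {0..1} s * (\<integral>y. ek k s y \<partial>?\<nu>) \<partial>lborel)"
      unfolding ek_def diff_op_def by (rule coup_covariance[OF void_prob_algebra _ _ _ b]) auto
    moreover have "(\<integral>p. f (Fk k (fst p)) * Fk k (snd p) \<partial>coupling 1) = (\<integral>\<tau>. f (Fk k \<tau>) * Fk k \<tau> \<partial>Q)"
      by (subst integral_coup_endpoints(1)[OF void_prob_algebra _ _ b]) (auto simp: void_bind_kern)
    ultimately show ?thesis by simp
  qed
  have "(\<lambda>k. \<integral>s. indicator {0..1} s * (\<integral>y. ek k s y \<partial>?\<nu>) \<partial>lborel) \<longlonglongrightarrow>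
     (\<integral>\<tau>. f (F \<tau>) * F \<tau> \<partial>Q) - (\<integral>p. f (F (fst p)) * F (snd p) \<partial>coupling 0)"
    unfolding eq[symmetric] by (rule tendsto_diff[OF lhs1 lhs2])
  from LIMSEQ_unique[OF this rhs] show ?thesis unfolding e_def .
qed

end

lemma (in poisson_kicks) integral_coup_eq_coup_mean:
  assumes W: "W \<in> space (prob_algebra N)" and H[measurable]: "H \<in> borel_measurable (N \<Otimes>\<^sub>M N)"
    and C: "\<And>\<tau> \<tau>'. \<tau> \<in> space N \<Longrightarrow> \<tau>' \<in> space N \<Longrightarrow> \<bar>H (\<tau>, \<tau>')\<bar> \<le> C"
  shows "(\<integral>p. H p \<partial>coup W t s) = (\<integral>u. coup_mean t s H u \<partial>W)" (is "?l = ?r")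
proof -
  have W1: "W \<bind> kern s \<in> space (prob_algebra N)" by (rule bind_kern_in_prob_algebra[OF W])
  then have spW1: "space (W \<bind> kern s) = space N" by (auto simp: space_prob_algebra dest: sets_eq_imp_space_eq)
  have "?l = (\<integral>\<rho>. (\<integral>p. H p \<partial>(kern (t - s) \<rho> \<Otimes>\<^sub>M kern (t - s) \<rho>)) \<partial>(W \<bind> kern s))"
    unfolding coup_def by (rule integral_bind_bounded[OF W1 _ H, where C = C]) (auto simp: space_pair_measure C)
  also have "... = (\<integral>\<rho>. pair_mean (t - s) H \<rho> \<partial>(W \<bind> kern s))"
  proof (rule Bochner_Integration.integral_cong[OF refl])
    fix \<rho> assume "\<rho> \<in> space (W \<bind> kern s)"
    then have \<rho>: "\<rho> \<in> space N" by (simp add: spW1)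
    interpret K: prob_space "kern (t - s) \<rho>" by (rule prob_space_kern[OF \<rho>])
    interpret KK: pair_prob_space "kern (t - s) \<rho>" "kern (t - s) \<rho>" ..
    have "integrable (kern (t - s) \<rho> \<Otimes>\<^sub>M kern (t - s) \<rho>) H"
      by (rule KK.P.integrable_const_bound[where B = C]) (auto simp: space_pair_measure C)
    from KK.integral_fst'[OF this]
    show "(\<integral>p. H p \<partial>(kern (t - s) \<rho> \<Otimes>\<^sub>M kern (t - s) \<rho>)) = pair_mean (t - s) H \<rho>"
      by (simp add: pair_mean_def)
  qed
  also have "... = ?r"
    unfolding coup_mean_def
    by (rule integral_bind_bounded[OF W, where C = C]) (auto intro: abs_pair_mean_le C)
  finally show ?thesis .
qed

context mecke_window
begin

text \<open>
  The inequality \<open>poincare_coup\<close> leaves the variance of the conditional mean given the exterior, to which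
  \<open>poincare\<close> applies. A common bound \<open>E\<close> of joint and separate increments makes the total independent of
  \<open>s\<close>: the weights \<open>s\<close> and \<open>1 - s\<close> inside \<open>B\<close> add up to the weight 1 outside \<open>B\<close>.
\<close>

lemma poincare_coupling_bounded:
  assumes s: "0 \<le> s" "s \<le> 1" and H[measurable]: "H \<in> borel_measurable (point_algebra L \<Otimes>\<^sub>M point_algebra L)"
    and C: "\<And>\<tau> \<tau>'. \<tau> \<in> space (point_algebra L) \<Longrightarrow> \<tau>' \<in> space (point_algebra L) \<Longrightarrow> \<bar>H (\<tau>, \<tau>')\<bar> \<le> C"
    and E[measurable]: "E \<in> borel_measurable L"
    and D12: "AE y in L. (\<integral>\<^sup>+p. ennreal ((H (add_dirac (fst p) y, add_dirac (snd p) y) - H p)\<^sup>2) \<partial>coupling s) \<le> E y"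
    and D1D2: "AE y in L. (\<integral>\<^sup>+p. ennreal ((H (add_dirac (fst p) y, snd p) - H p)\<^sup>2) +
       ennreal ((H (fst p, add_dirac (snd p) y) - H p)\<^sup>2) \<partial>coupling s) \<le> E y"
  shows "(\<integral>\<^sup>+p. ennreal ((H p - (\<integral>p. H p \<partial>coupling s))\<^sup>2) \<partial>coupling s) \<le> (\<integral>\<^sup>+y. E y \<partial>L)" (is "_ \<le> ?r")
proof -
  interpret cp: prob_space "coupling s" by (rule prob_space_coupling)
  interpret V: mecke_process "restricted L (space L - B)" void by unfold_locales (rule mecke_void)
  define m where "m = (\<integral>p. H p \<partial>coupling s)"
  define G where "G p = H p - m" for p
  have [measurable]: "G \<in> borel_measurable (point_algebra L \<Otimes>\<^sub>M point_algebra L)" unfolding G_def[abs_def] by measurable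
  have Gd: "G p - G p' = H p - H p'" for p p' by (simp add: G_def)
  have Gb: "\<bar>G (\<tau>, \<tau>')\<bar> \<le> C + \<bar>m\<bar>" if "\<tau> \<in> space (point_algebra L)" "\<tau>' \<in> space (point_algebra L)" for \<tau> \<tau>'
    using C[OF that] by (simp add: G_def)
  let ?h = "coup_mean 1 s G"
  have int_H: "integrable (coupling s) H"
    using C by (intro cp.integrable_const_bound[where B = C]) (auto simp: space_coupling)
  then have "(\<integral>p. G p \<partial>coupling s) = 0" by (simp add: G_def m_def cp.prob_space)
  then have h0: "(\<integral>u. ?h u \<partial>void) = 0"
    using integral_coup_eq_coup_mean[where H = G and C = "C + \<bar>m\<bar>", OF void_prob_algebra _ Gb, of 1 s] by simp
  have hb: "\<bar>?h u\<bar> \<le> C + \<bar>m\<bar>" if "u \<in> space (point_algebra L)" for u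
    using that by (intro abs_coup_mean_le[where H = G] Gb) auto
  have AEr: "AE y in restricted L A. P y" if "AE y in L. P y" "A \<in> sets L" for A P
    using that unfolding restricted_def by (subst AE_density) auto
  let ?D12 = "\<lambda>y. \<integral>\<^sup>+p. ennreal ((G (add_dirac (fst p) y, add_dirac (snd p) y) - G p)\<^sup>2) \<partial>coupling s"
  have D12': "AE y in restricted L A. ?D12 y \<le> E y" if "A \<in> sets L" for A
    unfolding Gd by (rule AEr[OF D12 that])
  have out: "(\<integral>\<^sup>+u. ennreal ((?h u)\<^sup>2) \<partial>void) \<le> (\<integral>\<^sup>+y. E y \<partial>restricted L (space L - B))" (is "?l1 \<le> ?r1")
  proof -
    have "?l1 \<le> (\<integral>\<^sup>+y. (\<integral>\<^sup>+u. ennreal ((diff_op y ?h u)\<^sup>2) \<partial>void) \<partial>restricted L (space L - B))"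
      using V.poincare[of ?h "C + \<bar>m\<bar>"] hb by (simp add: h0)
    also have "... \<le> ?r1"
    proof (rule nn_integral_mono_AE)
      have "space L - B \<in> sets L" by simp
      from D12'[OF this] show "AE y in restricted L (space L - B). (\<integral>\<^sup>+u. ennreal ((diff_op y ?h u)\<^sup>2) \<partial>void) \<le> E y"
        using AE_space
      proof eventually_elim
        case (elim y)
        then have "y \<in> space (restricted L B)" by simp
        from coup_mean_act_diff[where H = G and C = "C + \<bar>m\<bar>", OF void_prob_algebra _ this Gb, of 1 s] elim
        show ?case by (simp add: diff_op_def)
      qed
    qed
    finally show ?thesis .
  qed
  have "(\<integral>\<^sup>+p. ennreal ((G p)\<^sup>2) \<partial>coupling s) \<le> (\<integral>\<^sup>+u. ennreal ((?h u)\<^sup>2) \<partial>void) +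
      ennreal s * (\<integral>\<^sup>+y. ?D12 y \<partial>restricted L B) +
      ennreal (1 - s) * (\<integral>\<^sup>+y. (\<integral>\<^sup>+p. ennreal ((G (add_dirac (fst p) y, snd p) - G p)\<^sup>2) +
         ennreal ((G (fst p, add_dirac (snd p) y) - G p)\<^sup>2) \<partial>coupling s) \<partial>restricted L B)"
    by (rule poincare_coup[where H = G and C = "C + \<bar>m\<bar>", OF void_prob_algebra s _ Gb]) auto
  also have "... \<le> (\<integral>\<^sup>+y. E y \<partial>restricted L (space L - B)) + ennreal s * (\<integral>\<^sup>+y. E y \<partial>restricted L B) + ennreal (1 - s) * (\<integral>\<^sup>+y. E y \<partial>restricted L B)"
    by (intro add_mono mult_left_mono nn_integral_mono_AE out D12') (simp_all only: Gd B_sets AEr[OF D1D2 B_sets], simp_all)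
  also have "... = (\<integral>\<^sup>+y. E y \<partial>restricted L (space L - B)) + (\<integral>\<^sup>+y. E y \<partial>restricted L B)"
    using s by (simp add: add.assoc flip: distrib_right ennreal_plus)
  also have "... = (\<integral>\<^sup>+y. E y * indicator (space L - B) y + E y * indicator B y \<partial>L)"
    by (simp add: nn_integral_restricted nn_integral_add)
  also have "... = ?r"
    by (intro nn_integral_cong) (auto simp: indicator_def)
  finally show ?thesis by (simp add: G_def m_def)
qed

text \<open>Truncation and Fatou's lemma.\<close>

theorem poincare_coupling:
  assumes s: "0 \<le> s" "s \<le> 1" and H[measurable]: "H \<in> borel_measurable (point_algebra L \<Otimes>\<^sub>M point_algebra L)"
    and int_H: "integrable (coupling s) H"
    and E[measurable]: "E \<in> borel_measurable L"
    and D12: "AE y in L. (\<integral>\<^sup>+p. ennreal ((H (add_dirac (fst p) y, add_dirac (snd p) y) - H p)\<^sup>2) \<partial>coupling s) \<le> E y"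
    and D1D2: "AE y in L. (\<integral>\<^sup>+p. ennreal ((H (add_dirac (fst p) y, snd p) - H p)\<^sup>2) +
       ennreal ((H (fst p, add_dirac (snd p) y) - H p)\<^sup>2) \<partial>coupling s) \<le> E y"
  shows "(\<integral>\<^sup>+p. ennreal ((H p - (\<integral>p. H p \<partial>coupling s))\<^sup>2) \<partial>coupling s) \<le> (\<integral>\<^sup>+y. E y \<partial>L)" (is "?l \<le> ?r")
proof -
  let ?H = "\<lambda>k p. clamp_real (real k) (H p)"
  let ?m = "\<lambda>k. \<integral>p. ?H k p \<partial>coupling s"
  have sq: "ennreal ((?H k p - ?H k p')\<^sup>2) \<le> ennreal ((H p - H p')\<^sup>2)" for k p p'
    using clamp_real_bounds(3)[of "real k" "H p" "H p'"] by (intro ennreal_leI) (simp add: abs_le_square_iff)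
  have k: "(\<integral>\<^sup>+p. ennreal ((?H k p - ?m k)\<^sup>2) \<partial>coupling s) \<le> ?r" for k
  proof (rule poincare_coupling_bounded[OF s, where C = "real k"])
    show "AE y in L. (\<integral>\<^sup>+p. ennreal ((?H k (add_dirac (fst p) y, add_dirac (snd p) y) - ?H k p)\<^sup>2) \<partial>coupling s) \<le> E y"
      using D12 by eventually_elim (erule order_trans[rotated], intro nn_integral_mono sq)
    show "AE y in L. (\<integral>\<^sup>+p. ennreal ((?H k (add_dirac (fst p) y, snd p) - ?H k p)\<^sup>2) +
       ennreal ((?H k (fst p, add_dirac (snd p) y) - ?H k p)\<^sup>2) \<partial>coupling s) \<le> E y"
      using D1D2 by eventually_elim (erule order_trans[rotated], intro nn_integral_mono add_mono sq)
  qed (auto simp: clamp_real_bounds)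
  have m: "?m \<longlonglongrightarrow> (\<integral>p. H p \<partial>coupling s)"
    by (rule integral_dominated_convergence[where w = "\<lambda>p. \<bar>H p\<bar>"])
       (use int_H in \<open>auto simp: clamp_real_bounds clamp_real_tendsto\<close>)
  have "?l =
     (\<integral>\<^sup>+p. liminf (\<lambda>k. ennreal ((?H k p - ?m k)\<^sup>2)) \<partial>coupling s)"
    by (intro nn_integral_cong lim_imp_Liminf[symmetric] tendsto_ennrealI tendsto_intros clamp_real_tendsto m) simp
  also have "... \<le> liminf (\<lambda>k. \<integral>\<^sup>+p. ennreal ((?H k p - ?m k)\<^sup>2) \<partial>coupling s)"
    by (rule nn_integral_liminf) measurable
  also have "... \<le> ?r"
    by (intro Liminf_le always_eventually allI k) simp
  finally show ?thesis .
qed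

end

section \<open>The variance of the product of gradients\<close>

lemma ennreal_le_of_square_le:
  fixes x y :: ennreal
  assumes "x\<^sup>2 \<le> y\<^sup>2"
  shows "x \<le> y"
proof (rule ccontr)
  assume "\<not> x \<le> y"
  then have "y < x" by (simp only: not_le)
  have "y * y < x * x"
  proof (cases "x = top")
    case True
    then show ?thesis using \<open>y < x\<close> by (simp add: ennreal_mult_less_top)
  next
    case False
    have "0 < x" using \<open>y < x\<close> by (rule le_less_trans[OF zero_le])
    have "y * y \<le> y * x" using \<open>y < x\<close> by (intro mult_left_mono) auto
    also have "... < x * x"
      using False \<open>y < x\<close> \<open>0 < x\<close> by (intro ennreal_mult_strict_right_mono) (auto simp: less_top)
    finally show ?thesis .
  qed
  with assms show False by (simp add: power2_eq_square)
qed

lemma measurable_ennreal_powr [measurable (raw)]: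
  "f \<in> borel_measurable X \<Longrightarrow> (\<lambda>x. ennreal_powr (f x) r) \<in> borel_measurable X"
  unfolding ennreal_powr_def by (auto intro!: measurable_If)

lemma ennreal_powr_half_square: "(ennreal_powr x (1/2))\<^sup>2 = x"
proof (cases x)
  case (real r)
  then show ?thesis by (simp add: ennreal_powr_def ennreal_power powr_half_sqrt)
qed (simp add: ennreal_powr_def power2_eq_square)

lemma nn_integral_mult_le_powr_half:
  assumes "f \<in> borel_measurable X" "g \<in> borel_measurable X"
  shows "(\<integral>\<^sup>+x. f x * g x \<partial>X) \<le> ennreal_powr (\<integral>\<^sup>+x. (f x)\<^sup>2 \<partial>X) (1/2) * ennreal_powr (\<integral>\<^sup>+x. (g x)\<^sup>2 \<partial>X) (1/2)"
  by (rule ennreal_le_of_square_le)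
     (use Cauchy_Schwarz_nn_integral[OF assms] in \<open>simp add: power_mult_distrib ennreal_powr_half_square\<close>)

text \<open>Minkowski's inequality, in a form without roots.\<close>

lemma nn_integral_square_add_le:
  fixes \<alpha> \<beta> :: ennreal
  assumes [measurable]: "f \<in> borel_measurable X" "g \<in> borel_measurable X"
    and f: "(\<integral>\<^sup>+x. (f x)\<^sup>2 \<partial>X) \<le> \<alpha>\<^sup>2" and g: "(\<integral>\<^sup>+x. (g x)\<^sup>2 \<partial>X) \<le> \<beta>\<^sup>2"
  shows "(\<integral>\<^sup>+x. (f x + g x)\<^sup>2 \<partial>X) \<le> (\<alpha> + \<beta>)\<^sup>2" (is "?l \<le> _")
proof -
  have "(\<integral>\<^sup>+x. f x * g x \<partial>X)\<^sup>2 \<le> (\<integral>\<^sup>+x. (f x)\<^sup>2 \<partial>X) * (\<integral>\<^sup>+x. (g x)\<^sup>2 \<partial>X)"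
    by (rule Cauchy_Schwarz_nn_integral) measurable
  also have "... \<le> (\<alpha> * \<beta>)\<^sup>2" unfolding power_mult_distrib by (intro mult_mono f g) auto
  finally have fg: "(\<integral>\<^sup>+x. f x * g x \<partial>X) \<le> \<alpha> * \<beta>" by (rule ennreal_le_of_square_le)
  have "?l = (\<integral>\<^sup>+x. (f x)\<^sup>2 + (g x)\<^sup>2 + 2 * (f x * g x) \<partial>X)"
    by (simp only: power2_sum mult.assoc)
  also have "... = (\<integral>\<^sup>+x. (f x)\<^sup>2 \<partial>X) + (\<integral>\<^sup>+x. (g x)\<^sup>2 \<partial>X) + 2 * (\<integral>\<^sup>+x. f x * g x \<partial>X)"
    by (simp add: nn_integral_add nn_integral_cmult)
  also have "... \<le> \<alpha>\<^sup>2 + \<beta>\<^sup>2 + 2 * (\<alpha> * \<beta>)" by (intro add_mono f g mult_left_mono fg) auto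
  also have "... = (\<alpha> + \<beta>)\<^sup>2" by (simp only: power2_sum mult.assoc)
  finally show ?thesis .
qed

text \<open>
  The product rule. If the right-hand side is infinite there is nothing to prove, and otherwise all products
  are integrable.
\<close>

lemma integral_product_increment_le:
  fixes p q p' q' :: "'b \<Rightarrow> real"
  assumes [measurable]: "p \<in> borel_measurable X" "q \<in> borel_measurable X" "p' \<in> borel_measurable X" "q' \<in> borel_measurable X"
    and fin: "(\<integral>\<^sup>+z. ennreal (\<bar>p z\<bar> * \<bar>p' z\<bar>) \<partial>X) < \<infinity>"
  shows "ennreal \<bar>(\<integral>z. (p z + q z) * (p' z + q' z) \<partial>X) - (\<integral>z. p z * p' z \<partial>X)\<bar> \<le>
    (\<integral>\<^sup>+z. ennreal (\<bar>q z\<bar> * \<bar>p' z\<bar>) \<partial>X) + (\<integral>\<^sup>+z. ennreal (\<bar>p z\<bar> * \<bar>q' z\<bar>) \<partial>X) + (\<integral>\<^sup>+z. ennreal (\<bar>q z\<bar> * \<bar>q' z\<bar>) \<partial>X)" (is "?l \<le> _")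
proof -
  let ?r = "\<lambda>z. q z * p' z + p z * q' z + q z * q' z"
  let ?R = "(\<integral>\<^sup>+z. ennreal (\<bar>q z\<bar> * \<bar>p' z\<bar>) \<partial>X) + (\<integral>\<^sup>+z. ennreal (\<bar>p z\<bar> * \<bar>q' z\<bar>) \<partial>X) + (\<integral>\<^sup>+z. ennreal (\<bar>q z\<bar> * \<bar>q' z\<bar>) \<partial>X)"
  have "(\<integral>\<^sup>+z. ennreal \<bar>?r z\<bar> \<partial>X) \<le> (\<integral>\<^sup>+z. ennreal (\<bar>q z\<bar> * \<bar>p' z\<bar>) + ennreal (\<bar>p z\<bar> * \<bar>q' z\<bar>) + ennreal (\<bar>q z\<bar> * \<bar>q' z\<bar>) \<partial>X)"
  proof (rule nn_integral_mono)
    fix z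
    have "\<bar>?r z\<bar> \<le> \<bar>q z\<bar> * \<bar>p' z\<bar> + \<bar>p z\<bar> * \<bar>q' z\<bar> + \<bar>q z\<bar> * \<bar>q' z\<bar>"
      unfolding abs_mult[symmetric] by linarith
    from ennreal_leI[OF this]
    show "ennreal \<bar>?r z\<bar> \<le> ennreal (\<bar>q z\<bar> * \<bar>p' z\<bar>) + ennreal (\<bar>p z\<bar> * \<bar>q' z\<bar>) + ennreal (\<bar>q z\<bar> * \<bar>q' z\<bar>)"
      by (simp add: ennreal_plus)
  qed
  also have "... = ?R" by (simp add: nn_integral_add)
  finally have r: "(\<integral>\<^sup>+z. ennreal \<bar>?r z\<bar> \<partial>X) \<le> ?R" .
  show ?thesis
  proof (cases "?R < \<infinity>")
    case True
    have pp: "integrable X (\<lambda>z. p z * p' z)"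
      using fin by (intro integrableI_bounded) (auto simp: abs_mult)
    have rr: "integrable X ?r"
      using order_le_less_trans[OF r True] by (intro integrableI_bounded) auto
    have "(\<integral>z. (p z + q z) * (p' z + q' z) \<partial>X) = (\<integral>z. p z * p' z + ?r z \<partial>X)"
      by (intro Bochner_Integration.integral_cong) (auto simp: algebra_simps)
    also have "... = (\<integral>z. p z * p' z \<partial>X) + (\<integral>z. ?r z \<partial>X)"
      by (rule Bochner_Integration.integral_add[OF pp rr])
    finally have "?l = ennreal (norm (\<integral>z. ?r z \<partial>X))"
      by simp
    also have "... \<le> (\<integral>\<^sup>+z. ennreal (norm (?r z)) \<partial>X)" by (rule integral_norm_bound_ennreal[OF rr])
    also have "... \<le> ?R" using r by simp
    finally show ?thesis .
  next
    case False
    then have "?R = top" by (simp only: infinity_ennreal_def not_less top_unique)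
    then show ?thesis by (simp only: top_greatest)
  qed
qed

lemma diff_op2_commute: "sets \<mu> = sets L \<Longrightarrow> diff_op2 x y \<phi> \<mu> = diff_op2 y x \<phi> \<mu>"
  by (simp add: diff_op2_expand add_dirac_commute)

context mecke_window
begin

lemma measurable_diff_op [measurable (raw)]:
  assumes "F \<in> borel_measurable (point_algebra L)" "f \<in> X \<rightarrow>\<^sub>M point_algebra L" "g \<in> X \<rightarrow>\<^sub>M L"
  shows "(\<lambda>x. diff_op (g x) F (f x)) \<in> borel_measurable X"
  unfolding diff_op_def
  by (intro borel_measurable_diff measurable_compose[OF _ assms(1)] measurable_add_dirac assms)

lemma measurable_diff_op2 [measurable (raw)]:
  assumes "F \<in> borel_measurable (point_algebra L)" "f \<in> X \<rightarrow>\<^sub>M point_algebra L" "g \<in> X \<rightarrow>\<^sub>M L" "h \<in> X \<rightarrow>\<^sub>M L"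
  shows "(\<lambda>x. diff_op2 (g x) (h x) F (f x)) \<in> borel_measurable X"
  unfolding diff_op2_expand
  by (intro borel_measurable_diff borel_measurable_add measurable_compose[OF _ assms(1)] measurable_add_dirac assms)

text \<open>
  Writing the square as a double integral, the Cauchy-Schwarz inequality for fixed \<open>z1\<close> and \<open>z2\<close> separates the
  two copies, and both have law \<open>Q\<close>.
\<close>

lemma coupling_square_le:
  fixes f g :: "'a \<Rightarrow> 'a measure \<Rightarrow> ennreal"
  assumes s: "0 \<le> s" "s \<le> 1"
    and [measurable]: "(\<lambda>(z, \<tau>). f z \<tau>) \<in> borel_measurable (L \<Otimes>\<^sub>M point_algebra L)" "(\<lambda>(z, \<tau>). g z \<tau>) \<in> borel_measurable (L \<Otimes>\<^sub>M point_algebra L)"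
  shows "(\<integral>\<^sup>+p. (\<integral>\<^sup>+z. f z (fst p) * g z (snd p) \<partial>L)\<^sup>2 \<partial>coupling s) \<le>
    (\<integral>\<^sup>+z1. (\<integral>\<^sup>+z2. ennreal_powr (\<integral>\<^sup>+\<tau>. (f z1 \<tau>)\<^sup>2 * (f z2 \<tau>)\<^sup>2 \<partial>Q) (1/2) * ennreal_powr (\<integral>\<^sup>+\<tau>. (g z1 \<tau>)\<^sup>2 * (g z2 \<tau>)\<^sup>2 \<partial>Q) (1/2) \<partial>L) \<partial>L)" (is "?l \<le> ?r")
proof -
  let ?k = "\<lambda>z1 z2 p. (f z1 (fst p) * f z2 (fst p)) * (g z1 (snd p) * g z2 (snd p))"
  interpret cp: prob_space "coupling s" by (rule prob_space_coupling)
  interpret cL: pair_sigma_finite "coupling s" L ..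
  have "?l =
    (\<integral>\<^sup>+p. (\<integral>\<^sup>+z1. (\<integral>\<^sup>+z2. ?k z1 z2 p \<partial>L) \<partial>L) \<partial>coupling s)"
  proof (rule nn_integral_cong)
    fix p assume "p \<in> space (coupling s)"
    then have [measurable]: "fst p \<in> space (point_algebra L)" "snd p \<in> space (point_algebra L)"
      by (auto simp: space_coupling)
    let ?h = "\<lambda>z. f z (fst p) * g z (snd p)"
    have "(\<integral>\<^sup>+z. ?h z \<partial>L)\<^sup>2 = (\<integral>\<^sup>+z1. ?h z1 * (\<integral>\<^sup>+z2. ?h z2 \<partial>L) \<partial>L)"
      unfolding power2_eq_square by (rule nn_integral_multc[symmetric]) measurable
    also have "... = (\<integral>\<^sup>+z1. (\<integral>\<^sup>+z2. ?h z1 * ?h z2 \<partial>L) \<partial>L)"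
      by (intro nn_integral_cong nn_integral_cmult[symmetric]) measurable
    also have "... = (\<integral>\<^sup>+z1. (\<integral>\<^sup>+z2. ?k z1 z2 p \<partial>L) \<partial>L)"
      by (simp only: mult_ac)
    finally show "(\<integral>\<^sup>+z. ?h z \<partial>L)\<^sup>2 = (\<integral>\<^sup>+z1. (\<integral>\<^sup>+z2. ?k z1 z2 p \<partial>L) \<partial>L)" .
  qed
  also have "... = (\<integral>\<^sup>+z1. (\<integral>\<^sup>+p. (\<integral>\<^sup>+z2. ?k z1 z2 p \<partial>L) \<partial>coupling s) \<partial>L)"
    by (rule cL.Fubini'[symmetric]) measurable
  also have "... = (\<integral>\<^sup>+z1. (\<integral>\<^sup>+z2. (\<integral>\<^sup>+p. ?k z1 z2 p \<partial>coupling s) \<partial>L) \<partial>L)"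
    by (intro nn_integral_cong cL.Fubini'[symmetric]) measurable
  also have "... \<le> ?r"
  proof (intro nn_integral_mono)
    fix z1 z2 assume [measurable]: "z1 \<in> space L" "z2 \<in> space L"
    have "(\<integral>\<^sup>+p. ?k z1 z2 p \<partial>coupling s) \<le>
      ennreal_powr (\<integral>\<^sup>+p. (f z1 (fst p) * f z2 (fst p))\<^sup>2 \<partial>coupling s) (1/2) *
      ennreal_powr (\<integral>\<^sup>+p. (g z1 (snd p) * g z2 (snd p))\<^sup>2 \<partial>coupling s) (1/2)"
      by (rule nn_integral_mult_le_powr_half) measurable
    also have "(\<integral>\<^sup>+p. (f z1 (fst p) * f z2 (fst p))\<^sup>2 \<partial>coupling s) = (\<integral>\<^sup>+\<tau>. (f z1 \<tau> * f z2 \<tau>)\<^sup>2 \<partial>Q)"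
      by (rule coupling_marginal(1)[OF s]) measurable
    also have "(\<integral>\<^sup>+p. (g z1 (snd p) * g z2 (snd p))\<^sup>2 \<partial>coupling s) = (\<integral>\<^sup>+\<tau>. (g z1 \<tau> * g z2 \<tau>)\<^sup>2 \<partial>Q)"
      by (rule coupling_marginal(2)[OF s]) measurable
    finally show "(\<integral>\<^sup>+p. ?k z1 z2 p \<partial>coupling s) \<le>
      ennreal_powr (\<integral>\<^sup>+\<tau>. (f z1 \<tau>)\<^sup>2 * (f z2 \<tau>)\<^sup>2 \<partial>Q) (1/2) * ennreal_powr (\<integral>\<^sup>+\<tau>. (g z1 \<tau>)\<^sup>2 * (g z2 \<tau>)\<^sup>2 \<partial>Q) (1/2)"
      by (simp only: power_mult_distrib)
  qed
  finally show ?thesis .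
qed

text \<open>
  If \<open>B\<close> is the whole space, then averaging over \<open>s\<close> and over the second copy gives the integral of
  \<open>D\<^sub>z F\<close> times \<open>- D\<^sub>z A\<^sup>-\<^sup>1 F\<close> for the Ornstein-Uhlenbeck generator \<open>A\<close>, the usual Malliavin-Stein expression.
\<close>

definition gradient_product :: "('a measure \<Rightarrow> real) \<Rightarrow> 'a measure \<times> 'a measure \<Rightarrow> real" where
  "gradient_product F p = (\<integral>z. diff_op z F (fst p) * diff_op z F (snd p) \<partial>restricted L B)"

lemma measurable_gradient_product [measurable]:
  assumes [measurable]: "F \<in> borel_measurable (point_algebra L)"
  shows "gradient_product F \<in> borel_measurable (point_algebra L \<Otimes>\<^sub>M point_algebra L)"
  unfolding gradient_product_def[abs_def] by measurable

lemma nn_integral_gradient_product_le: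
  assumes s: "0 \<le> s" "s \<le> 1" and [measurable]: "F \<in> borel_measurable (point_algebra L)"
  shows "(\<integral>\<^sup>+p. (\<integral>\<^sup>+z. ennreal (\<bar>diff_op z F (fst p)\<bar> * \<bar>diff_op z F (snd p)\<bar>) \<partial>restricted L B) \<partial>coupling s) \<le>
    (\<integral>\<^sup>+z. (\<integral>\<^sup>+\<tau>. ennreal ((diff_op z F \<tau>)\<^sup>2) \<partial>Q) \<partial>restricted L B)" (is "?l \<le> ?r")
proof -
  interpret cp: prob_space "coupling s" by (rule prob_space_coupling)
  interpret cL: pair_sigma_finite "coupling s" "restricted L B" ..
  have "?l =
    (\<integral>\<^sup>+z. (\<integral>\<^sup>+p. ennreal \<bar>diff_op z F (fst p)\<bar> * ennreal \<bar>diff_op z F (snd p)\<bar> \<partial>coupling s) \<partial>restricted L B)"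
    by (subst cL.Fubini'[symmetric]) (auto simp: ennreal_mult)
  also have "... \<le> ?r"
  proof (rule nn_integral_mono)
    fix z assume "z \<in> space (restricted L B)"
    then have [measurable]: "z \<in> space L" by simp
    let ?m = "\<integral>\<^sup>+\<tau>. ennreal ((diff_op z F \<tau>)\<^sup>2) \<partial>Q"
    have "(\<integral>\<^sup>+p. ennreal \<bar>diff_op z F (fst p)\<bar> * ennreal \<bar>diff_op z F (snd p)\<bar> \<partial>coupling s) \<le>
      ennreal_powr (\<integral>\<^sup>+p. (ennreal \<bar>diff_op z F (fst p)\<bar>)\<^sup>2 \<partial>coupling s) (1/2) * ennreal_powr (\<integral>\<^sup>+p. (ennreal \<bar>diff_op z F (snd p)\<bar>)\<^sup>2 \<partial>coupling s) (1/2)"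
      by (rule nn_integral_mult_le_powr_half) measurable
    also have "... = ennreal_powr ?m (1/2) * ennreal_powr ?m (1/2)"
      using coupling_marginal[OF s, of "\<lambda>\<tau>. ennreal ((diff_op z F \<tau>)\<^sup>2)"] by (simp add: ennreal_power)
    also have "... = ?m" using ennreal_powr_half_square[of ?m] by (simp add: power2_eq_square)
    finally show "(\<integral>\<^sup>+p. ennreal \<bar>diff_op z F (fst p)\<bar> * ennreal \<bar>diff_op z F (snd p)\<bar> \<partial>coupling s) \<le> ?m" .
  qed
  finally show ?thesis .
qed

end

context mecke_process
begin

definition gradient_moment :: "('a measure \<Rightarrow> real) \<Rightarrow> 'a \<Rightarrow> 'a \<Rightarrow> ennreal" where
  "gradient_moment F z1 z2 = (\<integral>\<^sup>+\<tau>. ennreal ((diff_op z1 F \<tau>)\<^sup>2 * (diff_op z2 F \<tau>)\<^sup>2) \<partial>Q)"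

definition hessian_moment :: "('a measure \<Rightarrow> real) \<Rightarrow> 'a \<Rightarrow> 'a \<Rightarrow> 'a \<Rightarrow> ennreal" where
  "hessian_moment F z1 z2 y = (\<integral>\<^sup>+\<tau>. ennreal ((diff_op2 z1 y F \<tau>)\<^sup>2 * (diff_op2 z2 y F \<tau>)\<^sup>2) \<partial>Q)"

definition third_order_moment :: "('a measure \<Rightarrow> real) \<Rightarrow> 'a \<Rightarrow> ennreal" where
  "third_order_moment F z = ennreal_powr (\<integral>\<^sup>+\<tau>. ennreal (\<bar>diff_op z F \<tau>\<bar> ^ 3) \<partial>Q) (1/3) *
     ennreal_powr (\<integral>\<^sup>+\<tau>. ennreal (min (sqrt 8 * \<bar>diff_op z F \<tau>\<bar> powr (3/2)) (\<bar>diff_op z F \<tau>\<bar> ^ 3)) \<partial>Q) (2/3)"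

end

context mecke_window
begin

lemma nn_integral_restricted_le:
  assumes "f \<in> borel_measurable L"
  shows "(\<integral>\<^sup>+x. f x \<partial>restricted L B) \<le> (\<integral>\<^sup>+x. f x \<partial>L)"
  unfolding nn_integral_restricted[OF assms B_sets] by (intro nn_integral_mono) (auto simp: indicator_def)

text \<open>
  The difference operator at the configuration with \<open>y\<close> added is \<open>diff_op z F\<close> plus \<open>diff_op2 z y F\<close>, exactly.
  In the product rule the second difference appears at the first copy (\<open>a\<close>), the second copy (\<open>b\<close>) or both (\<open>c\<close>).
\<close>

lemma gradient_product_increment:
  assumes [measurable]: "F \<in> borel_measurable (point_algebra L)"
    and \<tau>[measurable]: "\<tau> \<in> space (point_algebra L)" "\<tau>' \<in> space (point_algebra L)" and y[measurable]: "y \<in> space L"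
    and fin: "(\<integral>\<^sup>+z. ennreal (\<bar>diff_op z F \<tau>\<bar> * \<bar>diff_op z F \<tau>'\<bar>) \<partial>restricted L B) < \<infinity>"
  defines "a \<equiv> (\<integral>\<^sup>+z. ennreal \<bar>diff_op2 z y F \<tau>\<bar> * ennreal \<bar>diff_op z F \<tau>'\<bar> \<partial>L)"
    and "b \<equiv> (\<integral>\<^sup>+z. ennreal \<bar>diff_op z F \<tau>\<bar> * ennreal \<bar>diff_op2 z y F \<tau>'\<bar> \<partial>L)"
    and "c \<equiv> (\<integral>\<^sup>+z. ennreal \<bar>diff_op2 z y F \<tau>\<bar> * ennreal \<bar>diff_op2 z y F \<tau>'\<bar> \<partial>L)"
  shows "ennreal ((gradient_product F (add_dirac \<tau> y, add_dirac \<tau>' y) - gradient_product F (\<tau>, \<tau>'))\<^sup>2) \<le> (a + b + c)\<^sup>2"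
    and "ennreal ((gradient_product F (add_dirac \<tau> y, \<tau>') - gradient_product F (\<tau>, \<tau>'))\<^sup>2) \<le> a\<^sup>2"
    and "ennreal ((gradient_product F (\<tau>, add_dirac \<tau>' y) - gradient_product F (\<tau>, \<tau>'))\<^sup>2) \<le> b\<^sup>2"
proof -
  let ?\<nu> = "restricted L B"
  have shift: "diff_op z F (add_dirac \<mu> y) = diff_op z F \<mu> + diff_op2 z y F \<mu>" if "\<mu> \<in> space (point_algebra L)" for z \<mu>
    using diff_op2_commute[of \<mu> L z y F] that
    by (simp add: sets_point_measure diff_op2_def diff_op_def[of y "diff_op z F"])
  have le: "(\<integral>\<^sup>+z. ennreal (\<bar>diff_op2 z y F \<tau>\<bar> * \<bar>diff_op z F \<tau>'\<bar>) \<partial>?\<nu>) \<le> a"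
    "(\<integral>\<^sup>+z. ennreal (\<bar>diff_op z F \<tau>\<bar> * \<bar>diff_op2 z y F \<tau>'\<bar>) \<partial>?\<nu>) \<le> b"
    "(\<integral>\<^sup>+z. ennreal (\<bar>diff_op2 z y F \<tau>\<bar> * \<bar>diff_op2 z y F \<tau>'\<bar>) \<partial>?\<nu>) \<le> c"
    unfolding a_def b_def c_def by (simp_all only: ennreal_mult abs_ge_zero) (rule nn_integral_restricted_le, measurable)+
  have sq: "ennreal (x\<^sup>2) \<le> u\<^sup>2" if "ennreal \<bar>x\<bar> \<le> u" for x u
    using power_mono[OF that, of 2] by (simp add: ennreal_power)
  note inc = integral_product_increment_le[where X = ?\<nu> and p = "\<lambda>z. diff_op z F \<tau>" and p' = "\<lambda>z. diff_op z F \<tau>'"]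
  have "ennreal \<bar>gradient_product F (add_dirac \<tau> y, add_dirac \<tau>' y) - gradient_product F (\<tau>, \<tau>')\<bar> \<le> a + b + c"
    using inc[of "\<lambda>z. diff_op2 z y F \<tau>" "\<lambda>z. diff_op2 z y F \<tau>'"] fin
    by (simp add: gradient_product_def shift[OF \<tau>(1)] shift[OF \<tau>(2)]) (erule order_trans, intro add_mono le)
  then show "ennreal ((gradient_product F (add_dirac \<tau> y, add_dirac \<tau>' y) - gradient_product F (\<tau>, \<tau>'))\<^sup>2) \<le> (a + b + c)\<^sup>2"
    by (rule sq)
  have "ennreal \<bar>gradient_product F (add_dirac \<tau> y, \<tau>') - gradient_product F (\<tau>, \<tau>')\<bar> \<le> a"
    using inc[of "\<lambda>z. diff_op2 z y F \<tau>" "\<lambda>z. 0"] fin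
    by (simp add: gradient_product_def shift[OF \<tau>(1)] shift[OF \<tau>(2)]) (erule order_trans, intro le)
  then show "ennreal ((gradient_product F (add_dirac \<tau> y, \<tau>') - gradient_product F (\<tau>, \<tau>'))\<^sup>2) \<le> a\<^sup>2"
    by (rule sq)
  have "ennreal \<bar>gradient_product F (\<tau>, add_dirac \<tau>' y) - gradient_product F (\<tau>, \<tau>')\<bar> \<le> b"
    using inc[of "\<lambda>z. 0" "\<lambda>z. diff_op2 z y F \<tau>'"] fin
    by (simp add: gradient_product_def shift[OF \<tau>(1)] shift[OF \<tau>(2)]) (erule order_trans, intro le)
  then show "ennreal ((gradient_product F (\<tau>, add_dirac \<tau>' y) - gradient_product F (\<tau>, \<tau>'))\<^sup>2) \<le> b\<^sup>2"
    by (rule sq)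
qed

lemma integrable_gradient_product:
  assumes s: "0 \<le> s" "s \<le> 1" and [measurable]: "F \<in> borel_measurable (point_algebra L)"
    and DF: "(\<integral>\<^sup>+z. (\<integral>\<^sup>+\<tau>. ennreal ((diff_op z F \<tau>)\<^sup>2) \<partial>Q) \<partial>restricted L B) < \<infinity>"
  shows "integrable (coupling s) (gradient_product F)"
    and "AE p in coupling s. (\<integral>\<^sup>+z. ennreal (\<bar>diff_op z F (fst p)\<bar> * \<bar>diff_op z F (snd p)\<bar>) \<partial>restricted L B) < \<infinity>"
    and "(\<integral>\<^sup>+p. ennreal (norm (gradient_product F p)) \<partial>coupling s) \<le> (\<integral>\<^sup>+z. (\<integral>\<^sup>+\<tau>. ennreal ((diff_op z F \<tau>)\<^sup>2) \<partial>Q) \<partial>restricted L B)"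
proof -
  let ?G = "\<lambda>p. \<integral>\<^sup>+z. ennreal (\<bar>diff_op z F (fst p)\<bar> * \<bar>diff_op z F (snd p)\<bar>) \<partial>restricted L B"
  have [measurable]: "?G \<in> borel_measurable (point_algebra L \<Otimes>\<^sub>M point_algebra L)" by measurable
  have fin: "(\<integral>\<^sup>+p. ?G p \<partial>coupling s) < \<infinity>"
    using nn_integral_gradient_product_le[OF s assms(3)] DF by (rule order_le_less_trans)
  then have "AE p in coupling s. ?G p \<noteq> \<infinity>" by (intro nn_integral_PInf_AE) auto
  then show "AE p in coupling s. ?G p < \<infinity>" by (simp add: less_top)
  have le: "(\<integral>\<^sup>+p. ennreal (norm (gradient_product F p)) \<partial>coupling s) \<le> (\<integral>\<^sup>+p. ?G p \<partial>coupling s)"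
  proof (rule nn_integral_mono)
    fix p
    let ?g = "\<lambda>z. diff_op z F (fst p) * diff_op z F (snd p)"
    show "ennreal (norm (gradient_product F p)) \<le> ?G p"
    proof (cases "integrable (restricted L B) ?g")
      case True
      from integral_norm_bound_ennreal[OF this] show ?thesis by (simp add: gradient_product_def abs_mult)
    qed (simp add: gradient_product_def not_integrable_integral_eq)
  qed
  then show "integrable (coupling s) (gradient_product F)"
    using fin by (intro integrableI_bounded) auto
  show "(\<integral>\<^sup>+p. ennreal (norm (gradient_product F p)) \<partial>coupling s) \<le> (\<integral>\<^sup>+z. (\<integral>\<^sup>+\<tau>. ennreal ((diff_op z F \<tau>)\<^sup>2) \<partial>Q) \<partial>restricted L B)"
    using le nn_integral_gradient_product_le[OF s assms(3)] by (rule order_trans)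
qed

text \<open>
  Joint increments are bounded by \<open>a + b + c\<close> and separate ones by \<open>a\<close> and \<open>b\<close>, so the square of \<open>a + b + c\<close> serves
  in \<open>poincare_coupling\<close>. The terms \<open>a\<close> and \<open>b\<close> mix first and second differences and have norm at most
  \<open>\<gamma>\<^sub>1 / 2\<close>; the term \<open>c\<close> has two second differences and norm at most \<open>\<gamma>\<^sub>2\<close>.
\<close>

theorem gradient_product_variance:
  fixes \<gamma>\<^sub>1 \<gamma>\<^sub>2 :: ennreal
  assumes s: "0 \<le> s" "s \<le> 1" and [measurable]: "F \<in> borel_measurable (point_algebra L)"
    and DF: "(\<integral>\<^sup>+z. (\<integral>\<^sup>+\<tau>. ennreal ((diff_op z F \<tau>)\<^sup>2) \<partial>Q) \<partial>restricted L B) < \<infinity>"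
    and g1: "4 * (\<integral>\<^sup>+y. (\<integral>\<^sup>+z1. (\<integral>\<^sup>+z2. ennreal_powr (gradient_moment F z1 z2) (1/2) * ennreal_powr (hessian_moment F z1 z2 y) (1/2) \<partial>L) \<partial>L) \<partial>L) = \<gamma>\<^sub>1\<^sup>2"
    and g2: "(\<integral>\<^sup>+y. (\<integral>\<^sup>+z1. (\<integral>\<^sup>+z2. hessian_moment F z1 z2 y \<partial>L) \<partial>L) \<partial>L) = \<gamma>\<^sub>2\<^sup>2"
  shows "(\<integral>\<^sup>+\<omega>. ennreal ((gradient_product F \<omega> - (\<integral>\<omega>. gradient_product F \<omega> \<partial>coupling s))\<^sup>2) \<partial>coupling s) \<le> (\<gamma>\<^sub>1 + \<gamma>\<^sub>2)\<^sup>2"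
proof -
  let ?P = "gradient_product F" and ?P1 = "\<lambda>y \<omega>. gradient_product F (add_dirac (fst \<omega>) y, snd \<omega>)"
  let ?P2 = "\<lambda>y \<omega>. gradient_product F (fst \<omega>, add_dirac (snd \<omega>) y)" and ?P12 = "\<lambda>y \<omega>. gradient_product F (add_dirac (fst \<omega>) y, add_dirac (snd \<omega>) y)"
  interpret cp: prob_space "coupling s" by (rule prob_space_coupling)
  interpret Lc: pair_sigma_finite L "coupling s" ..
  let ?V = "\<lambda>z \<tau>. ennreal \<bar>diff_op z F \<tau>\<bar>" and ?U = "\<lambda>y z \<tau>. ennreal \<bar>diff_op2 z y F \<tau>\<bar>"
  define a where "a y \<omega> = (\<integral>\<^sup>+z. ?U y z (fst \<omega>) * ?V z (snd \<omega>) \<partial>L)" for y \<omega>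
  define b where "b y \<omega> = (\<integral>\<^sup>+z. ?V z (fst \<omega>) * ?U y z (snd \<omega>) \<partial>L)" for y \<omega>
  define c where "c y \<omega> = (\<integral>\<^sup>+z. ?U y z (fst \<omega>) * ?U y z (snd \<omega>) \<partial>L)" for y \<omega>
  have [measurable]: "(\<lambda>(y, \<omega>). a y \<omega>) \<in> borel_measurable (L \<Otimes>\<^sub>M coupling s)" "(\<lambda>(y, \<omega>). b y \<omega>) \<in> borel_measurable (L \<Otimes>\<^sub>M coupling s)"
    "(\<lambda>(y, \<omega>). c y \<omega>) \<in> borel_measurable (L \<Otimes>\<^sub>M coupling s)"
    unfolding a_def b_def c_def by measurable
  define E where "E y = (\<integral>\<^sup>+\<omega>. (a y \<omega> + b y \<omega> + c y \<omega>)\<^sup>2 \<partial>coupling s)" for y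
  have [measurable]: "E \<in> borel_measurable L" unfolding E_def by measurable
  note good = integrable_gradient_product(2)[OF s assms(3) DF]
  have "(\<integral>\<^sup>+\<omega>. ennreal ((?P \<omega> - (\<integral>\<omega>. ?P \<omega> \<partial>coupling s))\<^sup>2) \<partial>coupling s) \<le> (\<integral>\<^sup>+y. E y \<partial>L)"
  proof (rule poincare_coupling[OF s])
    show "integrable (coupling s) (?P)" by (rule integrable_gradient_product(1)[OF s assms(3) DF])
    show "AE y in L. (\<integral>\<^sup>+\<omega>. ennreal ((?P12 y \<omega> - ?P \<omega>)\<^sup>2) \<partial>coupling s) \<le> E y"
    proof (intro AE_I2)
      fix y assume y: "y \<in> space L"
      show "(\<integral>\<^sup>+\<omega>. ennreal ((?P12 y \<omega> - ?P \<omega>)\<^sup>2) \<partial>coupling s) \<le> E y"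
        unfolding E_def
      proof (rule nn_integral_mono_AE)
        show "AE \<omega> in coupling s. ennreal ((?P12 y \<omega> - ?P \<omega>)\<^sup>2) \<le> (a y \<omega> + b y \<omega> + c y \<omega>)\<^sup>2"
          using good AE_space
        proof eventually_elim
          case (elim \<omega>)
          then have "fst \<omega> \<in> space (point_algebra L)" "snd \<omega> \<in> space (point_algebra L)" by (auto simp: space_coupling)
          from gradient_product_increment(1)[OF assms(3) this y elim(1)] show ?case by (simp add: a_def b_def c_def)
        qed
      qed
    qed
    show "AE y in L. (\<integral>\<^sup>+\<omega>. ennreal ((?P1 y \<omega> - ?P \<omega>)\<^sup>2) +
       ennreal ((?P2 y \<omega> - ?P \<omega>)\<^sup>2) \<partial>coupling s) \<le> E y"
    proof (intro AE_I2)
      fix y assume y: "y \<in> space L"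
      show "(\<integral>\<^sup>+\<omega>. ennreal ((?P1 y \<omega> - ?P \<omega>)\<^sup>2) +
         ennreal ((?P2 y \<omega> - ?P \<omega>)\<^sup>2) \<partial>coupling s) \<le> E y"
        unfolding E_def
      proof (rule nn_integral_mono_AE)
        show "AE \<omega> in coupling s. ennreal ((?P1 y \<omega> - ?P \<omega>)\<^sup>2) +
           ennreal ((?P2 y \<omega> - ?P \<omega>)\<^sup>2) \<le> (a y \<omega> + b y \<omega> + c y \<omega>)\<^sup>2"
          using good AE_space
        proof eventually_elim
          case (elim \<omega>)
          then have sp: "fst \<omega> \<in> space (point_algebra L)" "snd \<omega> \<in> space (point_algebra L)" by (auto simp: space_coupling)
          have "ennreal ((?P1 y \<omega> - ?P \<omega>)\<^sup>2) +
             ennreal ((?P2 y \<omega> - ?P \<omega>)\<^sup>2) \<le> (a y \<omega>)\<^sup>2 + (b y \<omega>)\<^sup>2"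
            using gradient_product_increment(2,3)[OF assms(3) sp y elim(1)] by (intro add_mono) (simp_all add: a_def b_def)
          also have "... \<le> (a y \<omega> + b y \<omega>)\<^sup>2" by (simp only: power2_sum) (rule add_increasing2, simp_all)
          also have "... \<le> (a y \<omega> + b y \<omega> + c y \<omega>)\<^sup>2" by (intro power_mono) auto
          finally show ?case .
        qed
      qed
    qed
  qed measurable
  also have "... = (\<integral>\<^sup>+p. ((case p of (y, \<omega>) \<Rightarrow> a y \<omega>) + (case p of (y, \<omega>) \<Rightarrow> b y \<omega>) + (case p of (y, \<omega>) \<Rightarrow> c y \<omega>))\<^sup>2 \<partial>(L \<Otimes>\<^sub>M coupling s))"
    unfolding E_def by (subst cp.nn_integral_fst[symmetric]) auto
  also have "... \<le> (\<gamma>\<^sub>1 / 2 + \<gamma>\<^sub>1 / 2 + \<gamma>\<^sub>2)\<^sup>2"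
  proof (intro nn_integral_square_add_le)
    let ?A = "(\<integral>\<^sup>+y. (\<integral>\<^sup>+z1. (\<integral>\<^sup>+z2. ennreal_powr (gradient_moment F z1 z2) (1/2) * ennreal_powr (hessian_moment F z1 z2 y) (1/2) \<partial>L) \<partial>L) \<partial>L)"
    have A: "?A = (\<gamma>\<^sub>1 / 2)\<^sup>2"
    proof (cases \<gamma>\<^sub>1)
      case (real r)
      have "ennreal (1/4) * (4 * ?A) = ennreal (1/4) * ennreal (r\<^sup>2)" using g1 real by (simp add: ennreal_power)
      moreover have "ennreal (1/4) * (4 * ?A) = ?A"
      proof -
        have "ennreal (1/4) * 4 = 1" by (simp flip: ennreal_mult ennreal_numeral)
        then show ?thesis by (simp only: mult.assoc[symmetric] mult_1_left)
      qed
      moreover have "ennreal (1/4) * ennreal (r\<^sup>2) = (\<gamma>\<^sub>1 / 2)\<^sup>2"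
        using real by (simp add: ennreal_power divide_ennreal power_divide flip: ennreal_mult ennreal_numeral)
      ultimately show ?thesis by simp
    next
      case top
      then have "4 * ?A = top" using g1 by (simp add: power2_eq_square)
      then have "?A = top" by (simp add: ennreal_mult_eq_top_iff)
      then show ?thesis using top by (simp only: ennreal_top_divide) (simp add: power2_eq_square)
    qed
    note moments = gradient_moment_def hessian_moment_def
    have sq: "(ennreal \<bar>x\<bar>)\<^sup>2 * (ennreal \<bar>x'\<bar>)\<^sup>2 = ennreal (x\<^sup>2 * x'\<^sup>2)" for x x' :: real
      by (simp add: ennreal_power ennreal_mult)
    show "(\<integral>\<^sup>+p. (case p of (y, \<omega>) \<Rightarrow> a y \<omega>)\<^sup>2 \<partial>(L \<Otimes>\<^sub>M coupling s)) \<le> (\<gamma>\<^sub>1 / 2)\<^sup>2" (is "?l2 \<le> _")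
    proof -
      have "?l2 = (\<integral>\<^sup>+y. (\<integral>\<^sup>+\<omega>. (a y \<omega>)\<^sup>2 \<partial>coupling s) \<partial>L)"
        by (subst cp.nn_integral_fst[symmetric]) auto
      also have "... \<le> ?A"
        unfolding a_def
        by (intro nn_integral_mono order_trans[OF coupling_square_le[OF s]]) (measurable, simp only: sq moments mult.commute)
      finally show ?thesis unfolding A .
    qed
    show "(\<integral>\<^sup>+p. (case p of (y, \<omega>) \<Rightarrow> b y \<omega>)\<^sup>2 \<partial>(L \<Otimes>\<^sub>M coupling s)) \<le> (\<gamma>\<^sub>1 / 2)\<^sup>2" (is "?l2 \<le> _")
    proof -
      have "?l2 = (\<integral>\<^sup>+y. (\<integral>\<^sup>+\<omega>. (b y \<omega>)\<^sup>2 \<partial>coupling s) \<partial>L)"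
        by (subst cp.nn_integral_fst[symmetric]) auto
      also have "... \<le> ?A"
        unfolding b_def
        by (intro nn_integral_mono order_trans[OF coupling_square_le[OF s]]) (measurable, simp only: sq moments order_refl)
      finally show ?thesis unfolding A .
    qed
    show "(\<integral>\<^sup>+p. (case p of (y, \<omega>) \<Rightarrow> c y \<omega>)\<^sup>2 \<partial>(L \<Otimes>\<^sub>M coupling s)) \<le> \<gamma>\<^sub>2\<^sup>2" (is "?l2 \<le> _")
    proof -
      have half: "ennreal_powr x (1/2) * ennreal_powr x (1/2) = x" for x
        using ennreal_powr_half_square[of x] by (simp only: power2_eq_square)
      have "?l2 = (\<integral>\<^sup>+y. (\<integral>\<^sup>+\<omega>. (c y \<omega>)\<^sup>2 \<partial>coupling s) \<partial>L)"
        by (subst cp.nn_integral_fst[symmetric]) auto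
      also have "... \<le> \<gamma>\<^sub>2\<^sup>2"
        unfolding c_def g2[symmetric]
        by (intro nn_integral_mono order_trans[OF coupling_square_le[OF s]]) (measurable, simp only: sq moments half order_refl)
      finally show ?thesis .
    qed
  qed measurable
  also have "\<gamma>\<^sub>1 / 2 + \<gamma>\<^sub>1 / 2 = \<gamma>\<^sub>1"
    by (cases \<gamma>\<^sub>1) (simp add: divide_ennreal flip: ennreal_plus ennreal_numeral, simp add: ennreal_top_divide)
  finally show ?thesis .
qed

end

section \<open>Stein's method in a window\<close>

lemma ennreal_powr_eq_0: "0 < r \<Longrightarrow> ennreal_powr x r = 0 \<longleftrightarrow> x = 0"
  by (cases x) (auto simp: ennreal_powr_def)

lemma ennreal_powr_mono:
  assumes "x \<le> y" "0 \<le> r"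
  shows "ennreal_powr x r \<le> ennreal_powr y r"
proof (cases "y = top")
  case False
  then have "x \<noteq> top" using assms by (auto simp: top_unique)
  with False assms show ?thesis
    by (auto simp: ennreal_powr_def less_top intro!: ennreal_leI powr_mono2 enn2real_mono)
qed (simp add: ennreal_powr_def)

text \<open>Young's inequality after normalising both factors; the degenerate cases follow the conventions for \<open>0 * \<infinity>\<close>.\<close>

lemma nn_integral_holder:
  fixes u v :: "'b \<Rightarrow> real"
  assumes [measurable]: "u \<in> borel_measurable X" "v \<in> borel_measurable X"
    and u: "\<And>x. 0 \<le> u x" and v: "\<And>x. 0 \<le> v x" and pq: "1 < p" "1 < q" "1 / p + 1 / q = 1"
  shows "(\<integral>\<^sup>+x. ennreal (u x * v x) \<partial>X) \<le>
    ennreal_powr (\<integral>\<^sup>+x. ennreal (u x powr p) \<partial>X) (1/p) * ennreal_powr (\<integral>\<^sup>+x. ennreal (v x powr q) \<partial>X) (1/q)"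
    (is "?I \<le> ennreal_powr ?a _ * ennreal_powr ?b _")
proof -
  have zero: "?I = 0" if "?a = 0 \<or> ?b = 0"
  proof -
    have "AE x in X. u x = 0 \<or> v x = 0"
      using that
    proof
      assume "?a = 0"
      then have "AE x in X. ennreal (u x powr p) = 0" by (subst (asm) nn_integral_0_iff_AE) auto
      then show ?thesis by eventually_elim (use u in \<open>auto simp: ennreal_eq_0_iff powr_nonneg_iff\<close>)
    next
      assume "?b = 0"
      then have "AE x in X. ennreal (v x powr q) = 0" by (subst (asm) nn_integral_0_iff_AE) auto
      then show ?thesis by eventually_elim (use v in \<open>auto simp: ennreal_eq_0_iff powr_nonneg_iff\<close>)
    qed
    then have "AE x in X. ennreal (u x * v x) = 0" by eventually_elim auto
    then show ?thesis by (subst nn_integral_0_iff_AE) auto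
  qed
  consider "?a = 0 \<or> ?b = 0" | "?a \<noteq> 0" "?b \<noteq> 0" "?a = top \<or> ?b = top" | "?a \<noteq> 0" "?b \<noteq> 0" "?a \<noteq> top" "?b \<noteq> top"
    by blast
  then show ?thesis
  proof cases
    case 1
    then show ?thesis by (simp only: zero) simp
  next
    case 2
    then have "ennreal_powr ?a (1/p) \<noteq> 0" "ennreal_powr ?b (1/q) \<noteq> 0"
      using pq by (simp_all add: ennreal_powr_eq_0)
    moreover have "ennreal_powr ?a (1/p) = top \<or> ennreal_powr ?b (1/q) = top"
      using 2(3) by (auto simp: ennreal_powr_def)
    ultimately have "ennreal_powr ?a (1/p) * ennreal_powr ?b (1/q) = top"
      by (auto simp: ennreal_mult_eq_top_iff)
    then show ?thesis by (simp only: top_greatest)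
  next
    case 3
    define a where "a = enn2real ?a"
    define b where "b = enn2real ?b"
    have a: "?a = ennreal a" "0 < a" and b: "?b = ennreal b" "0 < b"
      using 3 by (auto simp: a_def b_def less_top zero_less_iff_neq_zero enn2real_positive_iff)
    define \<alpha> where "\<alpha> = a powr (1/p)"
    define \<beta> where "\<beta> = b powr (1/q)"
    have \<alpha>: "0 < \<alpha>" "\<alpha> powr p = a" and \<beta>: "0 < \<beta>" "\<beta> powr q = b"
      using a b pq by (simp_all add: \<alpha>_def \<beta>_def powr_powr)
    let ?w = "\<lambda>x. \<alpha> * \<beta> / (p * a) * u x powr p + \<alpha> * \<beta> / (q * b) * v x powr q"
    have "?I \<le> (\<integral>\<^sup>+x. ennreal (\<alpha> * \<beta> / (p * a)) * ennreal (u x powr p) + ennreal (\<alpha> * \<beta> / (q * b)) * ennreal (v x powr q) \<partial>X)"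
    proof (rule nn_integral_mono)
      fix x
      have "(u x / \<alpha>) * (v x / \<beta>) \<le> (u x / \<alpha>) powr p / p + (v x / \<beta>) powr q / q"
        using pq u v \<alpha> \<beta> by (intro Youngs_inequality) auto
      then have "\<alpha> * \<beta> * ((u x / \<alpha>) * (v x / \<beta>)) \<le> \<alpha> * \<beta> * ((u x / \<alpha>) powr p / p + (v x / \<beta>) powr q / q)"
        using \<alpha> \<beta> by (intro mult_left_mono) auto
      also have "\<alpha> * \<beta> * ((u x / \<alpha>) * (v x / \<beta>)) = u x * v x" using \<alpha> \<beta> by simp
      also have "\<alpha> * \<beta> * ((u x / \<alpha>) powr p / p + (v x / \<beta>) powr q / q) = ?w x"
        using \<alpha> \<beta> u v by (simp add: powr_divide distrib_left mult.commute)
      finally have "ennreal (u x * v x) \<le> ennreal (?w x)" by (rule ennreal_leI)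
      also have "... = ennreal (\<alpha> * \<beta> / (p * a)) * ennreal (u x powr p) + ennreal (\<alpha> * \<beta> / (q * b)) * ennreal (v x powr q)"
        using \<alpha> \<beta> a b pq by (subst ennreal_plus) (auto simp: ennreal_mult[symmetric])
      finally show "ennreal (u x * v x) \<le> ennreal (\<alpha> * \<beta> / (p * a)) * ennreal (u x powr p) + ennreal (\<alpha> * \<beta> / (q * b)) * ennreal (v x powr q)" .
    qed
    also have "... = ennreal (\<alpha> * \<beta> / (p * a)) * ennreal a + ennreal (\<alpha> * \<beta> / (q * b)) * ennreal b"
      by (simp add: nn_integral_add nn_integral_cmult a(1) b(1))
    also have "... = ennreal (\<alpha> * \<beta> / (p * a) * a + \<alpha> * \<beta> / (q * b) * b)"
      using \<alpha> \<beta> a b pq by (subst ennreal_plus) (auto simp: ennreal_mult[symmetric])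
    also have "\<alpha> * \<beta> / (p * a) * a + \<alpha> * \<beta> / (q * b) * b = \<alpha> * \<beta> * (1 / p + 1 / q)"
      using a b by (simp add: distrib_left)
    also have "ennreal (\<alpha> * \<beta> * (1 / p + 1 / q)) = ennreal \<alpha> * ennreal \<beta>"
      using pq \<alpha> \<beta> by (simp add: ennreal_mult)
    also have "... = ennreal_powr ?a (1/p) * ennreal_powr ?b (1/q)"
      using a b by (simp add: ennreal_powr_def \<alpha>_def \<beta>_def)
    finally show ?thesis .
  qed
qed

text \<open>The constant \<open>sqrt 8\<close> is \<open>2 powr (3/2)\<close>.\<close>

lemma min_square_powr_le:
  fixes x :: real
  assumes "0 \<le> x"
  shows "min (2 * x) (x\<^sup>2) powr (3/2) \<le> min (sqrt 8 * x powr (3/2)) (x ^ 3)" (is "?l \<le> _")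
proof -
  have "?l \<le> (2 * x) powr (3/2)" using assms by (intro powr_mono2) auto
  also have "... = sqrt 8 * x powr (3/2)"
    using assms powr_powr[of 2 3 "1/2"] by (simp add: powr_mult powr_half_sqrt)
  finally have 1: "?l \<le> sqrt 8 * x powr (3/2)" .
  have "?l \<le> (x\<^sup>2) powr (3/2)" using assms by (intro powr_mono2) auto
  also have "... = x ^ 3" using assms powr_powr[of x 2 "3/2"] by simp
  finally show ?thesis using 1 by simp
qed

context mecke_window
begin

text \<open>Hoelder's inequality with exponent 3/2 for the first copy and 3 for the second.\<close>

lemma coupling_min_square_le:
  assumes s: "0 \<le> s" "s \<le> 1" and [measurable]: "d \<in> borel_measurable (point_algebra L)"
  shows "(\<integral>\<^sup>+p. ennreal (min (2 * \<bar>d (fst p)\<bar>) ((d (fst p))\<^sup>2) * \<bar>d (snd p)\<bar>) \<partial>coupling s) \<le>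
    ennreal_powr (\<integral>\<^sup>+\<tau>. ennreal (\<bar>d \<tau>\<bar> ^ 3) \<partial>Q) (1/3) *
    ennreal_powr (\<integral>\<^sup>+\<tau>. ennreal (min (sqrt 8 * \<bar>d \<tau>\<bar> powr (3/2)) (\<bar>d \<tau>\<bar> ^ 3)) \<partial>Q) (2/3)"
proof -
  let ?u = "\<lambda>\<tau>. min (2 * \<bar>d \<tau>\<bar>) ((d \<tau>)\<^sup>2)"
  have "(\<integral>\<^sup>+p. ennreal (?u (fst p) * \<bar>d (snd p)\<bar>) \<partial>coupling s) \<le>
    ennreal_powr (\<integral>\<^sup>+p. ennreal (?u (fst p) powr (3/2)) \<partial>coupling s) (1/(3/2)) *
    ennreal_powr (\<integral>\<^sup>+p. ennreal (\<bar>d (snd p)\<bar> powr 3) \<partial>coupling s) (1/3)"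
    by (rule nn_integral_holder) auto
  also have "(\<integral>\<^sup>+p. ennreal (?u (fst p) powr (3/2)) \<partial>coupling s) = (\<integral>\<^sup>+\<tau>. ennreal (?u \<tau> powr (3/2)) \<partial>Q)"
    by (rule coupling_marginal(1)[OF s]) measurable
  also have "(\<integral>\<^sup>+p. ennreal (\<bar>d (snd p)\<bar> powr 3) \<partial>coupling s) = (\<integral>\<^sup>+\<tau>. ennreal (\<bar>d \<tau>\<bar> powr 3) \<partial>Q)"
    by (rule coupling_marginal(2)[OF s]) measurable
  also have "(\<integral>\<^sup>+\<tau>. ennreal (\<bar>d \<tau>\<bar> powr 3) \<partial>Q) = (\<integral>\<^sup>+\<tau>. ennreal (\<bar>d \<tau>\<bar> ^ 3) \<partial>Q)"
    by simp
  also have "ennreal_powr (\<integral>\<^sup>+\<tau>. ennreal (?u \<tau> powr (3/2)) \<partial>Q) (1/(3/2)) \<le>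
      ennreal_powr (\<integral>\<^sup>+\<tau>. ennreal (min (sqrt 8 * \<bar>d \<tau>\<bar> powr (3/2)) (\<bar>d \<tau>\<bar> ^ 3)) \<partial>Q) (2/3)"
    using min_square_powr_le[of "\<bar>d _\<bar>"] by (simp del: min_less_iff_conj min.bounded_iff) (intro ennreal_powr_mono nn_integral_mono ennreal_leI, simp_all)
  finally show ?thesis by (simp add: mult.commute mult_right_mono)
qed

lemma gradient_product_fubini:
  fixes w :: "'a measure \<times> 'a measure \<Rightarrow> real"
  assumes s: "0 \<le> s" "s \<le> 1" and [measurable]: "F \<in> borel_measurable (point_algebra L)"
    and DF: "(\<integral>\<^sup>+z. (\<integral>\<^sup>+\<tau>. ennreal ((diff_op z F \<tau>)\<^sup>2) \<partial>Q) \<partial>restricted L B) < \<infinity>"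
    and [measurable]: "w \<in> borel_measurable (point_algebra L \<Otimes>\<^sub>M point_algebra L)" and w: "\<And>\<omega>. \<bar>w \<omega>\<bar> \<le> 1"
  shows "(\<integral>z. (\<integral>\<omega>. w \<omega> * (diff_op z F (fst \<omega>) * diff_op z F (snd \<omega>)) \<partial>coupling s) \<partial>restricted L B) =
      (\<integral>\<omega>. w \<omega> * gradient_product F \<omega> \<partial>coupling s)"
    and "integrable (restricted L B) (\<lambda>z. \<integral>\<omega>. w \<omega> * (diff_op z F (fst \<omega>) * diff_op z F (snd \<omega>)) \<partial>coupling s)"
    and "AE z in restricted L B. integrable (coupling s) (\<lambda>\<omega>. w \<omega> * (diff_op z F (fst \<omega>) * diff_op z F (snd \<omega>)))"
proof -
  interpret cp: prob_space "coupling s" by (rule prob_space_coupling)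
  interpret Lc: pair_sigma_finite "coupling s" "restricted L B" ..
  interpret cL: pair_sigma_finite "restricted L B" "coupling s" ..
  let ?g = "\<lambda>\<omega> z. w \<omega> * (diff_op z F (fst \<omega>) * diff_op z F (snd \<omega>))"
  have int: "integrable (coupling s \<Otimes>\<^sub>M restricted L B) (case_prod ?g)"
  proof (rule integrableI_bounded)
    have "(\<integral>\<^sup>+p. ennreal (norm (case_prod ?g p)) \<partial>(coupling s \<Otimes>\<^sub>M restricted L B)) =
      (\<integral>\<^sup>+\<omega>. (\<integral>\<^sup>+z. ennreal (norm (?g \<omega> z)) \<partial>restricted L B) \<partial>coupling s)"
      by (subst nn_integral_fst[symmetric]) auto
    also have "... \<le> (\<integral>\<^sup>+\<omega>. (\<integral>\<^sup>+z. ennreal (\<bar>diff_op z F (fst \<omega>)\<bar> * \<bar>diff_op z F (snd \<omega>)\<bar>) \<partial>restricted L B) \<partial>coupling s)"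
      by (intro nn_integral_mono ennreal_leI) (auto simp: abs_mult intro!: mult_left_le_one_le w)
    also have "... \<le> (\<integral>\<^sup>+z. (\<integral>\<^sup>+\<tau>. ennreal ((diff_op z F \<tau>)\<^sup>2) \<partial>Q) \<partial>restricted L B)"
      by (rule nn_integral_gradient_product_le[OF s assms(3)])
    finally show "(\<integral>\<^sup>+p. ennreal (norm (case_prod ?g p)) \<partial>(coupling s \<Otimes>\<^sub>M restricted L B)) < \<infinity>"
      using DF by (rule order_le_less_trans)
  qed measurable
  show "(\<integral>z. (\<integral>\<omega>. ?g \<omega> z \<partial>coupling s) \<partial>restricted L B) = (\<integral>\<omega>. w \<omega> * gradient_product F \<omega> \<partial>coupling s)"
    unfolding Lc.Fubini_integral[OF int] gradient_product_def by simp
  show "integrable (restricted L B) (\<lambda>z. \<integral>\<omega>. ?g \<omega> z \<partial>coupling s)"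
    using Lc.integrable_snd[OF int] by simp
  show "AE z in restricted L B. integrable (coupling s) (\<lambda>\<omega>. ?g \<omega> z)"
    using cL.AE_integrable_fst'[OF Lc.integrable_product_swap[OF int]] by simp
qed

lemma gradient_product_covariance_le:
  fixes w :: "'a measure \<times> 'a measure \<Rightarrow> real" and K :: ennreal
  assumes int: "integrable (coupling s) (gradient_product F)"
    and w[measurable]: "w \<in> borel_measurable (point_algebra L \<Otimes>\<^sub>M point_algebra L)" "\<And>p. \<bar>w p\<bar> \<le> 1"
    and var: "(\<integral>\<^sup>+p. ennreal ((gradient_product F p - (\<integral>p. gradient_product F p \<partial>coupling s))\<^sup>2) \<partial>coupling s) \<le> K\<^sup>2"
  shows "ennreal \<bar>(\<integral>p. w p * gradient_product F p \<partial>coupling s) - (\<integral>p. w p \<partial>coupling s) * (\<integral>p. gradient_product F p \<partial>coupling s)\<bar> \<le> K"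
proof -
  interpret cp: prob_space "coupling s" by (rule prob_space_coupling)
  let ?P = "gradient_product F" and ?m = "\<integral>p. gradient_product F p \<partial>coupling s"
  have [measurable]: "?P \<in> borel_measurable (coupling s)" using int by auto
  have int_w: "integrable (coupling s) w" by (rule cp.integrable_const_bound[where B = 1]) (use w in auto)
  have int_wP: "integrable (coupling s) (\<lambda>p. w p * ?P p)"
    by (rule Bochner_Integration.integrable_bound[OF int]) (auto simp: abs_mult intro!: mult_left_le_one_le w)
  have "(\<integral>p. w p * ?P p \<partial>coupling s) - (\<integral>p. w p \<partial>coupling s) * ?m = (\<integral>p. w p * (?P p - ?m) \<partial>coupling s)"
    using int_w int_wP by (simp add: right_diff_distrib)
  moreover have "(ennreal \<bar>\<integral>p. w p * (?P p - ?m) \<partial>coupling s\<bar>)\<^sup>2 \<le> K\<^sup>2" (is "?l1 \<le> _")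
  proof -
    have "?l1 \<le> (\<integral>\<^sup>+p. ennreal ((w p * (?P p - ?m))\<^sup>2) \<partial>coupling s)"
      using cp.ennreal_square_integral_le[of "\<lambda>p. w p * (?P p - ?m)"] by (simp add: ennreal_power)
    also have "... \<le> (\<integral>\<^sup>+p. ennreal ((?P p - ?m)\<^sup>2) \<partial>coupling s)"
    proof (intro nn_integral_mono ennreal_leI)
      fix p
      have "(w p)\<^sup>2 \<le> 1" using power_mono[OF w(2)[of p], of 2] by simp
      then show "(w p * (?P p - ?m))\<^sup>2 \<le> (?P p - ?m)\<^sup>2"
        unfolding power_mult_distrib by (intro mult_left_le_one_le) auto
    qed
    also have "... \<le> K\<^sup>2" by (rule var)
    finally show ?thesis .
  qed
  ultimately show ?thesis using ennreal_le_of_square_le by simp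
qed

end

text \<open>The properties of a solution of Stein's equation that matter below.\<close>

locale stein_test =
  fixes f f' :: "real \<Rightarrow> real"
  assumes f_lipschitz: "1-lipschitz_on UNIV f"
    and f'_measurable [measurable]: "f' \<in> borel_measurable borel"
    and f'_bounded: "\<And>x. \<bar>f' x\<bar> \<le> 1"
    and f_taylor: "\<And>x d. \<bar>f (x + d) - f x - f' x * d\<bar> \<le> d\<^sup>2"
begin

lemma f_measurable [measurable]: "f \<in> borel_measurable borel"
  using lipschitz_on_continuous_on[OF f_lipschitz] by (rule borel_measurable_continuous_onI)

lemma f_increment_le: "\<bar>f x - f y\<bar> \<le> \<bar>x - y\<bar>"
  using lipschitz_onD[OF f_lipschitz, of x y] by (simp add: dist_real_def)

lemma taylor_le_min: "\<bar>f (x + d) - f x - f' x * d\<bar> \<le> min (2 * \<bar>d\<bar>) (d\<^sup>2)"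
proof -
  have "\<bar>f' x * d\<bar> \<le> \<bar>d\<bar>" using f'_bounded[of x] by (simp add: abs_mult mult_left_le_one_le)
  moreover have "\<bar>f (x + d) - f x\<bar> \<le> \<bar>d\<bar>" using f_increment_le[of "x + d" x] by simp
  ultimately show ?thesis using f_taylor[of x d] by simp
qed

end

text \<open>The estimates inside one window, with \<open>K\<close> in place of \<open>\<gamma>\<^sub>1 + \<gamma>\<^sub>2\<close>.\<close>

locale stein_window = mecke_window L Q B + stein_test f f' for L :: "'a measure" and Q B f f' +
  fixes F :: "'a measure \<Rightarrow> real" and K \<gamma>\<^sub>3 :: ennreal
  assumes F_measurable [measurable]: "F \<in> borel_measurable (point_algebra L)"
    and energy: "(\<integral>\<^sup>+z. (\<integral>\<^sup>+\<tau>. ennreal ((diff_op z F \<tau>)\<^sup>2) \<partial>Q) \<partial>restricted L B) < \<infinity>"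
    and variance: "\<And>s. 0 \<le> s \<Longrightarrow> s \<le> 1 \<Longrightarrow>
      (\<integral>\<^sup>+p. ennreal ((gradient_product F p - (\<integral>p. gradient_product F p \<partial>coupling s))\<^sup>2) \<partial>coupling s) \<le> K\<^sup>2"
    and third_moment: "(\<integral>\<^sup>+z. third_order_moment F z \<partial>L) \<le> \<gamma>\<^sub>3"
    and third_finite: "\<gamma>\<^sub>3 < \<infinity>"
begin

text \<open>
  The mean of \<open>diff_op y (f \<circ> F)\<close> at the first times \<open>diff_op y F\<close> at the second copy splits into \<open>k y\<close>, which
  integrates to the mean of \<open>f'(F)\<close> times \<open>gradient_product F\<close>, and the Taylor remainder \<open>\<rho> y\<close>. The
  covariance inequality controls the former, the third moments control the latter.
\<close>

lemma slice_bound: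
  assumes s: "0 \<le> s" "s \<le> 1"
  shows "ennreal \<bar>(\<integral>y. (\<integral>p. diff_op y (\<lambda>\<tau>. f (F \<tau>)) (fst p) * diff_op y F (snd p) \<partial>coupling s) \<partial>restricted L B) -
    (\<integral>\<tau>. f' (F \<tau>) \<partial>Q) * (\<integral>p. gradient_product F p \<partial>coupling s)\<bar> \<le> K + \<gamma>\<^sub>3"
proof -
  let ?d = "\<lambda>y. diff_op y F"
  interpret cp: prob_space "coupling s" by (rule prob_space_coupling)
  let ?\<nu> = "restricted L B"
  define r where "r y \<tau> = diff_op y (\<lambda>\<tau>. f (F \<tau>)) \<tau> - f' (F \<tau>) * ?d y \<tau>" for y \<tau>
  have r_le: "\<bar>r y \<tau>\<bar> \<le> min (2 * \<bar>?d y \<tau>\<bar>) ((?d y \<tau>)\<^sup>2)" for y \<tau>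
    using taylor_le_min[of "F \<tau>" "?d y \<tau>"] by (simp add: r_def diff_op_def)
  have [measurable]: "(\<lambda>(\<tau>, y). r y \<tau>) \<in> borel_measurable (point_algebra L \<Otimes>\<^sub>M L)"
    unfolding r_def by measurable
  define k where "k y = (\<integral>p. f' (F (fst p)) * (?d y (fst p) * ?d y (snd p)) \<partial>coupling s)" for y
  define \<rho> where "\<rho> y = (\<integral>p. r y (fst p) * ?d y (snd p) \<partial>coupling s)" for y
  define e where "e y = (\<integral>p. diff_op y (\<lambda>\<tau>. f (F \<tau>)) (fst p) * ?d y (snd p) \<partial>coupling s)" for y
  have cs: "(\<lambda>y. coupling s) \<in> ?\<nu> \<rightarrow>\<^sub>M prob_algebra (point_algebra L \<Otimes>\<^sub>M point_algebra L)"
    using measurable_space[OF measurable_coup[OF void_prob_algebra, of 1], of s] by simp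
  have [measurable]: "k \<in> borel_measurable ?\<nu>" "\<rho> \<in> borel_measurable ?\<nu>" "e \<in> borel_measurable ?\<nu>"
    unfolding k_def[abs_def] \<rho>_def[abs_def] e_def[abs_def] by (rule measurable_lebesgue_integral_kernel[OF _ cs], measurable)+
  note fub = gradient_product_fubini[OF s F_measurable energy, of "\<lambda>p. f' (F (fst p))"]
  have int_k: "integrable ?\<nu> k" unfolding k_def by (rule fub(2)) (auto simp: f'_bounded)
  have eq_k: "(\<integral>y. k y \<partial>?\<nu>) = (\<integral>p. f' (F (fst p)) * gradient_product F p \<partial>coupling s)"
    unfolding k_def by (rule fub(1)) (auto simp: f'_bounded)
  have "AE y in ?\<nu>. (\<integral>\<^sup>+\<tau>. ennreal ((?d y \<tau>)\<^sup>2) \<partial>Q) \<noteq> \<infinity>"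
    using energy by (intro nn_integral_PInf_AE) auto
  moreover have "AE y in ?\<nu>. integrable (coupling s) (\<lambda>p. f' (F (fst p)) * (?d y (fst p) * ?d y (snd p)))"
    by (rule fub(3)) (auto simp: f'_bounded)
  ultimately have "AE y in ?\<nu>. e y = k y + \<rho> y"
    using AE_space
  proof eventually_elim
    case (elim y)
    then have y[measurable]: "y \<in> space L" by simp
    have D2: "integrable Q (\<lambda>\<tau>. (?d y \<tau>)\<^sup>2)" using elim(1) by (intro integrableI_bounded) (auto simp: less_top)
    have "integrable Q (\<lambda>\<tau>. (r y \<tau>)\<^sup>2)"
    proof (rule Bochner_Integration.integrable_bound[where f = "\<lambda>\<tau>. 4 * (?d y \<tau>)\<^sup>2"])
      show "AE \<tau> in Q. norm ((r y \<tau>)\<^sup>2) \<le> norm (4 * (?d y \<tau>)\<^sup>2)"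
      proof (rule AE_I2)
        fix \<tau>
        have "\<bar>r y \<tau>\<bar> \<le> 2 * \<bar>?d y \<tau>\<bar>" using r_le[of y \<tau>] by simp
        from power_mono[OF this, of 2] show "norm ((r y \<tau>)\<^sup>2) \<le> norm (4 * (?d y \<tau>)\<^sup>2)"
          by (simp add: power_mult_distrib)
      qed
    qed (use D2 in auto)
    then have "integrable (coupling s) (\<lambda>p. r y (fst p) * ?d y (snd p))"
      by (intro coupling_product(1)[OF s] D2) measurable
    from Bochner_Integration.integral_add[OF elim(2) this, symmetric]
    show ?case unfolding e_def k_def \<rho>_def r_def by (simp add: algebra_simps)
  qed
  then have "(\<integral>y. e y \<partial>?\<nu>) = (\<integral>y. k y + \<rho> y \<partial>?\<nu>)" by (intro integral_cong_AE) auto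
  have \<rho>_le: "(\<integral>\<^sup>+y. ennreal (norm (\<rho> y)) \<partial>?\<nu>) \<le> \<gamma>\<^sub>3"
  proof -
    let ?h = "third_order_moment F"
    have [measurable]: "?h \<in> borel_measurable L" unfolding third_order_moment_def[abs_def] by measurable
    have "(\<integral>\<^sup>+y. ennreal (norm (\<rho> y)) \<partial>?\<nu>) \<le> (\<integral>\<^sup>+y. ?h y \<partial>?\<nu>)"
    proof (rule nn_integral_mono)
      fix y assume "y \<in> space ?\<nu>"
      then have y[measurable]: "y \<in> space L" by simp
      let ?g = "\<lambda>p. r y (fst p) * ?d y (snd p)"
      have "ennreal (norm (\<rho> y)) \<le> (\<integral>\<^sup>+p. ennreal (norm (?g p)) \<partial>coupling s)"
      proof (cases "integrable (coupling s) ?g")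
        case True
        then show ?thesis unfolding \<rho>_def by (rule integral_norm_bound_ennreal)
      qed (simp add: \<rho>_def not_integrable_integral_eq)
      also have "... \<le> (\<integral>\<^sup>+p. ennreal (min (2 * \<bar>?d y (fst p)\<bar>) ((?d y (fst p))\<^sup>2) * \<bar>?d y (snd p)\<bar>) \<partial>coupling s)"
        unfolding real_norm_def abs_mult by (intro nn_integral_mono ennreal_leI mult_right_mono r_le) simp
      also have "... \<le> ?h y" unfolding third_order_moment_def by (rule coupling_min_square_le[OF s]) measurable
      finally show "ennreal (norm (\<rho> y)) \<le> ?h y" .
    qed
    also have "... \<le> (\<integral>\<^sup>+y. ?h y \<partial>L)" by (rule nn_integral_restricted_le) measurable
    also have "... \<le> \<gamma>\<^sub>3" by (rule third_moment)
    finally show ?thesis .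
  qed
  have int_\<rho>: "integrable ?\<nu> \<rho>"
    using order_le_less_trans[OF \<rho>_le third_finite] by (intro integrableI_bounded) auto
  let ?m = "\<integral>\<tau>. f' (F \<tau>) \<partial>Q" and ?P = "\<integral>p. gradient_product F p \<partial>coupling s"
  let ?w = "\<integral>p. f' (F (fst p)) * gradient_product F p \<partial>coupling s"
  have "?m = (\<integral>p. f' (F (fst p)) \<partial>coupling s)"
    by (rule coupling_marginal_real(1)[OF s, symmetric]) measurable
  then have cov: "ennreal \<bar>?w - ?m * ?P\<bar> \<le> K"
    using gradient_product_covariance_le[OF integrable_gradient_product(1)[OF s F_measurable energy], of "\<lambda>p. f' (F (fst p))" K]
      variance[OF s] by (simp add: f'_bounded)
  have "(\<integral>y. e y \<partial>?\<nu>) - ?m * ?P = (?w - ?m * ?P) + (\<integral>y. \<rho> y \<partial>?\<nu>)"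
    using \<open>(\<integral>y. e y \<partial>?\<nu>) = (\<integral>y. k y + \<rho> y \<partial>?\<nu>)\<close> int_k int_\<rho> eq_k by simp
  then have "\<bar>(\<integral>y. e y \<partial>?\<nu>) - ?m * ?P\<bar> \<le> \<bar>?w - ?m * ?P\<bar> + \<bar>\<integral>y. \<rho> y \<partial>?\<nu>\<bar>" by linarith
  from ennreal_leI[OF this]
  have "ennreal \<bar>(\<integral>y. e y \<partial>?\<nu>) - ?m * ?P\<bar> \<le> ennreal \<bar>?w - ?m * ?P\<bar> + ennreal \<bar>\<integral>y. \<rho> y \<partial>?\<nu>\<bar>"
    by (simp only: ennreal_plus abs_ge_zero)
  also have "... \<le> K + \<gamma>\<^sub>3"
  proof (rule add_mono[OF cov])
    show "ennreal \<bar>\<integral>y. \<rho> y \<partial>?\<nu>\<bar> \<le> \<gamma>\<^sub>3"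
      using integral_norm_bound_ennreal[OF int_\<rho>] \<rho>_le by simp
  qed
  finally show ?thesis by (simp add: e_def)
qed

text \<open>
  Integration of \<open>slice_bound\<close> over \<open>s\<close>. The covariance formula turns the two parts into the left-hand side,
  applied to \<open>f\<close> and, for the means of \<open>gradient_product F\<close>, to the identity.
\<close>

theorem window_bound:
  assumes F2: "integrable Q (\<lambda>\<tau>. (F \<tau>)\<^sup>2)"
  shows "ennreal \<bar>((\<integral>\<tau>. f (F \<tau>) * F \<tau> \<partial>Q) - (\<integral>p. f (F (fst p)) * F (snd p) \<partial>coupling 0)) -
    (\<integral>\<tau>. f' (F \<tau>) \<partial>Q) * ((\<integral>\<tau>. (F \<tau>)\<^sup>2 \<partial>Q) - (\<integral>p. F (fst p) * F (snd p) \<partial>coupling 0))\<bar> \<le> K + \<gamma>\<^sub>3"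
proof (cases "K + \<gamma>\<^sub>3 = top")
  case False
  define c where "c = enn2real (K + \<gamma>\<^sub>3)"
  have c: "K + \<gamma>\<^sub>3 = ennreal c" "0 \<le> c" using False by (auto simp: c_def less_top)
  define V where "V = enn2real (\<integral>\<^sup>+z. (\<integral>\<^sup>+\<tau>. ennreal ((diff_op z F \<tau>)\<^sup>2) \<partial>Q) \<partial>restricted L B)"
  have V: "(\<integral>\<^sup>+z. (\<integral>\<^sup>+\<tau>. ennreal ((diff_op z F \<tau>)\<^sup>2) \<partial>Q) \<partial>restricted L B) = ennreal V" "0 \<le> V"
    using energy by (auto simp: V_def less_top)
  let ?m = "\<integral>\<tau>. f' (F \<tau>) \<partial>Q"
  define I where "I s = (\<integral>y. (\<integral>p. diff_op y (\<lambda>\<tau>. f (F \<tau>)) (fst p) * diff_op y F (snd p) \<partial>coupling s) \<partial>restricted L B)" for s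
  define J where "J s = (\<integral>y. (\<integral>p. diff_op y F (fst p) * diff_op y F (snd p) \<partial>coupling s) \<partial>restricted L B)" for s
  note [measurable] = measurable_coup[OF void_prob_algebra, of 1]
  have [measurable]: "I \<in> borel_measurable borel" "J \<in> borel_measurable borel"
    unfolding I_def[abs_def] J_def[abs_def] by measurable
  have J_eq: "J s = (\<integral>p. gradient_product F p \<partial>coupling s)" if "0 \<le> s" "s \<le> 1" for s
    using gradient_product_fubini(1)[OF that F_measurable energy, of "\<lambda>_. 1"] by (simp add: J_def)
  have J_le: "\<bar>J s\<bar> \<le> V" if "0 \<le> s" "s \<le> 1" for s
  proof -
    note P = integrable_gradient_product[OF that F_measurable energy]
    have "ennreal \<bar>J s\<bar> \<le> ennreal V"
      using order_trans[OF integral_norm_bound_ennreal[OF P(1)] P(3)] by (simp add: J_eq[OF that] V)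
    then show ?thesis using V(2) by simp
  qed
  have d: "\<bar>I s - ?m * J s\<bar> \<le> c" if "0 \<le> s" "s \<le> 1" for s
    using slice_bound[OF that] c by (simp add: I_def J_eq[OF that])
  have int_J: "integrable lborel (\<lambda>s. indicator {0..1} s * J s)"
  proof (rule Bochner_Integration.integrable_bound[where f = "\<lambda>s. indicator {0..1::real} s * V"])
    show "integrable lborel (\<lambda>s. indicator {0..1::real} s * V)"
      by (intro integrable_mult_left) (auto simp: emeasure_lborel_Icc_eq)
    show "AE s in lborel. norm (indicator {0..1} s * J s) \<le> norm (indicator {0..1::real} s * V)"
      using J_le V(2) by (intro AE_I2) (auto simp: indicator_def)
  qed measurable
  have int_c: "integrable lborel (\<lambda>s. indicator {0..1::real} s * c)"
    by (intro integrable_mult_left) (auto simp: emeasure_lborel_Icc_eq)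
  have int_d: "integrable lborel (\<lambda>s. indicator {0..1} s * (I s - ?m * J s))"
  proof (rule Bochner_Integration.integrable_bound[OF int_c])
    show "AE s in lborel. norm (indicator {0..1} s * (I s - ?m * J s)) \<le> norm (indicator {0..1::real} s * c)"
      using d c(2) by (intro AE_I2) (auto simp: indicator_def)
  qed measurable
  have "(\<integral>\<tau>. f (F \<tau>) * F \<tau> \<partial>Q) - (\<integral>p. f (F (fst p)) * F (snd p) \<partial>coupling 0) = (\<integral>s. indicator {0..1} s * I s \<partial>lborel)"
    unfolding I_def by (rule coupling_covariance[OF F_measurable F2 energy f_lipschitz])
  also have "... = (\<integral>s. indicator {0..1} s * (I s - ?m * J s) + ?m * (indicator {0..1} s * J s) \<partial>lborel)"
    by (simp add: algebra_simps)
  also have "... = (\<integral>s. indicator {0..1} s * (I s - ?m * J s) \<partial>lborel) + ?m * (\<integral>s. indicator {0..1} s * J s \<partial>lborel)"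
    using int_d int_J by simp
  also have "(\<integral>s. indicator {0..1} s * J s \<partial>lborel) = (\<integral>\<tau>. (F \<tau>)\<^sup>2 \<partial>Q) - (\<integral>p. F (fst p) * F (snd p) \<partial>coupling 0)"
    using coupling_covariance[OF F_measurable F2 energy, of "\<lambda>x. x"]
    by (simp add: J_def power2_eq_square lipschitz_on_def)
  finally have eq: "((\<integral>\<tau>. f (F \<tau>) * F \<tau> \<partial>Q) - (\<integral>p. f (F (fst p)) * F (snd p) \<partial>coupling 0)) -
    ?m * ((\<integral>\<tau>. (F \<tau>)\<^sup>2 \<partial>Q) - (\<integral>p. F (fst p) * F (snd p) \<partial>coupling 0)) = (\<integral>s. indicator {0..1} s * (I s - ?m * J s) \<partial>lborel)"
    by simp
  have "\<bar>\<integral>s. indicator {0..1} s * (I s - ?m * J s) \<partial>lborel\<bar> \<le> (\<integral>s. \<bar>indicator {0..1} s * (I s - ?m * J s)\<bar> \<partial>lborel)"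
    by (rule integral_abs_bound)
  also have "... \<le> (\<integral>s. indicator {0..1::real} s * c \<partial>lborel)"
    using d c(2) by (intro integral_mono int_c integrable_abs int_d) (auto simp: indicator_def)
  also have "... = c" by simp
  finally show ?thesis unfolding eq c(1) by (rule ennreal_leI)
next
  case True
  then show ?thesis by (simp only: top_greatest)
qed

end

section \<open>Normal approximation\<close>

context mecke_exhaustion
begin

definition window_correlation :: "nat \<Rightarrow> ('a measure \<Rightarrow> real) \<Rightarrow> ('a measure \<Rightarrow> real) \<Rightarrow> real" where
  "window_correlation n F G = (\<integral>p. F (fst p) * G (snd p)
     \<partial>poisson_kicks.coup (restricted L (B n)) (point_algebra L) add_dirac (void_law L Q (B n)) 1 0)"

text \<open>Since \<open>G\<close> is centred, \<open>F\<close> may be centred as well, and then \<open>window_correlation_le\<close> applies.\<close>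

lemma window_correlation_tendsto_0:
  fixes F G :: "'a measure \<Rightarrow> real"
  assumes F[measurable]: "F \<in> borel_measurable (point_algebra L)" and F2: "integrable Q (\<lambda>\<tau>. (F \<tau>)\<^sup>2)"
    and G[measurable]: "G \<in> borel_measurable (point_algebra L)" and G2: "integrable Q (\<lambda>\<tau>. (G \<tau>)\<^sup>2)"
    and mean: "(\<integral>\<tau>. G \<tau> \<partial>Q) = 0"
  shows "(\<lambda>n. window_correlation n F G) \<longlonglongrightarrow> 0"
proof -
  define m where "m = (\<integral>\<tau>. F \<tau> \<partial>Q)"
  define F0 where "F0 \<tau> = F \<tau> - m" for \<tau>
  have intF: "integrable Q F" by (rule integrable_of_square[OF F F2])
  have F0_meas[measurable]: "F0 \<in> borel_measurable (point_algebra L)" unfolding F0_def[abs_def] by measurable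
  have F02: "integrable Q (\<lambda>\<tau>. (F0 \<tau>)\<^sup>2)"
    unfolding F0_def power2_diff using F2 intF by (simp add: mult.assoc)
  have centred: "window_correlation n F G = window_correlation n F0 G" for n
  proof -
    interpret W: mecke_window L Q "B n" by (rule win)
    have G1: "integrable (W.coupling 0) (\<lambda>p. G (snd p))" "(\<integral>p. G (snd p) \<partial>W.coupling 0) = 0"
      using W.coupling_marginal_real(2,4)[of 0 G] integrable_of_square[OF G G2] mean by auto
    have FG: "integrable (W.coupling 0) (\<lambda>p. F (fst p) * G (snd p))"
      by (rule W.coupling_product(1)) (use F2 G2 in auto)
    have "window_correlation n F0 G = (\<integral>p. F (fst p) * G (snd p) - m * G (snd p) \<partial>W.coupling 0)"
      by (simp add: window_correlation_def F0_def left_diff_distrib)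
    also have "... = window_correlation n F G"
      using FG G1 by (simp add: window_correlation_def)
    finally show ?thesis by simp
  qed
  let ?I = "\<integral>\<^sup>+\<tau>. ennreal ((G \<tau>)\<^sup>2) \<partial>Q"
  have "(\<lambda>n. ennreal ((window_correlation n F0 G)\<^sup>2)) \<longlonglongrightarrow> 0"
  proof (rule tendsto_sandwich)
    show "(\<lambda>_. 0 :: ennreal) \<longlonglongrightarrow> 0" by simp
    have I: "?I \<noteq> top" using G2 by (simp add: integrable_iff_bounded less_top)
    have "(\<lambda>n. window_form L Q (B n) F0) \<longlonglongrightarrow> 0"
      using vanishingD(4)[OF vanishing_square_integrable[OF F F2]] by (simp add: F0_def[abs_def] m_def)
    from ennreal_tendsto_cmult[OF _ ennreal_tendsto_cmult[OF _ this, of 2], of ?I] I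
    show "(\<lambda>n. ?I * (2 * window_form L Q (B n) F0)) \<longlonglongrightarrow> 0" by (simp add: less_top)
    show "\<forall>\<^sub>F n in sequentially. ennreal ((window_correlation n F0 G)\<^sup>2) \<le> ?I * (2 * window_form L Q (B n) F0)"
      unfolding window_correlation_def
      by (intro always_eventually allI mecke_window.window_correlation_le[OF win] F0_meas G F02 G2)
  qed simp
  then have "(\<lambda>n. (window_correlation n F0 G)\<^sup>2) \<longlonglongrightarrow> 0"
    by (subst (asm) ennreal_tendsto_0_iff) auto
  from tendsto_real_sqrt[OF this] have "(\<lambda>n. \<bar>window_correlation n F0 G\<bar>) \<longlonglongrightarrow> 0" by simp
  then show ?thesis unfolding centred by (rule tendsto_rabs_zero_cancel)
qed

end

text \<open>The bounds of \<open>window_bound\<close> are the same for all windows, while the terms for \<open>s = 0\<close> vanish.\<close>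

theorem (in mecke_process) stein_bound:
  fixes F :: "'a measure \<Rightarrow> real" and \<gamma>\<^sub>1 \<gamma>\<^sub>2 \<gamma>\<^sub>3 :: ennreal
  assumes f: "stein_test f f'"
    and F[measurable]: "F \<in> borel_measurable (point_algebra L)" and F2: "integrable Q (\<lambda>\<tau>. (F \<tau>)\<^sup>2)"
    and mean: "(\<integral>\<tau>. F \<tau> \<partial>Q) = 0" and variance: "(\<integral>\<tau>. (F \<tau>)\<^sup>2 \<partial>Q) = 1"
    and energy: "(\<integral>\<^sup>+z. (\<integral>\<^sup>+\<tau>. ennreal ((diff_op z F \<tau>)\<^sup>2) \<partial>Q) \<partial>L) < \<infinity>"
    and g1: "4 * (\<integral>\<^sup>+y. (\<integral>\<^sup>+z1. (\<integral>\<^sup>+z2. ennreal_powr (gradient_moment F z1 z2) (1/2) * ennreal_powr (hessian_moment F z1 z2 y) (1/2) \<partial>L) \<partial>L) \<partial>L) = \<gamma>\<^sub>1\<^sup>2"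
    and g2: "(\<integral>\<^sup>+y. (\<integral>\<^sup>+z1. (\<integral>\<^sup>+z2. hessian_moment F z1 z2 y \<partial>L) \<partial>L) \<partial>L) = \<gamma>\<^sub>2\<^sup>2"
    and g3: "(\<integral>\<^sup>+z. third_order_moment F z \<partial>L) = \<gamma>\<^sub>3"
  shows "ennreal \<bar>(\<integral>\<tau>. f (F \<tau>) * F \<tau> \<partial>Q) - (\<integral>\<tau>. f' (F \<tau>) \<partial>Q)\<bar> \<le> \<gamma>\<^sub>1 + \<gamma>\<^sub>2 + \<gamma>\<^sub>3"
proof (cases "\<gamma>\<^sub>3 = top")
  case False
  interpret st: stein_test f f' by (rule f)
  obtain B where "mecke_exhaustion L Q B" using exhaustion_exists by blast
  then interpret X: mecke_exhaustion L Q B .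
  define fF where "fF \<tau> = f (F \<tau>)" for \<tau>
  have fF_meas[measurable]: "fF \<in> borel_measurable (point_algebra L)" unfolding fF_def[abs_def] by measurable
  have fF2: "integrable Q (\<lambda>\<tau>. (fF \<tau>)\<^sup>2)"
  proof (rule Bochner_Integration.integrable_bound[where f = "\<lambda>\<tau>. (\<bar>f 0\<bar> + \<bar>F \<tau>\<bar>)\<^sup>2"])
    show "integrable Q (\<lambda>\<tau>. (\<bar>f 0\<bar> + \<bar>F \<tau>\<bar>)\<^sup>2)"
      using F2 integrable_of_square[OF F F2] by (simp add: power2_sum)
    show "AE \<tau> in Q. norm ((fF \<tau>)\<^sup>2) \<le> norm ((\<bar>f 0\<bar> + \<bar>F \<tau>\<bar>)\<^sup>2)"
    proof (rule AE_I2)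
      fix \<tau>
      have "\<bar>fF \<tau>\<bar> \<le> \<bar>f 0\<bar> + \<bar>F \<tau>\<bar>" using st.f_increment_le[of "F \<tau>" 0] by (simp add: fF_def)
      from power_mono[OF this, of 2] show "norm ((fF \<tau>)\<^sup>2) \<le> norm ((\<bar>f 0\<bar> + \<bar>F \<tau>\<bar>)\<^sup>2)" by simp
    qed
  qed measurable
  let ?m = "\<integral>\<tau>. f' (F \<tau>) \<partial>Q"
  let ?c = "\<lambda>n F G. X.window_correlation n F G"
  have n: "ennreal \<bar>((\<integral>\<tau>. fF \<tau> * F \<tau> \<partial>Q) - ?c n fF F) - ?m * (1 - ?c n F F)\<bar> \<le> \<gamma>\<^sub>1 + \<gamma>\<^sub>2 + \<gamma>\<^sub>3" for n
  proof -
    interpret W: mecke_window L Q "B n" by (rule X.win)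
    have e: "(\<integral>\<^sup>+z. (\<integral>\<^sup>+\<tau>. ennreal ((diff_op z F \<tau>)\<^sup>2) \<partial>Q) \<partial>restricted L (B n)) < \<infinity>"
      using energy by (rule order_le_less_trans[rotated]) (rule W.nn_integral_restricted_le, measurable)
    interpret S: stein_window L Q "B n" f f' F "\<gamma>\<^sub>1 + \<gamma>\<^sub>2" \<gamma>\<^sub>3
    proof unfold_locales
      show "(\<integral>\<^sup>+p. ennreal ((W.gradient_product F p - (\<integral>p. W.gradient_product F p \<partial>W.coupling s))\<^sup>2) \<partial>W.coupling s) \<le> (\<gamma>\<^sub>1 + \<gamma>\<^sub>2)\<^sup>2"
        if "0 \<le> s" "s \<le> 1" for s
        by (rule W.gradient_product_variance[OF that F e g1 g2])
    qed (use False e g3 in \<open>auto simp: less_top\<close>)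
    show ?thesis
      using S.window_bound[OF F2] unfolding X.window_correlation_def fF_def variance .
  qed
  have lim: "(\<lambda>n. \<bar>((\<integral>\<tau>. fF \<tau> * F \<tau> \<partial>Q) - ?c n fF F) - ?m * (1 - ?c n F F)\<bar>) \<longlonglongrightarrow>
      \<bar>((\<integral>\<tau>. fF \<tau> * F \<tau> \<partial>Q) - 0) - ?m * (1 - 0)\<bar>"
    by (intro tendsto_intros X.window_correlation_tendsto_0[OF fF_meas fF2 F F2 mean]
        X.window_correlation_tendsto_0[OF F F2 F F2 mean])
  have "ennreal \<bar>((\<integral>\<tau>. fF \<tau> * F \<tau> \<partial>Q) - 0) - ?m * (1 - 0)\<bar> \<le> \<gamma>\<^sub>1 + \<gamma>\<^sub>2 + \<gamma>\<^sub>3"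
    by (rule LIMSEQ_le_const2[OF tendsto_ennrealI[OF lim]]) (use n in blast)
  then show ?thesis by (simp add: fF_def)
next
  case True
  then show ?thesis by simp
qed

lemma (in sigma_finite_measure) nn_integral_triple:
  assumes f: "(\<lambda>(x, y, z). f x y z) \<in> borel_measurable (M \<Otimes>\<^sub>M M \<Otimes>\<^sub>M M)"
  shows "(\<integral>\<^sup>+(x, y, z). f x y z \<partial>(M \<Otimes>\<^sub>M M \<Otimes>\<^sub>M M)) = (\<integral>\<^sup>+z. (\<integral>\<^sup>+x. (\<integral>\<^sup>+y. f x y z \<partial>M) \<partial>M) \<partial>M)" (is "?l = ?r")
proof -
  interpret MM: pair_sigma_finite M M ..
  have [measurable (raw)]: "(\<lambda>w. f (a w) (b w) (c w)) \<in> borel_measurable X"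
    if "a \<in> X \<rightarrow>\<^sub>M M" "b \<in> X \<rightarrow>\<^sub>M M" "c \<in> X \<rightarrow>\<^sub>M M" for a b c and X :: "'z measure"
    using measurable_compose[OF measurable_Pair[OF that(1) measurable_Pair[OF that(2,3)]] f] by simp
  have "?l = (\<integral>\<^sup>+x. (\<integral>\<^sup>+q. (case q of (y, z) \<Rightarrow> f x y z) \<partial>(M \<Otimes>\<^sub>M M)) \<partial>M)"
    by (subst sigma_finite_measure.nn_integral_fst[OF MM.sigma_finite_measure_axioms, symmetric]) auto
  also have "... = (\<integral>\<^sup>+x. (\<integral>\<^sup>+y. (\<integral>\<^sup>+z. f x y z \<partial>M) \<partial>M) \<partial>M)"
    by (intro nn_integral_cong) (subst nn_integral_fst[symmetric], auto)
  also have "... = (\<integral>\<^sup>+x. (\<integral>\<^sup>+z. (\<integral>\<^sup>+y. f x y z \<partial>M) \<partial>M) \<partial>M)"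
    by (intro nn_integral_cong MM.Fubini') measurable
  also have "... = ?r"
    by (rule MM.Fubini') measurable
  finally show ?thesis .
qed

lemma stein_test_of_derivative:
  assumes d: "\<And>w. (f has_real_derivative f' w) (at w)" and b: "\<And>w. \<bar>f' w\<bar> \<le> 1"
    and l: "\<And>v w. \<bar>f' v - f' w\<bar> \<le> 2 * \<bar>v - w\<bar>"
  shows "stein_test f f'"
proof
  show "1-lipschitz_on UNIV f"
  proof (rule lipschitz_onI)
    fix x y :: real
    have "norm (f x - f y) \<le> 1 * norm (x - y)"
      by (rule field_differentiable_bound[where S = UNIV and f' = f']) (use d b in \<open>auto intro: has_field_derivative_at_within\<close>)
    then show "dist (f x) (f y) \<le> 1 * dist x y" by (simp add: dist_real_def)
  qed simp
  have "2-lipschitz_on UNIV f'" by (rule lipschitz_onI) (use l in \<open>auto simp: dist_real_def\<close>)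
  then show "f' \<in> borel_measurable borel"
    using lipschitz_on_continuous_on borel_measurable_continuous_onI by blast
qed (use b taylor_remainder_of_lipschitz_derivative[OF d l] in auto)

theorem theorem3p1:
  fixes M :: "'w measure" and L :: "'a measure" and \<eta> :: "'w \<Rightarrow> 'a measure"
    and F :: "'w \<Rightarrow> real" and \<phi> :: "'a measure \<Rightarrow> real"
    and M' :: "'v measure" and Z :: "'v \<Rightarrow> real"
    and \<gamma>\<^sub>1 \<gamma>\<^sub>2 \<gamma>\<^sub>3 :: ennreal
  assumes "prob_space M"
    and "sigma_finite_measure L"
    and "poisson_process M L \<eta>"
    and "poisson_functional M L \<eta> F \<phi>"
    and "square_integrable M F"
    and "square_integrable (M \<Otimes>\<^sub>M L) (\<lambda>(\<omega>, z). diff_op z \<phi> (\<eta> \<omega>))"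
    and "(\<integral>\<omega>. F \<omega> \<partial>M) = 0"
    and "(\<integral>\<omega>. (F \<omega>)\<^sup>2 \<partial>M) = 1"
    and "prob_space M'"
    and "distributed M' lborel Z std_normal_density"
    and "\<gamma>\<^sub>1\<^sup>2 = 4 * (\<integral>\<^sup>+(z\<^sub>1, z\<^sub>2, z\<^sub>3).
           ennreal_powr (\<integral>\<^sup>+\<omega>. ennreal ((diff_op z\<^sub>1 \<phi> (\<eta> \<omega>))\<^sup>2 * (diff_op z\<^sub>2 \<phi> (\<eta> \<omega>))\<^sup>2) \<partial>M) (1/2) *
           ennreal_powr (\<integral>\<^sup>+\<omega>. ennreal ((diff_op2 z\<^sub>1 z\<^sub>3 \<phi> (\<eta> \<omega>))\<^sup>2 * (diff_op2 z\<^sub>2 z\<^sub>3 \<phi> (\<eta> \<omega>))\<^sup>2) \<partial>M) (1/2)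
         \<partial>(L \<Otimes>\<^sub>M L \<Otimes>\<^sub>M L))"
    and "\<gamma>\<^sub>2\<^sup>2 = (\<integral>\<^sup>+(z\<^sub>1, z\<^sub>2, z\<^sub>3).
           (\<integral>\<^sup>+\<omega>. ennreal ((diff_op2 z\<^sub>1 z\<^sub>3 \<phi> (\<eta> \<omega>))\<^sup>2 * (diff_op2 z\<^sub>2 z\<^sub>3 \<phi> (\<eta> \<omega>))\<^sup>2) \<partial>M)
         \<partial>(L \<Otimes>\<^sub>M L \<Otimes>\<^sub>M L))"
    and "\<gamma>\<^sub>3 = (\<integral>\<^sup>+z.
           ennreal_powr (\<integral>\<^sup>+\<omega>. ennreal (\<bar>diff_op z \<phi> (\<eta> \<omega>)\<bar> ^ 3) \<partial>M) (1/3) *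
           ennreal_powr (\<integral>\<^sup>+\<omega>. ennreal (min (sqrt 8 * \<bar>diff_op z \<phi> (\<eta> \<omega>)\<bar> powr (3/2))
                                            (\<bar>diff_op z \<phi> (\<eta> \<omega>)\<bar> ^ 3)) \<partial>M) (2/3)
         \<partial>L)"
  shows "wasserstein_dist M F M' Z \<le> \<gamma>\<^sub>1 + \<gamma>\<^sub>2 + \<gamma>\<^sub>3"
proof -
  let ?N = "point_algebra L"
  interpret M: prob_space M by fact
  interpret L: sigma_finite_measure L by fact
  define Q where "Q = distr M ?N \<eta>"
  have \<eta>[measurable]: "\<eta> \<in> M \<rightarrow>\<^sub>M ?N" using assms(3) by (simp add: poisson_process_def)
  have F[measurable]: "F \<in> borel_measurable M" and \<phi>[measurable]: "\<phi> \<in> borel_measurable ?N"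
    and F_eq: "AE \<omega> in M. F \<omega> = \<phi> (\<eta> \<omega>)"
    using assms(4) by (auto simp: poisson_functional_def)
  interpret Q: mecke_process L Q
    by unfold_locales (use mecke_of_poisson_process[OF assms(1-3)] in \<open>simp add: Q_def\<close>)
  \<comment> \<open>Any window serves to make the difference operators measurable.\<close>
  interpret W: mecke_window L Q "{}" by unfold_locales auto
  have nn: "(\<integral>\<^sup>+\<omega>. g (\<eta> \<omega>) \<partial>M) = (\<integral>\<^sup>+\<tau>. g \<tau> \<partial>Q)" if "g \<in> borel_measurable ?N" for g
    unfolding Q_def by (rule nn_integral_distr[symmetric]) (use that in auto)
  have re: "(\<integral>\<omega>. g (F \<omega>) \<partial>M) = (\<integral>\<tau>. g (\<phi> \<tau>) \<partial>Q)" if g[measurable]: "g \<in> borel_measurable borel" for g :: "real \<Rightarrow> real"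
  proof -
    have "(\<integral>\<omega>. g (F \<omega>) \<partial>M) = (\<integral>\<omega>. g (\<phi> (\<eta> \<omega>)) \<partial>M)"
      by (rule integral_cong_AE) (use F_eq in auto)
    also have "\<dots> = (\<integral>\<tau>. g (\<phi> \<tau>) \<partial>Q)"
      unfolding Q_def by (rule integral_distr[symmetric]) measurable
    finally show ?thesis .
  qed
  have "integrable M (\<lambda>\<omega>. (\<phi> (\<eta> \<omega>))\<^sup>2)"
    using assms(5) F_eq unfolding square_integrable_def
    by (subst integrable_cong_AE[where g = "\<lambda>\<omega>. (F \<omega>)\<^sup>2"]) auto
  then have \<phi>2: "integrable Q (\<lambda>\<tau>. (\<phi> \<tau>)\<^sup>2)"
    unfolding Q_def by (subst integrable_distr_eq) auto
  have \<phi>1: "integrable Q \<phi>" by (rule Q.integrable_of_square[OF \<phi> \<phi>2])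
  have mean: "(\<integral>\<tau>. \<phi> \<tau> \<partial>Q) = 0" and variance: "(\<integral>\<tau>. (\<phi> \<tau>)\<^sup>2 \<partial>Q) = 1"
    using re[of "\<lambda>x. x"] re[of "\<lambda>x. x\<^sup>2"] assms(7,8) by simp_all
  have energy: "(\<integral>\<^sup>+z. (\<integral>\<^sup>+\<tau>. ennreal ((diff_op z \<phi> \<tau>)\<^sup>2) \<partial>Q) \<partial>L) < \<infinity>" (is "?l1 < _")
  proof -
    interpret ME: pair_sigma_finite M L ..
    have "?l1 = (\<integral>\<^sup>+z. (\<integral>\<^sup>+\<omega>. ennreal ((diff_op z \<phi> (\<eta> \<omega>))\<^sup>2) \<partial>M) \<partial>L)"
      by (intro nn_integral_cong nn[symmetric]) measurable
    also have "\<dots> = (\<integral>\<^sup>+p. ennreal ((case p of (\<omega>, z) \<Rightarrow> diff_op z \<phi> (\<eta> \<omega>))\<^sup>2) \<partial>(M \<Otimes>\<^sub>M L))"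
      by (subst ME.nn_integral_snd[symmetric]) auto
    also have "\<dots> < \<infinity>"
      using assms(6) by (auto simp: square_integrable_def integrable_iff_bounded)
    finally show ?thesis .
  qed
  have g1: "4 * (\<integral>\<^sup>+y. (\<integral>\<^sup>+z\<^sub>1. (\<integral>\<^sup>+z\<^sub>2. ennreal_powr (Q.gradient_moment \<phi> z\<^sub>1 z\<^sub>2) (1/2) * ennreal_powr (Q.hessian_moment \<phi> z\<^sub>1 z\<^sub>2 y) (1/2) \<partial>L) \<partial>L) \<partial>L) = \<gamma>\<^sub>1\<^sup>2"
    unfolding assms(11) Q.gradient_moment_def Q.hessian_moment_def
    by (subst L.nn_integral_triple, measurable)
       (intro arg_cong2[where f = "(*)"] refl nn_integral_cong arg_cong2[where f = ennreal_powr] nn[symmetric], measurable)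
  have g2: "(\<integral>\<^sup>+y. (\<integral>\<^sup>+z\<^sub>1. (\<integral>\<^sup>+z\<^sub>2. Q.hessian_moment \<phi> z\<^sub>1 z\<^sub>2 y \<partial>L) \<partial>L) \<partial>L) = \<gamma>\<^sub>2\<^sup>2"
    unfolding assms(12) Q.hessian_moment_def
    by (subst L.nn_integral_triple, measurable) (intro nn_integral_cong nn[symmetric], measurable)
  have g3: "(\<integral>\<^sup>+z. Q.third_order_moment \<phi> z \<partial>L) = \<gamma>\<^sub>3"
    unfolding assms(13) Q.third_order_moment_def
    by (intro arg_cong2[where f = "(*)"] refl nn_integral_cong arg_cong2[where f = ennreal_powr] nn[symmetric]) measurable
  show ?thesis
    unfolding wasserstein_dist_def
  proof (rule SUP_least)
    fix h :: "real \<Rightarrow> real" assume "h \<in> {h. 1-lipschitz_on UNIV h}"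
    then have h: "1-lipschitz_on UNIV h" by simp
    have [measurable]: "h \<in> borel_measurable borel"
      using lipschitz_on_continuous_on[OF h] by (rule borel_measurable_continuous_onI)
    define c where "c = (\<integral>x. std_normal_density x * h x \<partial>lborel)"
    obtain f f' where d: "\<And>w. (f has_real_derivative f' w) (at w)"
      and eq: "\<And>w. f' w - w * f w = h w - c" and b: "\<And>w. \<bar>f' w\<bar> \<le> 1"
      and l: "\<And>v w. \<bar>f' v - f' w\<bar> \<le> 2 * \<bar>v - w\<bar>"
      using stein_equation_solution[OF h] unfolding c_def by blast
    interpret st: stein_test f f' by (rule stein_test_of_derivative[OF d b l])
    have Z: "(\<integral>\<omega>. h (Z \<omega>) \<partial>M') = c"
      unfolding c_def by (rule distributed_integral[OF assms(10), symmetric]) auto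
    have int1: "integrable Q (\<lambda>\<tau>. f' (\<phi> \<tau>))"
      by (rule Q.Q.integrable_const_bound[where B = 1]) (auto simp: b)
    have int2: "integrable Q (\<lambda>\<tau>. f (\<phi> \<tau>) * \<phi> \<tau>)"
    proof (rule Bochner_Integration.integrable_bound[where f = "\<lambda>\<tau>. (\<bar>f 0\<bar> + \<bar>\<phi> \<tau>\<bar>) * \<bar>\<phi> \<tau>\<bar>"])
      show "integrable Q (\<lambda>\<tau>. (\<bar>f 0\<bar> + \<bar>\<phi> \<tau>\<bar>) * \<bar>\<phi> \<tau>\<bar>)"
        using \<phi>1 \<phi>2 by (simp add: distrib_right power2_eq_square[symmetric] abs_mult_self_eq)
      have f0: "\<bar>f x\<bar> \<le> \<bar>f 0\<bar> + \<bar>x\<bar>" for x using st.f_increment_le[of x 0] by simp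
      show "AE \<tau> in Q. norm (f (\<phi> \<tau>) * \<phi> \<tau>) \<le> norm ((\<bar>f 0\<bar> + \<bar>\<phi> \<tau>\<bar>) * \<bar>\<phi> \<tau>\<bar>)"
        using f0 by (intro AE_I2) (simp add: abs_mult mult_right_mono)
    qed measurable
    have "(\<integral>\<omega>. h (F \<omega>) \<partial>M) = (\<integral>\<tau>. h (\<phi> \<tau>) \<partial>Q)" by (rule re) measurable
    also have "\<dots> = (\<integral>\<tau>. (f' (\<phi> \<tau>) - f (\<phi> \<tau>) * \<phi> \<tau>) + c \<partial>Q)"
      using eq[of "\<phi> _"] by (intro Bochner_Integration.integral_cong) (auto simp: algebra_simps)
    also have "\<dots> = (\<integral>\<tau>. f' (\<phi> \<tau>) \<partial>Q) - (\<integral>\<tau>. f (\<phi> \<tau>) * \<phi> \<tau> \<partial>Q) + c"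
      using int1 int2 by (simp add: Q.Q.prob_space)
    finally have "\<bar>(\<integral>\<omega>. h (F \<omega>) \<partial>M) - (\<integral>\<omega>. h (Z \<omega>) \<partial>M')\<bar> = \<bar>(\<integral>\<tau>. f (\<phi> \<tau>) * \<phi> \<tau> \<partial>Q) - (\<integral>\<tau>. f' (\<phi> \<tau>) \<partial>Q)\<bar>"
      by (simp add: Z abs_minus_commute)
    then show "ennreal \<bar>(\<integral>\<omega>. h (F \<omega>) \<partial>M) - (\<integral>\<omega>. h (Z \<omega>) \<partial>M')\<bar> \<le> \<gamma>\<^sub>1 + \<gamma>\<^sub>2 + \<gamma>\<^sub>3"
      using Q.stein_bound[OF st.stein_test_axioms \<phi> \<phi>2 mean variance energy g1 g2 g3] by simp
  qed
qed

end
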